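(* Let $(b_\theta,Q_\theta,\nu_\theta)$, $\theta\in I$, be a uniformly bounded family of triplets, i.e. $b_\theta\in\mathbb{R}^d$, $Q_\theta\in\mathbb{R}^{d\times d}$ positive semidefinite, $\nu_\theta$ a measure on $\mathbb{R}^d\setminus\{0\}$, and $$\sup_{\theta\in I}\Big(|b_\theta|+|Q_\theta|+\int_{y\ne0}\min\{1,|y|^2\}\,\nu_\theta(dy)\Big)<\infty.$$ (i) There exists a Lévy process for sublinear expectations with characteristics $(b_\theta,Q_\theta,\nu_\theta)_{\theta\in I}$. (ii) If the family $\nu_\theta$, $\theta\in I$, is tight, i.e. $\lim_{R\to\infty}\sup_{\theta\in I}\nu_\theta(\{|y|>R\})=0$, then there exists a unique Lévy process for sublinear expectations with characteristics $(b_\theta,Q_\theta,\nu_\theta)_{\theta\in I}$, in the sense that any two sublinear Lévy processes with these characteristics have the same finite-dimensional distributions.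
   Context: $C_b^{uc}(\mathbb{R}^d)$ denotes the bounded uniformly continuous real functions. A sublinear expectation space $(\Omega,\mathcal{H},\mathcal{E})$ consists of a non-empty set $\Omega$, a linear space $\mathcal{H}$ of functions $\Omega\to\mathbb{R}$, and $\mathcal{E}:\mathcal{H}\to\mathbb{R}$ that is subadditive, positively homogeneous ($\mathcal{E}(\lambda X)=\lambda\mathcal{E}(X)$, $\lambda\ge0$), preserves constants ($\mathcal{E}(c)=c$) and is monotone. A map $X:\Omega\to\mathbb{R}^d$ is adapted if $\varphi(X)\in\mathcal{H}$ for all $\varphi\in C_b^{uc}(\mathbb{R}^d)$. $X\stackrel{d}{=}Y$ means $\mathcal{E}(\varphi(X))=\mathcal{E}(\varphi(Y))$ for all $\varphi\in C_b^{uc}$. $X,Y$ are independent (in this order) if $\mathcal{E}(\varphi(X,Y))=\mathcal{E}\big(\mathcal{E}(\varphi(x,Y))|_{x=X}\big)$ for all bounded uniformly continuous $\varphi$ of both variables (all terms implicitly assumed well-defined); $Y_1,\dots,Y_n$ are independent if for each $k\ge2$ the pair $(Y_1,\dots,Y_{k-1})$, $Y_k$ is independent in this sense. A family $X_t:\Omega\to\mathbb{R}^d$, $t\ge0$, on a sublinear expectation space is a Lévy process for sublinear expectations (sublinear Lévy process) if: each $X_t$ is adapted; $X_0\stackrel{d}{=}0$; $X_{t_1}-X_{t_0},\dots,X_{t_n}-X_{t_{n-1}}$ are independent for all $0=t_0<\dots<t_n$; $X_t-X_s\stackrel{d}{=}X_{t-s}$ for $s\le t$; and $\mathcal{E}f(X_t)\to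 f(0)$ as $t\downarrow0$ for all $f\in C_b^{uc}(\mathbb{R}^d)$. Its semigroup is $T_tf(x):=\mathcal{E}f(x+X_t)$ on $C_b^{uc}(\mathbb{R}^d)$. The pointwise generator $A^{(p)}$: $f\in\mathcal{D}(A^{(p)})$ iff $f\in C_b^{uc}(\mathbb{R}^d)$, $g(x):=\lim_{t\downarrow0}t^{-1}(T_tf(x)-f(x))$ exists for all $x$ and $g\in C_b^{uc}(\mathbb{R}^d)$; $A^{(p)}f:=g$. The process has characteristics $(b_\theta,Q_\theta,\nu_\theta)_{\theta\in I}$ if $C_c^\infty(\mathbb{R}^d)\subseteq\mathcal{D}(A^{(p)})$ ("rich domain") and, for all $f\in C_c^\infty(\mathbb{R}^d)$ and $x\in\mathbb{R}^d$, $$A^{(p)}f(x)=\sup_{\theta\in I}\Big(b_\theta\cdot\nabla f(x)+\tfrac12\operatorname{tr}(Q_\theta\nabla^2f(x))+\int_{y\ne0}\big(f(x+y)-f(x)-y\cdot\nabla f(x)\mathbf{1}_{(0,1)}(|y|)\big)\,\nu_\theta(dy)\Big).$$ Two processes $(X_t)$, $(Y_t)$ (possibly on different sublinear expectation spaces) have the same finite-dimensional distributions if $\mathcal{E}\varphi(X_{t_1},\dots,X_{t_n})=\mathcal{E}'\varphi(Y_{t_1},\dots,Y_{t_n})$ for all $n$, $t_1,\dots,t_n\ge0$ and all bounded uniformly continuous $\varphi$ on $(\mathbb{R}^d)^n$. *)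

theory Defs
  imports "HOL-Analysis.Analysis"
begin

section \<open>Bounded uniformly continuous functions\<close>

definition Cbuc :: "('a::metric_space \<Rightarrow> real) set" where
  "Cbuc = {f. bounded (range f) \<and> uniformly_continuous_on UNIV f}"

text \<open>Points of the \<open>n\<close>-fold power of \<open>'a\<close> are the lists of length \<open>n\<close>, with the Euclidean
  product metric; the values of a test function on lists of any other length are irrelevant.\<close>

definition Cbuc_tuples :: "nat \<Rightarrow> ('a::metric_space list \<Rightarrow> real) set" where
  "Cbuc_tuples n = {\<phi>. bounded (\<phi> ` {xs. length xs = n}) \<and>
     (\<forall>e>0. \<exists>d>0. \<forall>xs ys. length xs = n \<longrightarrow> length ys = n \<longrightarrow>
        L2_set (\<lambda>i. dist (xs ! i) (ys ! i)) {..<n} < d \<longrightarrow> dist (\<phi> xs) (\<phi> ys) < e)}"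


section \<open>Sublinear expectation spaces\<close>

text \<open>The underlying set is the (non-empty) type \<open>'w\<close>. Only the values of \<open>\<E>\<close> on \<open>H\<close> are meaningful,
  so every definition below that evaluates \<open>\<E>\<close> also records that the argument lies in \<open>H\<close>.\<close>

locale sublinear_expectation_space =
  fixes H :: "('w \<Rightarrow> real) set" and \<E> :: "('w \<Rightarrow> real) \<Rightarrow> real"
  assumes const_mem: "(\<lambda>\<omega>. c) \<in> H"
    and add_mem: "X \<in> H \<Longrightarrow> Y \<in> H \<Longrightarrow> (\<lambda>\<omega>. X \<omega> + Y \<omega>) \<in> H"
    and scale_mem: "X \<in> H \<Longrightarrow> (\<lambda>\<omega>. a * X \<omega>) \<in> H"
    and subadditive: "X \<in> H \<Longrightarrow> Y \<in> H \<Longrightarrow> \<E> (\<lambda>\<omega>. X \<omega> + Y \<omega>) \<le> \<E> X + \<E> Y"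
    and pos_homogeneous: "X \<in> H \<Longrightarrow> a \<ge> 0 \<Longrightarrow> \<E> (\<lambda>\<omega>. a * X \<omega>) = a * \<E> X"
    and const_preserving: "\<E> (\<lambda>\<omega>. c) = c"
    and monotone: "X \<in> H \<Longrightarrow> Y \<in> H \<Longrightarrow> (\<And>\<omega>. X \<omega> \<le> Y \<omega>) \<Longrightarrow> \<E> X \<le> \<E> Y"

definition adapted :: "('w \<Rightarrow> real) set \<Rightarrow> ('w \<Rightarrow> 'a::metric_space) \<Rightarrow> bool" where
  "adapted H X \<longleftrightarrow> (\<forall>\<phi>\<in>Cbuc. (\<lambda>\<omega>. \<phi> (X \<omega>)) \<in> H)"

definition eq_in_law ::
    "('w \<Rightarrow> real) set \<Rightarrow> (('w \<Rightarrow> real) \<Rightarrow> real) \<Rightarrow> ('w \<Rightarrow> 'a::metric_space) \<Rightarrow> ('w \<Rightarrow> 'a) \<Rightarrow> bool" where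
  "eq_in_law H \<E> X Y \<longleftrightarrow> adapted H X \<and> adapted H Y \<and>
     (\<forall>\<phi>\<in>Cbuc. \<E> (\<lambda>\<omega>. \<phi> (X \<omega>)) = \<E> (\<lambda>\<omega>. \<phi> (Y \<omega>)))"

text \<open>Independence, in this order, of an \<open>m\<close>-tuple \<open>X\<close> and a single random variable \<open>Y\<close>;
  test functions of both variables are test functions of the \<open>(m+1)\<close>-tuple \<open>X @ [Y]\<close>.\<close>

definition indep_pair ::
    "('w \<Rightarrow> real) set \<Rightarrow> (('w \<Rightarrow> real) \<Rightarrow> real) \<Rightarrow> nat \<Rightarrow> ('w \<Rightarrow> 'a::metric_space list) \<Rightarrow> ('w \<Rightarrow> 'a) \<Rightarrow> bool"
where
  "indep_pair H \<E> m X Y \<longleftrightarrow> (\<forall>\<phi>\<in>Cbuc_tuples (Suc m).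
     (\<lambda>\<omega>. \<phi> (X \<omega> @ [Y \<omega>])) \<in> H \<and>
     (\<forall>x. length x = m \<longrightarrow> (\<lambda>\<omega>. \<phi> (x @ [Y \<omega>])) \<in> H) \<and>
     (\<lambda>\<omega>. \<E> (\<lambda>\<omega>'. \<phi> (X \<omega> @ [Y \<omega>']))) \<in> H \<and>
     \<E> (\<lambda>\<omega>. \<phi> (X \<omega> @ [Y \<omega>])) = \<E> (\<lambda>\<omega>. \<E> (\<lambda>\<omega>'. \<phi> (X \<omega> @ [Y \<omega>']))))"

text \<open>The sequence is \<open>Y 0, \<dots>, Y (n - 1)\<close>.\<close>

definition indep_seq ::
    "('w \<Rightarrow> real) set \<Rightarrow> (('w \<Rightarrow> real) \<Rightarrow> real) \<Rightarrow> nat \<Rightarrow> (nat \<Rightarrow> 'w \<Rightarrow> 'a::metric_space) \<Rightarrow> bool" where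
  "indep_seq H \<E> n Y \<longleftrightarrow>
     (\<forall>k. 1 \<le> k \<and> k < n \<longrightarrow> indep_pair H \<E> k (\<lambda>\<omega>. map (\<lambda>i. Y i \<omega>) [0..<k]) (Y k))"


section \<open>Levy processes for sublinear expectations\<close>

text \<open>The time index is real, and only times \<open>t \<ge> 0\<close> matter.\<close>

locale sublinear_levy_process = sublinear_expectation_space H \<E>
  for H :: "('w \<Rightarrow> real) set" and \<E> :: "('w \<Rightarrow> real) \<Rightarrow> real" +
  fixes X :: "real \<Rightarrow> 'w \<Rightarrow> real ^ 'd::finite"
  assumes adapted: "t \<ge> 0 \<Longrightarrow> adapted H (X t)"
    and start: "eq_in_law H \<E> (X 0) (\<lambda>\<omega>. 0)"
    and indep_increments:
      "\<And>n t. t 0 = 0 \<Longrightarrow> (\<And>i. i < n \<Longrightarrow> t i < t (Suc i)) \<Longrightarrow>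
         indep_seq H \<E> n (\<lambda>i \<omega>. X (t (Suc i)) \<omega> - X (t i) \<omega>)"
    and stationary_increments:
      "0 \<le> s \<Longrightarrow> s \<le> t \<Longrightarrow> eq_in_law H \<E> (\<lambda>\<omega>. X t \<omega> - X s \<omega>) (X (t - s))"
    and continuous_at_0:
      "f \<in> Cbuc \<Longrightarrow> ((\<lambda>t. \<E> (\<lambda>\<omega>. f (X t \<omega>))) \<longlongrightarrow> f 0) (at_right 0)"

text \<open>The joint value \<open>\<phi> (X\<^sub>t\<^sub>1, \<dots>, X\<^sub>t\<^sub>n)\<close> automatically lies in \<open>H\<close> when \<open>n = 1\<close> or \<open>X\<^sub>0\<close> is identically
  \<open>0\<close>, since it is then a uniformly continuous function of increments; but \<open>X\<^sub>0\<close> is only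
  required to vanish in law, and then \<open>H\<close> may fail to contain it. Since \<open>\<E>\<close> has no meaning outside \<open>H\<close>,
  the two expectations are compared whenever both are defined.\<close>

definition same_fdd ::
    "('w \<Rightarrow> real) set \<Rightarrow> (('w \<Rightarrow> real) \<Rightarrow> real) \<Rightarrow> (real \<Rightarrow> 'w \<Rightarrow> real ^ 'd::finite) \<Rightarrow>
     ('v \<Rightarrow> real) set \<Rightarrow> (('v \<Rightarrow> real) \<Rightarrow> real) \<Rightarrow> (real \<Rightarrow> 'v \<Rightarrow> real ^ 'd) \<Rightarrow> bool" where
  "same_fdd H \<E> X H' \<E>' Y \<longleftrightarrow>
     (\<forall>ts \<phi>. (\<forall>t\<in>set ts. t \<ge> 0) \<longrightarrow> \<phi> \<in> Cbuc_tuples (length ts) \<longrightarrow>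
        (\<lambda>\<omega>. \<phi> (map (\<lambda>t. X t \<omega>) ts)) \<in> H \<longrightarrow> (\<lambda>\<omega>. \<phi> (map (\<lambda>t. Y t \<omega>) ts)) \<in> H' \<longrightarrow>
        \<E> (\<lambda>\<omega>. \<phi> (map (\<lambda>t. X t \<omega>) ts)) = \<E>' (\<lambda>\<omega>. \<phi> (map (\<lambda>t. Y t \<omega>) ts)))"


section \<open>Pointwise generator\<close>

definition levy_semigroup ::
    "(('w \<Rightarrow> real) \<Rightarrow> real) \<Rightarrow> (real \<Rightarrow> 'w \<Rightarrow> real ^ 'd::finite) \<Rightarrow> real \<Rightarrow> (real ^ 'd \<Rightarrow> real) \<Rightarrow> real ^ 'd \<Rightarrow> real"
where
  "levy_semigroup \<E> X t f x = \<E> (\<lambda>\<omega>. f (x + X t \<omega>))"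

definition generator_rel ::
    "(('w \<Rightarrow> real) \<Rightarrow> real) \<Rightarrow> (real \<Rightarrow> 'w \<Rightarrow> real ^ 'd::finite) \<Rightarrow> (real ^ 'd \<Rightarrow> real) \<Rightarrow> (real ^ 'd \<Rightarrow> real) \<Rightarrow> bool"
where
  "generator_rel \<E> X f g \<longleftrightarrow> f \<in> Cbuc \<and> g \<in> Cbuc \<and>
     (\<forall>x. ((\<lambda>t. (levy_semigroup \<E> X t f x - f x) / t) \<longlongrightarrow> g x) (at_right 0))"

definition generator_domain ::
    "(('w \<Rightarrow> real) \<Rightarrow> real) \<Rightarrow> (real \<Rightarrow> 'w \<Rightarrow> real ^ 'd::finite) \<Rightarrow> (real ^ 'd \<Rightarrow> real) set" where
  "generator_domain \<E> X = {f. \<exists>g. generator_rel \<E> X f g}"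

definition generator ::
    "(('w \<Rightarrow> real) \<Rightarrow> real) \<Rightarrow> (real \<Rightarrow> 'w \<Rightarrow> real ^ 'd::finite) \<Rightarrow> (real ^ 'd \<Rightarrow> real) \<Rightarrow> real ^ 'd \<Rightarrow> real" where
  "generator \<E> X f = (THE g. generator_rel \<E> X f g)"


section \<open>Test functions and characteristics\<close>

definition partial :: "'d \<Rightarrow> (real ^ 'd::finite \<Rightarrow> real) \<Rightarrow> real ^ 'd \<Rightarrow> real" where
  "partial i f x = frechet_derivative f (at x) (axis i 1)"

definition grad :: "(real ^ 'd::finite \<Rightarrow> real) \<Rightarrow> real ^ 'd \<Rightarrow> real ^ 'd" where
  "grad f x = (\<chi> i. partial i f x)"

definition hessian :: "(real ^ 'd::finite \<Rightarrow> real) \<Rightarrow> real ^ 'd \<Rightarrow> real ^ 'd ^ 'd" where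
  "hessian f x = (\<chi> i j. partial i (partial j f) x)"

primrec Ck :: "nat \<Rightarrow> (real ^ 'd::finite \<Rightarrow> real) \<Rightarrow> bool" where
  "Ck 0 f \<longleftrightarrow> continuous_on UNIV f"
| "Ck (Suc k) f \<longleftrightarrow> (\<forall>x. f differentiable (at x)) \<and> (\<forall>i. Ck k (partial i f))"

definition Cc_infty :: "(real ^ 'd::finite \<Rightarrow> real) set" where
  "Cc_infty = {f. (\<forall>k. Ck k f) \<and> compact (closure {x. f x \<noteq> 0})}"

definition pos_semidef :: "real ^ 'd::finite ^ 'd \<Rightarrow> bool" where
  "pos_semidef Q \<longleftrightarrow> transpose Q = Q \<and> (\<forall>x. x \<bullet> (Q *v x) \<ge> 0)"

text \<open>A jump measure \<open>\<nu>\<close> is a Borel measure whose space is the punctured Euclidean space, so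
  integrals with respect to \<open>\<nu>\<close> are integrals over \<open>y \<noteq> 0\<close>.\<close>

definition levy_operator ::
    "real ^ 'd::finite \<Rightarrow> real ^ 'd ^ 'd \<Rightarrow> (real ^ 'd) measure \<Rightarrow> (real ^ 'd \<Rightarrow> real) \<Rightarrow> real ^ 'd \<Rightarrow> real" where
  "levy_operator b Q \<nu> f x =
     b \<bullet> grad f x + 1/2 * trace (Q ** hessian f x) +
     (LINT y|\<nu>. f (x + y) - f x - (y \<bullet> grad f x) * indicator {0<..<1} (norm y))"

definition uniformly_bounded_triplets ::
    "'i set \<Rightarrow> ('i \<Rightarrow> real ^ 'd::finite) \<Rightarrow> ('i \<Rightarrow> real ^ 'd ^ 'd) \<Rightarrow> ('i \<Rightarrow> (real ^ 'd) measure) \<Rightarrow> bool" where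
  "uniformly_bounded_triplets I b Q \<nu> \<longleftrightarrow>
     (\<forall>\<theta>\<in>I. pos_semidef (Q \<theta>) \<and> sets (\<nu> \<theta>) = sets (restrict_space borel (- {0}))) \<and>
     (SUP \<theta>\<in>I. ennreal (norm (b \<theta>)) + ennreal (norm (Q \<theta>)) +
        (\<integral>\<^sup>+y. ennreal (min 1 ((norm y)\<^sup>2)) \<partial>\<nu> \<theta>)) < \<infinity>"

definition tight_jumps :: "'i set \<Rightarrow> ('i \<Rightarrow> (real ^ 'd::finite) measure) \<Rightarrow> bool" where
  "tight_jumps I \<nu> \<longleftrightarrow>
     ((\<lambda>R. SUP \<theta>\<in>I. emeasure (\<nu> \<theta>) {y \<in> space (\<nu> \<theta>). norm y > R}) \<longlongrightarrow> 0) (at_top :: real filter)"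

text \<open>The supremum is taken in the extended reals, where it always has its order-theoretic meaning.\<close>

definition has_characteristics ::
    "(('w \<Rightarrow> real) \<Rightarrow> real) \<Rightarrow> (real \<Rightarrow> 'w \<Rightarrow> real ^ 'd::finite) \<Rightarrow>
     'i set \<Rightarrow> ('i \<Rightarrow> real ^ 'd) \<Rightarrow> ('i \<Rightarrow> real ^ 'd ^ 'd) \<Rightarrow> ('i \<Rightarrow> (real ^ 'd) measure) \<Rightarrow> bool" where
  "has_characteristics \<E> X I b Q \<nu> \<longleftrightarrow> Cc_infty \<subseteq> generator_domain \<E> X \<and>
     (\<forall>f\<in>Cc_infty. \<forall>x. ereal (generator \<E> X f x) =
        (SUP \<theta>\<in>I. ereal (levy_operator (b \<theta>) (Q \<theta>) (\<nu> \<theta>) f x)))"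

end

theory Submission
  imports Defs "HOL-Complex_Analysis.Great_Picard" "HOL-Computational_Algebra.Polynomial"
begin

text \<open>Existence: every Levy operator \<open>A\<^sub>\<theta>\<close> is approximated by bounded positive jump operators
  \<open>A\<^sub>\<theta>\<^sub>,\<^sub>h\<close>, and the semigroup is the limit of the powers of the one-step operators
  \<open>f + h sup\<^sub>\<theta> A\<^sub>\<theta>\<^sub>,\<^sub>h f\<close> along dyadic \<open>h\<close>. The step operators are sublinear and commute with
  translations, so by Jensen's inequality mollification turns the iterates of one scheme into smooth
  approximate supersolutions of any other scheme with the same generator. This compares two consistent
  schemes in both directions without any regularity theory, and gives uniform convergence. The process
  on the path space is built from iterated expectations along finitely many times.

  Uniqueness: the same comparison applies to two semigroups with the same generator on the test
  functions, once their difference quotients are known to be close uniformly over mollified Lipschitz functions.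
  Tightness permits a cutoff to compact sets, where these functions are precompact in \<open>C\<^sup>2\<close>.\<close>

section \<open>Smooth functions\<close>

text \<open>The order of choices carries the comparison. The mollification radius \<open>r\<close>
  is fixed by the Lipschitz constant and costs \<open>2 * (\<bar>L\<bar> * r)\<close> once, not per
  step; it then fixes a bound on three derivatives of every mollified iterate. Consistency is
  required only uniformly over such a class, with an error small compared with the step, so the
  accumulated error is time times a small number and no convergence rate is needed. A jump operator
  gives a monotone step only if its total rate times the step is at most one; this ties the
  truncation scale to the cube root of the step length. Dyadic steps make a coarse step comparable
  with a whole number of fine ones. A sublinear functional on bounded uniformly continuous functions
  need not be continuous along decreasing sequences, so nothing may rest on an integral
  representation: domination by finitely many test functions and subadditivity replace it. For
  uniqueness the difficulty is that pointwise convergence on compactly supported functions sees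
  neither uniformity nor mass of order \<open>h\<close> escaping to infinity.\<close>

definition smooth :: "(real ^ 'd::finite \<Rightarrow> real) \<Rightarrow> bool" where
  "smooth f \<longleftrightarrow> (\<forall>k. Ck k f)"

text \<open>Written in coordinates, so that iterating \<open>directional y\<close> yields the higher
  derivatives along a line as sums of iterated partial derivatives.\<close>

definition directional :: "real ^ 'd::finite \<Rightarrow> (real ^ 'd \<Rightarrow> real) \<Rightarrow> real ^ 'd \<Rightarrow> real" where
  "directional y f x = (\<Sum>i\<in>UNIV. y $ i * partial i f x)"

lemma Ck_Suc_imp: "Ck (Suc k) f \<Longrightarrow> Ck k f"
proof (induction k arbitrary: f)
  case 0
  then show ?case
    by (auto simp: continuous_on_eq_continuous_at differentiable_imp_continuous_within)
next
  case (Suc k)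
  then have "\<forall>x. f differentiable (at x)" "\<And>i. Ck (Suc k) (partial i f)"
    by auto
  with Suc.IH show ?case
    by simp
qed

lemma smooth_differentiable: "smooth f \<Longrightarrow> f differentiable (at x)"
  unfolding smooth_def by (metis Ck.simps(2))

lemma smooth_partial: "smooth f \<Longrightarrow> smooth (partial i f)"
  unfolding smooth_def by (metis Ck.simps(2))

lemma smooth_continuous_on: "smooth f \<Longrightarrow> continuous_on S f"
  unfolding smooth_def by (metis Ck.simps(1) continuous_on_subset subset_UNIV)

text \<open>Coinduction for smoothness: a class of differentiable functions that is closed under
  partial derivatives lies in every \<open>Ck k\<close>.\<close>

lemma smoothI:
  assumes "P f" "\<And>g x. P g \<Longrightarrow> g differentiable (at x)" "\<And>g i. P g \<Longrightarrow> P (partial i g)"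
  shows "smooth f"
proof -
  have "Ck k g" if "P g" for k g
    using that
  proof (induction k arbitrary: g)
    case 0
    then show ?case
      using assms(2) by (auto simp: continuous_on_eq_continuous_at differentiable_imp_continuous_within)
  qed (use assms in auto)
  with assms(1) show ?thesis
    by (simp add: smooth_def)
qed

lemma partial_eqI: "(f has_derivative F) (at x) \<Longrightarrow> partial i f x = F (axis i 1)"
  unfolding partial_def by (metis frechet_derivative_at)

lemma frechet_directional:
  assumes "f differentiable (at x)"
  shows "frechet_derivative f (at x) y = directional y f x"
proof -
  interpret L: linear "frechet_derivative f (at x)"
    using assms by (rule linear_frechet_derivative)
  have "frechet_derivative f (at x) y = frechet_derivative f (at x) (\<Sum>i\<in>UNIV. y $ i *\<^sub>R axis i 1)"
    using basis_expansion[of y] by (simp add: scalar_mult_eq_scaleR)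
  then show ?thesis
    by (simp add: L.sum L.scale directional_def partial_def)
qed

lemma has_derivative_directional:
  assumes "f differentiable (at x)"
  shows "(f has_derivative (\<lambda>y. directional y f x)) (at x)"
proof -
  have "(\<lambda>y. directional y f x) = frechet_derivative f (at x)"
    using frechet_directional[OF assms] by auto
  with assms show ?thesis
    by (simp add: frechet_derivative_works)
qed

lemma directional_axis [simp]: "directional (axis i 1) f x = partial i f x"
  by (simp add: directional_def axis_def if_distrib[of "\<lambda>c. c * _"] cong: if_cong)

lemma inner_grad: "y \<bullet> grad f x = directional y f x"
  by (simp add: grad_def directional_def inner_vec_def)

lemma partial_const [simp]: "partial i (\<lambda>x. c) = (\<lambda>x. 0)"
  by (rule ext, rule partial_eqI[THEN trans]) (rule has_derivative_const, simp)

lemma partial_add: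
  assumes "f differentiable (at x)" "g differentiable (at x)"
  shows "partial i (\<lambda>x. f x + g x) x = partial i f x + partial i g x"
  by (subst partial_eqI[OF has_derivative_add[OF assms[THEN has_derivative_directional]]]) simp

lemma partial_mult:
  assumes "f differentiable (at x)" "g differentiable (at x)"
  shows "partial i (\<lambda>x. f x * g x) x = partial i f x * g x + f x * partial i g x"
  by (subst partial_eqI[OF has_derivative_mult[OF assms[THEN has_derivative_directional]]])
     (simp add: algebra_simps)

lemma smooth_const [simp]: "smooth (\<lambda>x. c)"
  by (rule smoothI[where P = "\<lambda>f. \<exists>c. f = (\<lambda>x. c)"]) auto

lemma Ck_add: "Ck k f \<Longrightarrow> Ck k g \<Longrightarrow> Ck k (\<lambda>x. f x + g x)"
proof (induction k arbitrary: f g)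
  case (Suc k)
  then have d: "\<And>x. f differentiable (at x)" "\<And>x. g differentiable (at x)"
    and c: "\<And>i. Ck k (partial i f)" "\<And>i. Ck k (partial i g)" by auto
  have "partial i (\<lambda>x. f x + g x) = (\<lambda>x. partial i f x + partial i g x)" for i
    using d by (auto simp: partial_add)
  with Suc.IH c d show ?case by simp
qed (auto intro: continuous_intros)

lemma Ck_mult: "Ck k f \<Longrightarrow> Ck k g \<Longrightarrow> Ck k (\<lambda>x. f x * g x)"
proof (induction k arbitrary: f g)
  case (Suc k)
  then have d: "\<And>x. f differentiable (at x)" "\<And>x. g differentiable (at x)"
    and c: "\<And>i. Ck k (partial i f)" "\<And>i. Ck k (partial i g)" by auto
  have "partial i (\<lambda>x. f x * g x) = (\<lambda>x. partial i f x * g x + f x * partial i g x)" for i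
    using d by (auto simp: partial_mult)
  with Suc.IH c d Suc.prems[THEN Ck_Suc_imp] show ?case by (simp add: Ck_add)
qed (auto intro: continuous_intros)

lemma smooth_add: "smooth f \<Longrightarrow> smooth g \<Longrightarrow> smooth (\<lambda>x. f x + g x)"
  by (simp add: smooth_def Ck_add)

lemma smooth_mult: "smooth f \<Longrightarrow> smooth g \<Longrightarrow> smooth (\<lambda>x. f x * g x)"
  by (simp add: smooth_def Ck_mult)

lemma smooth_diff: "smooth f \<Longrightarrow> smooth g \<Longrightarrow> smooth (\<lambda>x. f x - g x)"
  using smooth_add[of f "\<lambda>x. (-1) * g x"] smooth_mult[of "\<lambda>x. -1" g] by simp

lemma smooth_sum: "finite A \<Longrightarrow> (\<And>i. i \<in> A \<Longrightarrow> smooth (f i)) \<Longrightarrow> smooth (\<lambda>x. \<Sum>i\<in>A. f i x)"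
  by (induction A rule: finite_induct) (auto simp: smooth_add)

lemma smooth_prod: "finite A \<Longrightarrow> (\<And>i. i \<in> A \<Longrightarrow> smooth (f i)) \<Longrightarrow> smooth (\<lambda>x. \<Prod>i\<in>A. f i x)"
  by (induction A rule: finite_induct) (auto simp: smooth_mult)

lemma partial_coord: "partial i (\<lambda>x. x $ j) = (\<lambda>x. if i = j then 1 else 0)"
proof
  fix x :: "real ^ 'a"
  have "((\<lambda>x. x $ j) has_derivative (\<lambda>x. x $ j)) (at x)"
    by (intro bounded_linear_imp_has_derivative bounded_linear_vec_nth)
  from partial_eqI[OF this, of i] show "partial i (\<lambda>x. x $ j) x = (if i = j then 1 else 0)"
    by (auto simp: axis_def)
qed

lemma smooth_coord [simp]: "smooth (\<lambda>x. x $ j)"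
proof (rule smoothI[where P = "\<lambda>f. f = (\<lambda>x. x $ j) \<or> (\<exists>c. f = (\<lambda>x. c))"])
  fix g :: "real ^ 'a \<Rightarrow> real" and x i
  assume *: "g = (\<lambda>x. x $ j) \<or> (\<exists>c. g = (\<lambda>x. c))"
  then show "g differentiable (at x)"
    by (auto intro: bounded_linear_imp_differentiable bounded_linear_vec_nth)
  show "partial i g = (\<lambda>x. x $ j) \<or> (\<exists>c. partial i g = (\<lambda>x. c))"
    using * by (auto simp: partial_coord)
qed simp

lemma smooth_translate:
  fixes f :: "real ^ 'd::finite \<Rightarrow> real"
  assumes "smooth f"
  shows "smooth (\<lambda>y. f (x + y))" "partial i (\<lambda>y. f (x + y)) = (\<lambda>y. partial i f (x + y))"
proof -
  have d: "((\<lambda>y. g (x + y)) has_derivative (\<lambda>z. directional z g (x + y))) (at y)"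
    if "smooth g" for g :: "real ^ 'd \<Rightarrow> real" and y
  proof -
    have "((\<lambda>y. x + y) has_derivative (\<lambda>z. z)) (at y)"
      by (auto intro!: derivative_eq_intros)
    from has_derivative_compose[OF this has_derivative_directional]
    show ?thesis using that by (simp add: smooth_differentiable)
  qed
  have p: "partial i (\<lambda>y. g (x + y)) = (\<lambda>y. partial i g (x + y))" if "smooth g" for g :: "real ^ 'd \<Rightarrow> real" and i
    using partial_eqI[OF d[OF that], of i] by auto
  show "partial i (\<lambda>y. f (x + y)) = (\<lambda>y. partial i f (x + y))"
    using p assms by auto
  show "smooth (\<lambda>y. f (x + y))"
  proof (rule smoothI[where P = "\<lambda>h. \<exists>g. smooth g \<and> h = (\<lambda>y. g (x + y))"])
    show "\<exists>g. smooth g \<and> (\<lambda>y. f (x + y)) = (\<lambda>y. g (x + y))" using assms by auto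
  next
    fix h z i assume "\<exists>g. smooth g \<and> h = (\<lambda>y. g (x + y))"
    then obtain g where g: "smooth g" "h = (\<lambda>y. g (x + y))" by blast
    show "h differentiable (at z)"
      unfolding differentiable_def g(2) using d[OF g(1)] by blast
    show "\<exists>g. smooth g \<and> partial i h = (\<lambda>y. g (x + y))"
      using p[OF g(1)] g smooth_partial by blast
  qed
qed

section \<open>Derivatives along lines and Taylor estimates\<close>

lemma DERIV_line:
  assumes "smooth f"
  shows "((\<lambda>t. f (x + t *\<^sub>R y)) has_real_derivative directional y f (x + t *\<^sub>R y)) (at t)"
proof -
  have "((\<lambda>t. x + t *\<^sub>R y) has_derivative (\<lambda>s. s *\<^sub>R y)) (at t)"
    by (auto intro!: derivative_eq_intros)
  from has_derivative_compose[OF this has_derivative_directional[OF smooth_differentiable[OF assms]]]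
  have "((\<lambda>t. f (x + t *\<^sub>R y)) has_derivative (\<lambda>s. directional (s *\<^sub>R y) f (x + t *\<^sub>R y))) (at t)" .
  moreover have "(\<lambda>s. directional (s *\<^sub>R y) f (x + t *\<^sub>R y)) = (*) (directional y f (x + t *\<^sub>R y))"
    by (auto simp: directional_def sum_distrib_right sum_distrib_left mult_ac)
  ultimately show ?thesis
    by (simp add: has_field_derivative_def)
qed

lemma smooth_directional: "smooth f \<Longrightarrow> smooth (directional y f)"
proof -
  assume "smooth f"
  then have "smooth (\<lambda>x. \<Sum>i\<in>UNIV. y $ i * partial i f x)"
    by (intro smooth_sum smooth_mult smooth_const smooth_partial) auto
  then show ?thesis
    by (simp add: directional_def[abs_def])
qed

text \<open>The one-variable Maclaurin formula on the segment from \<open>x\<close> to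
  \<open>x + y\<close>, evaluated at parameter one.\<close>

lemma directional_taylor:
  assumes "smooth f" "0 < n"
  obtains t where "0 < t" "t < 1"
    "f (x + y) = (\<Sum>m<n. (directional y ^^ m) f x / fact m) + (directional y ^^ n) f (x + t *\<^sub>R y) / fact n"
proof -
  have sm: "smooth ((directional y ^^ m) f)" for m
    by (induction m) (auto simp: assms smooth_directional)
  have "\<exists>t>0. t < 1 \<and> f (x + 1 *\<^sub>R y) = (\<Sum>m<n. ((directional y ^^ m) f (x + 0 *\<^sub>R y) / fact m) * 1 ^ m)
       + ((directional y ^^ n) f (x + t *\<^sub>R y) / fact n) * 1 ^ n"
    by (rule Maclaurin[where diff = "\<lambda>m t. (directional y ^^ m) f (x + t *\<^sub>R y)" and f = "\<lambda>t. f (x + t *\<^sub>R y)"])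
       (use assms DERIV_line[OF sm] in auto)
  then show ?thesis using that by auto
qed

text \<open>Three orders with one constant: the finite differences are checked against a
  second-order Taylor expansion with controlled remainder, and the third derivatives also make the
  Levy operator Lipschitz in the base point.\<close>

definition C3_bounded :: "real \<Rightarrow> (real ^ 'd::finite \<Rightarrow> real) \<Rightarrow> bool" where
  "C3_bounded K f \<longleftrightarrow> smooth f \<and> (\<forall>x. \<bar>f x\<bar> \<le> K) \<and> (\<forall>i x. \<bar>partial i f x\<bar> \<le> K) \<and>
     (\<forall>i j x. \<bar>partial i (partial j f) x\<bar> \<le> K) \<and>
     (\<forall>i j k x. \<bar>partial i (partial j (partial k f)) x\<bar> \<le> K)"

lemma abs_directional_le:
  fixes y :: "real ^ 'd::finite"
  assumes "\<And>i. \<bar>partial i f x\<bar> \<le> K"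
  shows "\<bar>directional y f x\<bar> \<le> real CARD('d) * norm y * K"
proof -
  have "\<bar>directional y f x\<bar> \<le> (\<Sum>i\<in>(UNIV :: 'd set). \<bar>y $ i * partial i f x\<bar>)"
    unfolding directional_def by (rule sum_abs)
  also have "\<dots> \<le> (\<Sum>i\<in>(UNIV :: 'd set). norm y * K)"
    using assms by (intro sum_mono) (simp add: abs_mult mult_mono' component_le_norm_cart)
  finally show ?thesis by simp
qed

lemma partial_directional:
  assumes "smooth f"
  shows "partial j (directional y f) x = (\<Sum>i\<in>UNIV. y $ i * partial j (partial i f) x)"
proof -
  have "((\<lambda>x. \<Sum>i\<in>UNIV. y $ i * partial i f x) has_derivative
      (\<lambda>z. \<Sum>i\<in>UNIV. y $ i * directional z (partial i f) x)) (at x)"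
    by (intro has_derivative_sum has_derivative_mult_right has_derivative_directional
        smooth_differentiable smooth_partial assms)
  from partial_eqI[OF this, of j] show ?thesis
    unfolding directional_axis by (simp add: directional_def[abs_def])
qed

text \<open>The first-order bound is used twice, first for the partial derivatives of
  \<open>directional y f\<close> and then for its derivative along \<open>y\<close>.\<close>

lemma directional2_le:
  fixes y :: "real ^ 'd::finite"
  assumes "smooth f" "\<And>i j. \<bar>partial i (partial j f) x\<bar> \<le> K"
  shows "\<bar>directional y (directional y f) x\<bar> \<le> (real CARD('d) * norm y)\<^sup>2 * K"
proof -
  have "\<bar>partial j (directional y f) x\<bar> \<le> real CARD('d) * norm y * K" for j
  proof -
    have "\<bar>partial j (directional y f) x\<bar> \<le> (\<Sum>i\<in>(UNIV :: 'd set). \<bar>y $ i * partial j (partial i f) x\<bar>)"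
      using assms by (simp add: partial_directional)
    also have "\<dots> \<le> (\<Sum>i\<in>(UNIV :: 'd set). norm y * K)"
      using assms by (intro sum_mono) (simp add: abs_mult mult_mono' component_le_norm_cart)
    finally show ?thesis by simp
  qed
  from abs_directional_le[OF this, of y] show ?thesis
    by (simp add: power2_eq_square mult_ac)
qed

lemma directional3_le:
  fixes y :: "real ^ 'd::finite"
  assumes "smooth f" "\<And>i j k. \<bar>partial i (partial j (partial k f)) x\<bar> \<le> K"
  shows "\<bar>directional y (directional y (directional y f)) x\<bar> \<le> (real CARD('d) * norm y) ^ 3 * K"
proof -
  have eq: "partial j (directional y f) = (\<lambda>x. \<Sum>i\<in>UNIV. y $ i * partial j (partial i f) x)" for j
    using assms by (auto simp: partial_directional)
  have "\<bar>partial k (partial j (directional y f)) x\<bar> \<le> real CARD('d) * norm y * K" for j k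
  proof -
    have "((\<lambda>x. \<Sum>i\<in>UNIV. y $ i * partial j (partial i f) x) has_derivative
      (\<lambda>z. \<Sum>i\<in>UNIV. y $ i * directional z (partial j (partial i f)) x)) (at x)"
      by (intro has_derivative_sum has_derivative_mult_right has_derivative_directional
          smooth_differentiable smooth_partial assms)
    from partial_eqI[OF this, of k]
    have "\<bar>partial k (partial j (directional y f)) x\<bar>
        \<le> (\<Sum>i\<in>(UNIV :: 'd set). \<bar>y $ i * partial k (partial j (partial i f)) x\<bar>)"
      using assms by (simp add: eq)
    also have "\<dots> \<le> (\<Sum>i\<in>(UNIV :: 'd set). norm y * K)"
      using assms by (intro sum_mono) (simp add: abs_mult mult_mono' component_le_norm_cart)
    finally show ?thesis by simp
  qed
  from directional2_le[OF smooth_directional[OF assms(1)] this, of y] show ?thesis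
    by (simp add: power2_eq_square power3_eq_cube mult_ac)
qed

lemma C3_boundedD:
  assumes "C3_bounded K f"
  shows "smooth f" "\<bar>f x\<bar> \<le> K" "\<bar>partial i f x\<bar> \<le> K" "\<bar>partial i (partial j f) x\<bar> \<le> K"
    "\<bar>partial i (partial j (partial k f)) x\<bar> \<le> K" "0 \<le> K"
proof -
  show "\<bar>f x\<bar> \<le> K"
    using assms unfolding C3_bounded_def by blast
  then show "0 \<le> K"
    by linarith
qed (use assms in \<open>auto simp: C3_bounded_def\<close>)

lemma taylor1_bound:
  fixes y :: "real ^ 'd::finite"
  assumes "C3_bounded K f"
  shows "\<bar>f (x + y) - f x\<bar> \<le> real CARD('d) * K * norm y"
proof -
  obtain t where "f (x + y) = f x + directional y f (x + t *\<^sub>R y)"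
    using directional_taylor[OF C3_boundedD(1)[OF assms], of 1 x y] by auto
  with abs_directional_le[of f "x + t *\<^sub>R y" K y] C3_boundedD[OF assms] show ?thesis
    by (simp add: mult_ac)
qed

lemma taylor2_bound_ball:
  fixes y :: "real ^ 'd::finite"
  assumes "smooth f" "\<And>i j z. norm z \<le> norm y \<Longrightarrow> \<bar>partial i (partial j f) (x + z)\<bar> \<le> K"
  shows "\<bar>f (x + y) - f x - directional y f x\<bar> \<le> real CARD('d) ^ 2 * K * norm y ^ 2"
proof -
  obtain t where t: "0 < t" "t < 1" and *: "f (x + y) = f x + directional y f x
     + directional y (directional y f) (x + t *\<^sub>R y) / 2"
    using directional_taylor[OF assms(1), of 2 x y] by (auto simp: eval_nat_numeral)
  have "norm (t *\<^sub>R y) \<le> norm y" using t by (simp add: mult_left_le_one_le)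
  with assms(2) have "\<bar>directional y (directional y f) (x + t *\<^sub>R y)\<bar> \<le> (real CARD('d) * norm y)\<^sup>2 * K"
    by (intro directional2_le assms)
  with * show ?thesis
    by (simp add: mult_ac power_mult_distrib)
qed

lemma taylor2_bound:
  fixes y :: "real ^ 'd::finite"
  assumes "C3_bounded K f"
  shows "\<bar>f (x + y) - f x - directional y f x\<bar> \<le> real CARD('d) ^ 2 * K * norm y ^ 2"
  by (rule taylor2_bound_ball) (use C3_boundedD[OF assms] in auto)

lemma taylor3_bound:
  fixes y :: "real ^ 'd::finite"
  assumes "C3_bounded K f"
  shows "\<bar>f (x + y) - f x - directional y f x - directional y (directional y f) x / 2\<bar>
     \<le> real CARD('d) ^ 3 * K * norm y ^ 3"
proof -
  obtain t where t: "0 < t" "t < 1" and t3: "f (x + y) = (\<Sum>m<3. (directional y ^^ m) f x / fact m)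
        + (directional y ^^ 3) f (x + t *\<^sub>R y) / fact 3"
    by (rule directional_taylor[OF C3_boundedD(1)[OF assms], of 3 x y]) auto
  have "{..<3::nat} = {0, 1, 2}" "fact 3 = (6 :: real)"
    by (auto simp: fact_numeral)
  with t3 have *: "f (x + y) = f x + directional y f x
     + directional y (directional y f) x / 2
     + directional y (directional y (directional y f)) (x + t *\<^sub>R y) / 6"
    by (simp add: numeral_3_eq_3 numeral_2_eq_2)
  have "\<bar>directional y (directional y (directional y f)) (x + t *\<^sub>R y)\<bar> \<le> (real CARD('d) * norm y) ^ 3 * K"
    by (intro directional3_le) (use C3_boundedD[OF assms] in auto)
  moreover have "0 \<le> (real CARD('d) * norm y) ^ 3 * K"
    using C3_boundedD[OF assms] by simp
  ultimately show ?thesis using *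
    by (simp add: mult_ac power_mult_distrib)
qed

lemma C3_bounded_translate: "C3_bounded K f \<Longrightarrow> C3_bounded K (\<lambda>y. f (x + y))"
  by (auto simp: C3_bounded_def smooth_translate smooth_partial)

section \<open>Smooth functions with compact support\<close>

lemma Cc_infty_iff: "f \<in> Cc_infty \<longleftrightarrow> smooth f \<and> (\<exists>R. \<forall>x. norm x > R \<longrightarrow> f x = 0)"
proof -
  have "compact (closure {x. f x \<noteq> 0}) \<longleftrightarrow> bounded {x. f x \<noteq> 0}"
    by simp
  also have "\<dots> \<longleftrightarrow> (\<exists>R. \<forall>x. norm x > R \<longrightarrow> f x = 0)"
    unfolding bounded_iff by (auto simp: not_less) (metis not_le)+
  finally show ?thesis by (auto simp: Cc_infty_def smooth_def)
qed

lemma partial_eq_0: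
  assumes "\<And>x. norm x > R \<Longrightarrow> f x = 0" "norm x > R"
  shows "partial i f x = 0"
proof -
  have "open {x::real^'a. norm x > R}"
    by (intro open_Collect_less continuous_intros)
  then have "(f has_derivative (\<lambda>_. 0)) (at x)"
    using assms by (intro has_derivative_transform_within_open[OF has_derivative_const[of 0]]) auto
  from partial_eqI[OF this] show ?thesis by simp
qed

lemma Cc_infty_partial: "f \<in> Cc_infty \<Longrightarrow> partial i f \<in> Cc_infty"
  by (auto simp: Cc_infty_iff smooth_partial) (metis partial_eq_0)

lemma Cc_infty_bounded:
  assumes "f \<in> Cc_infty"
  obtains K where "\<And>x. \<bar>f x\<bar> \<le> K" "K \<ge> 0"
proof -
  obtain R where R: "\<And>x. norm x > R \<Longrightarrow> f x = 0" and "smooth f"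
    using assms by (auto simp: Cc_infty_iff)
  then have "compact (f ` cball 0 R)"
    by (intro compact_continuous_image smooth_continuous_on) auto
  then obtain K where K: "\<And>x. x \<in> cball 0 R \<Longrightarrow> \<bar>f x\<bar> \<le> K"
    by (metis bounded_iff compact_imp_bounded imageI real_norm_def)
  have "\<bar>f x\<bar> \<le> max K 0" for x
    using K[of x] R[of x] by (cases "norm x \<le> R") auto
  then show ?thesis using that by (meson max.cobounded2)
qed

text \<open>There are finitely many index triples, hence finitely many values of \<open>B\<close>.
  The functional \<open>B\<close> is arbitrary so that it can select, for each derivative, a sup
  bound or the constant of a convolution estimate.\<close>

lemma third_order_uniform_bound:
  fixes B :: "(real ^ 'd::finite \<Rightarrow> real) \<Rightarrow> real"
  obtains K where "B f \<le> K" "\<And>i. B (partial i f) \<le> K" "\<And>i j. B (partial i (partial j f)) \<le> K"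
    "\<And>i j k. B (partial i (partial j (partial k f))) \<le> K"
proof -
  let ?S = "insert (B f) (range (\<lambda>i. B (partial i f)) \<union> range (\<lambda>(i, j). B (partial i (partial j f)))
     \<union> range (\<lambda>(i, j, k). B (partial i (partial j (partial k f)))))"
  have "finite ?S" by simp
  then obtain K where K: "\<And>s. s \<in> ?S \<Longrightarrow> s \<le> K"
    by (meson Max_ge)
  show ?thesis
    by (rule that[of K]; rule K) (simp_all add: image_iff, blast+)
qed

lemma Cc_infty_C3:
  fixes f :: "real ^ 'd::finite \<Rightarrow> real"
  assumes "f \<in> Cc_infty"
  obtains K where "C3_bounded K f"
proof -
  define B :: "(real ^ 'd \<Rightarrow> real) \<Rightarrow> real" where "B = (\<lambda>g. SOME K. \<forall>x. \<bar>g x\<bar> \<le> K)"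
  have B: "\<bar>g x\<bar> \<le> K" if "g \<in> Cc_infty" "B g \<le> K" for g x K
  proof -
    have "\<forall>x. \<bar>g x\<bar> \<le> B g"
      unfolding B_def by (rule someI_ex) (use Cc_infty_bounded[OF that(1)] in blast)
    with that show ?thesis by (meson order_trans)
  qed
  obtain K where K: "B f \<le> K" "\<And>i. B (partial i f) \<le> K" "\<And>i j. B (partial i (partial j f)) \<le> K"
    "\<And>i j k. B (partial i (partial j (partial k f))) \<le> K"
    using third_order_uniform_bound[of B f] by blast
  have "C3_bounded K f"
    unfolding C3_bounded_def using assms by (intro conjI allI B K Cc_infty_partial) (auto simp: Cc_infty_iff)
  then show ?thesis using that by blast
qed

lemma Cc_infty_mult: "smooth f \<Longrightarrow> g \<in> Cc_infty \<Longrightarrow> (\<lambda>x. f x * g x) \<in> Cc_infty"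
  unfolding Cc_infty_iff by (metis mult_zero_right smooth_mult)

section \<open>A bump function\<close>

text \<open>Products of a polynomial in \<open>1 / t\<close> with \<open>exp (- (1 / t))\<close>,
  extended by zero: this family is closed under differentiation, so one computation gives all
  derivatives, including those at the origin.\<close>

definition flat_exp :: "real poly \<Rightarrow> real \<Rightarrow> real" where
  "flat_exp p t = (if t > 0 then poly p (1 / t) * exp (- (1 / t)) else 0)"

lemma poly_exp_tendsto_0: "((\<lambda>y::real. poly p y * exp (- y)) \<longlongrightarrow> 0) at_top"
proof -
  have "((\<lambda>y::real. \<Sum>i\<le>degree p. coeff p i * (y ^ i / exp y)) \<longlongrightarrow> (\<Sum>i\<le>degree p. coeff p i * 0)) at_top"
    by (intro tendsto_intros tendsto_power_div_exp_0)
  then show ?thesis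
    by (simp add: poly_altdef sum_distrib_right exp_minus divide_inverse mult.assoc)
qed

text \<open>For \<open>t > 0\<close> the chain rule turns \<open>p\<close> into
  \<open>y\<^sup>2 * (p - p')\<close> at \<open>y = 1 / t\<close>, and \<open>[:0, 0, 1:]\<close> is
  \<open>y\<^sup>2\<close>. At \<open>t = 0\<close> exponential decay beats the polynomial.\<close>

lemma flat_exp_derivative:
  "(flat_exp p has_real_derivative flat_exp ([:0, 0, 1:] * (p - pderiv p)) t) (at t)"
proof -
  consider "t > 0" | "t < 0" | "t = 0" by linarith
  then show ?thesis
  proof cases
    case 1
    have "((\<lambda>t. poly p (1 / t) * exp (- (1 / t))) has_real_derivative
       flat_exp ([:0, 0, 1:] * (p - pderiv p)) t) (at t)"
      using 1 by (auto intro!: derivative_eq_intros DERIV_chain2[where f = "poly p"] poly_DERIV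
          simp: flat_exp_def field_simps power2_eq_square)
    then show ?thesis
      by (rule has_field_derivative_transform_within_open[where S = "{0<..}"])
         (use 1 in \<open>auto simp: flat_exp_def\<close>)
  next
    case 2
    have "((\<lambda>t. 0) has_real_derivative 0) (at t)" by simp
    then have "(flat_exp p has_real_derivative 0) (at t)"
      by (rule has_field_derivative_transform_within_open[where S = "{..<0}"])
         (use 2 in \<open>auto simp: flat_exp_def\<close>)
    with 2 show ?thesis by (simp add: flat_exp_def)
  next
    case 3
    \<comment> \<open>Dividing by \<open>y\<close> multiplies the polynomial in \<open>1 / y\<close>
      by its variable, so the difference quotient at zero has the same form as the function.\<close>
    have "((\<lambda>y. poly ([:0, 1:] * p) (inverse y) * exp (- inverse y)) \<longlongrightarrow> 0) (at_right (0::real))"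
      by (rule filterlim_compose[OF poly_exp_tendsto_0 filterlim_inverse_at_top_right])
    moreover have "\<forall>\<^sub>F y in at_right (0::real). poly ([:0, 1:] * p) (inverse y) * exp (- inverse y) = flat_exp p y / y"
      by (auto simp: eventually_at_filter flat_exp_def divide_inverse mult_ac)
    ultimately have "((\<lambda>y. flat_exp p y / y) \<longlongrightarrow> 0) (at_right 0)"
      by (rule Lim_transform_eventually)
    moreover have "((\<lambda>y. flat_exp p y / y) \<longlongrightarrow> 0) (at_left 0)"
      by (rule Lim_transform_eventually[OF tendsto_const])
         (auto simp: eventually_at_filter flat_exp_def)
    ultimately have "((\<lambda>y. flat_exp p y / y) \<longlongrightarrow> 0) (at 0)"
      by (simp add: filterlim_at_split)
    with 3 show ?thesis
      by (simp add: has_field_derivative_iff flat_exp_def)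
  qed
qed

text \<open>A scalar factor is part of the closed class because the chain rule produces the factor
  \<open>s\<close>.\<close>

lemma smooth_flat_exp: "smooth (\<lambda>x. flat_exp p (a + s * x $ j))"
proof (rule smoothI[where P = "\<lambda>f. \<exists>c p. f = (\<lambda>x. c * flat_exp p (a + s * x $ j))"])
  show "\<exists>c q. (\<lambda>x. flat_exp p (a + s * x $ j)) = (\<lambda>x. c * flat_exp q (a + s * x $ j))"
    by (metis mult_1)
next
  fix f :: "real ^ 'a \<Rightarrow> real" and x i
  assume "\<exists>c p. f = (\<lambda>x. c * flat_exp p (a + s * x $ j))"
  then obtain c p where f: "f = (\<lambda>x. c * flat_exp p (a + s * x $ j))" by blast
  let ?q = "[:0, 0, 1:] * (p - pderiv p)"
  have d: "(f has_derivative (\<lambda>z. c * (flat_exp ?q (a + s * x $ j) * (s * z $ j)))) (at x)" for x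
  proof -
    have "((\<lambda>x. a + s * x $ j) has_derivative (\<lambda>z. s * z $ j)) (at x)"
      by (auto intro!: derivative_eq_intros bounded_linear_imp_has_derivative bounded_linear_vec_nth)
    from has_derivative_compose[OF this flat_exp_derivative[unfolded has_field_derivative_def, of p]]
    show ?thesis
      unfolding f by (intro has_derivative_mult_right)
  qed
  then show "f differentiable (at x)" by (auto simp: differentiable_def)
  have "partial i f = (\<lambda>x. (c * s * axis i 1 $ j) * flat_exp ?q (a + s * x $ j))"
    using partial_eqI[OF d, of i] by auto
  then show "\<exists>c q. partial i f = (\<lambda>x. c * flat_exp q (a + s * x $ j))" by blast
qed

text \<open>A product over the coordinates, each factor a function of a single coordinate; its
  support is the cube of half side \<open>r\<close>, which lies in the ball of radius
  \<open>CARD('d) * r\<close>. The factors \<open>1\<close> and \<open>-1\<close> match the affine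
  form in \<open>smooth_flat_exp\<close>.\<close>

definition bump :: "real \<Rightarrow> real ^ 'd::finite \<Rightarrow> real" where
  "bump r x = (\<Prod>j\<in>UNIV. flat_exp 1 (r + 1 * x $ j) * flat_exp 1 (r + (-1) * x $ j))"

lemma flat_exp_nonneg: "0 \<le> flat_exp 1 t"
  by (simp add: flat_exp_def)

lemma bump_nonneg: "0 \<le> bump r x"
  unfolding bump_def by (intro prod_nonneg mult_nonneg_nonneg flat_exp_nonneg ballI)

lemma bump_pos: "r > 0 \<Longrightarrow> 0 < bump r 0"
  unfolding bump_def by (intro prod_pos) (auto simp: flat_exp_def)

lemma smooth_bump: "smooth (bump r)"
  unfolding bump_def[abs_def] by (intro smooth_prod smooth_mult smooth_flat_exp) auto

lemma bump_eq_0: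
  fixes x :: "real ^ 'd::finite"
  assumes "norm x > real CARD('d) * r"
  shows "bump r x = 0"
proof -
  have "\<exists>j. \<bar>x $ j\<bar> > r"
  proof (rule ccontr)
    assume "\<not> ?thesis"
    then have "(\<Sum>j\<in>UNIV. \<bar>x $ j\<bar>) \<le> (\<Sum>j\<in>(UNIV :: 'd set). r)"
      by (intro sum_mono) (simp add: not_less)
    with norm_le_l1_cart[of x] assms show False by simp
  qed
  then obtain j where j: "\<bar>x $ j\<bar> > r" by blast
  have "flat_exp 1 (r + 1 * x $ j) * flat_exp 1 (r + (-1) * x $ j) = 0"
    using j by (auto simp: flat_exp_def abs_if split: if_splits)
  then show ?thesis
    unfolding bump_def by (intro prod_zero) auto
qed

section \<open>Mollification\<close>

definition convolve :: "(real ^ 'd::finite \<Rightarrow> real) \<Rightarrow> (real ^ 'd \<Rightarrow> real) \<Rightarrow> real ^ 'd \<Rightarrow> real" where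
  "convolve \<rho> u x = (LINT y|lborel. \<rho> (x - y) * u y)"

lemma integral_bounded_support:
  fixes f :: "real ^ 'd::finite \<Rightarrow> real"
  assumes [measurable]: "f \<in> borel_measurable borel"
    and "\<And>y. norm (x - y) \<le> R \<Longrightarrow> \<bar>f y\<bar> \<le> B" "\<And>y. norm (x - y) > R \<Longrightarrow> f y = 0"
  shows "integrable lborel f" "\<bar>LINT y|lborel. f y\<bar> \<le> B * measure lborel (cball x R)"
proof -
  have fin: "emeasure lborel (cball x R) < \<infinity>"
    by (intro emeasure_bounded_finite) auto
  show i: "integrable lborel f"
    by (rule integrableI_bounded_set[of "cball x R" _ _ B])
       (use assms fin in \<open>auto simp: dist_norm not_le\<close>)
  have "\<bar>LINT y|lborel. f y\<bar> \<le> (LINT y|lborel. \<bar>f y\<bar>)"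
    by (rule integral_abs_bound)
  also have "\<dots> \<le> (LINT y|lborel. B * indicator (cball x R) y)"
  proof (rule integral_mono)
    show "integrable lborel (\<lambda>y. B * indicator (cball x R) y :: real)"
      using fin by (intro integrable_mult_right integrable_real_indicator) auto
    show "\<bar>f y\<bar> \<le> B * indicator (cball x R) y" for y
      using assms(2,3)[of y] by (cases "norm (x - y) \<le> R") (auto simp: dist_norm)
  qed (use i in auto)
  also have "\<dots> = B * measure lborel (cball x R)"
    by simp
  finally show "\<bar>LINT y|lborel. f y\<bar> \<le> B * measure lborel (cball x R)" .
qed

lemma measure_cball_center: "measure lborel (cball (x :: real ^ 'd::finite) R) = measure lborel (cball (0 :: real ^ 'd) R)"
proof (cases "R \<ge> 0")
  case True
  then show ?thesis by (simp add: content_cball)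
qed simp

lemma Cc_infty_measurable: "f \<in> Cc_infty \<Longrightarrow> f \<in> borel_measurable borel"
  by (intro borel_measurable_continuous_onI smooth_continuous_on) (auto simp: Cc_infty_iff)

lemma convolve_integrable:
  fixes u :: "real ^ 'd::finite \<Rightarrow> real"
  assumes "\<rho> \<in> Cc_infty" and [measurable]: "u \<in> borel_measurable borel" and "\<And>y. \<bar>u y\<bar> \<le> M"
  shows "integrable lborel (\<lambda>y. \<rho> (x - y) * u y)"
proof -
  obtain K where K: "\<And>x. \<bar>\<rho> x\<bar> \<le> K" "K \<ge> 0" using Cc_infty_bounded[OF assms(1)] by blast
  obtain R where R: "\<And>x. norm x > R \<Longrightarrow> \<rho> x = 0" using assms(1) by (auto simp: Cc_infty_iff)
  have [measurable]: "\<rho> \<in> borel_measurable borel" using assms by (intro Cc_infty_measurable)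
  show ?thesis
  proof (rule integral_bounded_support(1))
    show "\<bar>\<rho> (x - y) * u y\<bar> \<le> K * M" for y
      unfolding abs_mult by (intro mult_mono K assms) auto
  qed (use R in auto)
qed

text \<open>The derivative falls on the kernel: the first-order Taylor remainder of
  \<open>\<rho>\<close> is of size \<open>norm h ^ 2\<close> and, for \<open>norm h \<le> 1\<close>,
  vanishes outside a ball of radius \<open>R + 1\<close>, so its integral against the bounded
  \<open>u\<close> is again of order \<open>norm h ^ 2\<close>.\<close>

lemma convolve_has_derivative:
  fixes u :: "real ^ 'd::finite \<Rightarrow> real"
  assumes \<rho>: "\<rho> \<in> Cc_infty" and [measurable]: "u \<in> borel_measurable borel" and M: "\<And>y. \<bar>u y\<bar> \<le> M"
  shows "(convolve \<rho> u has_derivative (\<lambda>h. \<Sum>i\<in>UNIV. h $ i * convolve (partial i \<rho>) u x)) (at x)"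
proof -
  obtain K where K: "C3_bounded K \<rho>" using Cc_infty_C3[OF \<rho>] .
  obtain R where R: "\<And>x. norm x > R \<Longrightarrow> \<rho> x = 0" using \<rho> by (auto simp: Cc_infty_iff)
  let ?D = "real CARD('d)"
  have [measurable]: "\<rho> \<in> borel_measurable borel" "partial i \<rho> \<in> borel_measurable borel" for i
    using \<rho> by (auto intro!: Cc_infty_measurable Cc_infty_partial)
  have M0: "0 \<le> M" using M[of 0] by linarith
  define C where "C = ?D ^ 2 * K * M * measure lborel (cball (0 :: real ^ 'd) (R + 1))"
  have main: "\<bar>convolve \<rho> u (x + h) - convolve \<rho> u x - (\<Sum>i\<in>UNIV. h $ i * convolve (partial i \<rho>) u x)\<bar>
      \<le> C * norm h ^ 2" if "norm h \<le> 1" for h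
  proof -
    note int = convolve_integrable[OF _ _ M]
    have "convolve \<rho> u (x + h) - convolve \<rho> u x - (\<Sum>i\<in>UNIV. h $ i * convolve (partial i \<rho>) u x)
       = (LINT y|lborel. \<rho> (x + h - y) * u y - \<rho> (x - y) * u y - (\<Sum>i\<in>UNIV. h $ i * (partial i \<rho> (x - y) * u y)))"
      unfolding convolve_def using \<rho>
      by (subst Bochner_Integration.integral_diff Bochner_Integration.integral_sum
            | intro Bochner_Integration.integrable_diff Bochner_Integration.integrable_sum
                integrable_mult_right int Cc_infty_partial | simp)+
    also have "\<dots> = (LINT y|lborel. (\<rho> ((x - y) + h) - \<rho> (x - y) - directional h \<rho> (x - y)) * u y)"
      by (intro Bochner_Integration.integral_cong)
         (auto simp: directional_def algebra_simps sum_distrib_left sum_distrib_right)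
    also have "\<bar>\<dots>\<bar> \<le> (?D ^ 2 * K * norm h ^ 2) * M * measure lborel (cball x (R + 1))"
    proof (rule integral_bounded_support(2))
      show "(\<lambda>y. (\<rho> ((x - y) + h) - \<rho> (x - y) - directional h \<rho> (x - y)) * u y) \<in> borel_measurable borel"
        unfolding directional_def by measurable
      show "\<bar>(\<rho> ((x - y) + h) - \<rho> (x - y) - directional h \<rho> (x - y)) * u y\<bar>
          \<le> (?D ^ 2 * K * norm h ^ 2) * M" for y
        unfolding abs_mult by (intro mult_mono taylor2_bound K M) (use C3_boundedD[OF K] in auto)
      fix y assume y: "norm (x - y) > R + 1"
      then have "norm (x - y + h) > R" "norm (x - y) > R"
        using that norm_triangle_ineq2[of "x - y" "- h"] by auto
      then show "(\<rho> ((x - y) + h) - \<rho> (x - y) - directional h \<rho> (x - y)) * u y = 0"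
        by (simp add: R directional_def partial_eq_0[OF R])
    qed
    also have "\<dots> = C * norm h ^ 2"
      by (simp add: C_def measure_cball_center[of x] mult_ac)
    finally show ?thesis .
  qed
  show ?thesis
  proof (rule has_derivativeI_sandwich[where e = 1 and H = "\<lambda>y. C * norm (y - x)"])
    show "bounded_linear (\<lambda>h. \<Sum>i\<in>UNIV. h $ i * convolve (partial i \<rho>) u x)"
      by (intro bounded_linear_sum bounded_linear_mult_const bounded_linear_vec_nth)
    show "norm (convolve \<rho> u y - convolve \<rho> u x - (\<Sum>i\<in>UNIV. (y - x) $ i * convolve (partial i \<rho>) u x))
        / norm (y - x) \<le> C * norm (y - x)" if "y \<noteq> x" "dist y x < 1" for y
      using main[of "y - x"] that by (simp add: dist_norm divide_simps power2_eq_square mult_ac)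
    show "((\<lambda>y. C * norm (y - x)) \<longlongrightarrow> 0) (at x)"
      by (auto intro!: tendsto_eq_intros)
  qed simp
qed

lemma partial_convolve:
  assumes "\<rho> \<in> Cc_infty" "u \<in> borel_measurable borel" "\<And>y. \<bar>u y\<bar> \<le> M"
  shows "partial i (convolve \<rho> u) = convolve (partial i \<rho>) u"
proof
  fix x
  from partial_eqI[OF convolve_has_derivative[OF assms], of i x]
  show "partial i (convolve \<rho> u) x = convolve (partial i \<rho>) u x"
    by (simp add: axis_def if_distrib[of "\<lambda>c. c * _"] cong: if_cong)
qed

lemma smooth_convolve:
  assumes "\<rho> \<in> Cc_infty" "u \<in> borel_measurable borel" "\<And>y. \<bar>u y\<bar> \<le> M"
  shows "smooth (convolve \<rho> u)"
proof (rule smoothI[where P = "\<lambda>f. \<exists>\<rho>\<in>Cc_infty. f = convolve \<rho> u"])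
  fix f x i assume "\<exists>\<rho>\<in>Cc_infty. f = convolve \<rho> u"
  then obtain \<rho> where \<rho>: "\<rho> \<in> Cc_infty" "f = convolve \<rho> u" by blast
  then show "f differentiable (at x)"
    using convolve_has_derivative[OF \<rho>(1) assms(2,3)] by (auto simp: differentiable_def)
  show "\<exists>\<rho>\<in>Cc_infty. partial i f = convolve \<rho> u"
    using partial_convolve[OF \<rho>(1) assms(2,3)] \<rho> Cc_infty_partial by blast
qed (use assms in blast)

text \<open>\<open>C\<close> depends on the kernel only, and the value at \<open>x\<close> sees
  \<open>u\<close> only within distance \<open>R\<close> of \<open>x\<close>. This locality lets
  closeness on a ball control the mollified functions on a smaller ball.\<close>

lemma convolve_local_bound:
  fixes u :: "real ^ 'd::finite \<Rightarrow> real"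
  assumes "\<rho> \<in> Cc_infty" and R: "\<And>x. norm x > R \<Longrightarrow> \<rho> x = 0"
  obtains C where "C \<ge> 0"
    "\<And>(u :: real ^ 'd \<Rightarrow> real) x m. u \<in> borel_measurable borel \<Longrightarrow> (\<And>y. norm (x - y) \<le> R \<Longrightarrow> \<bar>u y\<bar> \<le> m) \<Longrightarrow> 0 \<le> m
      \<Longrightarrow> \<bar>convolve \<rho> u x\<bar> \<le> C * m"
proof -
  obtain K where K: "\<And>x. \<bar>\<rho> x\<bar> \<le> K" "K \<ge> 0" using Cc_infty_bounded[OF assms(1)] by blast
  have [measurable]: "\<rho> \<in> borel_measurable borel" using assms by (intro Cc_infty_measurable)
  show ?thesis
  proof (rule that[of "K * measure lborel (cball (0 :: real ^ 'd) R)"])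
    fix u :: "real ^ 'd \<Rightarrow> real" and x m
    assume [measurable]: "u \<in> borel_measurable borel" and m: "\<And>y. norm (x - y) \<le> R \<Longrightarrow> \<bar>u y\<bar> \<le> m" "0 \<le> m"
    have "\<bar>convolve \<rho> u x\<bar> \<le> (K * m) * measure lborel (cball x R)"
      unfolding convolve_def
    proof (rule integral_bounded_support(2))
      show "\<bar>\<rho> (x - y) * u y\<bar> \<le> K * m" if "norm (x - y) \<le> R" for y
        unfolding abs_mult by (intro mult_mono K m that) auto
    qed (use R in auto)
    then show "\<bar>convolve \<rho> u x\<bar> \<le> K * measure lborel (cball (0 :: real ^ 'd) R) * m"
      by (simp add: measure_cball_center[of x] mult_ac)
  qed (use K in auto)
qed

lemma convolve_commute:
  fixes u :: "real ^ 'd::finite \<Rightarrow> real"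
  assumes "\<rho> \<in> Cc_infty" and [measurable]: "u \<in> borel_measurable borel"
  shows "convolve \<rho> u x = (LINT y|lborel. \<rho> y * u (x - y))"
proof -
  have [measurable]: "\<rho> \<in> borel_measurable borel" using assms by (intro Cc_infty_measurable)
  have eq: "lborel = distr lborel borel (\<lambda>y. x - y)"
    using lborel_affine[of "-1" x] by (simp add: density_1)
  have "convolve \<rho> u x = (LINT y|distr lborel borel (\<lambda>y. x - y). \<rho> (x - y) * u y)"
    unfolding convolve_def by (subst eq) simp
  also have "\<dots> = (LINT y|lborel. \<rho> y * u (x - y))"
    by (subst integral_distr) auto
  finally show ?thesis .
qed

definition mollifier :: "real \<Rightarrow> (real ^ 'd::finite \<Rightarrow> real) \<Rightarrow> bool" where
  "mollifier r \<rho> \<longleftrightarrow> \<rho> \<in> Cc_infty \<and> (\<forall>x. 0 \<le> \<rho> x) \<and> (LINT y|lborel. \<rho> y) = 1 \<and> (\<forall>x. norm x > r \<longrightarrow> \<rho> x = 0)"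

text \<open>A normalised bump. Its integral is positive: otherwise the bump would vanish almost
  everywhere, although it is positive on a nonempty open set.\<close>

lemma mollifier_exists:
  assumes "r > 0"
  obtains \<rho> :: "real ^ 'd::finite \<Rightarrow> real" where "mollifier r \<rho>"
proof -
  define s where "s = r / real CARD('d)"
  have s: "s > 0" using assms by (simp add: s_def)
  let ?b = "bump s :: real ^ 'd \<Rightarrow> real"
  have sup: "norm x > r \<Longrightarrow> ?b x = 0" for x
    using bump_eq_0[where r = s, of x] by (simp add: s_def)
  then have Cc: "?b \<in> Cc_infty" by (auto simp: Cc_infty_iff smooth_bump)
  obtain K where K: "\<And>x. \<bar>?b x\<bar> \<le> K"
    using Cc_infty_bounded[OF Cc] by blast
  have int: "integrable lborel ?b"
    by (rule integral_bounded_support(1)[where x = 0 and R = r])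
       (use K sup Cc Cc_infty_measurable in auto)
  have "(LINT y|lborel. ?b y) \<noteq> 0"
  proof
    assume "(LINT y|lborel. ?b y) = 0"
    then have "AE y in lborel. ?b y = 0"
      using int by (subst (asm) integral_nonneg_eq_0_iff_AE) (auto simp: bump_nonneg)
    moreover have "open {y. ?b y \<noteq> 0}"
      by (intro open_Collect_neq smooth_continuous_on smooth_bump continuous_intros)
    ultimately have "{y. ?b y \<noteq> 0} = {}"
      using open_not_negligible[of "{y. ?b y \<noteq> 0}"]
      by (auto simp: negligible_iff_null_sets AE_iff_null null_sets_completionI)
    moreover have "?b 0 > 0" using s by (rule bump_pos)
    ultimately show False by auto
  qed
  moreover have "(LINT y|lborel. ?b y) \<ge> 0"
    by (simp add: bump_nonneg)
  ultimately have pos: "(LINT y|lborel. ?b y) > 0" by linarith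
  let ?c = "1 / (LINT y|lborel. ?b y)"
  have "mollifier r (\<lambda>x. ?c * ?b x)"
    unfolding mollifier_def
  proof (intro conjI allI impI)
    show "(\<lambda>x. ?c * ?b x) \<in> Cc_infty" by (intro Cc_infty_mult Cc smooth_const)
  qed (use pos bump_nonneg[of s] sup in \<open>auto simp: bump_nonneg\<close>)
  then show ?thesis using that by blast
qed

lemma mollifierD:
  assumes "mollifier r \<rho>"
  shows "\<rho> \<in> Cc_infty" "0 \<le> \<rho> x" "(LINT y|lborel. \<rho> y) = 1" "norm x > r \<Longrightarrow> \<rho> x = 0" "integrable lborel \<rho>"
proof -
  show "\<rho> \<in> Cc_infty" "0 \<le> \<rho> x" "(LINT y|lborel. \<rho> y) = 1" "norm x > r \<Longrightarrow> \<rho> x = 0"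
    using assms by (auto simp: mollifier_def)
  show "integrable lborel \<rho>"
    using assms not_integrable_integral_eq[of lborel \<rho>] by (auto simp: mollifier_def)
qed

text \<open>A mollifier is a limit of finite convex combinations of translations, uniformly over all
  functions with a given modulus of continuity; this is what makes Jensen's inequality available
  for sublinear functionals without any continuity assumption.\<close>

lemma mollifier_finite_approx:
  fixes \<rho> :: "real ^ 'd::finite \<Rightarrow> real"
  assumes \<rho>: "mollifier r \<rho>" and "\<eta> > 0"
  obtains m :: nat and w :: "nat \<Rightarrow> real" and z :: "nat \<Rightarrow> real ^ 'd"
  where "\<And>k. 0 \<le> w k" "(\<Sum>k<m. w k) = 1"
    "\<And>(u :: real ^ 'd \<Rightarrow> real) x M \<kappa>. u \<in> borel_measurable borel \<Longrightarrow> (\<And>y. \<bar>u y\<bar> \<le> M) \<Longrightarrow>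
       (\<And>a b. dist a b < \<eta> \<Longrightarrow> \<bar>u a - u b\<bar> \<le> \<kappa>) \<Longrightarrow>
       \<bar>convolve \<rho> u x - (\<Sum>k<m. w k * u (x - z k))\<bar> \<le> \<kappa>"
proof -
  note \<rho>D = mollifierD[OF \<rho>]
  have [measurable]: "\<rho> \<in> borel_measurable borel" using \<rho>D by (intro Cc_infty_measurable)
  have "cball (0 :: real ^ 'd) r \<subseteq> (\<Union>z\<in>UNIV. ball z \<eta>)"
    using \<open>\<eta> > 0\<close> by (metis UN_I UNIV_I centre_in_ball subsetI)
  then obtain Z where Z: "finite Z" "cball (0 :: real ^ 'd) r \<subseteq> (\<Union>z\<in>Z. ball z \<eta>)"
    using compactE_image[OF compact_cball, of UNIV "\<lambda>z. ball z \<eta>" 0 r] by (metis open_ball)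
  obtain m z where mz: "Z = z ` {..<m::nat}"
    using finite_imp_nat_seg_image_inj_on[OF Z(1)] by (auto simp: lessThan_def)
  \<comment> \<open>Indices from \<open>m\<close> on get the empty set, which turns the finite cover
    into a sequence that can be made disjoint.\<close>
  define B where "B k = (if k < m then ball (z k) \<eta> else {})" for k
  define A where "A = disjointed B"
  have dis: "disjoint_family A" unfolding A_def by (rule disjoint_family_disjointed)
  have AB: "A k \<subseteq> B k" for k unfolding A_def by (rule disjointed_subset)
  have UA: "(\<Union>k. A k) = (\<Union>k. B k)" unfolding A_def by (rule UN_disjointed_eq)
  have [measurable]: "A k \<in> sets borel" for k
    unfolding A_def disjointed_def B_def by auto
  define w where "w k = (LINT y|lborel. \<rho> y * indicator (A k) y)" for k
  have intA: "integrable lborel (\<lambda>y. \<rho> y * indicator (A k) y)" for k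
    using \<rho>D(5) by (rule integrable_real_mult_indicator[rotated]) auto
  have ind: "(\<Sum>k<m. indicator (A k) y :: real) = 1" if y: "norm y \<le> r" for y
  proof -
    have "y \<in> (\<Union>z\<in>Z. ball z \<eta>)" by (rule subsetD[OF Z(2)]) (use y in simp)
    then have "y \<in> (\<Union>k. B k)" by (auto simp: mz B_def)
    then obtain k where k: "y \<in> A k" using UA by blast
    with AB[of k] have km: "k < m" by (auto simp: B_def split: if_splits)
    have "(\<Sum>k<m. indicator (A k) y :: real) = (\<Sum>l<m. if l = k then 1 else 0)"
      using k dis by (intro sum.cong) (auto simp: disjoint_family_on_def indicator_def)
    with km show ?thesis by simp
  qed
  \<comment> \<open>Outside the ball of radius \<open>r\<close> both sides are zero because the
    mollifier vanishes there, so the decomposition holds at every point.\<close>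
  have dec: "\<rho> y * c = (\<Sum>k<m. \<rho> y * indicator (A k) y * c)" for y c
  proof (cases "norm y \<le> r")
    case True
    then show ?thesis
      using ind[OF True] by (simp flip: sum_distrib_left sum_distrib_right)
  next
    case False
    then show ?thesis using \<rho>D(4)[of y] by simp
  qed
  have "(\<Sum>k<m. w k) = (LINT y|lborel. (\<Sum>k<m. \<rho> y * indicator (A k) y))"
    unfolding w_def by (rule Bochner_Integration.integral_sum[symmetric]) (rule intA)
  also have "(\<lambda>y. \<Sum>k<m. \<rho> y * indicator (A k) y) = \<rho>"
    using dec[of _ 1] by (intro ext) (simp only: mult_1_right)
  also have "(LINT y|lborel. \<rho> y) = 1"
    by (rule \<rho>D)
  finally have sw: "(\<Sum>k<m. w k) = 1" .
  have w0: "0 \<le> w k" for k unfolding w_def by (rule Bochner_Integration.integral_nonneg) (simp add: \<rho>D)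
  show ?thesis
  proof (rule that[OF w0 sw])
    fix u :: "real ^ 'd \<Rightarrow> real" and x M \<kappa>
    assume um [measurable]: "u \<in> borel_measurable borel" and M: "\<And>y. \<bar>u y\<bar> \<le> M"
      and \<kappa>: "\<And>a b. dist a b < \<eta> \<Longrightarrow> \<bar>u a - u b\<bar> \<le> \<kappa>"
    have intu: "integrable lborel (\<lambda>y. \<rho> y * indicator (A k) y * u (x - y))" for k
    proof (rule Bochner_Integration.integrable_bound[OF integrable_mult_right[OF \<rho>D(5), of M]])
      show "AE y in lborel. norm (\<rho> y * indicator (A k) y * u (x - y)) \<le> norm (M * \<rho> y)"
      proof (rule AE_I2)
        fix y
        have "\<bar>u (x - y)\<bar> * \<rho> y \<le> \<bar>M\<bar> * \<rho> y"
          using M \<rho>D(2) by (intro mult_right_mono) (auto intro: order_trans[OF M abs_ge_self])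
        then show "norm (\<rho> y * indicator (A k) y * u (x - y)) \<le> norm (M * \<rho> y)"
          using \<rho>D(2)[of y] by (auto simp: abs_mult indicator_def mult.commute)
      qed
    qed simp
    have eq: "(\<lambda>y. \<rho> y * u (x - y)) = (\<lambda>y. \<Sum>k<m. \<rho> y * indicator (A k) y * u (x - y))"
      by (rule ext) (rule dec)
    have "convolve \<rho> u x - (\<Sum>k<m. w k * u (x - z k))
       = (LINT y|lborel. (\<Sum>k<m. \<rho> y * indicator (A k) y * u (x - y))) - (\<Sum>k<m. w k * u (x - z k))"
      by (simp only: convolve_commute[OF \<rho>D(1) um] eq)
    also have "\<dots> = (\<Sum>k<m. (LINT y|lborel. \<rho> y * indicator (A k) y * u (x - y)) - w k * u (x - z k))"
      using intu by (simp add: sum_subtractf)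
    also have "\<bar>\<dots>\<bar> \<le> (\<Sum>k<m. w k * \<kappa>)"
    proof (rule order_trans[OF sum_abs sum_mono])
      fix k assume "k \<in> {..<m}"
      have "(LINT y|lborel. \<rho> y * indicator (A k) y * u (x - y)) - w k * u (x - z k)
         = (LINT y|lborel. \<rho> y * indicator (A k) y * u (x - y) - \<rho> y * indicator (A k) y * u (x - z k))"
        unfolding w_def using intu intA by simp
      also have "\<bar>\<dots>\<bar> \<le> (LINT y|lborel. \<bar>\<rho> y * indicator (A k) y * u (x - y) - \<rho> y * indicator (A k) y * u (x - z k)\<bar>)"
        by (rule integral_abs_bound)
      also have "\<dots> \<le> (LINT y|lborel. \<rho> y * indicator (A k) y * \<kappa>)"
      proof (rule integral_mono)
        fix y
        have "\<bar>u (x - y) - u (x - z k)\<bar> \<le> \<kappa>" if "y \<in> A k"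
          using that AB[of k] by (intro \<kappa>) (auto simp: B_def dist_norm norm_minus_commute split: if_splits)
        then show "\<bar>\<rho> y * indicator (A k) y * u (x - y) - \<rho> y * indicator (A k) y * u (x - z k)\<bar>
            \<le> \<rho> y * indicator (A k) y * \<kappa>"
          using \<rho>D(2)[of y] by (auto simp: indicator_def abs_mult simp flip: right_diff_distrib intro!: mult_left_mono)
      qed (use intu intA in auto)
      also have "\<dots> = w k * \<kappa>" by (simp add: w_def)
      finally show "\<bar>(LINT y|lborel. \<rho> y * indicator (A k) y * u (x - y)) - w k * u (x - z k)\<bar> \<le> w k * \<kappa>" .
    qed
    also have "\<dots> = \<kappa>" using sw by (simp flip: sum_distrib_right)
    finally show "\<bar>convolve \<rho> u x - (\<Sum>k<m. w k * u (x - z k))\<bar> \<le> \<kappa>" .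
  qed
qed

text \<open>Convolution averages \<open>u\<close> over the ball of radius \<open>r\<close>, so it
  stays in any closed interval that contains these values. It serves with
  \<open>\<kappa> = 0\<close> for local constancy, with an interval for sup bounds and with a
  modulus of continuity.\<close>

lemma convolve_const_on:
  fixes u :: "real ^ 'd::finite \<Rightarrow> real"
  assumes \<rho>: "mollifier r \<rho>" and "u \<in> borel_measurable borel" "\<And>y. norm (x - y) \<le> r \<Longrightarrow> \<bar>u y - c\<bar> \<le> \<kappa>" "\<And>y. \<bar>u y\<bar> \<le> M"
  shows "\<bar>convolve \<rho> u x - c\<bar> \<le> \<kappa>"
proof -
  note \<rho>D = mollifierD[OF \<rho>]
  have i: "integrable lborel (\<lambda>y. \<rho> (x - y) * u y)"
    if "u \<in> borel_measurable borel" "\<And>y. \<bar>u y\<bar> \<le> M" for u :: "real ^ 'd \<Rightarrow> real" and M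
    using that by (intro convolve_integrable \<rho>D)
  have c1: "(LINT y|lborel. \<rho> (x - y) * c) = c" for c
    using convolve_commute[OF \<rho>D(1), of "\<lambda>_. c" x] \<rho>D by (simp add: convolve_def)
  have "convolve \<rho> u x - c = (LINT y|lborel. \<rho> (x - y) * u y - \<rho> (x - y) * c)"
    unfolding convolve_def using i[OF assms(2,4)] i[of "\<lambda>_. c" "\<bar>c\<bar>"] c1[of c] by simp
  also have "\<bar>\<dots>\<bar> \<le> (LINT y|lborel. \<bar>\<rho> (x - y) * u y - \<rho> (x - y) * c\<bar>)"
    by (rule integral_abs_bound)
  also have "\<dots> \<le> (LINT y|lborel. \<rho> (x - y) * \<kappa>)"
  proof (rule integral_mono)
    fix y
    show "\<bar>\<rho> (x - y) * u y - \<rho> (x - y) * c\<bar> \<le> \<rho> (x - y) * \<kappa>"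
    proof (cases "norm (x - y) \<le> r")
      case True
      then show ?thesis
        using assms(3) \<rho>D(2)[of "x - y"] by (simp add: abs_mult mult_left_mono flip: right_diff_distrib)
    qed (use \<rho>D(4) in auto)
  qed (use i[OF assms(2,4)] i[of "\<lambda>_. c" "\<bar>c\<bar>"] i[of "\<lambda>_. \<kappa>" "\<bar>\<kappa>\<bar>"] in auto)
  also have "\<dots> = \<kappa>" by (rule c1)
  finally show ?thesis .
qed

text \<open>The cutoff is the indicator of the ball of radius \<open>R + 1\<close> smoothed at scale
  one, hence the margin of two between the regions.\<close>

lemma cutoff_exists:
  assumes "R > 0"
  obtains \<zeta> :: "real ^ 'd::finite \<Rightarrow> real"
  where "\<zeta> \<in> Cc_infty" "\<And>x. 0 \<le> \<zeta> x" "\<And>x. \<zeta> x \<le> 1" "\<And>x. norm x \<le> R \<Longrightarrow> \<zeta> x = 1"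
    "\<And>x. norm x > R + 2 \<Longrightarrow> \<zeta> x = 0"
proof -
  obtain \<rho> :: "real ^ 'd \<Rightarrow> real" where \<rho>: "mollifier 1 \<rho>" using mollifier_exists[of 1] by auto
  let ?u = "indicator (cball (0 :: real ^ 'd) (R + 1)) :: real ^ 'd \<Rightarrow> real"
  let ?\<zeta> = "convolve \<rho> ?u"
  have u: "?u \<in> borel_measurable borel" "\<And>y. \<bar>?u y\<bar> \<le> 1"
    by (measurable, auto simp: indicator_def)
  have one: "?\<zeta> x = 1" if "norm x \<le> R" for x
  proof -
    have "\<bar>?\<zeta> x - 1\<bar> \<le> 0"
    proof (rule convolve_const_on[OF \<rho> u(1) _ u(2)])
      fix y assume "norm (x - y) \<le> 1"
      with that norm_triangle_ineq3[of x y] have "norm y \<le> R + 1" by linarith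
      then show "\<bar>?u y - 1\<bar> \<le> 0" by simp
    qed
    then show ?thesis by simp
  qed
  have zero: "?\<zeta> x = 0" if "norm x > R + 2" for x
  proof -
    have "\<bar>?\<zeta> x - 0\<bar> \<le> 0"
    proof (rule convolve_const_on[OF \<rho> u(1) _ u(2)])
      fix y assume "norm (x - y) \<le> 1"
      with that norm_triangle_ineq3[of x y] have "norm y > R + 1" by linarith
      then show "\<bar>?u y - 0\<bar> \<le> 0" by simp
    qed
    then show ?thesis by simp
  qed
  \<comment> \<open>The interval with centre and half length \<open>1 / 2\<close> expresses
    \<open>0 \<le> \<zeta> \<le> 1\<close> by a single application.\<close>
  have half: "\<bar>?\<zeta> x - 1/2\<bar> \<le> 1/2" for x
    by (rule convolve_const_on[OF \<rho> u(1) _ u(2)]) (auto simp: indicator_def)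
  have bd: "0 \<le> ?\<zeta> x" "?\<zeta> x \<le> 1" for x
    using half[of x] unfolding abs_le_iff by linarith+
  show ?thesis
    by (rule that[of ?\<zeta>, OF _ bd one zero])
       (use zero smooth_convolve[OF mollifierD(1)[OF \<rho>] u] in \<open>auto simp: Cc_infty_iff\<close>)
qed

text \<open>All derivatives up to order three fall on the kernel, so this is
  \<open>convolve_local_bound\<close> for finitely many kernels. The estimate is in terms of the
  bound \<open>m\<close> near \<open>x\<close>; the global bound \<open>M\<close> does not enter
  it.\<close>

lemma mollified_local_bounds:
  fixes \<rho> :: "real ^ 'd::finite \<Rightarrow> real"
  assumes \<rho>: "mollifier r \<rho>"
  obtains C where "C \<ge> 0"
    "\<And>(u :: real ^ 'd \<Rightarrow> real) x m M. u \<in> borel_measurable borel \<Longrightarrow> (\<And>y. \<bar>u y\<bar> \<le> M) \<Longrightarrow>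
      (\<And>y. norm (x - y) \<le> r \<Longrightarrow> \<bar>u y\<bar> \<le> m) \<Longrightarrow> 0 \<le> m \<Longrightarrow>
      \<bar>convolve \<rho> u x\<bar> \<le> C * m \<and> (\<forall>i. \<bar>partial i (convolve \<rho> u) x\<bar> \<le> C * m) \<and>
      (\<forall>i j. \<bar>partial i (partial j (convolve \<rho> u)) x\<bar> \<le> C * m) \<and>
      (\<forall>i j k. \<bar>partial i (partial j (partial k (convolve \<rho> u))) x\<bar> \<le> C * m)"
proof -
  define P :: "(real ^ 'd \<Rightarrow> real) \<Rightarrow> real \<Rightarrow> bool" where
    "P g C \<longleftrightarrow> C \<ge> 0 \<and> (\<forall>(u :: real ^ 'd \<Rightarrow> real) x m. u \<in> borel_measurable borel \<longrightarrow>
      (\<forall>y. norm (x - y) \<le> r \<longrightarrow> \<bar>u y\<bar> \<le> m) \<longrightarrow> 0 \<le> m \<longrightarrow> \<bar>convolve g u x\<bar> \<le> C * m)" for g C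
  define B where "B g = (SOME C. P g C)" for g
  have P: "P g K" if "g \<in> Cc_infty" "\<And>x. norm x > r \<Longrightarrow> g x = 0" "B g \<le> K" for g K
  proof -
    have "\<exists>C. P g C"
      using convolve_local_bound[OF that(1,2)] unfolding P_def by metis
    then have "P g (B g)" unfolding B_def by (rule someI_ex)
    with that(3) show ?thesis
      unfolding P_def by (meson order_trans mult_right_mono)
  qed
  obtain K where K: "B \<rho> \<le> K" "\<And>i. B (partial i \<rho>) \<le> K" "\<And>i j. B (partial i (partial j \<rho>)) \<le> K"
    "\<And>i j k. B (partial i (partial j (partial k \<rho>))) \<le> K"
    using third_order_uniform_bound[of B \<rho>] by blast
  note \<rho>D = mollifierD[OF \<rho>]
  have PK: "P \<rho> K" "P (partial i \<rho>) K" "P (partial i (partial j \<rho>)) K" "P (partial i (partial j (partial k \<rho>))) K" for i j k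
    by (intro P K Cc_infty_partial \<rho>D partial_eq_0[where R = r]; assumption)+
  show ?thesis
  proof (rule that)
    show "K \<ge> 0" using PK(1) by (simp add: P_def)
    fix u :: "real ^ 'd \<Rightarrow> real" and x m M
    assume u: "u \<in> borel_measurable borel" "\<And>y. \<bar>u y\<bar> \<le> M"
      and m: "\<And>y. norm (x - y) \<le> r \<Longrightarrow> \<bar>u y\<bar> \<le> m" "0 \<le> m"
    have "\<bar>convolve g u x\<bar> \<le> K * m" if "P g K" for g
      using that u m unfolding P_def by blast
    moreover have "partial i (convolve g u) = convolve (partial i g) u" if "g \<in> Cc_infty" for g i
      using partial_convolve[OF that u] .
    ultimately show "\<bar>convolve \<rho> u x\<bar> \<le> K * m \<and> (\<forall>i. \<bar>partial i (convolve \<rho> u) x\<bar> \<le> K * m) \<and>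
      (\<forall>i j. \<bar>partial i (partial j (convolve \<rho> u)) x\<bar> \<le> K * m) \<and>
      (\<forall>i j k. \<bar>partial i (partial j (partial k (convolve \<rho> u))) x\<bar> \<le> K * m)"
      using PK \<rho>D(1) Cc_infty_partial by metis
  qed
qed

text \<open>\<open>K\<close> depends on \<open>\<rho>\<close> and \<open>M\<close> but not on
  \<open>u\<close>: all mollified iterates of a scheme started from a function bounded by
  \<open>M\<close> lie in one class \<open>C3_bounded K\<close>.\<close>

lemma mollified_C3_bounded:
  fixes \<rho> :: "real ^ 'd::finite \<Rightarrow> real"
  assumes \<rho>: "mollifier r \<rho>" and "0 \<le> M"
  obtains K where "\<And>(u :: real ^ 'd \<Rightarrow> real). u \<in> borel_measurable borel \<Longrightarrow> (\<And>y. \<bar>u y\<bar> \<le> M) \<Longrightarrow> C3_bounded K (convolve \<rho> u)"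
proof -
  obtain C where "C \<ge> 0" and C:
    "\<And>(u :: real ^ 'd \<Rightarrow> real) x m M. u \<in> borel_measurable borel \<Longrightarrow> (\<And>y. \<bar>u y\<bar> \<le> M) \<Longrightarrow>
      (\<And>y. norm (x - y) \<le> r \<Longrightarrow> \<bar>u y\<bar> \<le> m) \<Longrightarrow> 0 \<le> m \<Longrightarrow>
      \<bar>convolve \<rho> u x\<bar> \<le> C * m \<and> (\<forall>i. \<bar>partial i (convolve \<rho> u) x\<bar> \<le> C * m) \<and>
      (\<forall>i j. \<bar>partial i (partial j (convolve \<rho> u)) x\<bar> \<le> C * m) \<and>
      (\<forall>i j k. \<bar>partial i (partial j (partial k (convolve \<rho> u))) x\<bar> \<le> C * m)"
    using mollified_local_bounds[OF \<rho>] by blast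
  show ?thesis
  proof (rule that)
    fix u :: "real ^ 'd \<Rightarrow> real"
    assume u: "u \<in> borel_measurable borel" "\<And>y. \<bar>u y\<bar> \<le> M"
    show "C3_bounded (C * M) (convolve \<rho> u)"
      unfolding C3_bounded_def
      using C[OF u(1,2) u(2) assms(2)] smooth_convolve[OF mollifierD(1)[OF \<rho>] u] by simp
  qed
qed

section \<open>Sublinear functionals on bounded uniformly continuous functions\<close>

lemma CbucI:
  assumes "\<And>x. \<bar>f x\<bar> \<le> M" "\<And>e. e > 0 \<Longrightarrow> \<exists>d>0. \<forall>x y. dist x y < d \<longrightarrow> \<bar>f x - f y\<bar> \<le> e"
  shows "f \<in> Cbuc"
  unfolding Cbuc_def uniformly_continuous_on_def
proof (intro CollectI conjI allI impI)
  show "bounded (range f)" using assms(1) by (auto simp: bounded_iff)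
  fix e :: real assume "e > 0"
  then obtain d where "d > 0" "\<forall>x y. dist x y < d \<longrightarrow> \<bar>f x - f y\<bar> \<le> e / 2"
    using assms(2)[of "e / 2"] by auto
  with \<open>e > 0\<close> show "\<exists>d>0. \<forall>x\<in>UNIV. \<forall>x'\<in>UNIV. dist x' x < d \<longrightarrow> dist (f x') (f x) < e"
    unfolding dist_real_def by (intro exI[of _ d]) (smt (verit) field_sum_of_halves)
qed

lemma Cbuc_bounded:
  assumes "f \<in> Cbuc"
  obtains M where "\<And>x. \<bar>f x\<bar> \<le> M" "0 \<le> M"
proof -
  obtain M where "\<And>x. \<bar>f x\<bar> \<le> M"
    using assms by (auto simp: Cbuc_def bounded_iff)
  with that[of M] show ?thesis by (meson abs_ge_zero order_trans)
qed

lemma Cbuc_modulus: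
  assumes "f \<in> Cbuc" "e > 0"
  obtains d where "d > 0" "\<And>x y. dist x y < d \<Longrightarrow> \<bar>f x - f y\<bar> \<le> e"
proof -
  have "\<exists>d>0. \<forall>x x'. dist x' x < d \<longrightarrow> dist (f x') (f x) < e"
    using assms by (auto simp: Cbuc_def uniformly_continuous_on_def)
  with that show ?thesis unfolding dist_real_def by (meson less_imp_le)
qed

lemma Cbuc_const [simp]: "(\<lambda>x. c) \<in> Cbuc"
  by (rule CbucI[where M = "\<bar>c\<bar>"]) (auto intro: exI[of _ 1])

lemma Cbuc_add:
  assumes "f \<in> Cbuc" "g \<in> Cbuc"
  shows "(\<lambda>x. f x + g x) \<in> Cbuc"
  using assms unfolding Cbuc_def
  by (auto intro: bounded_plus_comp uniformly_continuous_on_add)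

lemma Cbuc_scale:
  assumes "f \<in> Cbuc"
  shows "(\<lambda>x. a * f x) \<in> Cbuc"
proof -
  have "uniformly_continuous_on UNIV (\<lambda>x. a *\<^sub>R f x)"
    using assms unfolding Cbuc_def by (intro uniformly_continuous_on_cmul) auto
  then show ?thesis
    using assms bounded_scaling[of "range f" a] unfolding Cbuc_def by (auto simp: image_image)
qed

lemma Cbuc_minus: "f \<in> Cbuc \<Longrightarrow> (\<lambda>x. - f x) \<in> Cbuc"
  using Cbuc_scale[of f "-1"] by simp

lemma Cbuc_diff: "f \<in> Cbuc \<Longrightarrow> g \<in> Cbuc \<Longrightarrow> (\<lambda>x. f x - g x) \<in> Cbuc"
  using Cbuc_add[OF _ Cbuc_minus] by fastforce

lemma Cbuc_sum: "finite A \<Longrightarrow> (\<And>i. i \<in> A \<Longrightarrow> f i \<in> Cbuc) \<Longrightarrow> (\<lambda>x. \<Sum>i\<in>A. f i x) \<in> Cbuc"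
  by (induction A rule: finite_induct) (auto simp: Cbuc_add)

lemma Cbuc_translate:
  fixes f :: "'a::real_normed_vector \<Rightarrow> real"
  assumes "f \<in> Cbuc"
  shows "(\<lambda>y. f (x + y)) \<in> Cbuc"
proof -
  obtain M where M: "\<And>x. \<bar>f x\<bar> \<le> M" using Cbuc_bounded[OF assms] by blast
  show ?thesis
  proof (rule CbucI[OF M])
    fix e :: real assume "e > 0"
    from Cbuc_modulus[OF assms this] show "\<exists>d>0. \<forall>a b. dist a b < d \<longrightarrow> \<bar>f (x + a) - f (x + b)\<bar> \<le> e"
      by (metis dist_add_cancel)
  qed
qed

lemma Cbuc_translate_right: "f \<in> Cbuc \<Longrightarrow> (\<lambda>y. f (y + x)) \<in> Cbuc" for f :: "'a::real_normed_vector \<Rightarrow> real"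
  using Cbuc_translate[of f x] by (simp add: add.commute)

lemma Cbuc_measurable: "f \<in> Cbuc \<Longrightarrow> f \<in> borel_measurable borel" for f :: "'a::metric_space \<Rightarrow> real"
  by (intro borel_measurable_continuous_onI uniformly_continuous_imp_continuous) (auto simp: Cbuc_def)

lemma Cbuc_uniform_limit:
  fixes f :: "'a::metric_space \<Rightarrow> real"
  assumes "\<And>e. e > 0 \<Longrightarrow> \<exists>g\<in>Cbuc. \<forall>x. \<bar>f x - g x\<bar> \<le> e"
  shows "f \<in> Cbuc"
proof -
  obtain g where g: "g \<in> Cbuc" "\<And>x. \<bar>f x - g x\<bar> \<le> 1" using assms[of 1] by auto
  obtain M where M: "\<And>x. \<bar>g x\<bar> \<le> M" using Cbuc_bounded[OF g(1)] by blast
  show ?thesis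
  proof (rule CbucI)
    show "\<bar>f x\<bar> \<le> M + 1" for x using g(2)[of x] M[of x] by linarith
    fix e :: real assume "e > 0"
    then obtain g where g: "g \<in> Cbuc" "\<And>x. \<bar>f x - g x\<bar> \<le> e / 3" using assms[of "e / 3"] by auto
    obtain d where d: "d > 0" "\<And>x y. dist x y < d \<Longrightarrow> \<bar>g x - g y\<bar> \<le> e / 3"
      using Cbuc_modulus[OF g(1), of "e / 3"] \<open>e > 0\<close> by auto
    show "\<exists>d>0. \<forall>x y. dist x y < d \<longrightarrow> \<bar>f x - f y\<bar> \<le> e"
    proof (intro exI[of _ d] conjI allI impI d(1))
      fix x y :: 'a assume "dist x y < d"
      from d(2)[OF this] g(2)[of x] g(2)[of y] show "\<bar>f x - f y\<bar> \<le> e" by linarith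
    qed
  qed
qed

text \<open>Bound and Lipschitz constant are both preserved by translation-invariant sublinear
  operators, so this class is invariant under a scheme.\<close>

definition lipschitz_bounded :: "real \<Rightarrow> real \<Rightarrow> ('a::metric_space \<Rightarrow> real) \<Rightarrow> bool" where
  "lipschitz_bounded L M f \<longleftrightarrow> (\<forall>x. \<bar>f x\<bar> \<le> M) \<and> (\<forall>x y. \<bar>f x - f y\<bar> \<le> L * dist x y)"

lemma lipschitz_bounded_Cbuc:
  assumes "lipschitz_bounded L M f"
  shows "f \<in> Cbuc"
proof (rule CbucI)
  show "\<bar>f x\<bar> \<le> M" for x using assms by (simp add: lipschitz_bounded_def)
  fix e :: real assume "e > 0"
  show "\<exists>d>0. \<forall>x y. dist x y < d \<longrightarrow> \<bar>f x - f y\<bar> \<le> e"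
  proof (intro exI[of _ "e / (\<bar>L\<bar> + 1)"] conjI allI impI)
    fix x y :: 'a assume "dist x y < e / (\<bar>L\<bar> + 1)"
    then have "dist x y * (\<bar>L\<bar> + 1) < e" by (simp add: pos_less_divide_eq)
    moreover have "L * dist x y \<le> dist x y * (\<bar>L\<bar> + 1)"
      by (subst mult.commute) (intro mult_left_mono, auto)
    ultimately show "\<bar>f x - f y\<bar> \<le> e"
      using assms unfolding lipschitz_bounded_def by (meson less_imp_le order_trans le_less_trans)
  qed (use \<open>e > 0\<close> in auto)
qed

lemma C3_bounded_lipschitz:
  fixes f :: "real ^ 'd::finite \<Rightarrow> real"
  assumes "C3_bounded K f"
  shows "lipschitz_bounded (real CARD('d) * K) K f"
  unfolding lipschitz_bounded_def
proof (intro conjI allI)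
  fix x y
  have "\<bar>f (x + (y - x)) - f x\<bar> \<le> real CARD('d) * K * norm (y - x)"
    by (rule taylor1_bound[OF assms])
  then show "\<bar>f x - f y\<bar> \<le> real CARD('d) * K * dist x y"
    by (simp add: dist_norm norm_minus_commute abs_minus_commute)
qed (rule C3_boundedD(2)[OF assms])

lemma C3_bounded_Cbuc: "C3_bounded K f \<Longrightarrow> f \<in> Cbuc"
  using C3_bounded_lipschitz lipschitz_bounded_Cbuc by blast

lemma Cc_infty_Cbuc: "f \<in> Cc_infty \<Longrightarrow> f \<in> Cbuc"
  using Cc_infty_C3 C3_bounded_Cbuc by metis

section \<open>Calculus of sublinear expectations\<close>

context sublinear_expectation_space
begin

lemma minus_mem: "X \<in> H \<Longrightarrow> (\<lambda>\<omega>. - X \<omega>) \<in> H"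
  using scale_mem[of X "-1"] by simp

lemma diff_mem: "X \<in> H \<Longrightarrow> Y \<in> H \<Longrightarrow> (\<lambda>\<omega>. X \<omega> - Y \<omega>) \<in> H"
  using add_mem[OF _ minus_mem] by fastforce

lemma diff_le: "X \<in> H \<Longrightarrow> Y \<in> H \<Longrightarrow> \<E> X - \<E> Y \<le> \<E> (\<lambda>\<omega>. X \<omega> - Y \<omega>)"
  using subadditive[OF diff_mem[of X Y], of Y] by simp

text \<open>Subadditivity with the constants \<open>c\<close> and \<open>- c\<close> gives the two
  inequalities, since constants are preserved.\<close>

lemma add_const:
  assumes "X \<in> H"
  shows "\<E> (\<lambda>\<omega>. X \<omega> + c) = \<E> X + c"
proof (rule antisym)
  show "\<E> (\<lambda>\<omega>. X \<omega> + c) \<le> \<E> X + c"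
    using subadditive[OF assms const_mem[of c]] by (simp add: const_preserving)
  show "\<E> X + c \<le> \<E> (\<lambda>\<omega>. X \<omega> + c)"
    using subadditive[OF add_mem[OF assms const_mem[of c]] const_mem[of "- c"]]
    by (simp add: const_preserving)
qed

lemma mono_const:
  assumes "X \<in> H" "Y \<in> H" "\<And>\<omega>. X \<omega> \<le> Y \<omega> + c"
  shows "\<E> X \<le> \<E> Y + c"
  using monotone[OF assms(1) add_mem[OF assms(2) const_mem[of c]] assms(3)] add_const[OF assms(2)] by simp

lemma abs_diff_le:
  assumes "X \<in> H" "Y \<in> H" "\<And>\<omega>. \<bar>X \<omega> - Y \<omega>\<bar> \<le> c"
  shows "\<bar>\<E> X - \<E> Y\<bar> \<le> c"
proof -
  have "X \<omega> \<le> Y \<omega> + c" "Y \<omega> \<le> X \<omega> + c" for \<omega>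
    using assms(3)[of \<omega>] by linarith+
  from mono_const[OF assms(1,2) this(1)] mono_const[OF assms(2,1) this(2)] show ?thesis
    by linarith
qed

lemma abs_le_const: "X \<in> H \<Longrightarrow> (\<And>\<omega>. \<bar>X \<omega>\<bar> \<le> c) \<Longrightarrow> \<bar>\<E> X\<bar> \<le> c"
  using abs_diff_le[of X "\<lambda>_. 0" c] by (simp add: const_preserving const_mem)

lemma sum_mem: "finite A \<Longrightarrow> (\<And>i. i \<in> A \<Longrightarrow> X i \<in> H) \<Longrightarrow> (\<lambda>\<omega>. \<Sum>i\<in>A. X i \<omega>) \<in> H"
  by (induction A rule: finite_induct) (auto simp: add_mem const_mem)

lemma sum_le: "finite A \<Longrightarrow> (\<And>i. i \<in> A \<Longrightarrow> X i \<in> H) \<Longrightarrow> \<E> (\<lambda>\<omega>. \<Sum>i\<in>A. X i \<omega>) \<le> (\<Sum>i\<in>A. \<E> (X i))"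
proof (induction A rule: finite_induct)
  case (insert a A)
  have "\<E> (\<lambda>\<omega>. X a \<omega> + (\<Sum>i\<in>A. X i \<omega>)) \<le> \<E> (X a) + \<E> (\<lambda>\<omega>. \<Sum>i\<in>A. X i \<omega>)"
    using insert by (intro subadditive sum_mem) auto
  with insert show ?case by simp
qed (simp add: const_preserving)

end

section \<open>Translation-invariant operators\<close>

abbreviation sublinear_functional :: "((real ^ 'd::finite \<Rightarrow> real) \<Rightarrow> real) \<Rightarrow> bool" where
  "sublinear_functional e \<equiv> sublinear_expectation_space Cbuc e"

text \<open>One step of a random walk, started at \<open>x\<close>, whose increment has the
  sublinear law \<open>e\<close>.\<close>

definition shift_op :: "((real ^ 'd::finite \<Rightarrow> real) \<Rightarrow> real) \<Rightarrow> (real ^ 'd \<Rightarrow> real) \<Rightarrow> real ^ 'd \<Rightarrow> real" where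
  "shift_op e f x = e (\<lambda>y. f (x + y))"

lemma shift_op_0: "shift_op e f 0 = e f"
  by (simp add: shift_op_def)

lemma shift_op_translate: "shift_op e (\<lambda>y. f (a + y)) = (\<lambda>x. shift_op e f (a + x))"
  by (intro ext) (simp add: shift_op_def add.assoc)

lemma shift_op_power_translate: "(shift_op e ^^ k) (\<lambda>y. f (a + y)) = (\<lambda>x. (shift_op e ^^ k) f (a + x))"
  by (induction k) (simp_all add: shift_op_translate)

lemma shift_op_modulus:
  assumes "sublinear_functional e" "f \<in> Cbuc" "\<And>x y. dist x y < d \<Longrightarrow> \<bar>f x - f y\<bar> \<le> \<kappa>" "dist x y < d"
  shows "\<bar>shift_op e f x - shift_op e f y\<bar> \<le> \<kappa>"
proof -
  interpret sublinear_expectation_space Cbuc e by fact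
  show ?thesis
    unfolding shift_op_def using assms(2-4) by (intro abs_diff_le Cbuc_translate assms(3)) auto
qed

lemma shift_op_bounded:
  assumes "sublinear_functional e" "f \<in> Cbuc" "\<And>x. \<bar>f x\<bar> \<le> M"
  shows "\<bar>shift_op e f x\<bar> \<le> M"
proof -
  interpret sublinear_expectation_space Cbuc e by fact
  show ?thesis
    unfolding shift_op_def using assms by (intro abs_le_const Cbuc_translate) auto
qed

lemma shift_op_Cbuc:
  assumes "sublinear_functional e" "f \<in> Cbuc"
  shows "shift_op e f \<in> Cbuc"
proof -
  obtain M where M: "\<And>x. \<bar>f x\<bar> \<le> M" using Cbuc_bounded[OF assms(2)] by blast
  show ?thesis
  proof (rule CbucI)
    show "\<bar>shift_op e f x\<bar> \<le> M" for x using shift_op_bounded assms M by blast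
    fix r :: real assume "r > 0"
    from Cbuc_modulus[OF assms(2) this] shift_op_modulus[OF assms]
    show "\<exists>d>0. \<forall>x y. dist x y < d \<longrightarrow> \<bar>shift_op e f x - shift_op e f y\<bar> \<le> r" by metis
  qed
qed

lemma shift_op_lipschitz_bounded:
  assumes e: "sublinear_functional e" and f: "lipschitz_bounded L M f"
  shows "lipschitz_bounded L M (shift_op e f)"
proof -
  interpret sublinear_expectation_space Cbuc e by fact
  note fC = lipschitz_bounded_Cbuc[OF f]
  have "\<bar>e (\<lambda>z. f (x + z)) - e (\<lambda>z. f (y + z))\<bar> \<le> L * dist x y" for x y
  proof (intro abs_diff_le Cbuc_translate fC)
    fix z show "\<bar>f (x + z) - f (y + z)\<bar> \<le> L * dist x y"
      using f unfolding lipschitz_bounded_def by (metis dist_add_cancel2)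
  qed
  moreover have "\<bar>shift_op e f x\<bar> \<le> M" for x
    using shift_op_bounded[OF e fC] f by (simp add: lipschitz_bounded_def)
  ultimately show ?thesis
    by (simp add: lipschitz_bounded_def shift_op_def)
qed

lemma shift_op_mono_const:
  assumes e: "sublinear_functional e" and "f \<in> Cbuc" "g \<in> Cbuc" "\<And>x. f x \<le> g x + c"
  shows "shift_op e f x \<le> shift_op e g x + c"
proof -
  interpret sublinear_expectation_space Cbuc e by fact
  show ?thesis
    unfolding shift_op_def using assms by (intro mono_const Cbuc_translate) auto
qed

lemma shift_op_power_Cbuc:
  "sublinear_functional e \<Longrightarrow> f \<in> Cbuc \<Longrightarrow> (shift_op e ^^ k) f \<in> Cbuc"
  by (induction k) (auto simp: shift_op_Cbuc)

lemma shift_op_power_mono_const: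
  assumes e: "sublinear_functional e" and "f \<in> Cbuc" "g \<in> Cbuc" "\<And>x. f x \<le> g x + c"
  shows "(shift_op e ^^ k) f x \<le> (shift_op e ^^ k) g x + c"
  using assms
  by (induction k arbitrary: x) (auto intro!: shift_op_mono_const shift_op_power_Cbuc)

lemma shift_op_power_abs_diff:
  assumes e: "sublinear_functional e" and "f \<in> Cbuc" "g \<in> Cbuc" "\<And>x. \<bar>f x - g x\<bar> \<le> c"
  shows "\<bar>(shift_op e ^^ k) f x - (shift_op e ^^ k) g x\<bar> \<le> c"
proof -
  have "f x \<le> g x + c" "g x \<le> f x + c" for x using assms(4)[of x] by linarith+
  from shift_op_power_mono_const[OF assms(1-3) this(1), of k x]
    shift_op_power_mono_const[OF assms(1,3,2) this(2), of k x] show ?thesis by linarith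
qed

lemma shift_op_power_lipschitz_bounded:
  "sublinear_functional e \<Longrightarrow> lipschitz_bounded L M f \<Longrightarrow> lipschitz_bounded L M ((shift_op e ^^ k) f)"
  by (induction k) (auto simp: shift_op_lipschitz_bounded)

text \<open>\<open>k\<close> steps form again a single functional of the same kind, so a block of
  fine steps can play the part of one coarse step in the comparison.\<close>

lemma sublinear_functional_power:
  assumes e: "sublinear_functional e"
  shows "sublinear_functional (\<lambda>f. (shift_op e ^^ k) f 0)"
    and "shift_op (\<lambda>f. (shift_op e ^^ k) f 0) = shift_op e ^^ k"
proof -
  show "shift_op (\<lambda>f. (shift_op e ^^ k) f 0) = shift_op e ^^ k"
    by (intro ext) (simp add: shift_op_def[of "\<lambda>f. (shift_op e ^^ k) f 0"] shift_op_power_translate)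
  interpret E: sublinear_expectation_space Cbuc e by fact
  note P = shift_op_power_Cbuc[OF e]
  have sub: "(shift_op e ^^ k) (\<lambda>x. f x + g x) x \<le> (shift_op e ^^ k) f x + (shift_op e ^^ k) g x"
    if "f \<in> Cbuc" "g \<in> Cbuc" for f g x k
  proof (induction k arbitrary: x)
    case (Suc k)
    have "shift_op e ((shift_op e ^^ k) (\<lambda>x. f x + g x)) x
        \<le> shift_op e (\<lambda>x. (shift_op e ^^ k) f x + (shift_op e ^^ k) g x) x + 0"
      using Suc that by (intro shift_op_mono_const e P Cbuc_add) auto
    also have "\<dots> \<le> shift_op e ((shift_op e ^^ k) f) x + shift_op e ((shift_op e ^^ k) g) x"
      unfolding shift_op_def[of e _ x] using that by (simp, intro E.subadditive Cbuc_translate P) auto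
    finally show ?case by simp
  qed simp
  have hom: "(shift_op e ^^ k) (\<lambda>x. a * f x) = (\<lambda>x. a * (shift_op e ^^ k) f x)" if "f \<in> Cbuc" "a \<ge> 0" for f a k
  proof (induction k)
    case (Suc k)
    then show ?case
      using that by (auto simp: shift_op_def[of e "\<lambda>x. a * _ x"] E.pos_homogeneous Cbuc_translate P)
        (simp add: shift_op_def)
  qed simp
  have con: "(shift_op e ^^ k) (\<lambda>x. c) = (\<lambda>x. c)" for c k
    by (induction k) (auto simp: shift_op_def E.const_preserving)
  show "sublinear_functional (\<lambda>f. (shift_op e ^^ k) f 0)"
  proof
    fix X Y :: "real ^ 'a \<Rightarrow> real" assume "X \<in> Cbuc" "Y \<in> Cbuc" "\<And>\<omega>. X \<omega> \<le> Y \<omega>"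
    then show "(shift_op e ^^ k) X 0 \<le> (shift_op e ^^ k) Y 0"
      using shift_op_power_mono_const[OF e, of X Y 0 k 0] by auto
  qed (auto simp: Cbuc_add Cbuc_scale sub hom con)
qed

section \<open>Comparison of discrete schemes by mollification\<close>

lemma convolve_translate:
  assumes "\<rho> \<in> Cc_infty" "u \<in> Cbuc"
  shows "(\<lambda>y. convolve \<rho> u (x + y)) = convolve \<rho> (\<lambda>y. u (x + y))"
  using assms by (auto simp: convolve_commute Cbuc_measurable Cbuc_translate add_diff_eq)

lemma convolve_near:
  fixes u :: "real ^ 'd::finite \<Rightarrow> real"
  assumes \<rho>: "mollifier r \<rho>" and u: "lipschitz_bounded L M u"
  shows "\<bar>convolve \<rho> u x - u x\<bar> \<le> \<bar>L\<bar> * r"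
proof (rule convolve_const_on[OF \<rho> Cbuc_measurable[OF lipschitz_bounded_Cbuc[OF u]]])
  show "\<bar>u y\<bar> \<le> M" for y using u by (simp add: lipschitz_bounded_def)
  fix y assume y: "norm (x - y) \<le> r"
  have "\<bar>u y - u x\<bar> \<le> L * norm (x - y)"
    using u unfolding lipschitz_bounded_def dist_norm by (metis norm_minus_commute)
  also have "\<dots> \<le> \<bar>L\<bar> * r"
    using y by (intro mult_mono) auto
  finally show "\<bar>u y - u x\<bar> \<le> \<bar>L\<bar> * r" .
qed

lemma convolve_C3_bounded:
  fixes u :: "real ^ 'd::finite \<Rightarrow> real"
  assumes \<rho>: "mollifier r \<rho>" and u: "u \<in> Cbuc"
  obtains K where "C3_bounded K (convolve \<rho> u)"
proof -
  obtain M where M: "\<And>x. \<bar>u x\<bar> \<le> M" "0 \<le> M" using Cbuc_bounded[OF u] by blast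
  from mollified_C3_bounded[OF \<rho> M(2)] Cbuc_measurable[OF u] M that show ?thesis by metis
qed

text \<open>For a finite convex combination of translates the inequality is subadditivity together
  with homogeneity. The mollifier is within \<open>\<kappa>\<close> of one such combination both on
  \<open>u\<close> and on \<open>shift_op e u\<close>, because the two share a modulus of
  continuity.\<close>

lemma convolve_jensen:
  fixes u :: "real ^ 'd::finite \<Rightarrow> real"
  assumes \<rho>: "mollifier r \<rho>" and e: "sublinear_functional e" and u: "u \<in> Cbuc"
  shows "shift_op e (convolve \<rho> u) x \<le> convolve \<rho> (shift_op e u) x"
proof -
  interpret E: sublinear_expectation_space Cbuc e by fact
  obtain M where M: "\<And>x. \<bar>u x\<bar> \<le> M" using Cbuc_bounded[OF u] by blast
  have cu: "convolve \<rho> u \<in> Cbuc" using convolve_C3_bounded[OF \<rho> u] C3_bounded_Cbuc by metis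
  have main: "shift_op e (convolve \<rho> u) x \<le> convolve \<rho> (shift_op e u) x + \<kappa> + \<kappa>" if \<kappa>: "\<kappa> > 0" for \<kappa>
  proof -
    obtain d where d: "d > 0" "\<And>x y. dist x y < d \<Longrightarrow> \<bar>u x - u y\<bar> \<le> \<kappa>"
      using Cbuc_modulus[OF u \<kappa>] by blast
    obtain m :: nat and w :: "nat \<Rightarrow> real" and z :: "nat \<Rightarrow> real ^ 'd"
      where w: "\<And>k. 0 \<le> w k" "(\<Sum>k<m. w k) = 1"
       and ap: "\<And>(u :: real ^ 'd \<Rightarrow> real) x M \<kappa>. u \<in> borel_measurable borel \<Longrightarrow> (\<And>y. \<bar>u y\<bar> \<le> M) \<Longrightarrow>
       (\<And>a b. dist a b < d \<Longrightarrow> \<bar>u a - u b\<bar> \<le> \<kappa>) \<Longrightarrow>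
       \<bar>convolve \<rho> u x - (\<Sum>k<m. w k * u (x - z k))\<bar> \<le> \<kappa>"
    proof (rule mollifier_finite_approx[OF \<rho> d(1)])
      fix m :: nat and w :: "nat \<Rightarrow> real" and z :: "nat \<Rightarrow> real ^ 'd"
      assume "\<And>k. 0 \<le> w k" "(\<Sum>k<m. w k) = 1"
       and "\<And>(u :: real ^ 'd \<Rightarrow> real) x M \<kappa>. u \<in> borel_measurable borel \<Longrightarrow> (\<And>y. \<bar>u y\<bar> \<le> M) \<Longrightarrow>
       (\<And>a b. dist a b < d \<Longrightarrow> \<bar>u a - u b\<bar> \<le> \<kappa>) \<Longrightarrow>
       \<bar>convolve \<rho> u x - (\<Sum>k<m. w k * u (x - z k))\<bar> \<le> \<kappa>"
      then show thesis by (rule that)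
    qed
    have tr: "(\<lambda>y. u (y - a)) \<in> Cbuc" for a
      using Cbuc_translate_right[OF u, of "- a"] by simp
    have c: "(\<lambda>y. \<Sum>k<m. w k * u (y - z k)) \<in> Cbuc"
      by (intro Cbuc_sum Cbuc_scale tr) auto
    have "shift_op e (convolve \<rho> u) x \<le> shift_op e (\<lambda>y. \<Sum>k<m. w k * u (y - z k)) x + \<kappa>"
    proof (rule shift_op_mono_const[OF e cu c])
      fix x
      from ap[OF Cbuc_measurable[OF u] M d(2), of x]
      show "convolve \<rho> u x \<le> (\<Sum>k<m. w k * u (x - z k)) + \<kappa>" by linarith
    qed
    also have "shift_op e (\<lambda>y. \<Sum>k<m. w k * u (y - z k)) x \<le> (\<Sum>k<m. e (\<lambda>y. w k * u (x + y - z k)))"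
      unfolding shift_op_def by (intro E.sum_le Cbuc_scale Cbuc_translate[OF tr]) auto
    also have "\<dots> = (\<Sum>k<m. w k * shift_op e u (x - z k))"
    proof (rule sum.cong[OF refl])
      fix k
      have eq: "x + y - z k = (x - z k) + y" for y by (simp add: algebra_simps)
      show "e (\<lambda>y. w k * u (x + y - z k)) = w k * shift_op e u (x - z k)"
        unfolding eq shift_op_def by (intro E.pos_homogeneous Cbuc_translate u w)
    qed
    also have "\<dots> \<le> convolve \<rho> (shift_op e u) x + \<kappa>"
    proof -
      have "\<bar>convolve \<rho> (shift_op e u) x - (\<Sum>k<m. w k * shift_op e u (x - z k))\<bar> \<le> \<kappa>"
      proof (rule ap)
        show "\<bar>shift_op e u a - shift_op e u b\<bar> \<le> \<kappa>" if "dist a b < d" for a b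
          using shift_op_modulus[OF e u d(2) that] .
      qed (use Cbuc_measurable[OF shift_op_Cbuc[OF e u]] shift_op_bounded[OF e u M] in auto)
      then show ?thesis by linarith
    qed
    finally show ?thesis by simp
  qed
  show ?thesis
  proof (rule field_le_epsilon)
    fix \<kappa> :: real assume "\<kappa> > 0"
    with main[of "\<kappa> / 2"] show "shift_op e (convolve \<rho> u) x \<le> convolve \<rho> (shift_op e u) x + \<kappa>" by simp
  qed
qed

text \<open>The mollification of the first scheme is a smooth approximate supersolution of the second one,
  because mollification commutes with translations and the schemes are convex.\<close>

lemma scheme_comparison:
  fixes f :: "real ^ 'd::finite \<Rightarrow> real"
  assumes \<rho>: "mollifier r \<rho>" and e1: "sublinear_functional e1" and e2: "sublinear_functional e2"
    and f: "lipschitz_bounded L M f"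
    and c: "\<And>u. lipschitz_bounded L M u \<Longrightarrow> e2 (convolve \<rho> u) \<le> e1 (convolve \<rho> u) + c"
  shows "(shift_op e2 ^^ n) f x \<le> (shift_op e1 ^^ n) f x + 2 * (\<bar>L\<bar> * r) + real n * c"
proof -
  have LB: "lipschitz_bounded L M ((shift_op e1 ^^ n) f)" for n
    by (rule shift_op_power_lipschitz_bounded[OF e1 f])
  \<comment> \<open>The induction compares with the mollified iterate of the other scheme. Passing
    between an iterate and its mollification then costs \<open>\<bar>L\<bar> * r\<close> once at the
    start and once at the end, not in every step.\<close>
  have main: "(shift_op e2 ^^ n) f x \<le> convolve \<rho> ((shift_op e1 ^^ n) f) x + (\<bar>L\<bar> * r + real n * c)" for n x
  proof (induction n arbitrary: x)
    case 0
    then show ?case using convolve_near[OF \<rho> f, of x] by simp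
  next
    case (Suc n)
    define u where "u = (shift_op e1 ^^ n) f"
    have u: "lipschitz_bounded L M u" unfolding u_def by (rule LB)
    note uC = lipschitz_bounded_Cbuc[OF u]
    have cu: "convolve \<rho> u \<in> Cbuc" using convolve_C3_bounded[OF \<rho> uC] C3_bounded_Cbuc by metis
    have "shift_op e2 ((shift_op e2 ^^ n) f) x \<le> shift_op e2 (convolve \<rho> u) x + (\<bar>L\<bar> * r + real n * c)"
      using Suc.IH unfolding u_def[symmetric]
      by (intro shift_op_mono_const e2 shift_op_power_Cbuc cu lipschitz_bounded_Cbuc[OF f])
    also have "shift_op e2 (convolve \<rho> u) x \<le> shift_op e1 (convolve \<rho> u) x + c"
    proof -
      \<comment> \<open>The hypothesis speaks of the origin; translating \<open>u\<close>, which
        stays in the Lipschitz class, carries it to \<open>x\<close>.\<close>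
      have "lipschitz_bounded L M (\<lambda>y. u (x + y))"
        using u by (auto simp: lipschitz_bounded_def) (metis dist_add_cancel)
      from c[OF this] show ?thesis
        unfolding shift_op_def convolve_translate[OF mollifierD(1)[OF \<rho>] uC] .
    qed
    also have "shift_op e1 (convolve \<rho> u) x \<le> convolve \<rho> (shift_op e1 u) x"
      by (rule convolve_jensen[OF \<rho> e1 uC])
    finally show ?case by (simp add: u_def algebra_simps)
  qed
  from main[of n x] convolve_near[OF \<rho> LB[of n], of x] show ?thesis by linarith
qed

lemma shift_op_power_add:
  assumes e: "sublinear_functional e" and "f \<in> Cbuc" "g \<in> Cbuc"
  shows "(shift_op e ^^ k) (\<lambda>x. f x + g x) x \<le> (shift_op e ^^ k) f x + (shift_op e ^^ k) g x"
proof -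
  interpret P: sublinear_expectation_space Cbuc "\<lambda>f. (shift_op e ^^ k) f 0"
    by (rule sublinear_functional_power[OF e])
  show ?thesis
    using P.subadditive[OF Cbuc_translate[OF assms(2), of x] Cbuc_translate[OF assms(3), of x]]
      shift_op_power_translate[of k e "\<lambda>y. f y + g y" x]
    by (simp add: shift_op_power_translate)
qed

lemma shift_op_power_scale:
  assumes e: "sublinear_functional e" and "f \<in> Cbuc" "a \<ge> 0"
  shows "(shift_op e ^^ k) (\<lambda>x. a * f x) x = a * (shift_op e ^^ k) f x"
proof -
  interpret P: sublinear_expectation_space Cbuc "\<lambda>f. (shift_op e ^^ k) f 0"
    by (rule sublinear_functional_power[OF e])
  show ?thesis
    using P.pos_homogeneous[OF Cbuc_translate[OF assms(2), of x] assms(3)]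
      shift_op_power_translate[of k e "\<lambda>y. a * f y" x]
    by (simp add: shift_op_power_translate)
qed

lemma shift_op_power_const:
  assumes e: "sublinear_functional e"
  shows "(shift_op e ^^ k) (\<lambda>x. c) x = c"
proof -
  interpret P: sublinear_expectation_space Cbuc "\<lambda>f. (shift_op e ^^ k) f 0"
    by (rule sublinear_functional_power[OF e])
  show ?thesis
    using P.const_preserving[of c] fun_cong[OF shift_op_power_translate[of k e "\<lambda>y. c" x], of 0]
    by simp
qed

text \<open>Mollification at half of the modulus changes \<open>f\<close> by at most
  \<open>\<epsilon>\<close> and makes it Lipschitz, so the comparison of schemes, which is confined
  to Lipschitz functions, reaches all of \<open>Cbuc\<close>.\<close>

lemma Cbuc_lipschitz_approx:
  fixes f :: "real ^ 'd::finite \<Rightarrow> real"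
  assumes f: "f \<in> Cbuc" and "\<epsilon> > 0"
  obtains L M g where "lipschitz_bounded L M g" "\<And>x. \<bar>f x - g x\<bar> \<le> \<epsilon>"
proof -
  obtain d where d: "d > 0" "\<And>x y. dist x y < d \<Longrightarrow> \<bar>f x - f y\<bar> \<le> \<epsilon>"
    using Cbuc_modulus[OF f \<open>\<epsilon> > 0\<close>] by blast
  obtain \<rho> :: "real ^ 'd \<Rightarrow> real" where \<rho>: "mollifier (d / 2) \<rho>"
    using mollifier_exists[of "d / 2"] d by auto
  obtain K where K: "C3_bounded K (convolve \<rho> f)" using convolve_C3_bounded[OF \<rho> f] .
  obtain M where M: "\<And>x. \<bar>f x\<bar> \<le> M" using Cbuc_bounded[OF f] by blast
  have "\<bar>convolve \<rho> f x - f x\<bar> \<le> \<epsilon>" for x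
    by (rule convolve_const_on[OF \<rho> Cbuc_measurable[OF f] d(2) M])
       (use d(1) in \<open>auto simp: dist_norm norm_minus_commute\<close>)
  then show ?thesis
    using that[OF C3_bounded_lipschitz[OF K]] by (simp add: abs_minus_commute)
qed

text \<open>\<open>q\<close> is the squared norm on the unit ball and equals one far away. It serves
  as a Lyapunov function in Chebyshev-type estimates. It has no compact support itself, but
  \<open>q - 1\<close> has, which brings it within reach of a generator known on test functions
  only.\<close>

lemma quadratic_cutoff:
  obtains q :: "real ^ 'd::finite \<Rightarrow> real" and K
  where "C3_bounded K q" "q 0 = 0" "\<And>z. min 1 ((norm z)\<^sup>2) \<le> q z" "(\<lambda>z. q z - 1) \<in> Cc_infty"
proof -
  obtain \<zeta> :: "real ^ 'd \<Rightarrow> real" where \<zeta>: "\<zeta> \<in> Cc_infty" "\<And>x. 0 \<le> \<zeta> x" "\<And>x. \<zeta> x \<le> 1"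
      "\<And>x. norm x \<le> 1 \<Longrightarrow> \<zeta> x = 1" "\<And>x. norm x > 1 + 2 \<Longrightarrow> \<zeta> x = 0"
    using cutoff_exists[OF zero_less_one] by blast
  define q where "q z = 1 + ((norm z)\<^sup>2 - 1) * \<zeta> z" for z
  have sq: "(norm z)\<^sup>2 = (\<Sum>i\<in>UNIV. z $ i * z $ i)" for z :: "real ^ 'd"
    by (simp add: power2_norm_eq_inner inner_vec_def)
  have sm: "smooth (\<lambda>z :: real ^ 'd. (norm z)\<^sup>2 - 1)"
    unfolding sq by (intro smooth_diff smooth_sum smooth_mult smooth_coord smooth_const) auto
  have Cc: "(\<lambda>z. ((norm z)\<^sup>2 - 1) * \<zeta> z) \<in> Cc_infty"
    by (rule Cc_infty_mult[OF sm \<zeta>(1)])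
  obtain K where K: "C3_bounded K (\<lambda>z. ((norm z)\<^sup>2 - 1) * \<zeta> z)" using Cc_infty_C3[OF Cc] .
  have p: "partial i q = partial i (\<lambda>z. ((norm z)\<^sup>2 - 1) * \<zeta> z)" for i
    unfolding q_def[abs_def]
    by (rule ext, subst partial_add) (use smooth_differentiable[OF C3_boundedD(1)[OF K]] in auto)
  have "smooth q"
    unfolding q_def[abs_def] by (intro smooth_add smooth_const C3_boundedD(1)[OF K])
  moreover have "\<bar>q z\<bar> \<le> 1 + K" for z
    using C3_boundedD(2)[OF K, of z] unfolding q_def by linarith
  ultimately have "C3_bounded (1 + K) q"
    using C3_boundedD(3-6)[OF K] unfolding C3_bounded_def p by (simp add: add_increasing)
  moreover have "min 1 ((norm z)\<^sup>2) \<le> q z" for z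
  proof (cases "norm z \<le> 1")
    case False
    then have "1 \<le> (norm z)\<^sup>2" by (simp add: one_le_power)
    then have "0 \<le> ((norm z)\<^sup>2 - 1) * \<zeta> z" using \<zeta>(2) by (intro mult_nonneg_nonneg) auto
    then show ?thesis by (simp add: q_def)
  qed (simp add: q_def \<zeta>)
  moreover have "q 0 = 0" by (simp add: q_def \<zeta>)
  moreover have "(\<lambda>z. q z - 1) \<in> Cc_infty" using Cc by (simp add: q_def)
  ultimately show ?thesis using that by blast
qed

section \<open>Convergence of consistent schemes\<close>

locale convolution_semigroup =
  fixes E :: "real \<Rightarrow> (real ^ 'd::finite \<Rightarrow> real) \<Rightarrow> real"
  assumes sublinear: "t \<ge> 0 \<Longrightarrow> sublinear_functional (E t)"
    and zero: "f \<in> Cbuc \<Longrightarrow> E 0 f = f 0"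
    and semigroup: "f \<in> Cbuc \<Longrightarrow> s \<ge> 0 \<Longrightarrow> t \<ge> 0 \<Longrightarrow> E (s + t) f = E s (shift_op (E t) f)"
    and continuous: "f \<in> Cbuc \<Longrightarrow> ((\<lambda>t. E t f) \<longlongrightarrow> f 0) (at_right 0)"

lemma mult_divide_cancel: "B \<noteq> 0 \<Longrightarrow> B * (x / (c * B)) = x / c" for B x c :: real
  by simp

text \<open>The functional \<open>e n\<close> is one step of length \<open>1 / 2 ^ n\<close>.\<close>

locale consistent_scheme =
  fixes e :: "nat \<Rightarrow> (real ^ 'd::finite \<Rightarrow> real) \<Rightarrow> real" and G :: "(real ^ 'd \<Rightarrow> real) \<Rightarrow> real"
  assumes sublinear: "sublinear_functional (e n)"
    and consistent: "\<eta> > 0 \<Longrightarrow> \<exists>N. \<forall>n\<ge>N. \<forall>g. C3_bounded K g \<longrightarrow> \<bar>e n g - g 0 - G g / 2 ^ n\<bar> \<le> \<eta> / 2 ^ n"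
    and generator_lipschitz: "\<exists>\<Lambda>. \<forall>g. C3_bounded K g \<longrightarrow> lipschitz_bounded \<Lambda> \<Lambda> (\<lambda>x. G (\<lambda>y. g (x + y)))"
begin

abbreviation walk :: "nat \<Rightarrow> nat \<Rightarrow> (real ^ 'd \<Rightarrow> real) \<Rightarrow> real ^ 'd \<Rightarrow> real" where
  "walk n k \<equiv> shift_op (e n) ^^ k"

lemmas walk_Cbuc = shift_op_power_Cbuc[OF sublinear]
lemmas walk_mono = shift_op_power_mono_const[OF sublinear]
lemmas walk_abs_diff = shift_op_power_abs_diff[OF sublinear]
lemmas walk_add = shift_op_power_add[OF sublinear]
lemmas walk_scale = shift_op_power_scale[OF sublinear]
lemmas walk_const = shift_op_power_const[OF sublinear]

section \<open>Short-time behaviour of the walk\<close>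

lemma step_bound:
  assumes "\<forall>g. C3_bounded K g \<longrightarrow> \<bar>e n g - g 0 - G g / 2 ^ n\<bar> \<le> \<eta> / 2 ^ n" "C3_bounded K g"
  shows "\<bar>shift_op (e n) g x - g x - G (\<lambda>y. g (x + y)) / 2 ^ n\<bar> \<le> \<eta> / 2 ^ n"
  using assms(1)[rule_format, OF C3_bounded_translate[OF assms(2), of x]] by (simp add: shift_op_def)

text \<open>One step raises \<open>q\<close> by at most a constant times \<open>1 / 2 ^ n\<close>,
  since the generator is bounded on the class; monotonicity and preservation of constants carry this
  through all steps.\<close>

lemma quadratic_growth:
  assumes q: "C3_bounded K q"
  obtains C N where "C \<ge> 0" "\<And>n k x. n \<ge> N \<Longrightarrow> walk n k q x \<le> q x + C * (real k / 2 ^ n)"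
proof -
  obtain \<Lambda> where \<Lambda>: "\<And>g. C3_bounded K g \<Longrightarrow> lipschitz_bounded \<Lambda> \<Lambda> (\<lambda>x. G (\<lambda>y. g (x + y)))"
    using generator_lipschitz by blast
  obtain N where N: "\<And>n. n \<ge> N \<Longrightarrow> \<forall>g. C3_bounded K g \<longrightarrow> \<bar>e n g - g 0 - G g / 2 ^ n\<bar> \<le> 1 / 2 ^ n"
    using consistent[of 1 K] by auto
  note qC = C3_bounded_Cbuc[OF q]
  have one: "shift_op (e n) q x \<le> q x + (\<bar>\<Lambda>\<bar> + 1) / 2 ^ n" if "n \<ge> N" for n x
  proof -
    have "\<bar>G (\<lambda>y. q (x + y))\<bar> \<le> \<Lambda>"
      using \<Lambda>[OF q] by (simp add: lipschitz_bounded_def)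
    then have "G (\<lambda>y. q (x + y)) / 2 ^ n \<le> \<bar>\<Lambda>\<bar> / 2 ^ n"
      by (intro divide_right_mono) auto
    with step_bound[OF N[OF that] q, of x] show ?thesis
      by (simp add: add_divide_distrib)
  qed
  have "walk n k q x \<le> q x + (\<bar>\<Lambda>\<bar> + 1) * (real k / 2 ^ n)" if "n \<ge> N" for n k x
  proof (induction k arbitrary: x)
    case (Suc k)
    have "walk n (Suc k) q x \<le> shift_op (e n) q x + (\<bar>\<Lambda>\<bar> + 1) * (real k / 2 ^ n)"
      using Suc by (simp, intro shift_op_mono_const sublinear walk_Cbuc qC) auto
    with one[OF that, of x] show ?case
      by (simp add: field_simps)
  qed simp
  then show ?thesis using that[of "\<bar>\<Lambda>\<bar> + 1" N] by auto
qed

text \<open>Chebyshev: \<open>\<bar>f (x + y) - f x\<bar> \<le> \<eta> + B * q y\<close> with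
  \<open>B = 2 * M / min 1 (d\<^sup>2)\<close>, by the modulus of \<open>f\<close> inside the ball
  of radius \<open>d\<close> and by the sup bound outside. The constants \<open>C\<close> and
  \<open>N\<close> are chosen before \<open>f\<close>, which makes the estimate uniform over
  families of functions.\<close>

lemma walk_drift:
  obtains C N where "C \<ge> 0"
    "\<And>n k (f :: real ^ 'd \<Rightarrow> real) M d \<eta> x. n \<ge> N \<Longrightarrow> f \<in> Cbuc \<Longrightarrow> (\<And>x. \<bar>f x\<bar> \<le> M) \<Longrightarrow> d > 0 \<Longrightarrow>
       (\<And>x y. dist x y < d \<Longrightarrow> \<bar>f x - f y\<bar> \<le> \<eta>) \<Longrightarrow>
       \<bar>walk n k f x - f x\<bar> \<le> \<eta> + 2 * M / min 1 (d\<^sup>2) * (C * (real k / 2 ^ n))"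
proof -
  obtain q :: "real ^ 'd \<Rightarrow> real" and K where q: "C3_bounded K q" "q 0 = 0"
    "\<And>z. min 1 ((norm z)\<^sup>2) \<le> q z" "(\<lambda>z. q z - 1) \<in> Cc_infty"
    using quadratic_cutoff by blast
  note qC = C3_bounded_Cbuc[OF q(1)]
  obtain C N where C: "C \<ge> 0" "\<And>n k x. n \<ge> N \<Longrightarrow> walk n k q x \<le> q x + C * (real k / 2 ^ n)"
    using quadratic_growth[OF q(1)] by blast
  show ?thesis
  proof (rule that[OF C(1)])
    fix n k M d \<eta> and f :: "real ^ 'd \<Rightarrow> real" and x :: "real ^ 'd"
    assume n: "n \<ge> N" and f: "f \<in> Cbuc" and M: "\<And>x. \<bar>f x\<bar> \<le> M" and d: "d > 0"
      "\<And>x y. dist x y < d \<Longrightarrow> \<bar>f x - f y\<bar> \<le> \<eta>"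
    define B where "B = 2 * M / min 1 (d\<^sup>2)"
    define h where "h = (\<lambda>y. f (x + y))"
    have h: "h \<in> Cbuc" unfolding h_def by (rule Cbuc_translate[OF f])
    have M0: "0 \<le> M" using M[of 0] by linarith
    have m0: "min 1 (d\<^sup>2) > 0" using d by simp
    then have B0: "B \<ge> 0" using M0 by (simp add: B_def)
    have \<eta>0: "0 \<le> \<eta>" using d(2)[of 0 0] d(1) by simp
    have q0: "0 \<le> q z" for z using q(3)[of z] by (smt (verit) zero_le_power2)
    have near: "\<bar>h y - f x\<bar> \<le> \<eta> + B * q y" for y
    proof (cases "norm y < d")
      case True
      then have "\<bar>h y - f x\<bar> \<le> \<eta>" unfolding h_def by (intro d(2)) (simp add: dist_norm)
      with q0[of y] B0 show ?thesis by (simp add: add_increasing2)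
    next
      case False
      then have "d\<^sup>2 \<le> (norm y)\<^sup>2" using d(1) by (intro power_mono) auto
      then have "min 1 (d\<^sup>2) \<le> q y" using q(3)[of y] by linarith
      then have "B * min 1 (d\<^sup>2) \<le> B * q y" using B0 by (intro mult_left_mono)
      then have "2 * M \<le> B * q y" using m0 by (simp add: B_def)
      moreover have "\<bar>h y - f x\<bar> \<le> 2 * M" using M[of "x + y"] M[of x] unfolding h_def by linarith
      ultimately show ?thesis using \<eta>0 by linarith
    qed
    have Bq: "(\<lambda>y. B * q y) \<in> Cbuc" by (rule Cbuc_scale[OF qC])
    have wBq: "walk n k (\<lambda>y. B * q y) 0 \<le> B * (C * (real k / 2 ^ n))"
      using mult_left_mono[OF C(2)[OF n, of k 0] B0] walk_scale[OF qC B0, of k n 0] q(2) by simp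
    have eq: "walk n k f x = walk n k h 0"
      unfolding h_def shift_op_power_translate by simp
    have "walk n k h 0 \<le> walk n k (\<lambda>y. B * q y) 0 + (f x + \<eta>)"
    proof (rule walk_mono[OF h Bq])
      show "h y \<le> B * q y + (f x + \<eta>)" for y using near[of y] by linarith
    qed
    \<comment> \<open>The operator is not odd, so the lower bound is not the mirror image of the
      upper one: the term with \<open>q\<close> is added to \<open>h\<close> and split off by
      subadditivity.\<close>
    moreover have "f x - \<eta> \<le> walk n k h 0 + walk n k (\<lambda>y. B * q y) 0"
    proof -
      have "walk n k (\<lambda>_. f x - \<eta>) 0 \<le> walk n k (\<lambda>y. h y + B * q y) 0 + 0"
      proof (rule walk_mono[OF Cbuc_const Cbuc_add[OF h Bq]])
        show "f x - \<eta> \<le> h y + B * q y + 0" for y using near[of y] by linarith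
      qed
      also have "walk n k (\<lambda>y. h y + B * q y) 0 \<le> walk n k h 0 + walk n k (\<lambda>y. B * q y) 0"
        by (rule walk_add[OF h Bq])
      finally show ?thesis by (simp add: walk_const)
    qed
    ultimately show "\<bar>walk n k f x - f x\<bar> \<le> \<eta> + 2 * M / min 1 (d\<^sup>2) * (C * (real k / 2 ^ n))"
      using wBq eq unfolding B_def[symmetric] by linarith
  qed
qed

lemma walk_uniformly_near:
  assumes f: "f \<in> Cbuc" and "\<eta> > 0"
  obtains \<delta> N where "\<delta> > 0" "\<And>n k x. n \<ge> N \<Longrightarrow> real k / 2 ^ n \<le> \<delta> \<Longrightarrow> \<bar>walk n k f x - f x\<bar> \<le> \<eta>"
proof -
  obtain C N where C: "C \<ge> 0" and w:
    "\<And>n k (f :: real ^ 'd \<Rightarrow> real) M d \<eta> x. n \<ge> N \<Longrightarrow> f \<in> Cbuc \<Longrightarrow> (\<And>x. \<bar>f x\<bar> \<le> M) \<Longrightarrow> d > 0 \<Longrightarrow>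
       (\<And>x y. dist x y < d \<Longrightarrow> \<bar>f x - f y\<bar> \<le> \<eta>) \<Longrightarrow>
       \<bar>walk n k f x - f x\<bar> \<le> \<eta> + 2 * M / min 1 (d\<^sup>2) * (C * (real k / 2 ^ n))"
    using walk_drift by blast
  obtain M where M: "\<And>x. \<bar>f x\<bar> \<le> M" "0 \<le> M" using Cbuc_bounded[OF f] by blast
  obtain d where d: "d > 0" "\<And>x y. dist x y < d \<Longrightarrow> \<bar>f x - f y\<bar> \<le> \<eta> / 2"
    using Cbuc_modulus[OF f, of "\<eta> / 2"] \<open>\<eta> > 0\<close> by auto
  define A where "A = 2 * M / min 1 (d\<^sup>2) * C"
  have A: "A \<ge> 0" using M C d by (simp add: A_def)
  show ?thesis
  proof (rule that[of "\<eta> / (2 * (A + 1))" N])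
    show "\<eta> / (2 * (A + 1)) > 0" using \<open>\<eta> > 0\<close> A by simp
    fix n k x assume n: "n \<ge> N" "real k / 2 ^ n \<le> \<eta> / (2 * (A + 1))"
    have "A * (real k / 2 ^ n) \<le> (A + 1) * (\<eta> / (2 * (A + 1)))"
      using n(2) A by (intro mult_mono) auto
    also have "\<dots> = \<eta> / 2" using A by (intro mult_divide_cancel) simp
    finally have "2 * M / min 1 (d\<^sup>2) * (C * (real k / 2 ^ n)) \<le> \<eta> / 2"
      by (simp add: A_def mult_ac)
    with w[OF n(1) f M(1) d, of k x] show "\<bar>walk n k f x - f x\<bar> \<le> \<eta>" by linarith
  qed
qed

text \<open>Telescoping: each step adds \<open>1 / 2 ^ n\<close> times \<open>u\<close>, the
  generator applied to \<open>g\<close>, at the current position, and by \<open>walk_drift\<close>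
  the expectation of \<open>u\<close> moves by at most \<open>2 * \<eta>'\<close> in the short time
  considered. As \<open>u\<close> has bound and Lipschitz constant \<open>\<Lambda>\<close> for all
  \<open>g\<close> in the class, \<open>\<delta>\<close> and \<open>N\<close> do not depend on
  \<open>g\<close>.\<close>

lemma walk_generator:
  assumes "\<eta> > 0"
  obtains \<delta> N where "\<delta> > 0"
    "\<And>n k (g :: real ^ 'd \<Rightarrow> real) x. n \<ge> N \<Longrightarrow> real k / 2 ^ n \<le> \<delta> \<Longrightarrow> C3_bounded K g \<Longrightarrow>
      \<bar>walk n k g x - g x - real k / 2 ^ n * G (\<lambda>y. g (x + y))\<bar> \<le> real k / 2 ^ n * \<eta>"
proof -
  \<comment> \<open>One third is for the consistency error of a step, two thirds for the drift of
    \<open>u\<close>.\<close>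
  define \<eta>' where "\<eta>' = \<eta> / 3"
  have \<eta>': "\<eta>' > 0" using assms by (simp add: \<eta>'_def)
  obtain C N1 where C: "C \<ge> 0" and w:
    "\<And>n k (f :: real ^ 'd \<Rightarrow> real) M d \<eta> x. n \<ge> N1 \<Longrightarrow> f \<in> Cbuc \<Longrightarrow> (\<And>x. \<bar>f x\<bar> \<le> M) \<Longrightarrow> d > 0 \<Longrightarrow>
       (\<And>x y. dist x y < d \<Longrightarrow> \<bar>f x - f y\<bar> \<le> \<eta>) \<Longrightarrow>
       \<bar>walk n k f x - f x\<bar> \<le> \<eta> + 2 * M / min 1 (d\<^sup>2) * (C * (real k / 2 ^ n))"
    using walk_drift by blast
  obtain \<Lambda> where \<Lambda>: "\<And>g. C3_bounded K g \<Longrightarrow> lipschitz_bounded \<Lambda> \<Lambda> (\<lambda>x. G (\<lambda>y. g (x + y)))"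
    using generator_lipschitz by blast
  obtain N2 where N2: "\<And>n. n \<ge> N2 \<Longrightarrow> \<forall>g. C3_bounded K g \<longrightarrow> \<bar>e n g - g 0 - G g / 2 ^ n\<bar> \<le> \<eta>' / 2 ^ n"
    using consistent[OF \<eta>', of K] by auto
  \<comment> \<open>Within distance \<open>d\<close> a function with Lipschitz constant
    \<open>\<Lambda>\<close> varies by at most \<open>\<eta>'\<close>; below,
    \<open>\<delta>\<close> is so short that the Chebyshev term is at most \<open>\<eta>'\<close>
    too.\<close>
  define d where "d = \<eta>' / (\<bar>\<Lambda>\<bar> + 1)"
  have d: "d > 0" using \<eta>' by (simp add: d_def)
  define A where "A = 2 * \<bar>\<Lambda>\<bar> / min 1 (d\<^sup>2) * C"
  have A: "A \<ge> 0" using C d by (simp add: A_def)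
  define \<delta> where "\<delta> = \<eta>' / (A + 1)"
  have \<delta>: "\<delta> > 0" using \<eta>' A by (simp add: \<delta>_def)
  have A\<delta>: "A * \<delta> \<le> \<eta>'"
  proof -
    have "A * \<delta> \<le> (A + 1) * \<delta>" using \<delta> by (intro mult_right_mono) auto
    also have "\<dots> = \<eta>'" using A by (simp add: \<delta>_def)
    finally show ?thesis .
  qed
  show ?thesis
  proof (rule that[OF \<delta>, of "max N1 N2"])
    fix n k and g :: "real ^ 'd \<Rightarrow> real" and x :: "real ^ 'd"
    assume n: "n \<ge> max N1 N2" and k: "real k / 2 ^ n \<le> \<delta>" and g: "C3_bounded K g"
    define u where "u = (\<lambda>x. G (\<lambda>y. g (x + y)))"
    have u: "lipschitz_bounded \<Lambda> \<Lambda> u" unfolding u_def by (rule \<Lambda>[OF g])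
    note gC = C3_bounded_Cbuc[OF g] and uC = lipschitz_bounded_Cbuc[OF u]
    have mu: "lipschitz_bounded \<Lambda> \<Lambda> (\<lambda>x. - u x)" using u by (auto simp: lipschitz_bounded_def abs_minus_commute)
    have drift: "\<bar>walk n j v x - v x\<bar> \<le> 2 * \<eta>'" if v: "lipschitz_bounded \<Lambda> \<Lambda> v" and j: "real j / 2 ^ n \<le> \<delta>" for v j x
    proof -
      have "\<bar>walk n j v x - v x\<bar> \<le> \<eta>' + 2 * \<bar>\<Lambda>\<bar> / min 1 (d\<^sup>2) * (C * (real j / 2 ^ n))"
      proof (rule w)
        show "n \<ge> N1" using n by simp
        show "v \<in> Cbuc" by (rule lipschitz_bounded_Cbuc[OF v])
        show "\<bar>v x\<bar> \<le> \<bar>\<Lambda>\<bar>" for x using v unfolding lipschitz_bounded_def by (metis abs_ge_self order_trans)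
        fix x y :: "real ^ 'd" assume "dist x y < d"
        then have "(\<bar>\<Lambda>\<bar> + 1) * dist x y \<le> \<eta>'" by (simp add: d_def field_simps)
        moreover have "\<bar>v x - v y\<bar> \<le> \<Lambda> * dist x y" using v by (simp add: lipschitz_bounded_def)
        moreover have "\<Lambda> * dist x y \<le> (\<bar>\<Lambda>\<bar> + 1) * dist x y" by (intro mult_right_mono) auto
        ultimately show "\<bar>v x - v y\<bar> \<le> \<eta>'" by linarith
      qed (rule d)
      moreover have "A * (real j / 2 ^ n) \<le> A * \<delta>" using j A by (rule mult_left_mono)
      ultimately show ?thesis using A\<delta> by (simp add: A_def mult_ac)
    qed
    have one: "\<bar>shift_op (e n) g x - g x - u x / 2 ^ n\<bar> \<le> \<eta>' / 2 ^ n" for x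
      unfolding u_def by (rule step_bound[OF N2 g]) (use n in simp)
    let ?c = "1 / 2 ^ n :: real"
    have cu: "(\<lambda>x. ?c * v x) \<in> Cbuc" if "v \<in> Cbuc" for v :: "real ^ 'd \<Rightarrow> real" using that by (rule Cbuc_scale)
    have "walk n j g x \<le> g x + real j * ?c * (u x + 3 * \<eta>') \<and> g x + real j * ?c * (u x - 3 * \<eta>') \<le> walk n j g x"
      if "real j / 2 ^ n \<le> \<delta>" for j x
      using that
    proof (induction j)
      case (Suc j)
      have j: "real j / 2 ^ n \<le> \<delta>"
        by (rule order_trans[OF divide_right_mono Suc.prems]) auto
      have sw: "walk n (Suc j) g x = walk n j (shift_op (e n) g) x"
        by (simp add: funpow_swap1)
      have sC: "shift_op (e n) g \<in> Cbuc" by (rule shift_op_Cbuc[OF sublinear gC])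
      have "walk n j (shift_op (e n) g) x \<le> walk n j (\<lambda>x. g x + ?c * u x) x + ?c * \<eta>'"
      proof (rule walk_mono[OF sC Cbuc_add[OF gC cu[OF uC]]])
        fix x show "shift_op (e n) g x \<le> g x + ?c * u x + ?c * \<eta>'"
          using one[of x] by (simp add: abs_le_iff)
      qed
      also have "walk n j (\<lambda>x. g x + ?c * u x) x \<le> walk n j g x + ?c * walk n j u x"
        using walk_add[OF gC cu[OF uC], of j n x] walk_scale[OF uC, of ?c j n x] by simp
      also have "?c * walk n j u x \<le> ?c * (u x + 2 * \<eta>')"
        using drift[OF u j, of x] by (intro mult_left_mono) (auto simp: abs_le_iff)
      finally have 1: "walk n (Suc j) g x \<le> walk n j g x + ?c * (u x + 3 * \<eta>')"
        unfolding sw by (simp add: algebra_simps)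
      \<comment> \<open>The lower bound adds \<open>- u\<close> before the operator is applied, as
        subadditivity bounds sums from above only. Hence the drift estimate is used for
        \<open>- u\<close> as well.\<close>
      have "walk n j g x - ?c * \<eta>' \<le> walk n j (\<lambda>x. shift_op (e n) g x + ?c * - u x) x"
      proof -
        have "walk n j g x \<le> walk n j (\<lambda>x. shift_op (e n) g x + ?c * - u x) x + ?c * \<eta>'"
        proof (rule walk_mono[OF gC Cbuc_add[OF sC cu[OF Cbuc_minus[OF uC]]]])
          fix x show "g x \<le> shift_op (e n) g x + ?c * - u x + ?c * \<eta>'"
            using one[of x] by (simp add: abs_le_iff)
        qed
        then show ?thesis by simp
      qed
      also have "\<dots> \<le> walk n j (shift_op (e n) g) x + ?c * walk n j (\<lambda>x. - u x) x"
        using walk_add[OF sC cu[OF Cbuc_minus[OF uC]], of j n x] walk_scale[OF Cbuc_minus[OF uC], of ?c j n x] by simp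
      also have "?c * walk n j (\<lambda>x. - u x) x \<le> ?c * (- u x + 2 * \<eta>')"
        using drift[OF mu j, of x] by (intro mult_left_mono) (auto simp: abs_le_iff)
      finally have 2: "walk n j g x + ?c * (u x - 3 * \<eta>') \<le> walk n (Suc j) g x"
        unfolding sw by (simp add: algebra_simps)
      have s: "real (Suc j) * ?c * a = real j * ?c * a + ?c * a" for a
        by (simp add: algebra_simps add_divide_distrib)
      from Suc.IH[OF j] 1 2 show ?case unfolding s by linarith
    qed simp
    from this[OF k, of x] have "\<bar>walk n k g x - g x - real k * ?c * u x\<bar> \<le> real k * ?c * (3 * \<eta>')"
      unfolding abs_le_iff right_diff_distrib distrib_left by linarith
    then show "\<bar>walk n k g x - g x - real k / 2 ^ n * G (\<lambda>y. g (x + y))\<bar> \<le> real k / 2 ^ n * \<eta>"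
      by (simp add: u_def \<eta>'_def)
  qed
qed

text \<open>On a mollified function, one step of length \<open>1 / 2 ^ m\<close> and
  \<open>2 ^ (n - m)\<close> steps of length \<open>1 / 2 ^ n\<close> both equal the identity plus
  \<open>G / 2 ^ m\<close> up to \<open>\<eta> / 2 ^ m\<close>. The comparison of schemes, used in
  both directions, turns this local agreement into closeness of the iterates up to time
  \<open>t\<close>, uniformly in \<open>n \<ge> m\<close>.\<close>

lemma walk_refine_lipschitz:
  assumes f: "lipschitz_bounded L M f" and "\<epsilon> > 0" and t: "t \<ge> 0"
  obtains N where "\<And>m n k x. m \<ge> N \<Longrightarrow> n \<ge> m \<Longrightarrow> real k / 2 ^ m \<le> t \<Longrightarrow>
    \<bar>walk n (2 ^ (n - m) * k) f x - walk m k f x\<bar> \<le> \<epsilon>"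
proof -
  \<comment> \<open>The two mollifications together may cost \<open>\<epsilon> / 4\<close>. Only
    once \<open>r\<close> is fixed is the derivative bound \<open>K\<close> determined, and with it
    the admissible step length.\<close>
  define r where "r = \<epsilon> / (8 * (\<bar>L\<bar> + 1))"
  have r: "r > 0" using assms by (simp add: r_def)
  have Lr: "2 * (\<bar>L\<bar> * r) \<le> \<epsilon> / 4"
  proof -
    have "\<bar>L\<bar> * r \<le> (\<bar>L\<bar> + 1) * r" using r by (intro mult_right_mono) auto
    also have "\<dots> = \<epsilon> / 8" unfolding r_def by (rule mult_divide_cancel) simp
    finally show ?thesis by simp
  qed
  obtain \<rho> :: "real ^ 'd \<Rightarrow> real" where \<rho>: "mollifier r \<rho>" using mollifier_exists[OF r] .
  have M0: "0 \<le> M" using f unfolding lipschitz_bounded_def by (meson abs_ge_zero order_trans)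
  obtain K where K: "\<And>u :: real ^ 'd \<Rightarrow> real. u \<in> borel_measurable borel \<Longrightarrow> (\<And>y. \<bar>u y\<bar> \<le> M) \<Longrightarrow> C3_bounded K (convolve \<rho> u)"
    using mollified_C3_bounded[OF \<rho> M0] by blast
  \<comment> \<open>At most \<open>t * 2 ^ m\<close> steps, each with discrepancy
    \<open>2 * \<eta> / 2 ^ m\<close>, add up to at most \<open>\<epsilon> / 2\<close>.\<close>
  define \<eta> where "\<eta> = \<epsilon> / (4 * (t + 1))"
  have \<eta>: "\<eta> > 0" using assms by (simp add: \<eta>_def)
  obtain \<delta> N1 where \<delta>: "\<delta> > 0" and gen: "\<And>n k (g :: real ^ 'd \<Rightarrow> real) x. n \<ge> N1 \<Longrightarrow> real k / 2 ^ n \<le> \<delta> \<Longrightarrow> C3_bounded K g \<Longrightarrow>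
      \<bar>walk n k g x - g x - real k / 2 ^ n * G (\<lambda>y. g (x + y))\<bar> \<le> real k / 2 ^ n * \<eta>"
    using walk_generator[OF \<eta>] by blast
  obtain N2 where "(1 / 2) ^ N2 < \<delta>" using real_arch_pow_inv[OF \<delta>, of "1/2"] by auto
  then have N2: "1 / 2 ^ m \<le> \<delta>" if "m \<ge> N2" for m
    using power_decreasing[OF that, of "1/2 :: real"] by (simp add: power_one_over)
  show ?thesis
  proof (rule that[of "max N1 N2"])
    fix m n k and x :: "real ^ 'd"
    assume m: "m \<ge> max N1 N2" and nm: "n \<ge> m" and k: "real k / 2 ^ m \<le> t"
    define a :: nat where "a = 2 ^ (n - m)"
    have a: "real a / 2 ^ n = 1 / 2 ^ m"
    proof -
      have "(2::real) ^ n = 2 ^ (n - m) * 2 ^ m" using nm by (simp flip: power_add)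
      then show ?thesis by (simp add: a_def)
    qed
    define e2 where "e2 = (\<lambda>f. walk n a f 0)"
    have e2: "sublinear_functional e2" "shift_op e2 = walk n a"
      unfolding e2_def by (rule sublinear_functional_power[OF sublinear])+
    have close: "\<bar>e2 (convolve \<rho> u) - e m (convolve \<rho> u)\<bar> \<le> 2 * \<eta> / 2 ^ m" if u: "lipschitz_bounded L M u" for u
    proof -
      let ?g = "convolve \<rho> u"
      have g: "C3_bounded K ?g"
        using u by (intro K Cbuc_measurable lipschitz_bounded_Cbuc[OF u]) (auto simp: lipschitz_bounded_def)
      have "\<bar>walk n a ?g 0 - ?g 0 - real a / 2 ^ n * G (\<lambda>y. ?g (0 + y))\<bar> \<le> real a / 2 ^ n * \<eta>"
        using m nm N2[of m] by (intro gen g) (auto simp: a)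
      moreover have "\<bar>walk m 1 ?g 0 - ?g 0 - real 1 / 2 ^ m * G (\<lambda>y. ?g (0 + y))\<bar> \<le> real 1 / 2 ^ m * \<eta>"
        using m N2[of m] by (intro gen g) auto
      ultimately show ?thesis by (simp add: a e2_def shift_op_0)
    qed
    have ka: "(shift_op e2 ^^ k) f = walk n (2 ^ (n - m) * k) f"
      by (simp add: e2(2) a_def funpow_mult)
    have c1: "e2 (convolve \<rho> u) \<le> e m (convolve \<rho> u) + 2 * \<eta> / 2 ^ m"
      and c2: "e m (convolve \<rho> u) \<le> e2 (convolve \<rho> u) + 2 * \<eta> / 2 ^ m"
      if "lipschitz_bounded L M u" for u
      using close[OF that] by linarith+
    have tot: "real k * (2 * \<eta> / 2 ^ m) \<le> \<epsilon> / 2"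
    proof -
      have "real k / 2 ^ m * (2 * \<eta>) \<le> (t + 1) * (2 * \<eta>)"
        using k \<eta> by (intro mult_right_mono) auto
      also have "\<dots> = \<epsilon> / 2" using t by (simp add: \<eta>_def field_simps)
      finally show ?thesis by (simp add: field_simps)
    qed
    have "(shift_op e2 ^^ k) f x \<le> walk m k f x + 2 * (\<bar>L\<bar> * r) + real k * (2 * \<eta> / 2 ^ m)"
      by (rule scheme_comparison[OF \<rho> sublinear e2(1) f]) (rule c1)
    moreover have "walk m k f x \<le> (shift_op e2 ^^ k) f x + 2 * (\<bar>L\<bar> * r) + real k * (2 * \<eta> / 2 ^ m)"
      by (rule scheme_comparison[OF \<rho> e2(1) sublinear f]) (rule c2)
    moreover note Lr tot \<open>\<epsilon> > 0\<close>
    ultimately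
    show "\<bar>walk n (2 ^ (n - m) * k) f x - walk m k f x\<bar> \<le> \<epsilon>"
      unfolding ka by linarith
  qed
qed

lemma walk_refine:
  assumes f: "f \<in> Cbuc" and "\<epsilon> > 0" and t: "t \<ge> 0"
  obtains N where "\<And>m n k x. m \<ge> N \<Longrightarrow> n \<ge> m \<Longrightarrow> real k / 2 ^ m \<le> t \<Longrightarrow>
    \<bar>walk n (2 ^ (n - m) * k) f x - walk m k f x\<bar> \<le> \<epsilon>"
proof -
  obtain L M g where g: "lipschitz_bounded L M g" "\<And>x. \<bar>f x - g x\<bar> \<le> \<epsilon> / 3"
    using Cbuc_lipschitz_approx[OF f, of "\<epsilon> / 3"] \<open>\<epsilon> > 0\<close> by auto
  obtain N where N: "\<And>m n k x. m \<ge> N \<Longrightarrow> n \<ge> m \<Longrightarrow> real k / 2 ^ m \<le> t \<Longrightarrow>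
    \<bar>walk n (2 ^ (n - m) * k) g x - walk m k g x\<bar> \<le> \<epsilon> / 3"
    using walk_refine_lipschitz[OF g(1) _ t, of "\<epsilon> / 3"] \<open>\<epsilon> > 0\<close> by auto
  note gC = lipschitz_bounded_Cbuc[OF g(1)]
  show ?thesis
  proof (rule that[of N])
    fix m n k x assume "m \<ge> N" "n \<ge> m" "real k / 2 ^ m \<le> t"
    from N[OF this, of x] walk_abs_diff[OF f gC g(2), of "2 ^ (n - m) * k" n x] walk_abs_diff[OF f gC g(2), of k m x]
    show "\<bar>walk n (2 ^ (n - m) * k) f x - walk m k f x\<bar> \<le> \<epsilon>" by linarith
  qed
qed

section \<open>The limit semigroup\<close>

definition steps :: "nat \<Rightarrow> real \<Rightarrow> nat" where
  "steps n t = nat \<lfloor>t * 2 ^ n\<rfloor>"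

lemma steps_bounds: "t \<ge> 0 \<Longrightarrow> real (steps n t) / 2 ^ n \<le> t" "t \<ge> 0 \<Longrightarrow> t - 1 / 2 ^ n \<le> real (steps n t) / 2 ^ n"
proof -
  assume t: "t \<ge> 0"
  have "real (steps n t) = of_int \<lfloor>t * 2 ^ n\<rfloor>" using t by (simp add: steps_def)
  then have "real (steps n t) \<le> t * 2 ^ n" "t * 2 ^ n - 1 \<le> real (steps n t)" by linarith+
  then have "real (steps n t) / 2 ^ n \<le> t" "(t * 2 ^ n - 1) / 2 ^ n \<le> real (steps n t) / 2 ^ n"
    by (auto simp: pos_divide_le_eq intro: divide_right_mono)
  then show "real (steps n t) / 2 ^ n \<le> t" "t - 1 / 2 ^ n \<le> real (steps n t) / 2 ^ n"
    by (simp_all add: diff_divide_distrib)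
qed

lemma steps_tendsto:
  assumes "t \<ge> 0"
  shows "(\<lambda>n. real (steps n t) / 2 ^ n) \<longlonglongrightarrow> t"
proof (rule tendsto_sandwich)
  have "(\<lambda>n. t - (1 / 2) ^ n) \<longlonglongrightarrow> t - 0"
    by (intro tendsto_intros LIMSEQ_power_zero) auto
  then show "(\<lambda>n. t - 1 / 2 ^ n) \<longlonglongrightarrow> t" by (simp add: power_one_over)
  show "(\<lambda>n. t) \<longlonglongrightarrow> t" by simp
qed (use steps_bounds[OF assms] in auto)

lemma walk_shift_near:
  assumes "f \<in> Cbuc" "\<And>x. \<bar>walk n j f x - f x\<bar> \<le> \<kappa>"
  shows "\<bar>walk n (a + j) f x - walk n a f x\<bar> \<le> \<kappa>"
  unfolding funpow_add o_def using assms by (intro walk_abs_diff walk_Cbuc)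

text \<open>Rounding \<open>t\<close> down at level \<open>m\<close> loses at most one coarse step,
  and the \<open>j\<close> fine steps that fill this gap move \<open>f\<close> little; the rest is
  the refinement estimate at a common time.\<close>

lemma walk_Cauchy:
  assumes f: "f \<in> Cbuc" and "\<epsilon> > 0" and t: "t \<ge> 0"
  obtains N where "\<And>m n x. m \<ge> N \<Longrightarrow> n \<ge> m \<Longrightarrow>
    \<bar>walk n (steps n t) f x - walk m (steps m t) f x\<bar> \<le> \<epsilon>"
proof -
  obtain N1 where N1: "\<And>m n k x. m \<ge> N1 \<Longrightarrow> n \<ge> m \<Longrightarrow> real k / 2 ^ m \<le> t \<Longrightarrow>
    \<bar>walk n (2 ^ (n - m) * k) f x - walk m k f x\<bar> \<le> \<epsilon> / 2"
    using walk_refine[OF f _ t, of "\<epsilon> / 2"] \<open>\<epsilon> > 0\<close> by auto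
  obtain \<delta> N2 where \<delta>: "\<delta> > 0" and N2: "\<And>n k x. n \<ge> N2 \<Longrightarrow> real k / 2 ^ n \<le> \<delta> \<Longrightarrow> \<bar>walk n k f x - f x\<bar> \<le> \<epsilon> / 2"
    using walk_uniformly_near[OF f, of "\<epsilon> / 2"] \<open>\<epsilon> > 0\<close> by auto
  obtain N3 where "(1 / 2) ^ N3 < \<delta>" using real_arch_pow_inv[OF \<delta>, of "1/2"] by auto
  then have N3: "1 / 2 ^ m \<le> \<delta>" if "m \<ge> N3" for m
    using power_decreasing[OF that, of "1/2 :: real"] by (simp add: power_one_over)
  show ?thesis
  proof (rule that[of "max N1 (max N2 N3)"])
    fix m n x assume m: "m \<ge> max N1 (max N2 N3)" and nm: "n \<ge> m"
    define a where "a = 2 ^ (n - m) * steps m t"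
    have p: "(2::real) ^ n = 2 ^ (n - m) * 2 ^ m" using nm by (simp flip: power_add)
    have ra: "real a / 2 ^ n = real (steps m t) / 2 ^ m"
      by (simp add: a_def p)
    \<comment> \<open>The coarse time is also a multiple of the fine step that does not exceed
      \<open>t\<close>, hence it lies below the fine rounding.\<close>
    have "a \<le> steps n t"
    proof -
      have "real a / 2 ^ n \<le> t"
        using steps_bounds(1)[OF t, of m] ra by simp
      then have "real a \<le> t * 2 ^ n"
        by (simp add: pos_divide_le_eq)
      then have "int a \<le> \<lfloor>t * 2 ^ n\<rfloor>" by (simp add: le_floor_iff)
      then show ?thesis by (simp add: steps_def)
    qed
    then obtain j where j: "steps n t = a + j" using le_Suc_ex by blast
    have "real j / 2 ^ n = real (steps n t) / 2 ^ n - real a / 2 ^ n"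
      by (simp add: j diff_divide_distrib[symmetric])
    also have "\<dots> \<le> 1 / 2 ^ m"
      using steps_bounds(1)[OF t, of n] steps_bounds(2)[OF t, of m] unfolding ra by linarith
    also have "\<dots> \<le> \<delta>" using N3 m by simp
    finally have "\<bar>walk n (a + j) f x - walk n a f x\<bar> \<le> \<epsilon> / 2"
      using m nm by (intro walk_shift_near f N2) auto
    moreover have "\<bar>walk n a f x - walk m (steps m t) f x\<bar> \<le> \<epsilon> / 2"
      unfolding a_def using m nm steps_bounds[OF t] by (intro N1) auto
    ultimately show "\<bar>walk n (steps n t) f x - walk m (steps m t) f x\<bar> \<le> \<epsilon>"
      unfolding j by linarith
  qed
qed

definition limit_op :: "real \<Rightarrow> (real ^ 'd \<Rightarrow> real) \<Rightarrow> real ^ 'd \<Rightarrow> real" where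
  "limit_op t f x = lim (\<lambda>n. walk n (steps n t) f x)"

lemma limit_op_tendsto:
  assumes f: "f \<in> Cbuc" and t: "t \<ge> 0"
  shows "(\<lambda>n. walk n (steps n t) f x) \<longlonglongrightarrow> limit_op t f x"
proof -
  have "Cauchy (\<lambda>n. walk n (steps n t) f x)"
  proof (rule CauchyI')
    fix \<epsilon> :: real assume "\<epsilon> > 0"
    then obtain N where N: "\<And>m n x. m \<ge> N \<Longrightarrow> n \<ge> m \<Longrightarrow>
        \<bar>walk n (steps n t) f x - walk m (steps m t) f x\<bar> \<le> \<epsilon> / 2"
      using walk_Cauchy[OF f _ t, of "\<epsilon> / 2"] by auto
    then show "\<exists>N. \<forall>m\<ge>N. \<forall>n>m. dist (walk m (steps m t) f x) (walk n (steps n t) f x) < \<epsilon>"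
    proof (intro exI[of _ N] allI impI)
      fix m n assume "m \<ge> N" "n > m"
      with N[of m n x] \<open>\<epsilon> > 0\<close> show "dist (walk m (steps m t) f x) (walk n (steps n t) f x) < \<epsilon>"
        unfolding dist_real_def by linarith
    qed
  qed
  then show ?thesis
    unfolding limit_op_def by (simp add: Cauchy_convergent_iff convergent_LIMSEQ_iff)
qed

text \<open>The Cauchy estimate holds for all \<open>x\<close> at once, so it survives the limit in
  one of its indices; uniform convergence is what keeps the limit in \<open>Cbuc\<close>.\<close>

lemma limit_op_uniform:
  assumes f: "f \<in> Cbuc" and "\<epsilon> > 0" and t: "t \<ge> 0"
  obtains N where "\<And>n x. n \<ge> N \<Longrightarrow> \<bar>walk n (steps n t) f x - limit_op t f x\<bar> \<le> \<epsilon>"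
proof -
  obtain N where N: "\<And>m n x. m \<ge> N \<Longrightarrow> n \<ge> m \<Longrightarrow>
    \<bar>walk n (steps n t) f x - walk m (steps m t) f x\<bar> \<le> \<epsilon>"
    using walk_Cauchy[OF assms] by blast
  show ?thesis
  proof (rule that[of N])
    fix m x assume m: "m \<ge> N"
    have "(\<lambda>n. \<bar>walk m (steps m t) f x - walk n (steps n t) f x\<bar>) \<longlonglongrightarrow> \<bar>walk m (steps m t) f x - limit_op t f x\<bar>"
      by (intro tendsto_intros limit_op_tendsto f t)
    then show "\<bar>walk m (steps m t) f x - limit_op t f x\<bar> \<le> \<epsilon>"
      by (rule tendsto_upperbound) (use N[OF m] in \<open>auto simp: eventually_sequentially abs_minus_commute\<close>)
  qed
qed

lemma limit_op_Cbuc: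
  assumes "f \<in> Cbuc" "t \<ge> 0"
  shows "limit_op t f \<in> Cbuc"
proof (rule Cbuc_uniform_limit)
  fix \<epsilon> :: real assume "\<epsilon> > 0"
  then obtain N where "\<And>n x. n \<ge> N \<Longrightarrow> \<bar>walk n (steps n t) f x - limit_op t f x\<bar> \<le> \<epsilon>"
    using limit_op_uniform[OF assms(1) _ assms(2)] by blast
  then show "\<exists>g\<in>Cbuc. \<forall>x. \<bar>limit_op t f x - g x\<bar> \<le> \<epsilon>"
    by (intro bexI[of _ "walk N (steps N t) f"] walk_Cbuc assms) (auto simp: abs_minus_commute)
qed

definition limit_functional :: "real \<Rightarrow> (real ^ 'd \<Rightarrow> real) \<Rightarrow> real" where
  "limit_functional t f = limit_op t f 0"

lemma shift_op_limit_functional: "shift_op (limit_functional t) = limit_op t"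
  by (intro ext) (simp add: shift_op_def limit_functional_def limit_op_def shift_op_power_translate)

lemma sublinear_limit_functional:
  assumes t: "t \<ge> 0"
  shows "sublinear_functional (limit_functional t)"
proof
  fix f g :: "real ^ 'd \<Rightarrow> real" and a c :: real
  note lim = limit_op_tendsto[OF _ t, of _ 0]
  show "(\<lambda>\<omega>. c) \<in> Cbuc" by simp
  show "limit_functional t (\<lambda>\<omega>. c) = c"
    using lim[OF Cbuc_const, of c] by (simp add: walk_const limit_functional_def LIMSEQ_const_iff)
  assume f: "f \<in> Cbuc"
  show "(\<lambda>\<omega>. a * f \<omega>) \<in> Cbuc" by (rule Cbuc_scale[OF f])
  show "limit_functional t (\<lambda>\<omega>. a * f \<omega>) = a * limit_functional t f" if "a \<ge> 0"
    unfolding limit_functional_def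
    using LIMSEQ_unique[OF lim[OF Cbuc_scale[OF f, of a]], of "a * limit_op t f 0"]
      tendsto_mult_left[OF lim[OF f], of a]
    by (simp add: walk_scale[OF f that])
  assume g: "g \<in> Cbuc"
  show "(\<lambda>\<omega>. f \<omega> + g \<omega>) \<in> Cbuc" by (rule Cbuc_add[OF f g])
  show "limit_functional t (\<lambda>\<omega>. f \<omega> + g \<omega>) \<le> limit_functional t f + limit_functional t g"
    unfolding limit_functional_def
    by (rule LIMSEQ_le[OF lim[OF Cbuc_add[OF f g]] tendsto_add[OF lim[OF f] lim[OF g]]])
       (use walk_add[OF f g] in auto)
  show "limit_functional t f \<le> limit_functional t g" if "\<And>\<omega>. f \<omega> \<le> g \<omega>"
    unfolding limit_functional_def
    by (rule LIMSEQ_le[OF lim[OF f] lim[OF g]]) (use walk_mono[OF f g, of 0] that in auto)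
qed

lemma steps_add:
  assumes "s \<ge> 0" "t \<ge> 0"
  obtains j where "j \<le> 1" "steps n (s + t) = steps n s + steps n t + j"
proof -
  have "\<lfloor>s * 2 ^ n\<rfloor> + \<lfloor>t * 2 ^ n\<rfloor> \<le> \<lfloor>(s + t) * 2 ^ n\<rfloor>"
    "\<lfloor>(s + t) * 2 ^ n\<rfloor> \<le> \<lfloor>s * 2 ^ n\<rfloor> + \<lfloor>t * 2 ^ n\<rfloor> + 1"
    unfolding distrib_right by linarith+
  moreover have "0 \<le> \<lfloor>s * 2 ^ n\<rfloor>" "0 \<le> \<lfloor>t * 2 ^ n\<rfloor>" using assms by auto
  moreover have "nat (a - (b + c)) \<le> 1 \<and> nat a = nat b + nat c + nat (a - (b + c))"
    if "b + c \<le> a" "a \<le> b + c + 1" "0 \<le> b" "0 \<le> c" for a b c :: int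
    using that by linarith
  ultimately show ?thesis
    unfolding steps_def by (intro that[of "nat (\<lfloor>(s + t) * 2 ^ n\<rfloor> - (\<lfloor>s * 2 ^ n\<rfloor> + \<lfloor>t * 2 ^ n\<rfloor>))"]) (auto simp: steps_def)
qed

text \<open>Rounding is additive up to one step: \<open>steps n (s + t)\<close> exceeds
  \<open>steps n s + steps n t\<close> by at most one, and a single short step is
  negligible.\<close>

lemma limit_op_semigroup:
  assumes f: "f \<in> Cbuc" and s: "s \<ge> 0" and t: "t \<ge> 0"
  shows "limit_op (s + t) f x = limit_op s (limit_op t f) x"
proof -
  have "\<bar>limit_op (s + t) f x - limit_op s (limit_op t f) x\<bar> \<le> 0 + \<epsilon>" if "\<epsilon> > 0" for \<epsilon>
  proof -
    define \<kappa> where "\<kappa> = \<epsilon> / 4"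
    have \<kappa>: "\<kappa> > 0" using that by (simp add: \<kappa>_def)
    note tC = limit_op_Cbuc[OF f t]
    obtain N1 where N1: "\<And>n x. n \<ge> N1 \<Longrightarrow> \<bar>walk n (steps n (s + t)) f x - limit_op (s + t) f x\<bar> \<le> \<kappa>"
      using limit_op_uniform[OF f \<kappa>, of "s + t"] s t by auto
    obtain N2 where N2: "\<And>n x. n \<ge> N2 \<Longrightarrow> \<bar>walk n (steps n t) f x - limit_op t f x\<bar> \<le> \<kappa>"
      using limit_op_uniform[OF f \<kappa> t] by blast
    obtain N3 where N3: "\<And>n x. n \<ge> N3 \<Longrightarrow> \<bar>walk n (steps n s) (limit_op t f) x - limit_op s (limit_op t f) x\<bar> \<le> \<kappa>"
      using limit_op_uniform[OF tC \<kappa> s] by blast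
    obtain \<delta> N4 where \<delta>: "\<delta> > 0" and N4: "\<And>n k x. n \<ge> N4 \<Longrightarrow> real k / 2 ^ n \<le> \<delta> \<Longrightarrow> \<bar>walk n k f x - f x\<bar> \<le> \<kappa>"
      using walk_uniformly_near[OF f \<kappa>] by blast
    obtain N5 where "(1 / 2) ^ N5 < \<delta>" using real_arch_pow_inv[OF \<delta>, of "1/2"] by auto
    then have N5: "1 / 2 ^ m \<le> \<delta>" if "m \<ge> N5" for m
      using power_decreasing[OF that, of "1/2 :: real"] by (simp add: power_one_over)
    define n where "n = N1 + N2 + N3 + N4 + N5"
    obtain j where j: "j \<le> 1" "steps n (s + t) = steps n s + steps n t + j"
      using steps_add[OF s t] .
    have "real j / 2 ^ n \<le> 1 / 2 ^ n" using j(1) by (intro divide_right_mono) auto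
    then have "real j / 2 ^ n \<le> \<delta>" using N5[of n] by (simp add: n_def)
    then have "\<bar>walk n (steps n s + steps n t + j) f x - walk n (steps n s + steps n t) f x\<bar> \<le> \<kappa>"
      by (intro walk_shift_near f N4) (simp_all add: n_def)
    moreover have "\<bar>walk n (steps n s) (walk n (steps n t) f) x - walk n (steps n s) (limit_op t f) x\<bar> \<le> \<kappa>"
      by (intro walk_abs_diff walk_Cbuc f tC N2) (simp add: n_def)
    moreover have "walk n (steps n s + steps n t) f x = walk n (steps n s) (walk n (steps n t) f) x"
      by (simp add: funpow_add)
    moreover have "n \<ge> N1" "n \<ge> N3" by (simp_all add: n_def)
    note N1[OF this(1), of x] N3[OF this(2), of x]
    ultimately show ?thesis
      unfolding j(2) \<kappa>_def by linarith
  qed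
  from field_le_epsilon[OF this] show ?thesis by simp
qed

lemma limit_op_near:
  assumes f: "f \<in> Cbuc" and "\<eta> > 0"
  obtains \<delta> where "\<delta> > 0" "\<And>t x. 0 \<le> t \<Longrightarrow> t \<le> \<delta> \<Longrightarrow> \<bar>limit_op t f x - f x\<bar> \<le> \<eta>"
proof -
  obtain \<delta> N where \<delta>: "\<delta> > 0" and N: "\<And>n k x. n \<ge> N \<Longrightarrow> real k / 2 ^ n \<le> \<delta> \<Longrightarrow> \<bar>walk n k f x - f x\<bar> \<le> \<eta>"
    using walk_uniformly_near[OF assms] by blast
  show ?thesis
  proof (rule that[OF \<delta>])
    fix t x assume t: "0 \<le> t" "t \<le> \<delta>"
    have "(\<lambda>n. \<bar>walk n (steps n t) f x - f x\<bar>) \<longlonglongrightarrow> \<bar>limit_op t f x - f x\<bar>"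
      by (intro tendsto_intros limit_op_tendsto f t)
    then show "\<bar>limit_op t f x - f x\<bar> \<le> \<eta>"
    proof (rule tendsto_upperbound)
      show "\<forall>\<^sub>F n in sequentially. \<bar>walk n (steps n t) f x - f x\<bar> \<le> \<eta>"
        unfolding eventually_sequentially
        using steps_bounds(1)[OF t(1)] t by (intro exI[of _ N] allI impI N) (auto intro: order_trans)
    qed simp
  qed
qed

lemma limit_op_generator:
  assumes g: "C3_bounded K g" and "\<eta> > 0"
  obtains \<delta> where "\<delta> > 0"
    "\<And>t x. 0 \<le> t \<Longrightarrow> t \<le> \<delta> \<Longrightarrow> \<bar>limit_op t g x - g x - t * G (\<lambda>y. g (x + y))\<bar> \<le> t * \<eta>"
proof -
  obtain \<delta> N where \<delta>: "\<delta> > 0" and N: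
    "\<And>n k (g :: real ^ 'd \<Rightarrow> real) x. n \<ge> N \<Longrightarrow> real k / 2 ^ n \<le> \<delta> \<Longrightarrow> C3_bounded K g \<Longrightarrow>
      \<bar>walk n k g x - g x - real k / 2 ^ n * G (\<lambda>y. g (x + y))\<bar> \<le> real k / 2 ^ n * \<eta>"
    using walk_generator[OF assms(2)] by blast
  show ?thesis
  proof (rule that[OF \<delta>])
    fix t x assume t: "0 \<le> t" "t \<le> \<delta>"
    have l: "(\<lambda>n. \<bar>walk n (steps n t) g x - g x - real (steps n t) / 2 ^ n * G (\<lambda>y. g (x + y))\<bar>)
        \<longlonglongrightarrow> \<bar>limit_op t g x - g x - t * G (\<lambda>y. g (x + y))\<bar>"
      by (intro tendsto_intros limit_op_tendsto C3_bounded_Cbuc[OF g] steps_tendsto t)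
    have r: "(\<lambda>n. real (steps n t) / 2 ^ n * \<eta>) \<longlonglongrightarrow> t * \<eta>"
      by (intro tendsto_intros steps_tendsto t)
    have "\<bar>walk n (steps n t) g x - g x - real (steps n t) / 2 ^ n * G (\<lambda>y. g (x + y))\<bar>
        \<le> real (steps n t) / 2 ^ n * \<eta>" if "n \<ge> N" for n
      using steps_bounds(1)[OF t(1), of n] t by (intro N that g) linarith
    then show "\<bar>limit_op t g x - g x - t * G (\<lambda>y. g (x + y))\<bar> \<le> t * \<eta>"
      by (intro LIMSEQ_le[OF l r]) blast
  qed
qed

lemma limit_functional_semigroup: "convolution_semigroup limit_functional"
proof (rule convolution_semigroup.intro)
  fix f :: "real ^ 'd \<Rightarrow> real" and s t :: real
  assume f: "f \<in> Cbuc"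
  show "limit_functional 0 f = f 0"
    by (simp add: limit_functional_def limit_op_def steps_def)
  show "limit_functional (s + t) f = limit_functional s (shift_op (limit_functional t) f)" if "s \<ge> 0" "t \<ge> 0"
    using limit_op_semigroup[OF f that, of 0] by (simp add: shift_op_limit_functional) (simp add: limit_functional_def)
  show "((\<lambda>t. limit_functional t f) \<longlongrightarrow> f 0) (at_right 0)"
  proof (rule tendstoI)
    fix \<epsilon> :: real assume "\<epsilon> > 0"
    then obtain \<delta> where \<delta>: "\<delta> > 0" "\<And>t x. 0 \<le> t \<Longrightarrow> t \<le> \<delta> \<Longrightarrow> \<bar>limit_op t f x - f x\<bar> \<le> \<epsilon> / 2"
      using limit_op_near[OF f, of "\<epsilon> / 2"] by auto
    have "dist (limit_functional t f) (f 0) < \<epsilon>" if "0 < t" "t < \<delta>" for t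
      using \<delta>(2)[of t 0] that \<open>\<epsilon> > 0\<close> by (simp add: limit_functional_def dist_real_def)
    then show "\<forall>\<^sub>F t in at_right 0. dist (limit_functional t f) (f 0) < \<epsilon>"
      using \<delta>(1) by (auto simp: eventually_at_right intro!: exI[of _ \<delta>])
  qed
qed (rule sublinear_limit_functional)

end

section \<open>The process with a given convolution semigroup\<close>

lemma Cbuc_tuplesE:
  assumes "\<phi> \<in> Cbuc_tuples n"
  obtains M where "0 \<le> M" "\<And>xs. length xs = n \<Longrightarrow> \<bar>\<phi> xs\<bar> \<le> M"
proof -
  obtain M where M: "\<And>xs. length xs = n \<Longrightarrow> \<bar>\<phi> xs\<bar> \<le> M"
    using assms by (auto simp: Cbuc_tuples_def bounded_iff)
  have "\<bar>\<phi> xs\<bar> \<le> max M 0" if "length xs = n" for xs using M[OF that] by simp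
  then show ?thesis using that[of "max M 0"] by simp
qed

text \<open>Closeness in every coordinate replaces the Euclidean distance, which is at most the sum
  of the \<open>n\<close> coordinate distances; hence the division by \<open>n + 1\<close>.\<close>

lemma Cbuc_tuples_modulus:
  assumes "\<phi> \<in> Cbuc_tuples n" "e > 0"
  obtains d where "d > 0" "\<And>xs ys. length xs = n \<Longrightarrow> length ys = n \<Longrightarrow>
    (\<And>i. i < n \<Longrightarrow> dist (xs ! i) (ys ! i) < d) \<Longrightarrow> \<bar>\<phi> xs - \<phi> ys\<bar> \<le> e"
proof -
  have "\<exists>d>0. \<forall>xs ys. length xs = n \<longrightarrow> length ys = n \<longrightarrow>
        L2_set (\<lambda>i. dist (xs ! i) (ys ! i)) {..<n} < d \<longrightarrow> dist (\<phi> xs) (\<phi> ys) < e"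
    using assms unfolding Cbuc_tuples_def by blast
  then obtain d where d: "d > 0" and *: "\<And>xs ys. length xs = n \<Longrightarrow> length ys = n \<Longrightarrow>
        L2_set (\<lambda>i. dist (xs ! i) (ys ! i)) {..<n} < d \<Longrightarrow> dist (\<phi> xs) (\<phi> ys) < e"
    by blast
  define d' where "d' = d / (real n + 1)"
  have d': "d' > 0" using d by (simp add: d'_def)
  show ?thesis
  proof (rule that[OF d'])
    fix xs ys :: "'a list"
    assume len: "length xs = n" "length ys = n" and near: "\<And>i. i < n \<Longrightarrow> dist (xs ! i) (ys ! i) < d'"
    have "L2_set (\<lambda>i. dist (xs ! i) (ys ! i)) {..<n} \<le> (\<Sum>i<n. dist (xs ! i) (ys ! i))"
      by (rule L2_set_le_sum) simp
    also have "\<dots> \<le> (\<Sum>i<n. d')"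
      using near by (intro sum_mono) (simp add: less_imp_le)
    also have "\<dots> = real n * d'" by simp
    also have "\<dots> < d" using d by (simp add: d'_def field_simps)
    finally show "\<bar>\<phi> xs - \<phi> ys\<bar> \<le> e"
      using *[OF len] by (simp add: dist_real_def less_imp_le)
  qed
qed

lemma Cbuc_tuplesI:
  assumes "\<And>xs. length xs = n \<Longrightarrow> \<bar>\<phi> xs\<bar> \<le> M"
    and "\<And>e. e > 0 \<Longrightarrow> \<exists>d>0. \<forall>xs ys. length xs = n \<longrightarrow> length ys = n \<longrightarrow>
      (\<forall>i<n. dist (xs ! i) (ys ! i) < d) \<longrightarrow> \<bar>\<phi> xs - \<phi> ys\<bar> \<le> e"
  shows "\<phi> \<in> Cbuc_tuples n"
  unfolding Cbuc_tuples_def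
proof (intro CollectI conjI allI impI)
  show "bounded (\<phi> ` {xs. length xs = n})" using assms(1) by (auto simp: bounded_iff)
  fix e :: real assume "e > 0"
  then obtain d where d: "d > 0" and *: "\<And>xs ys. length xs = n \<Longrightarrow> length ys = n \<Longrightarrow>
      (\<forall>i<n. dist (xs ! i) (ys ! i) < d) \<Longrightarrow> \<bar>\<phi> xs - \<phi> ys\<bar> \<le> e / 2"
    using assms(2)[of "e / 2"] by auto
  show "\<exists>d>0. \<forall>xs ys. length xs = n \<longrightarrow> length ys = n \<longrightarrow>
      L2_set (\<lambda>i. dist (xs ! i) (ys ! i)) {..<n} < d \<longrightarrow> dist (\<phi> xs) (\<phi> ys) < e"
  proof (intro exI[of _ d] conjI d allI impI)
    fix xs ys :: "'a list"
    assume len: "length xs = n" "length ys = n" and L: "L2_set (\<lambda>i. dist (xs ! i) (ys ! i)) {..<n} < d"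
    have "dist (xs ! i) (ys ! i) < d" if "i < n" for i
      using member_le_L2_set[of "{..<n}" i "\<lambda>i. dist (xs ! i) (ys ! i)"] that L by simp
    then show "dist (\<phi> xs) (\<phi> ys) < e"
      using *[OF len] \<open>e > 0\<close> by (simp add: dist_real_def)
  qed
qed

lemma Cbuc_tuples_section:
  assumes \<phi>: "\<phi> \<in> Cbuc_tuples (Suc k)" and x: "length x = k"
  shows "(\<lambda>z. \<phi> (x @ [z])) \<in> Cbuc"
proof -
  obtain M where M: "\<And>xs. length xs = Suc k \<Longrightarrow> \<bar>\<phi> xs\<bar> \<le> M" using Cbuc_tuplesE[OF \<phi>] by blast
  show ?thesis
  proof (rule CbucI)
    show "\<bar>\<phi> (x @ [z])\<bar> \<le> M" for z using x by (intro M) simp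
    fix e :: real assume "e > 0"
    then obtain d where d: "d > 0" "\<And>xs ys. length xs = Suc k \<Longrightarrow> length ys = Suc k \<Longrightarrow>
      (\<And>i. i < Suc k \<Longrightarrow> dist (xs ! i) (ys ! i) < d) \<Longrightarrow> \<bar>\<phi> xs - \<phi> ys\<bar> \<le> e"
      using Cbuc_tuples_modulus[OF \<phi>] by blast
    show "\<exists>d>0. \<forall>y z. dist y z < d \<longrightarrow> \<bar>\<phi> (x @ [y]) - \<phi> (x @ [z])\<bar> \<le> e"
      by (intro exI[of _ d] conjI d allI impI) (use x d(1) in \<open>auto simp: nth_append\<close>)
  qed
qed

text \<open>An expectation is nonexpansive for the sup norm, so integrating out the last variable
  preserves the bound and the modulus in the others.\<close>

lemma (in sublinear_expectation_space) Cbuc_tuples_partial_expectation: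
  fixes Y :: "'w \<Rightarrow> 'b::metric_space"
  assumes \<phi>: "\<phi> \<in> Cbuc_tuples (Suc k)" and mem: "\<And>x. length x = k \<Longrightarrow> (\<lambda>\<omega>. \<phi> (x @ [Y \<omega>])) \<in> H"
  shows "(\<lambda>x. \<E> (\<lambda>\<omega>. \<phi> (x @ [Y \<omega>]))) \<in> Cbuc_tuples k"
proof -
  obtain M where M: "\<And>xs. length xs = Suc k \<Longrightarrow> \<bar>\<phi> xs\<bar> \<le> M" using Cbuc_tuplesE[OF \<phi>] by blast
  show ?thesis
  proof (rule Cbuc_tuplesI)
    show "\<bar>\<E> (\<lambda>\<omega>. \<phi> (xs @ [Y \<omega>]))\<bar> \<le> M" if "length xs = k" for xs
      using that by (intro abs_le_const mem M) auto
    fix e :: real assume "e > 0"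
    then obtain d where d: "d > 0" "\<And>xs ys. length xs = Suc k \<Longrightarrow> length ys = Suc k \<Longrightarrow>
      (\<And>i. i < Suc k \<Longrightarrow> dist (xs ! i) (ys ! i) < d) \<Longrightarrow> \<bar>\<phi> xs - \<phi> ys\<bar> \<le> e"
      using Cbuc_tuples_modulus[OF \<phi>] by blast
    show "\<exists>d>0. \<forall>xs ys. length xs = k \<longrightarrow> length ys = k \<longrightarrow> (\<forall>i<k. dist (xs ! i) (ys ! i) < d) \<longrightarrow>
        \<bar>\<E> (\<lambda>\<omega>. \<phi> (xs @ [Y \<omega>])) - \<E> (\<lambda>\<omega>. \<phi> (ys @ [Y \<omega>]))\<bar> \<le> e"
    proof (intro exI[of _ d] conjI d(1) allI impI)
      fix xs ys :: "'b list" assume "length xs = k" "length ys = k" "\<forall>i<k. dist (xs ! i) (ys ! i) < d"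
      then show "\<bar>\<E> (\<lambda>\<omega>. \<phi> (xs @ [Y \<omega>])) - \<E> (\<lambda>\<omega>. \<phi> (ys @ [Y \<omega>]))\<bar> \<le> e"
        using d(1) by (intro abs_diff_le mem d(2)) (auto simp: nth_append less_Suc_eq)
    qed
  qed
qed

text \<open>The path \<open>p\<close> before time \<open>t\<close>, frozen at \<open>x\<close> from
  then on; values at later times are overwritten by later gluings.\<close>

definition glue :: "(real \<Rightarrow> 'a) \<Rightarrow> real \<Rightarrow> 'a \<Rightarrow> real \<Rightarrow> 'a" where
  "glue p t x = (\<lambda>u. if u \<ge> t then x else p u)"

text \<open>Bounded and uniformly continuous in the coordinates from \<open>J\<close>; in particular
  \<open>F\<close> depends on the path only through its restriction to \<open>J\<close>. With
  \<open>J = UNIV\<close> this is continuity with respect to uniform closeness of whole paths, the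
  form that is carried through the iterated expectations.\<close>

definition admissible :: "real set \<Rightarrow> ((real \<Rightarrow> 'a::metric_space) \<Rightarrow> real) \<Rightarrow> bool" where
  "admissible J F \<longleftrightarrow> (\<exists>M. \<forall>p. \<bar>F p\<bar> \<le> M) \<and>
     (\<forall>e>0. \<exists>d>0. \<forall>p q. (\<forall>u\<in>J. dist (p u) (q u) < d) \<longrightarrow> \<bar>F p - F q\<bar> \<le> e)"

lemma admissible_mono: "admissible J F \<Longrightarrow> J \<subseteq> J' \<Longrightarrow> admissible J' F"
  unfolding admissible_def by (meson subsetD)

lemma admissibleE:
  assumes "admissible J F" "e > 0"
  obtains d where "d > 0" "\<And>p q. (\<And>u. u \<in> J \<Longrightarrow> dist (p u) (q u) < d) \<Longrightarrow> \<bar>F p - F q\<bar> \<le> e"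
  using assms unfolding admissible_def by meson

lemma admissible_local:
  assumes "admissible J F" "\<And>u. u \<in> J \<Longrightarrow> p u = q u"
  shows "F p = F q"
proof (rule ccontr)
  assume "F p \<noteq> F q"
  then have "\<bar>F p - F q\<bar> / 2 > 0" by simp
  from admissibleE[OF assms(1) this] obtain d where
    "d > 0" "\<And>p q. (\<And>u. u \<in> J \<Longrightarrow> dist (p u) (q u) < d) \<Longrightarrow> \<bar>F p - F q\<bar> \<le> \<bar>(F :: (real \<Rightarrow> 'a) \<Rightarrow> real) p - F q\<bar>"
    by blast
  from admissibleE[OF assms(1) \<open>\<bar>F p - F q\<bar> / 2 > 0\<close>] obtain d where
    d: "d > 0" "\<And>p' q'. (\<And>u. u \<in> J \<Longrightarrow> dist (p' u) (q' u) < d) \<Longrightarrow> \<bar>F p' - F q'\<bar> \<le> \<bar>F p - F q\<bar> / 2"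
    by blast
  have "\<bar>F p - F q\<bar> \<le> \<bar>F p - F q\<bar> / 2" by (rule d(2)) (use assms(2) d(1) in simp)
  with \<open>F p \<noteq> F q\<close> show False by simp
qed

lemma admissible_const: "admissible J (\<lambda>p. c)"
proof -
  have "\<exists>d>0. \<forall>p q. (\<forall>u\<in>J. dist (p u) (q u) < d) \<longrightarrow> \<bar>c - c\<bar> \<le> e" if "e > 0" for e :: real
    using that by (intro exI[of _ 1]) simp
  then show ?thesis
    unfolding admissible_def by blast
qed

lemma admissible_add:
  assumes "admissible J F" "admissible J G"
  shows "admissible J (\<lambda>p. F p + G p)"
  unfolding admissible_def
proof (intro conjI allI impI)
  obtain M M' where "\<And>p. \<bar>F p\<bar> \<le> M" "\<And>p. \<bar>G p\<bar> \<le> M'" using assms unfolding admissible_def by blast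
  then show "\<exists>M. \<forall>p. \<bar>F p + G p\<bar> \<le> M"
    by (intro exI[of _ "M + M'"]) (meson abs_triangle_ineq add_mono order_trans)
  fix e :: real assume "e > 0"
  then have "e / 2 > 0" by simp
  from admissibleE[OF assms(1) this] obtain d where d: "d > 0" "\<And>p q. (\<And>u. u \<in> J \<Longrightarrow> dist (p u) (q u) < d) \<Longrightarrow> \<bar>F p - F q\<bar> \<le> e / 2"
    by blast
  from admissibleE[OF assms(2) \<open>e / 2 > 0\<close>] obtain d' where d': "d' > 0" "\<And>p q. (\<And>u. u \<in> J \<Longrightarrow> dist (p u) (q u) < d') \<Longrightarrow> \<bar>G p - G q\<bar> \<le> e / 2"
    by blast
  show "\<exists>d>0. \<forall>p q. (\<forall>u\<in>J. dist (p u) (q u) < d) \<longrightarrow> \<bar>F p + G p - (F q + G q)\<bar> \<le> e"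
  proof (intro exI[of _ "min d d'"] conjI allI impI)
    fix p q :: "real \<Rightarrow> 'a" assume "\<forall>u\<in>J. dist (p u) (q u) < min d d'"
    then have "\<bar>F p - F q\<bar> \<le> e / 2" "\<bar>G p - G q\<bar> \<le> e / 2"
      by (intro d(2) d'(2); simp)+
    then show "\<bar>F p + G p - (F q + G q)\<bar> \<le> e" by linarith
  qed (use d d' in auto)
qed

lemma admissible_scale:
  assumes "admissible J F"
  shows "admissible J (\<lambda>p. a * F p)"
  unfolding admissible_def
proof (intro conjI allI impI)
  obtain M where "\<And>p. \<bar>F p\<bar> \<le> M" using assms unfolding admissible_def by blast
  then show "\<exists>M. \<forall>p. \<bar>a * F p\<bar> \<le> M"
    by (intro exI[of _ "\<bar>a\<bar> * M"]) (simp add: abs_mult mult_left_mono)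
  fix e :: real assume "e > 0"
  then have "e / (\<bar>a\<bar> + 1) > 0" by simp
  from admissibleE[OF assms this] obtain d where d: "d > 0" "\<And>p q. (\<And>u. u \<in> J \<Longrightarrow> dist (p u) (q u) < d) \<Longrightarrow> \<bar>F p - F q\<bar> \<le> e / (\<bar>a\<bar> + 1)"
    by blast
  show "\<exists>d>0. \<forall>p q. (\<forall>u\<in>J. dist (p u) (q u) < d) \<longrightarrow> \<bar>a * F p - a * F q\<bar> \<le> e"
  proof (intro exI[of _ d] conjI allI impI d(1))
    fix p q :: "real \<Rightarrow> 'a" assume "\<forall>u\<in>J. dist (p u) (q u) < d"
    then have "\<bar>F p - F q\<bar> \<le> e / (\<bar>a\<bar> + 1)" by (intro d) auto
    then have "\<bar>a\<bar> * \<bar>F p - F q\<bar> \<le> (\<bar>a\<bar> + 1) * (e / (\<bar>a\<bar> + 1))"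
      by (intro mult_mono) auto
    also have "\<dots> = e" by (simp add: add_nonneg_eq_0_iff)
    finally show "\<bar>a * F p - a * F q\<bar> \<le> e" by (simp add: abs_mult flip: right_diff_distrib)
  qed
qed

lemma admissible_glue:
  fixes F :: "(real \<Rightarrow> real ^ 'd::finite) \<Rightarrow> real"
  assumes "admissible UNIV F"
  shows "(\<lambda>z. F (glue p t (p s + z))) \<in> Cbuc"
proof -
  obtain M where M: "\<And>p. \<bar>F p\<bar> \<le> M" using assms by (auto simp: admissible_def)
  show ?thesis
  proof (rule CbucI[OF M])
    fix e :: real assume "e > 0"
    from admissibleE[OF assms this] obtain d where
      d: "d > 0" "\<And>p q. (\<And>u. u \<in> UNIV \<Longrightarrow> dist (p u) (q u) < d) \<Longrightarrow> \<bar>F p - F q\<bar> \<le> e" by blast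
    show "\<exists>d>0. \<forall>x y. dist x y < d \<longrightarrow> \<bar>F (glue p t (p s + x)) - F (glue p t (p s + y))\<bar> \<le> e"
      by (intro exI[of _ d] conjI d allI impI) (use d(1) in \<open>auto simp: glue_def\<close>)
  qed
qed

section \<open>Iterated expectations along a list of times\<close>

context convolution_semigroup
begin

text \<open>Given the path up to time \<open>s\<close>, the increment up to the next time
  \<open>t\<close> is drawn from \<open>E (t - s)\<close>, the path is frozen at its new value and
  the procedure continues; the expectation over the last time is the innermost one.\<close>

primrec path_exp :: "real \<Rightarrow> real list \<Rightarrow> ((real \<Rightarrow> real ^ 'd) \<Rightarrow> real) \<Rightarrow> (real \<Rightarrow> real ^ 'd) \<Rightarrow> real" where
  "path_exp s [] F p = F p"
| "path_exp s (t # ts) F p = E (t - s) (\<lambda>z. path_exp t ts F (glue p t (p s + z)))"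

lemma path_exp_admissible:
  assumes "admissible UNIV F" "sorted (s # ts)"
  shows "admissible UNIV (path_exp s ts F)"
  using assms(2)
proof (induction ts arbitrary: s)
  case Nil
  have "path_exp s [] F = F" by auto
  with assms(1) show ?case by simp
next
  case (Cons t ts)
  then have st: "t - s \<ge> 0" and IH: "admissible UNIV (path_exp t ts F)" by auto
  interpret S: sublinear_expectation_space Cbuc "E (t - s)" by (rule sublinear[OF st])
  obtain M where M: "\<And>p. \<bar>path_exp t ts F p\<bar> \<le> M" using IH by (auto simp: admissible_def)
  show ?case
    unfolding admissible_def
  proof (intro conjI allI impI)
    have "\<bar>path_exp s (t # ts) F p\<bar> \<le> M" for p
      by (simp, intro S.abs_le_const admissible_glue IH M)
    then show "\<exists>M. \<forall>p. \<bar>path_exp s (t # ts) F p\<bar> \<le> M" by blast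
    fix e :: real assume "e > 0"
    from admissibleE[OF IH this] obtain d where
      d: "d > 0" "\<And>p q. (\<And>u. u \<in> UNIV \<Longrightarrow> dist (p u) (q u) < d) \<Longrightarrow> \<bar>path_exp t ts F p - path_exp t ts F q\<bar> \<le> e" by blast
    show "\<exists>d>0. \<forall>p q. (\<forall>u\<in>UNIV. dist (p u) (q u) < d) \<longrightarrow>
        \<bar>path_exp s (t # ts) F p - path_exp s (t # ts) F q\<bar> \<le> e"
    proof (intro exI[of _ d] conjI d(1) allI impI)
      fix p q :: "real \<Rightarrow> real ^ 'd" assume "\<forall>u\<in>UNIV. dist (p u) (q u) < d"
      then show "\<bar>path_exp s (t # ts) F p - path_exp s (t # ts) F q\<bar> \<le> e"
        by (simp, intro S.abs_diff_le admissible_glue IH d(2)) (auto simp: glue_def)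
    qed
  qed
qed

lemma path_exp_section:
  "admissible UNIV F \<Longrightarrow> sorted (t # ts) \<Longrightarrow> (\<lambda>z. path_exp t ts F (glue p t (p s + z))) \<in> Cbuc"
  by (intro admissible_glue path_exp_admissible)

lemma path_exp_add:
  assumes F: "admissible UNIV F" and G: "admissible UNIV G" and "sorted (s # ts)"
  shows "path_exp s ts (\<lambda>p. F p + G p) p \<le> path_exp s ts F p + path_exp s ts G p"
  using assms(3)
proof (induction ts arbitrary: s p)
  case (Cons t ts)
  then have st: "t - s \<ge> 0" and ts: "sorted (t # ts)" by auto
  interpret S: sublinear_expectation_space Cbuc "E (t - s)" by (rule sublinear[OF st])
  have "path_exp s (t # ts) (\<lambda>p. F p + G p) p
     \<le> E (t - s) (\<lambda>z. path_exp t ts F (glue p t (p s + z)) + path_exp t ts G (glue p t (p s + z)))"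
    unfolding path_exp.simps
    by (intro S.monotone S.add_mem path_exp_section admissible_add F G ts Cons.IH)
  also have "\<dots> \<le> path_exp s (t # ts) F p + path_exp s (t # ts) G p"
    unfolding path_exp.simps by (intro S.subadditive path_exp_section F G ts)
  finally show ?case .
qed simp

lemma path_exp_scale:
  assumes F: "admissible UNIV F" and "a \<ge> 0" "sorted (s # ts)"
  shows "path_exp s ts (\<lambda>p. a * F p) p = a * path_exp s ts F p"
  using assms(3)
proof (induction ts arbitrary: s p)
  case (Cons t ts)
  then have st: "t - s \<ge> 0" and ts: "sorted (t # ts)" by auto
  interpret S: sublinear_expectation_space Cbuc "E (t - s)" by (rule sublinear[OF st])
  show ?case
    unfolding path_exp.simps Cons.IH[OF ts] by (intro S.pos_homogeneous path_exp_section F ts \<open>a \<ge> 0\<close>)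
qed simp

lemma path_exp_mono:
  assumes F: "admissible UNIV F" and G: "admissible UNIV G" and "\<And>p. F p \<le> G p" "sorted (s # ts)"
  shows "path_exp s ts F p \<le> path_exp s ts G p"
  using assms(4)
proof (induction ts arbitrary: s p)
  case (Cons t ts)
  then have st: "t - s \<ge> 0" and ts: "sorted (t # ts)" by auto
  interpret S: sublinear_expectation_space Cbuc "E (t - s)" by (rule sublinear[OF st])
  show ?case
    unfolding path_exp.simps by (intro S.monotone path_exp_section F G ts Cons.IH)
qed (simp add: assms(3))

text \<open>Every time in \<open>J\<close> after \<open>s\<close> occurs in \<open>ts\<close> and
  its value is overwritten by a gluing, so agreement at \<open>s\<close> and at the earlier times of
  \<open>J\<close> is enough.\<close>

lemma path_exp_cong:
  assumes F: "admissible J F" and "sorted (s # ts)" "\<And>u. u \<in> J \<Longrightarrow> u > s \<Longrightarrow> u \<in> set ts"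
    and "p s = q s" "\<And>u. u \<in> J \<Longrightarrow> u \<le> s \<Longrightarrow> p u = q u"
  shows "path_exp s ts F p = path_exp s ts F q"
  using assms(2-)
proof (induction ts arbitrary: s p q)
  case Nil
  have "p u = q u" if "u \<in> J" for u
    using Nil.prems(2)[OF that] Nil.prems(4)[OF that] by (cases "u \<le> s") auto
  then have "F p = F q" by (rule admissible_local[OF F])
  then show ?case by simp
next
  case (Cons t ts)
  have "path_exp t ts F (glue p t (p s + z)) = path_exp t ts F (glue q t (q s + z))" for z
  proof (rule Cons.IH)
    show "sorted (t # ts)" using Cons.prems by simp
    show "u \<in> set ts" if "u \<in> J" "u > t" for u
      using Cons.prems(2)[of u] Cons.prems(1) that by auto
    show "glue p t (p s + z) t = glue q t (q s + z) t" using Cons.prems by (simp add: glue_def)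
    fix u assume u: "u \<in> J" "u \<le> t"
    have "u \<le> s" if "u < t"
    proof (rule ccontr)
      assume "\<not> u \<le> s"
      then have "u \<in> set (t # ts)" using Cons.prems(2) u by auto
      with Cons.prems(1) that show False by auto
    qed
    then show "glue p t (p s + z) u = glue q t (q s + z) u"
      using Cons.prems(3,4) u by (auto simp: glue_def)
  qed
  then show ?case by simp
qed

text \<open>Chapman-Kolmogorov: the increments over \<open>r - s\<close> and \<open>t - r\<close>
  combine by the semigroup law to the one over \<open>t - s\<close>. If no time follows, constants
  are preserved, and for \<open>r = s\<close> the functional \<open>E 0\<close> is evaluation at
  zero.\<close>

lemma path_exp_insert_head:
  assumes F: "admissible J F" and sorted: "sorted (s # r # ts)" and J: "\<And>u. u \<in> J \<Longrightarrow> u > s \<Longrightarrow> u \<in> set ts"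
  shows "path_exp s (r # ts) F p = path_exp s ts F p"
proof (cases "r = s")
  case True
  have FU: "admissible UNIV F" by (rule admissible_mono[OF F]) simp
  have "path_exp s (r # ts) F p = path_exp s ts F (glue p s (p s + 0))"
    unfolding path_exp.simps True using path_exp_section[OF FU, of s ts p s] sorted True by (simp add: zero)
  also have "\<dots> = path_exp s ts F p"
    by (rule path_exp_cong[OF F]) (use sorted J in \<open>auto simp: glue_def\<close>)
  finally show ?thesis .
next
  case False
  then have sr: "s < r" using sorted by simp
  have FU: "admissible UNIV F" by (rule admissible_mono[OF F]) simp
  interpret S: sublinear_expectation_space Cbuc "E (r - s)" by (rule sublinear) (use sr in simp)
  show ?thesis
  proof (cases ts)
    case Nil
    have "F (glue p r (p s + z)) = F p" for z
      by (rule admissible_local[OF F]) (use J Nil sr in \<open>force simp: glue_def\<close>)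
    then show ?thesis by (simp add: Nil S.const_preserving)
  next
    case (Cons t ts')
    define \<psi> where "\<psi> z = path_exp t ts' F (glue p t (p s + z))" for z
    have \<psi>: "\<psi> \<in> Cbuc"
      unfolding \<psi>_def using path_exp_section[OF FU, of t ts' p s] sorted Cons by simp
    have "path_exp t ts' F (glue (glue p r (p s + z)) t (p s + z + z')) = \<psi> (z + z')" for z z'
      unfolding \<psi>_def
    proof (rule path_exp_cong[OF F])
      show "sorted (t # ts')" using sorted Cons by simp
      show "u \<in> set ts'" if "u \<in> J" "u > t" for u
        using J[OF that(1)] that sorted Cons by auto
      fix u assume u: "u \<in> J" "u \<le> t"
      have "u \<le> s" if "u < t"
      proof (rule ccontr)
        assume "\<not> u \<le> s"
        then have "u \<in> set (t # ts')" using J u Cons by auto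
        with sorted Cons that show False by auto
      qed
      then show "glue (glue p r (p s + z)) t (p s + z + z') u = glue p t (p s + (z + z')) u"
        using sr by (auto simp: glue_def add.assoc)
    qed (simp add: glue_def add.assoc)
    then have "path_exp s (r # ts) F p = E (r - s) (shift_op (E (t - r)) \<psi>)"
      by (simp add: Cons glue_def shift_op_def[abs_def])
    also have "\<dots> = E ((r - s) + (t - r)) \<psi>"
      using sorted Cons sr by (intro semigroup[symmetric] \<psi>) auto
    also have "\<dots> = path_exp s ts F p" by (simp add: Cons \<psi>_def[abs_def])
    finally show ?thesis .
  qed
qed

lemma path_exp_insort:
  assumes F: "admissible J F" and "sorted (s # ts)" "s \<le> r" "\<And>u. u \<in> J \<Longrightarrow> u > s \<Longrightarrow> u \<in> set ts"
  shows "path_exp s (insort r ts) F p = path_exp s ts F p"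
  using assms(2-)
proof (induction ts arbitrary: s p)
  case Nil
  then have "sorted [s, r]" by simp
  then have "path_exp s [r] F p = path_exp s [] F p"
    by (rule path_exp_insert_head[OF F]) (use Nil.prems in auto)
  then show ?case by simp
next
  case (Cons t ts)
  show ?case
  proof (cases "r \<le> t")
    case True
    then have "sorted (s # r # t # ts)" using Cons.prems by auto
    from path_exp_insert_head[OF F this] Cons.prems True show ?thesis by simp
  next
    case False
    have "path_exp t (insort r ts) F p = path_exp t ts F p" for p
      by (rule Cons.IH) (use Cons.prems False in \<open>force+\<close>)
    with False show ?thesis by simp
  qed
qed

text \<open>Kolmogorov consistency, by inserting the additional times one at a time.\<close>

lemma path_exp_superset:
  assumes F: "admissible J F" and "finite K" "J \<subseteq> K" "K \<subseteq> {0..}"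
  shows "path_exp 0 (sorted_list_of_set K) F p = path_exp 0 (sorted_list_of_set J) F p"
proof -
  have J: "finite J" using assms finite_subset by blast
  have "path_exp 0 (sorted_list_of_set (J \<union> A)) F p = path_exp 0 (sorted_list_of_set J) F p"
    if "finite A" "A \<subseteq> {0..}" for A
    using that
  proof (induction A rule: finite_induct)
    case (insert r A)
    show ?case
    proof (cases "r \<in> J")
      case True
      then have "J \<union> insert r A = J \<union> A" by auto
      with insert show ?thesis by simp
    next
      case False
      let ?L = "sorted_list_of_set (J \<union> A)"
      have "sorted_list_of_set (J \<union> insert r A) = insort r ?L"
        using False insert J by (simp add: sorted_list_of_set_insert)
      moreover have "path_exp 0 (insort r ?L) F p = path_exp 0 ?L F p"
        by (rule path_exp_insort[OF F]) (use insert J assms in auto)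
      ultimately show ?thesis using insert by simp
    qed
  qed simp
  from this[of K] assms show ?thesis by (simp add: Un_absorb1)
qed

section \<open>The expectation on path space\<close>

definition path_space :: "((real \<Rightarrow> real ^ 'd) \<Rightarrow> real) set" where
  "path_space = {F. \<exists>J. finite J \<and> J \<subseteq> {0..} \<and> admissible J F}"

text \<open>Any admissible finite set of times may be chosen, since by consistency the value does
  not depend on it. The zero path provides the initial value of the process.\<close>

definition path_functional :: "((real \<Rightarrow> real ^ 'd) \<Rightarrow> real) \<Rightarrow> real" where
  "path_functional F = path_exp 0 (sorted_list_of_set (SOME J. finite J \<and> J \<subseteq> {0..} \<and> admissible J F)) F (\<lambda>u. 0)"

text \<open>Two choices of times are compared through their union.\<close>

lemma path_functional_eq:
  assumes "finite J" "J \<subseteq> {0..}" "admissible J F"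
  shows "path_functional F = path_exp 0 (sorted_list_of_set J) F (\<lambda>u. 0)"
proof -
  define J' where "J' = (SOME J. finite J \<and> J \<subseteq> {0..} \<and> admissible J F)"
  have J': "finite J' \<and> J' \<subseteq> {0..} \<and> admissible J' F"
    unfolding J'_def by (rule someI_ex) (use assms in blast)
  have "path_functional F = path_exp 0 (sorted_list_of_set J') F (\<lambda>u. 0)"
    by (simp add: path_functional_def J'_def)
  also have "\<dots> = path_exp 0 (sorted_list_of_set (J \<union> J')) F (\<lambda>u. 0)"
    by (rule path_exp_superset[symmetric]) (use J' assms in auto)
  also have "\<dots> = path_exp 0 (sorted_list_of_set J) F (\<lambda>u. 0)"
    by (rule path_exp_superset) (use J' assms in auto)
  finally show ?thesis .
qed

lemma sorted_times: "finite J \<Longrightarrow> J \<subseteq> {0..} \<Longrightarrow> sorted ((0::real) # sorted_list_of_set J)"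
  by auto

lemma path_spaceI: "finite J \<Longrightarrow> J \<subseteq> {0..} \<Longrightarrow> admissible J F \<Longrightarrow> F \<in> path_space"
  by (auto simp: path_space_def)

lemma admissible_UNIV: "admissible J F \<Longrightarrow> admissible UNIV F"
  by (erule admissible_mono) simp

lemma sublinear_path_functional: "sublinear_expectation_space path_space path_functional"
proof
  fix F G :: "(real \<Rightarrow> real ^ 'd) \<Rightarrow> real" and a c :: real
  show "(\<lambda>\<omega>. c) \<in> path_space"
    by (rule path_spaceI[of "{}"]) (auto simp: admissible_const)
  show "path_functional (\<lambda>\<omega>. c) = c"
    using path_functional_eq[of "{}", OF _ _ admissible_const] by simp
  assume "F \<in> path_space"
  then obtain J where J: "finite J" "J \<subseteq> {0..}" "admissible J F" by (auto simp: path_space_def)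
  have sJ: "admissible J (\<lambda>\<omega>. a * F \<omega>)" by (rule admissible_scale[OF J(3)])
  then show "(\<lambda>\<omega>. a * F \<omega>) \<in> path_space" by (rule path_spaceI[OF J(1,2)])
  show "path_functional (\<lambda>\<omega>. a * F \<omega>) = a * path_functional F" if "a \<ge> 0"
    unfolding path_functional_eq[OF J(1,2) sJ] path_functional_eq[OF J]
    by (rule path_exp_scale[OF admissible_UNIV[OF J(3)] that sorted_times[OF J(1,2)]])
  assume "G \<in> path_space"
  then obtain J' where J': "finite J'" "J' \<subseteq> {0..}" "admissible J' G" by (auto simp: path_space_def)
  let ?K = "J \<union> J'"
  have K: "finite ?K" "?K \<subseteq> {0..}" "admissible ?K F" "admissible ?K G"
    using J J' by (auto intro: admissible_mono)
  note KU = admissible_UNIV[OF K(3)] admissible_UNIV[OF K(4)]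
  have aK: "admissible ?K (\<lambda>\<omega>. F \<omega> + G \<omega>)" by (rule admissible_add[OF K(3,4)])
  then show "(\<lambda>\<omega>. F \<omega> + G \<omega>) \<in> path_space" by (rule path_spaceI[OF K(1,2)])
  show "path_functional (\<lambda>\<omega>. F \<omega> + G \<omega>) \<le> path_functional F + path_functional G"
    unfolding path_functional_eq[OF K(1,2) aK] path_functional_eq[OF K(1-3)] path_functional_eq[OF K(1,2,4)]
    by (rule path_exp_add[OF KU sorted_times[OF K(1,2)]])
  show "path_functional F \<le> path_functional G" if "\<And>\<omega>. F \<omega> \<le> G \<omega>"
    unfolding path_functional_eq[OF K(1-3)] path_functional_eq[OF K(1,2,4)]
    by (rule path_exp_mono[OF KU that sorted_times[OF K(1,2)]])
qed

text \<open>Peels off the last time instead of the first, which exposes the innermost expectation as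
  the one over the last increment.\<close>

lemma path_exp_append:
  "path_exp s (ts @ [t]) F p =
    path_exp s ts (\<lambda>p. E (t - last (s # ts)) (\<lambda>z. F (glue p t (p (last (s # ts)) + z)))) p"
  by (induction ts arbitrary: s p) auto

text \<open>The factor two accounts for increments, each of which involves two values of the
  path.\<close>

lemma admissible_tuple:
  fixes \<phi> :: "'e::metric_space list \<Rightarrow> real" and g :: "nat \<Rightarrow> (real \<Rightarrow> 'f::metric_space) \<Rightarrow> 'e"
  assumes \<phi>: "\<phi> \<in> Cbuc_tuples m"
    and g: "\<And>i d p q. i < m \<Longrightarrow> (\<And>u. u \<in> J \<Longrightarrow> dist (p u) (q u) < d) \<Longrightarrow> dist (g i p) (g i q) < 2 * d"
  shows "admissible J (\<lambda>p. \<phi> (map (\<lambda>i. g i p) [0..<m]))"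
proof -
  obtain M where M: "\<And>xs. length xs = m \<Longrightarrow> \<bar>\<phi> xs\<bar> \<le> M" using Cbuc_tuplesE[OF \<phi>] by blast
  show ?thesis
    unfolding admissible_def
  proof (intro conjI allI impI)
    have "\<bar>\<phi> (map (\<lambda>i. g i p) [0..<m])\<bar> \<le> M" for p by (rule M) simp
    then show "\<exists>M. \<forall>p. \<bar>\<phi> (map (\<lambda>i. g i p) [0..<m])\<bar> \<le> M" by blast
    fix e :: real assume "e > 0"
    then obtain d where d: "d > 0" "\<And>xs ys. length xs = m \<Longrightarrow> length ys = m \<Longrightarrow>
      (\<And>i. i < m \<Longrightarrow> dist (xs ! i) (ys ! i) < d) \<Longrightarrow> \<bar>\<phi> xs - \<phi> ys\<bar> \<le> e"
      using Cbuc_tuples_modulus[OF \<phi>] by blast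
    show "\<exists>d>0. \<forall>p q. (\<forall>u\<in>J. dist (p u) (q u) < d) \<longrightarrow>
        \<bar>\<phi> (map (\<lambda>i. g i p) [0..<m]) - \<phi> (map (\<lambda>i. g i q) [0..<m])\<bar> \<le> e"
    proof (intro exI[of _ "d / 2"] conjI allI impI)
      fix p q :: "real \<Rightarrow> 'f" assume near: "\<forall>u\<in>J. dist (p u) (q u) < d / 2"
      have "dist (g i p) (g i q) < d" if "i < m" for i
        using g[of i p q "d / 2", OF that] near by simp
      then show "\<bar>\<phi> (map (\<lambda>i. g i p) [0..<m]) - \<phi> (map (\<lambda>i. g i q) [0..<m])\<bar> \<le> e"
        by (intro d(2)) auto
    qed (use d(1) in simp)
  qed
qed

lemma dist_diff_less:
  fixes a b a' b' :: "real ^ 'd"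
  assumes "dist a a' < d" "dist b b' < d"
  shows "dist (a - b) (a' - b') < 2 * d"
proof -
  have "dist (a - b) (a' - b') \<le> dist a a' + dist b b'"
    using norm_triangle_ineq4[of "a - a'" "b - b'"] by (simp add: dist_norm algebra_simps)
  with assms show ?thesis by linarith
qed

lemma admissible_increment:
  assumes f: "f \<in> Cbuc"
  shows "admissible {s, t} (\<lambda>p. f (p t - p s :: real ^ 'd))"
proof -
  obtain M where M: "\<And>x. \<bar>f x\<bar> \<le> M" using Cbuc_bounded[OF f] by blast
  show ?thesis
    unfolding admissible_def
  proof (intro conjI allI impI)
    show "\<exists>M. \<forall>p. \<bar>f (p t - p s)\<bar> \<le> M" using M by blast
    fix e :: real assume "e > 0"
    then obtain d where d: "d > 0" "\<And>x y. dist x y < d \<Longrightarrow> \<bar>f x - f y\<bar> \<le> e"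
      using Cbuc_modulus[OF f] by blast
    show "\<exists>d>0. \<forall>p q. (\<forall>u\<in>{s, t}. dist (p u) (q u) < d) \<longrightarrow> \<bar>f (p t - p s) - f (q t - q s)\<bar> \<le> e"
      by (intro exI[of _ "d / 2"] conjI allI impI d(2))
         (use d(1) dist_diff_less[where d = "d / 2"] in auto)
  qed
qed

lemma admissible_value:
  assumes f: "f \<in> Cbuc"
  shows "admissible {t} (\<lambda>p. f (p t :: real ^ 'd))"
proof -
  obtain M where M: "\<And>x. \<bar>f x\<bar> \<le> M" using Cbuc_bounded[OF f] by blast
  show ?thesis
    unfolding admissible_def
  proof (intro conjI allI impI)
    show "\<exists>M. \<forall>p. \<bar>f (p t)\<bar> \<le> M" using M by blast
    fix e :: real assume "e > 0"
    from Cbuc_modulus[OF f this]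
    show "\<exists>d>0. \<forall>p q. (\<forall>u\<in>{t}. dist (p u) (q u) < d) \<longrightarrow> \<bar>f (p t) - f (q t)\<bar> \<le> e"
      by (metis insertI1)
  qed
qed

lemma path_functional_value:
  assumes f: "f \<in> Cbuc" and t: "t \<ge> 0"
  shows "path_functional (\<lambda>\<omega>. f (\<omega> t)) = E t f"
  using path_functional_eq[OF _ _ admissible_value[OF f, of t]] t by (simp add: glue_def)

lemma path_functional_increment:
  assumes f: "f \<in> Cbuc" and s: "0 \<le> s" and t: "s \<le> t"
  shows "path_functional (\<lambda>\<omega>. f (\<omega> t - \<omega> s)) = E (t - s) f"
proof (cases "s = t")
  case True
  interpret P: sublinear_expectation_space path_space path_functional by (rule sublinear_path_functional)
  show ?thesis using True f by (simp add: zero P.const_preserving)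
next
  case False
  interpret S: sublinear_expectation_space Cbuc "E s" by (rule sublinear[OF s])
  \<comment> \<open>Once the position at time \<open>s\<close> is drawn, the expectation of the
    following increment does not depend on it, so the outer expectation acts on a constant.\<close>
  have "sorted_list_of_set {s, t} = [s, t]" using t False
    by (subst sorted_list_of_set_insert) auto
  then show ?thesis
    using path_functional_eq[OF _ _ admissible_increment[OF f, of s t]] s t False
    by (simp add: glue_def S.const_preserving)
qed

text \<open>The innermost expectation, over the last time, is the inner expectation in the
  definition of independence: gluing at \<open>t (Suc k)\<close> leaves the earlier increments alone
  and makes the last one equal to \<open>z\<close>.\<close>

lemma path_process_indep:
  assumes t0: "t 0 = (0::real)" and mono: "\<And>i. i < n \<Longrightarrow> t i < t (Suc i)"
  shows "indep_seq path_space path_functional n (\<lambda>i \<omega>. \<omega> (t (Suc i)) - \<omega> (t i))"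
  unfolding indep_seq_def indep_pair_def
proof (intro allI impI ballI)
  fix k and \<phi> :: "(real ^ 'd) list \<Rightarrow> real"
  assume k: "1 \<le> k \<and> k < n" and \<phi>: "\<phi> \<in> Cbuc_tuples (Suc k)"
  interpret P: sublinear_expectation_space path_space path_functional by (rule sublinear_path_functional)
  let ?X = "\<lambda>\<omega>::real \<Rightarrow> real ^ 'd. map (\<lambda>i. \<omega> (t (Suc i)) - \<omega> (t i)) [0..<k]"
  let ?Y = "\<lambda>\<omega>::real \<Rightarrow> real ^ 'd. \<omega> (t (Suc k)) - \<omega> (t k)"
  have less: "t i < t j" if "i < j" "j \<le> n" for i j
    using that
  proof (induction j)
    case (Suc j)
    then show ?case using mono[of j] by (cases "i = j") auto
  qed simp
  have pos: "t i \<ge> 0" if "i \<le> n" for i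
    using less[of 0 i] that t0 by (cases i) (auto intro: less_imp_le)
  \<comment> \<open>Strict monotonicity makes the times distinct, so that
    \<open>sorted_list_of_set\<close> returns them in their given order.\<close>
  have list: "sorted_list_of_set (t ` {0..m}) = map t [0..<Suc m]" if "m \<le> n" for m
  proof (rule sorted_list_of_set_unique[THEN iffD1])
    show "sorted_wrt (<) (map t [0..<Suc m]) \<and> set (map t [0..<Suc m]) = t ` {0..m} \<and> length (map t [0..<Suc m]) = card (t ` {0..m})"
    proof (intro conjI)
      show "sorted_wrt (<) (map t [0..<Suc m])"
        using that less by (auto simp: sorted_wrt_map sorted_wrt_iff_nth_less simp del: upt_Suc)
      have "inj_on t {0..m}"
        by (rule linorder_inj_onI) (use less that in force)+
      then show "length (map t [0..<Suc m]) = card (t ` {0..m})" by (simp add: card_image)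
      show "set (map t [0..<Suc m]) = t ` {0..m}" by (auto simp del: upt_Suc)
    qed
  qed simp
  have inc: "dist (p (t (Suc i)) - p (t i)) (q (t (Suc i)) - q (t i)) < 2 * d"
    if "i < m" "\<And>u. u \<in> t ` {0..m} \<Longrightarrow> dist (p u) (q u) < d" for i m d and p q :: "real \<Rightarrow> real ^ 'd"
    using that by (intro dist_diff_less that) auto
  have adm: "admissible (t ` {0..m}) (\<lambda>\<omega>. (\<psi> :: (real ^ 'd) list \<Rightarrow> real) (map (\<lambda>i. \<omega> (t (Suc i)) - \<omega> (t i)) [0..<m]))"
    if "\<psi> \<in> Cbuc_tuples m" for \<psi> m
    by (rule admissible_tuple[OF that]) (rule inc)
  have fin: "finite (t ` {0..m})" "m \<le> n \<Longrightarrow> t ` {0..m} \<subseteq> {0..}" for m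
    using pos by auto
  have eqF: "(\<lambda>\<omega>. \<phi> (?X \<omega> @ [?Y \<omega>])) = (\<lambda>\<omega>. \<phi> (map (\<lambda>i. \<omega> (t (Suc i)) - \<omega> (t i)) [0..<Suc k]))"
    by simp
  have admF: "admissible (t ` {0..Suc k}) (\<lambda>\<omega>. \<phi> (?X \<omega> @ [?Y \<omega>]))"
    unfolding eqF by (rule adm[OF \<phi>])
  have secH: "(\<lambda>\<omega>. \<phi> (x @ [?Y \<omega>])) \<in> path_space" and sec: "path_functional (\<lambda>\<omega>. \<phi> (x @ [?Y \<omega>])) = E (t (Suc k) - t k) (\<lambda>z. \<phi> (x @ [z]))"
    if x: "length x = k" for x
  proof -
    note s = Cbuc_tuples_section[OF \<phi> x]
    show "(\<lambda>\<omega>. \<phi> (x @ [?Y \<omega>])) \<in> path_space"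
      by (rule path_spaceI[OF _ _ admissible_increment[OF s]]) (use pos k in auto)
    show "path_functional (\<lambda>\<omega>. \<phi> (x @ [?Y \<omega>])) = E (t (Suc k) - t k) (\<lambda>z. \<phi> (x @ [z]))"
      using path_functional_increment[OF s, of "t k" "t (Suc k)"] pos[of k] less[of k "Suc k"] k by simp
  qed
  define \<psi> where "\<psi> x = path_functional (\<lambda>\<omega>. \<phi> (x @ [?Y \<omega>]))" for x
  have \<psi>: "\<psi> \<in> Cbuc_tuples k"
    unfolding \<psi>_def by (rule P.Cbuc_tuples_partial_expectation[OF \<phi> secH])
  have adm\<psi>: "admissible (t ` {0..k}) (\<lambda>\<omega>. \<psi> (?X \<omega>))"
    by (rule adm[OF \<psi>])
  have glue_eq: "\<phi> (?X (glue p (t (Suc k)) (p (t k) + z)) @ [?Y (glue p (t (Suc k)) (p (t k) + z))]) = \<phi> (?X p @ [z])" for p z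
  proof -
    have "?X (glue p (t (Suc k)) (p (t k) + z)) = ?X p"
    proof (rule map_cong[OF refl])
      fix i assume "i \<in> set [0..<k]"
      then have "t (Suc i) < t (Suc k)" "t i < t (Suc k)" using k by (auto intro!: less)
      then show "glue p (t (Suc k)) (p (t k) + z) (t (Suc i)) - glue p (t (Suc k)) (p (t k) + z) (t i) = p (t (Suc i)) - p (t i)"
        by (simp add: glue_def)
    qed
    moreover have "?Y (glue p (t (Suc k)) (p (t k) + z)) = z"
      using less[of k "Suc k"] k by (auto simp: glue_def)
    ultimately show ?thesis by (simp only:)
  qed
  have "path_functional (\<lambda>\<omega>. \<phi> (?X \<omega> @ [?Y \<omega>]))
      = path_exp 0 (map t [0..<Suc k] @ [t (Suc k)]) (\<lambda>\<omega>. \<phi> (?X \<omega> @ [?Y \<omega>])) (\<lambda>u. 0)"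
    using path_functional_eq[OF fin(1) fin(2) admF] list[of "Suc k"] k by simp
  also have "\<dots> = path_exp 0 (map t [0..<Suc k]) (\<lambda>p. \<psi> (?X p)) (\<lambda>u. 0)"
    unfolding path_exp_append by (simp add: glue_eq \<psi>_def sec)
  also have "\<dots> = path_functional (\<lambda>\<omega>. \<psi> (?X \<omega>))"
    using path_functional_eq[OF fin(1) fin(2) adm\<psi>] list[of k] k by simp
  finally have eq: "path_functional (\<lambda>\<omega>. \<phi> (?X \<omega> @ [?Y \<omega>])) = path_functional (\<lambda>\<omega>. \<psi> (?X \<omega>))" .
  show "(\<lambda>\<omega>. \<phi> (?X \<omega> @ [?Y \<omega>])) \<in> path_space \<and>
     (\<forall>x. length x = k \<longrightarrow> (\<lambda>\<omega>. \<phi> (x @ [?Y \<omega>])) \<in> path_space) \<and>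
     (\<lambda>\<omega>. path_functional (\<lambda>\<omega>'. \<phi> (?X \<omega> @ [?Y \<omega>']))) \<in> path_space \<and>
     path_functional (\<lambda>\<omega>. \<phi> (?X \<omega> @ [?Y \<omega>])) = path_functional (\<lambda>\<omega>. path_functional (\<lambda>\<omega>'. \<phi> (?X \<omega> @ [?Y \<omega>'])))"
    using path_spaceI[OF fin(1) fin(2) admF] path_spaceI[OF fin(1) fin(2) adm\<psi>] secH eq k
    unfolding \<psi>_def by simp
qed

lemma path_process_levy: "sublinear_levy_process path_space path_functional (\<lambda>t \<omega>. \<omega> t)"
proof -
  interpret P: sublinear_expectation_space path_space path_functional by (rule sublinear_path_functional)
  have val: "adapted path_space (\<lambda>\<omega>. \<omega> t)" if "t \<ge> 0" for t
    unfolding adapted_def using that by (auto intro!: path_spaceI[OF _ _ admissible_value])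
  have incr: "adapted path_space (\<lambda>\<omega>. \<omega> t - \<omega> s)" if "t \<ge> 0" "s \<ge> 0" for s t
    unfolding adapted_def using that by (auto intro!: path_spaceI[OF _ _ admissible_increment])
  show ?thesis
  proof
    show "eq_in_law path_space path_functional (\<lambda>\<omega>. \<omega> 0) (\<lambda>\<omega>. 0)"
      unfolding eq_in_law_def using val[of 0]
      by (auto simp: path_functional_value zero P.const_preserving adapted_def P.const_mem)
    show "indep_seq path_space path_functional n (\<lambda>i \<omega>. \<omega> (t (Suc i)) - \<omega> (t i))"
      if "t 0 = 0" "\<And>i. i < n \<Longrightarrow> t i < t (Suc i)" for n t
      by (rule path_process_indep) (use that in auto)
    show "eq_in_law path_space path_functional (\<lambda>\<omega>. \<omega> t - \<omega> s) (\<lambda>\<omega>. \<omega> (t - s))"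
      if "0 \<le> s" "s \<le> t" for s t
      unfolding eq_in_law_def using that
      by (auto simp: path_functional_increment path_functional_value intro!: val incr)
    show "((\<lambda>t. path_functional (\<lambda>\<omega>. f (\<omega> t))) \<longlongrightarrow> f 0) (at_right 0)" if "f \<in> Cbuc" for f
      by (rule Lim_transform_eventually[OF continuous[OF that]])
         (auto simp: eventually_at_filter path_functional_value that)
  qed (rule val)
qed

lemma levy_semigroup_path_process:
  assumes "f \<in> Cbuc" "t \<ge> 0"
  shows "levy_semigroup path_functional (\<lambda>t \<omega>. \<omega> t) t f x = shift_op (E t) f x"
  using path_functional_value[OF Cbuc_translate[OF assms(1)] assms(2), of x]
  by (simp add: levy_semigroup_def shift_op_def)

end

section \<open>Levy operators\<close>

definition bounded_triplet :: "real \<Rightarrow> real ^ 'd::finite \<Rightarrow> real ^ 'd ^ 'd \<Rightarrow> (real ^ 'd) measure \<Rightarrow> bool" where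
  "bounded_triplet B b Q \<nu> \<longleftrightarrow> pos_semidef Q \<and> sets \<nu> = sets (restrict_space borel (- {0})) \<and>
     norm b \<le> B \<and> norm Q \<le> B \<and> (\<integral>\<^sup>+y. ennreal (min 1 ((norm y)\<^sup>2)) \<partial>\<nu>) \<le> ennreal B"

lemma uniformly_bounded_tripletsE:
  assumes "uniformly_bounded_triplets I b Q \<nu>" "I \<noteq> {}"
  obtains B where "\<And>\<theta>. \<theta> \<in> I \<Longrightarrow> bounded_triplet B (b \<theta>) (Q \<theta>) (\<nu> \<theta>)" "B \<ge> 0"
proof -
  let ?s = "\<lambda>\<theta>. ennreal (norm (b \<theta>)) + ennreal (norm (Q \<theta>)) + (\<integral>\<^sup>+y. ennreal (min 1 ((norm y)\<^sup>2)) \<partial>\<nu> \<theta>)"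
  have "(SUP \<theta>\<in>I. ?s \<theta>) < \<infinity>" using assms by (simp add: uniformly_bounded_triplets_def)
  then obtain B where B: "B \<ge> 0" "(SUP \<theta>\<in>I. ?s \<theta>) = ennreal B"
    by (cases "SUP \<theta>\<in>I. ?s \<theta>" rule: ennreal_cases) auto
  have "bounded_triplet B (b \<theta>) (Q \<theta>) (\<nu> \<theta>)" if "\<theta> \<in> I" for \<theta>
  proof -
    have s: "?s \<theta> \<le> ennreal B" unfolding B(2)[symmetric] using that by (rule SUP_upper)
    have "x \<le> x + y + z" "y \<le> x + y + z" "z \<le> x + y + z" for x y z :: ennreal
      by (rule add_increasing2[OF zero_le add_increasing2[OF zero_le order_refl]],
          rule add_increasing2[OF zero_le add_increasing[OF zero_le order_refl]],
          rule add_increasing[OF zero_le order_refl])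
    with s have "ennreal (norm (b \<theta>)) \<le> ennreal B" "ennreal (norm (Q \<theta>)) \<le> ennreal B"
      "(\<integral>\<^sup>+y. ennreal (min 1 ((norm y)\<^sup>2)) \<partial>\<nu> \<theta>) \<le> ennreal B"
      by (meson order_trans)+
    with B(1) assms(1) that show ?thesis
      by (auto simp: bounded_triplet_def uniformly_bounded_triplets_def)
  qed
  with B(1) that show ?thesis by blast
qed

section \<open>Integrals against a jump measure\<close>

context
  fixes B :: real and b :: "real ^ 'd::finite" and Q :: "real ^ 'd ^ 'd" and \<nu> :: "(real ^ 'd) measure"
  assumes trip: "bounded_triplet B b Q \<nu>"
begin

lemma jump_measurable: "f \<in> borel_measurable borel \<Longrightarrow> f \<in> borel_measurable \<nu>"
proof -
  assume f: "f \<in> borel_measurable borel"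
  have "sets \<nu> = sets (restrict_space borel (- {0}))" using trip by (simp add: bounded_triplet_def)
  then show ?thesis
    using measurable_restrict_space1[OF f] measurable_cong_sets by blast
qed

lemma jump_space: "space \<nu> = - {0}"
  using trip sets_eq_imp_space_eq[of \<nu> "restrict_space borel (- {0})"]
  by (simp add: bounded_triplet_def space_restrict_space)

lemma triplet_nonneg: "0 \<le> B"
  using trip norm_ge_zero[of b] unfolding bounded_triplet_def by linarith

lemma jump_weight:
  "integrable \<nu> (\<lambda>y. min 1 ((norm y)\<^sup>2))" "(LINT y|\<nu>. min 1 ((norm y)\<^sup>2)) \<le> B"
proof -
  have m: "(\<lambda>y. min 1 ((norm y)\<^sup>2)) \<in> borel_measurable \<nu>"
    by (rule jump_measurable) measurable
  have le: "(\<integral>\<^sup>+y. ennreal (min 1 ((norm y)\<^sup>2)) \<partial>\<nu>) \<le> ennreal B"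
    using trip by (simp add: bounded_triplet_def)
  also have "\<dots> < \<infinity>" by simp
  finally show i: "integrable \<nu> (\<lambda>y. min 1 ((norm y)\<^sup>2))"
    using m by (intro integrableI_nonneg) auto
  have "ennreal (LINT y|\<nu>. min 1 ((norm y)\<^sup>2)) \<le> ennreal B"
    using le nn_integral_eq_integral[OF i] by simp
  then show "(LINT y|\<nu>. min 1 ((norm y)\<^sup>2)) \<le> B"
    using triplet_nonneg by simp
qed

text \<open>The measure may be infinite near the origin; the integral of the weight
  \<open>min 1 ((norm y)\<^sup>2)\<close>, at most \<open>B\<close>, is the information through
  which all jump integrals are controlled.\<close>

lemma jump_integral_bound:
  assumes "f \<in> borel_measurable borel" "\<And>y. y \<noteq> 0 \<Longrightarrow> \<bar>f y\<bar> \<le> C * min 1 ((norm y)\<^sup>2)" "0 \<le> C"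
  shows "integrable \<nu> f" "\<bar>LINT y|\<nu>. f y\<bar> \<le> C * B"
proof -
  have w: "integrable \<nu> (\<lambda>y. C * min 1 ((norm y)\<^sup>2))" using jump_weight(1) by simp
  show i: "integrable \<nu> f"
    by (rule Bochner_Integration.integrable_bound[OF w jump_measurable[OF assms(1)]])
       (use assms(2,3) in \<open>auto simp: jump_space abs_mult intro!: AE_I2\<close>)
  have "\<bar>LINT y|\<nu>. f y\<bar> \<le> (LINT y|\<nu>. \<bar>f y\<bar>)" by (rule integral_abs_bound)
  also have "\<dots> \<le> (LINT y|\<nu>. C * min 1 ((norm y)\<^sup>2))"
    by (rule integral_mono) (use i w assms(2) in \<open>auto simp: jump_space\<close>)
  also have "\<dots> \<le> C * B" using jump_weight(2) assms(3) by (simp add: mult_left_mono)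
  finally show "\<bar>LINT y|\<nu>. f y\<bar> \<le> C * B" .
qed

lemma jump_integral_lower:
  assumes "integrable \<nu> f" "\<And>y. y \<noteq> 0 \<Longrightarrow> - (C * min 1 ((norm y)\<^sup>2)) \<le> f y" "0 \<le> C"
  shows "- (C * B) \<le> (LINT y|\<nu>. f y)"
proof -
  have w: "integrable \<nu> (\<lambda>y. - (C * min 1 ((norm y)\<^sup>2)))" using jump_weight(1) by simp
  have "- (C * B) \<le> (LINT y|\<nu>. - (C * min 1 ((norm y)\<^sup>2)))"
    using jump_weight(2) assms(3) by (simp add: mult_left_mono)
  also have "\<dots> \<le> (LINT y|\<nu>. f y)"
    by (rule integral_mono) (use assms w in \<open>auto simp: jump_space\<close>)
  finally show ?thesis .
qed

end

definition jump_integrand :: "(real ^ 'd::finite \<Rightarrow> real) \<Rightarrow> real ^ 'd \<Rightarrow> real ^ 'd \<Rightarrow> real" where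
  "jump_integrand f x y = f (x + y) - f x - directional y f x * indicator {0<..<1} (norm y)"

lemma trace_hessian: "trace (Q ** hessian f x) = (\<Sum>i\<in>UNIV. \<Sum>j\<in>UNIV. Q $ i $ j * partial j (partial i f) x)"
  by (simp add: trace_def matrix_matrix_mult_def hessian_def)

lemma levy_operator_eq:
  "levy_operator b Q \<nu> f x = directional b f x + (1/2) * trace (Q ** hessian f x) + (LINT y|\<nu>. jump_integrand f x y)"
  by (simp add: levy_operator_def jump_integrand_def inner_grad)

text \<open>The bound on the operator takes two derivatives only. In this class the difference of
  two translates of a \<open>C3_bounded\<close> function is small, and so is the difference of two
  cut-off mollified functions that are close before mollification.\<close>

definition C2_bounded :: "real \<Rightarrow> (real ^ 'd::finite \<Rightarrow> real) \<Rightarrow> bool" where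
  "C2_bounded K f \<longleftrightarrow> smooth f \<and> (\<forall>x. \<bar>f x\<bar> \<le> K) \<and> (\<forall>i x. \<bar>partial i f x\<bar> \<le> K) \<and>
     (\<forall>i j x. \<bar>partial i (partial j f) x\<bar> \<le> K)"

lemma C3_C2_bounded: "C3_bounded K f \<Longrightarrow> C2_bounded K f"
  by (auto simp: C3_bounded_def C2_bounded_def)

lemma jump_integrand_measurable:
  assumes "smooth f"
  shows "jump_integrand f x \<in> borel_measurable borel"
proof -
  have [measurable]: "(\<lambda>y. f (x + y)) \<in> borel_measurable borel"
    by (intro borel_measurable_continuous_onI smooth_continuous_on smooth_translate(1) assms)
  show ?thesis
    unfolding jump_integrand_def[abs_def] directional_def by measurable
qed

text \<open>Inside the unit ball the compensated increment is a Taylor remainder of second order;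
  outside it is a plain increment, at most \<open>2 * K\<close>.\<close>

lemma jump_integrand_bound:
  fixes f :: "real ^ 'd::finite \<Rightarrow> real"
  assumes "C2_bounded K f"
  shows "\<bar>jump_integrand f x y\<bar> \<le> 2 * real CARD('d) ^ 2 * K * min 1 ((norm y)\<^sup>2)"
proof -
  have f: "smooth f" "\<And>x. \<bar>f x\<bar> \<le> K" "\<And>i j x. \<bar>partial i (partial j f) x\<bar> \<le> K" and K: "0 \<le> K"
    using assms order_trans[OF abs_ge_zero] by (auto simp: C2_bounded_def)
  have D: "1 \<le> real CARD('d) ^ 2" by (simp add: one_le_power Suc_leI)
  show ?thesis
  proof (cases "0 < norm y \<and> norm y < 1")
    case True
    have "\<bar>f (x + y) - f x - directional y f x\<bar> \<le> real CARD('d) ^ 2 * K * norm y ^ 2"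
      by (rule taylor2_bound_ball[OF f(1)]) (rule f(3))
    also have "\<dots> \<le> 2 * real CARD('d) ^ 2 * K * (norm y)\<^sup>2"
      using K by (intro mult_right_mono) auto
    finally show ?thesis
      using True by (simp add: jump_integrand_def power_le_one)
  next
    case False
    show ?thesis
    proof (cases "y = 0")
      case True
      then show ?thesis by (simp add: jump_integrand_def directional_def)
    next
      case False
      then have y: "norm y \<ge> 1" using \<open>\<not> (0 < norm y \<and> norm y < 1)\<close> by auto
      have "\<bar>f (x + y) - f x\<bar> \<le> 2 * K" using f(2)[of "x + y"] f(2)[of x] by linarith
      also have "\<dots> \<le> 2 * real CARD('d) ^ 2 * K"
        using mult_right_mono[OF D K] by simp
      finally show ?thesis
        using y by (simp add: jump_integrand_def one_le_power)
    qed
  qed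
qed

lemma abs_trace_hessian_le:
  fixes Q :: "real ^ 'd::finite ^ 'd"
  assumes "norm Q \<le> B" "\<And>i j. \<bar>partial i (partial j f) x\<bar> \<le> K"
  shows "\<bar>trace (Q ** hessian f x)\<bar> \<le> real CARD('d) ^ 2 * B * K"
proof -
  have "\<bar>Q $ i $ j\<bar> \<le> B" for i j
  proof -
    have "norm (Q $ i) \<le> norm Q" by (rule Finite_Cartesian_Product.norm_nth_le)
    with component_le_norm_cart[of "Q $ i" j] assms(1) show ?thesis by linarith
  qed
  then have "\<bar>Q $ i $ j * partial j (partial i f) x\<bar> \<le> B * K" for i j
    unfolding abs_mult by (intro mult_mono assms(2)) (auto intro: order_trans[OF abs_ge_zero])
  then have "\<bar>trace (Q ** hessian f x)\<bar> \<le> (\<Sum>i\<in>(UNIV::'d set). \<Sum>j\<in>(UNIV::'d set). B * K)"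
    unfolding trace_hessian by (intro order_trans[OF sum_abs] sum_mono)
  then show ?thesis by (simp add: power2_eq_square mult_ac)
qed

text \<open>In units of \<open>CARD('d)\<^sup>2 * B * K\<close>, drift, diffusion and jumps
  contribute at most \<open>1\<close>, \<open>1 / 2\<close> and \<open>2\<close>.\<close>

lemma levy_operator_bound:
  fixes f :: "real ^ 'd::finite \<Rightarrow> real"
  assumes trip: "bounded_triplet B b Q \<nu>" and f: "C2_bounded K f"
  shows "\<bar>levy_operator b Q \<nu> f x\<bar> \<le> 4 * real CARD('d) ^ 2 * B * K"
proof -
  let ?D = "real CARD('d)"
  have K: "0 \<le> K" and B: "0 \<le> B"
    using f order_trans[OF abs_ge_zero] triplet_nonneg[OF trip] by (auto simp: C2_bounded_def)
  have D: "?D \<le> ?D ^ 2" by (simp add: power2_eq_square Suc_leI)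
  have "\<bar>directional b f x\<bar> \<le> ?D * norm b * K"
    using f by (intro abs_directional_le) (auto simp: C2_bounded_def)
  also have "\<dots> \<le> ?D ^ 2 * B * K"
    using trip D K B by (intro mult_mono) (auto simp: bounded_triplet_def)
  finally have 1: "\<bar>directional b f x\<bar> \<le> ?D ^ 2 * B * K" .
  have 2: "\<bar>trace (Q ** hessian f x)\<bar> \<le> ?D ^ 2 * B * K"
    using f trip by (intro abs_trace_hessian_le) (auto simp: C2_bounded_def bounded_triplet_def)
  have 3: "\<bar>LINT y|\<nu>. jump_integrand f x y\<bar> \<le> 2 * ?D ^ 2 * K * B"
    using f K by (intro jump_integral_bound[OF trip] jump_integrand_measurable jump_integrand_bound)
      (auto simp: C2_bounded_def)
  have "0 \<le> ?D ^ 2 * B * K" using K B by simp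
  with 1 2 3 show ?thesis
    unfolding levy_operator_eq abs_le_iff by (simp add: mult_ac)
qed

lemma levy_operator_translate:
  assumes "smooth f"
  shows "levy_operator b Q \<nu> (\<lambda>y. f (x + y)) 0 = levy_operator b Q \<nu> f x"
proof -
  have "jump_integrand (\<lambda>y. f (x + y)) 0 = jump_integrand f x"
    using assms by (intro ext) (simp add: jump_integrand_def directional_def smooth_translate)
  then show ?thesis
    using assms by (simp add: levy_operator_eq directional_def trace_hessian smooth_translate smooth_partial)
qed

lemma partial_diff:
  assumes "smooth f" "smooth g"
  shows "partial i (\<lambda>x. f x - g x) = (\<lambda>x. partial i f x - partial i g x)"
proof
  fix x
  show "partial i (\<lambda>x. f x - g x) x = partial i f x - partial i g x"
    by (subst partial_eqI[OF has_derivative_diff[OF assms[THEN smooth_differentiable, THEN has_derivative_directional]]]) simp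
qed

lemma levy_operator_diff:
  fixes f :: "real ^ 'd::finite \<Rightarrow> real"
  assumes trip: "bounded_triplet B b Q \<nu>" and f: "C2_bounded K f" and g: "C2_bounded K g"
  shows "levy_operator b Q \<nu> (\<lambda>x. f x - g x) x = levy_operator b Q \<nu> f x - levy_operator b Q \<nu> g x"
proof -
  have s: "smooth f" "smooth g" using f g by (auto simp: C2_bounded_def)
  note p = partial_diff[OF s] partial_diff[OF smooth_partial[OF s(1)] smooth_partial[OF s(2)]]
  have j: "jump_integrand (\<lambda>x. f x - g x) x y = jump_integrand f x y - jump_integrand g x y" for y
    by (simp add: jump_integrand_def directional_def p right_diff_distrib sum_subtractf left_diff_distrib)
  have i: "integrable \<nu> (jump_integrand h x)" if h: "C2_bounded K h" for h
  proof -
    have "smooth h" "\<bar>h 0\<bar> \<le> K" using h by (auto simp: C2_bounded_def)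
    moreover from this have "0 \<le> K" by linarith
    ultimately show ?thesis
      by (intro jump_integral_bound(1)[OF trip jump_integrand_measurable jump_integrand_bound[OF h]]) auto
  qed
  show ?thesis
    using i[OF f] i[OF g]
    by (simp add: levy_operator_eq j directional_def trace_hessian p right_diff_distrib sum_subtractf)
qed

lemma lipschitz_of_partial_bound:
  fixes f :: "real ^ 'd::finite \<Rightarrow> real"
  assumes "smooth f" "\<And>i x. \<bar>partial i f x\<bar> \<le> K"
  shows "\<bar>f (a + z) - f (c + z)\<bar> \<le> real CARD('d) * K * norm (a - c)"
proof -
  obtain t where "f ((c + z) + (a - c)) = f (c + z) + directional (a - c) f (c + z + t *\<^sub>R (a - c))"
    using directional_taylor[OF assms(1), of 1 "c + z" "a - c"] by auto
  with abs_directional_le[OF assms(2), of "a - c"] show ?thesis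
    by (simp add: algebra_simps)
qed

text \<open>The difference of the operator at two points is the operator applied to
  \<open>f (a + z) - f (c + z)\<close>. By the bounds on the derivatives of \<open>f\<close> up to
  order three, this function and its first two derivatives are of order
  \<open>norm (a - c)\<close>.\<close>

lemma levy_operator_lipschitz:
  fixes f :: "real ^ 'd::finite \<Rightarrow> real"
  assumes trip: "bounded_triplet B b Q \<nu>" and f: "C3_bounded K f"
  shows "\<bar>levy_operator b Q \<nu> f a - levy_operator b Q \<nu> f c\<bar> \<le> 4 * real CARD('d) ^ 3 * B * K * norm (a - c)"
proof -
  let ?h = "\<lambda>z. f (a + z) - f (c + z)"
  note fD = C3_boundedD[OF f]
  have s: "smooth (\<lambda>z. f (x + z))" for x by (rule smooth_translate(1)[OF fD(1)])
  have p: "partial i ?h = (\<lambda>z. partial i f (a + z) - partial i f (c + z))" for i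
    using partial_diff[OF s s] smooth_translate(2)[OF fD(1)] by simp
  have p2: "partial j (partial i ?h) = (\<lambda>z. partial j (partial i f) (a + z) - partial j (partial i f) (c + z))" for i j
    unfolding p using smooth_partial[OF fD(1)] by (simp add: partial_diff smooth_translate)
  have h: "C2_bounded (real CARD('d) * K * norm (a - c)) ?h"
    unfolding C2_bounded_def p2 unfolding p
    by (intro conjI allI smooth_diff s lipschitz_of_partial_bound smooth_partial fD)
  have "C2_bounded K (\<lambda>z. f (x + z))" for x
    by (intro C3_C2_bounded C3_bounded_translate f)
  from levy_operator_diff[OF trip this this, of a c 0]
  have "levy_operator b Q \<nu> f a - levy_operator b Q \<nu> f c = levy_operator b Q \<nu> ?h 0"
    by (simp add: levy_operator_translate[OF fD(1)])
  with levy_operator_bound[OF trip h, of 0] show ?thesis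
    by (simp add: power2_eq_square power3_eq_cube mult_ac)
qed

section \<open>Positive finite-difference approximations of Levy operators\<close>

text \<open>Cholesky elimination: the row and column of a pivot \<open>s\<close> are split off as a
  rank-one term, and the induction runs over the set of indices that carries the matrix.\<close>

lemma pos_semidef_factorization:
  fixes Q :: "real ^ 'd::finite ^ 'd"
  assumes "pos_semidef Q"
  obtains v :: "'d \<Rightarrow> real ^ 'd" where "\<And>i j. Q $ i $ j = (\<Sum>k\<in>UNIV. v k $ i * v k $ j)"
proof -
  have "\<exists>v :: 'd \<Rightarrow> real ^ 'd. \<forall>i j. Q $ i $ j = (\<Sum>k\<in>S. v k $ i * v k $ j)"
    if "finite S" "pos_semidef Q" "\<And>i j. i \<notin> S \<Longrightarrow> Q $ i $ j = 0" for S and Q :: "real ^ 'd ^ 'd"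
    using that
  proof (induction S arbitrary: Q rule: finite_induct)
    case empty
    then show ?case by simp
  next
    case (insert s S)
    have sym: "Q $ i $ j = Q $ j $ i" for i j
      using insert.prems(1) unfolding pos_semidef_def transpose_def by (metis vec_lambda_beta)
    have psd: "0 \<le> x \<bullet> (Q *v x)" for x using insert.prems(1) by (simp add: pos_semidef_def)
    have symQ: "x \<bullet> (Q *v y) = y \<bullet> (Q *v x)" for x y
      using insert.prems(1) unfolding pos_semidef_def by (metis dot_lmul_matrix inner_commute transpose_matrix_vector)
    let ?e = "axis s 1 :: real ^ 'd"
    define w where "w = Q *v ?e"
    have w: "w $ i = Q $ i $ s" for i by (simp add: w_def matrix_vector_mul_component inner_axis)
    have q: "?e \<bullet> w = Q $ s $ s" by (simp add: inner_axis' w)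
    have expand: "(x - c *\<^sub>R ?e) \<bullet> (Q *v (x - c *\<^sub>R ?e)) = x \<bullet> (Q *v x) - 2 * c * (x \<bullet> w) + c\<^sup>2 * Q $ s $ s" for x c
    proof -
      have "Q *v (x - c *\<^sub>R ?e) = Q *v x - c *\<^sub>R w"
        by (simp add: w_def matrix_vector_mult_diff_distrib matrix_vector_mult_scaleR)
      then show ?thesis
        using symQ[of ?e x] q by (simp add: inner_diff_left inner_diff_right w_def power2_eq_square algebra_simps)
    qed
    show ?case
    proof (cases "Q $ s $ s = 0")
      case True
      have "Q $ j $ s = 0" for j
      proof (rule ccontr)
        assume "Q $ j $ s \<noteq> 0"
        then have j: "axis j 1 \<bullet> w \<noteq> 0" by (simp add: inner_axis' w)
        let ?x = "axis j 1 :: real ^ 'd"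
        \<comment> \<open>With zero pivot the form is affine along \<open>?e\<close>; this
          \<open>c\<close> would give it the value \<open>- 1\<close>, against
          semidefiniteness.\<close>
        define c where "c = (?x \<bullet> (Q *v ?x) + 1) / (2 * (?x \<bullet> w))"
        have "2 * c * (?x \<bullet> w) = ?x \<bullet> (Q *v ?x) + 1" using j by (simp add: c_def)
        with expand[of ?x c] psd[of "?x - c *\<^sub>R ?e"] True show False by simp
      qed
      then have "Q $ i $ j = 0" if "i \<notin> S" for i j
        using that insert.prems(2)[of i j] sym by (cases "i = s") auto
      from insert.IH[OF insert.prems(1) this] obtain v :: "'d \<Rightarrow> real ^ 'd"
        where v: "\<And>i j. Q $ i $ j = (\<Sum>k\<in>S. v k $ i * v k $ j)" by blast
      have "Q $ i $ j = (\<Sum>k\<in>insert s S. (v(s := 0)) k $ i * (v(s := 0)) k $ j)" for i j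
        using insert.hyps unfolding v by (auto intro!: sum.cong)
      then show ?thesis by blast
    next
      case False
      have "0 \<le> Q $ s $ s" using psd[of ?e] q by (simp add: w_def)
      with False have pos: "0 < Q $ s $ s" by simp
      \<comment> \<open>The Schur complement of the pivot.\<close>
      define Q' :: "real ^ 'd ^ 'd" where "Q' = (\<chi> i j. Q $ i $ j - w $ i * w $ j / Q $ s $ s)"
      have "Q' *v x = Q *v x - ((x \<bullet> w) / Q $ s $ s) *\<^sub>R w" for x
        by (simp add: vec_eq_iff matrix_vector_mult_def Q'_def inner_vec_def algebra_simps sum_subtractf
            sum_divide_distrib sum_distrib_left)
      then have form: "x \<bullet> (Q' *v x) = x \<bullet> (Q *v x) - (x \<bullet> w)\<^sup>2 / Q $ s $ s" for x
        by (simp add: inner_diff_right power2_eq_square)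
      have "0 \<le> x \<bullet> (Q' *v x)" for x
      proof -
        \<comment> \<open>The form of \<open>Q'\<close> at \<open>x\<close> is the minimum of the
          form of \<open>Q\<close> on the line through \<open>x\<close> in direction
          \<open>?e\<close>, attained with \<open>c = (x \<bullet> w) / Q $ s $ s\<close>.\<close>
        have "0 \<le> x \<bullet> (Q *v x) - 2 * ((x \<bullet> w) / Q $ s $ s) * (x \<bullet> w) + ((x \<bullet> w) / Q $ s $ s)\<^sup>2 * Q $ s $ s"
          unfolding expand[symmetric] by (rule psd)
        also have "\<dots> = x \<bullet> (Q' *v x)"
          using pos unfolding form by (simp add: power2_eq_square field_simps)
        finally show ?thesis .
      qed
      then have psd': "pos_semidef Q'"
        by (simp add: pos_semidef_def transpose_def Q'_def vec_eq_iff sym mult.commute)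
      have "Q' $ i $ j = 0" if "i \<notin> S" for i j
      proof (cases "i = s")
        case True
        then show ?thesis using False by (simp add: Q'_def w sym)
      next
        case False
        then have "Q $ i $ j = 0" "Q $ i $ s = 0" using that insert.prems(2) by auto
        then show ?thesis by (simp add: Q'_def w)
      qed
      from insert.IH[OF psd' this] obtain v :: "'d \<Rightarrow> real ^ 'd"
        where v: "\<And>i j. Q' $ i $ j = (\<Sum>k\<in>S. v k $ i * v k $ j)" by blast
      let ?v = "v(s := (1 / sqrt (Q $ s $ s)) *\<^sub>R w)"
      have "Q $ i $ j = (\<Sum>k\<in>insert s S. ?v k $ i * ?v k $ j)" for i j
      proof -
        have "(\<Sum>k\<in>S. ?v k $ i * ?v k $ j) = Q' $ i $ j"
          unfolding v using insert.hyps by (intro sum.cong) auto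
        moreover have "?v s $ i * ?v s $ j = w $ i * w $ j / Q $ s $ s"
          using pos by (simp add: field_simps flip: real_sqrt_mult)
        ultimately show ?thesis using insert.hyps by (simp add: Q'_def)
      qed
      then show ?thesis by blast
    qed
  qed
  from this[of UNIV Q] assms that show ?thesis by auto
qed

section \<open>Difference quotients with positive weights\<close>

lemma directional_scaleR: "directional (c *\<^sub>R y) f x = c * directional y f x"
  by (simp add: directional_def sum_distrib_left mult_ac)

lemma directional_scaleR_fun: "directional (c *\<^sub>R y) (directional (c *\<^sub>R y) f) x = c\<^sup>2 * directional y (directional y f) x"
  if "smooth f"
proof -
  have "directional (c *\<^sub>R y) f = (\<lambda>x. c * directional y f x)" by (rule ext) (rule directional_scaleR)
  moreover have "partial i (\<lambda>x. c * directional y f x) x = c * partial i (directional y f) x" for i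
    by (subst partial_mult) (auto intro: smooth_differentiable smooth_directional that)
  ultimately show ?thesis
    by (simp add: directional_def[of _ "\<lambda>x. c * directional y f x"] directional_scaleR
        directional_def[of y "directional y f"] sum_distrib_left power2_eq_square mult_ac)
qed

text \<open>The gradient term of a jump is replaced by a difference quotient in the direction opposite to the
  jump, so that every coefficient of a value of \<open>g\<close> away from the origin is positive.\<close>

definition second_diff :: "real \<Rightarrow> real ^ 'd::finite \<Rightarrow> (real ^ 'd \<Rightarrow> real) \<Rightarrow> real" where
  "second_diff \<delta> v g = (g (\<delta> *\<^sub>R v) - g 0 + (g (- (\<delta>\<^sup>2 *\<^sub>R v)) - g 0) / \<delta>) / \<delta>\<^sup>2"

text \<open>Jumps of length at least one are kept exactly. Those between \<open>\<delta>\<close> and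
  one keep their increment, with the compensator as a quotient of step \<open>\<delta>\<close>.
  Those shorter than \<open>\<delta>\<close> become a discretised diffusion of variance
  \<open>(norm y)\<^sup>2\<close> in their direction, so that the total weight stays below a
  multiple of \<open>min 1 ((norm y)\<^sup>2) / \<delta> ^ 3\<close>.\<close>

definition jump_diff :: "real \<Rightarrow> (real ^ 'd::finite \<Rightarrow> real) \<Rightarrow> real ^ 'd \<Rightarrow> real" where
  "jump_diff \<delta> g y = (if norm y \<ge> 1 then g y - g 0
     else if norm y \<ge> \<delta> then g y - g 0 + (g (- (\<delta> *\<^sub>R y)) - g 0) / \<delta>
     else (norm y)\<^sup>2 * second_diff \<delta> ((1 / norm y) *\<^sub>R y) g)"

text \<open>The first-order terms cancel, since the backward step \<open>\<delta>\<^sup>2\<close> is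
  divided by \<open>\<delta>\<close>. What remains is a third-order remainder \<open>R\<close> of
  size \<open>\<delta> ^ 3\<close> over \<open>\<delta>\<^sup>2\<close> and a second-order remainder
  \<open>S\<close> of size \<open>\<delta> ^ 4\<close> over \<open>\<delta> ^ 3\<close>.\<close>

lemma second_diff_error:
  fixes g :: "real ^ 'd::finite \<Rightarrow> real"
  assumes g: "C3_bounded K g" and \<delta>: "0 < \<delta>"
  shows "\<bar>second_diff \<delta> v g - directional v (directional v g) 0 / 2\<bar>
    \<le> real CARD('d) ^ 3 * K * \<delta> * ((norm v) ^ 3 + (norm v)\<^sup>2)"
proof -
  let ?D = "real CARD('d)"
  have K: "0 \<le> K" and s: "smooth g" using C3_boundedD[OF g] by auto
  define R where "R = g (\<delta> *\<^sub>R v) - g 0 - \<delta> * directional v g 0 - \<delta>\<^sup>2 * directional v (directional v g) 0 / 2"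
  define S where "S = g (- (\<delta>\<^sup>2 *\<^sub>R v)) - g 0 + \<delta>\<^sup>2 * directional v g 0"
  have R: "\<bar>R\<bar> \<le> ?D ^ 3 * K * (\<delta> ^ 3 * norm v ^ 3)"
    using taylor3_bound[OF g, of 0 "\<delta> *\<^sub>R v"] \<delta>
    unfolding directional_scaleR_fun[OF s] directional_scaleR[of \<delta> v g]
    by (simp add: R_def power_mult_distrib)
  have "\<bar>S\<bar> \<le> ?D ^ 2 * K * (\<delta> ^ 4 * (norm v)\<^sup>2)"
    using taylor2_bound[OF g, of 0 "(- (\<delta>\<^sup>2)) *\<^sub>R v"] \<delta> unfolding directional_scaleR
    by (simp add: S_def power_mult_distrib)
  also have "\<dots> \<le> ?D ^ 3 * K * (\<delta> ^ 4 * (norm v)\<^sup>2)"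
    using K by (intro mult_right_mono power_increasing) (auto simp: Suc_leI)
  finally have S: "\<bar>S\<bar> \<le> ?D ^ 3 * K * (\<delta> ^ 4 * (norm v)\<^sup>2)" .
  have "second_diff \<delta> v g - directional v (directional v g) 0 / 2 = R / \<delta>\<^sup>2 + S / \<delta> ^ 3"
    using \<delta> by (simp add: second_diff_def R_def S_def field_simps power2_eq_square power3_eq_cube)
  also have "\<bar>\<dots>\<bar> \<le> \<bar>R\<bar> / \<delta>\<^sup>2 + \<bar>S\<bar> / \<delta> ^ 3"
    using \<delta> by (intro order_trans[OF abs_triangle_ineq]) (simp add: abs_divide)
  also have "\<dots> \<le> ?D ^ 3 * K * (\<delta> ^ 3 * norm v ^ 3) / \<delta>\<^sup>2 + ?D ^ 3 * K * (\<delta> ^ 4 * (norm v)\<^sup>2) / \<delta> ^ 3"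
    using \<delta> R S by (intro add_mono divide_right_mono) auto
  also have "\<dots> = ?D ^ 3 * K * \<delta> * ((norm v) ^ 3 + (norm v)\<^sup>2)"
    using \<delta> by (simp add: field_simps power2_eq_square power3_eq_cube power4_eq_xxxx)
  finally show ?thesis .
qed

text \<open>For jumps shorter than \<open>\<delta>\<close> both terms are compared with half the
  second derivative along \<open>y\<close>: two units of error come from \<open>second_diff\<close>
  in the unit direction, one from the Taylor remainder of the integrand.\<close>

lemma jump_diff_error:
  fixes g :: "real ^ 'd::finite \<Rightarrow> real"
  assumes g: "C3_bounded K g" and \<delta>: "0 < \<delta>" "\<delta> \<le> 1" and y: "y \<noteq> 0"
  shows "\<bar>jump_diff \<delta> g y - jump_integrand g 0 y\<bar> \<le> 3 * real CARD('d) ^ 3 * K * \<delta> * min 1 ((norm y)\<^sup>2)"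
proof -
  let ?D = "real CARD('d)"
  have K: "0 \<le> K" and s: "smooth g" using C3_boundedD[OF g] by auto
  have "?D ^ 2 \<le> ?D ^ 3" "0 \<le> ?D ^ 3" by (intro power_increasing) (auto simp: Suc_leI)
  then have D: "?D ^ 2 \<le> 3 * ?D ^ 3" by linarith
  consider "norm y \<ge> 1" | "\<delta> \<le> norm y" "norm y < 1" | "norm y < \<delta>" "norm y < 1" by linarith
  then show ?thesis
  proof cases
    case 1
    then show ?thesis using K \<delta> by (simp add: jump_diff_def jump_integrand_def)
  next
    case 2
    have "jump_diff \<delta> g y - jump_integrand g 0 y = (g (- (\<delta> *\<^sub>R y)) - g 0 + \<delta> * directional y g 0) / \<delta>"
      using 2 \<delta> y by (simp add: jump_diff_def jump_integrand_def field_simps)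
    moreover have "\<bar>g (- (\<delta> *\<^sub>R y)) - g 0 + \<delta> * directional y g 0\<bar> \<le> ?D ^ 2 * K * (\<delta>\<^sup>2 * (norm y)\<^sup>2)"
      using taylor2_bound[OF g, of 0 "(- \<delta>) *\<^sub>R y"] \<delta> unfolding directional_scaleR
      by (simp add: power_mult_distrib)
    ultimately have "\<bar>jump_diff \<delta> g y - jump_integrand g 0 y\<bar> \<le> ?D ^ 2 * K * (\<delta>\<^sup>2 * (norm y)\<^sup>2) / \<delta>"
      using \<delta> by (simp add: abs_divide divide_right_mono)
    also have "\<dots> = ?D ^ 2 * (K * \<delta> * (norm y)\<^sup>2)" using \<delta> by (simp add: power2_eq_square)
    also have "\<dots> \<le> (3 * ?D ^ 3) * (K * \<delta> * (norm y)\<^sup>2)"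
      using D K \<delta> by (intro mult_right_mono mult_nonneg_nonneg) simp_all
    finally show ?thesis using 2 by (simp add: power_le_one mult_ac)
  next
    case 3
    define u where "u = (1 / norm y) *\<^sub>R y"
    have u: "norm u = 1" "y = norm y *\<^sub>R u" using y by (auto simp: u_def)
    have dd: "directional y (directional y g) 0 = (norm y)\<^sup>2 * directional u (directional u g) 0"
      using directional_scaleR_fun[OF s, of "norm y" u 0] u(2) by simp
    have j: "jump_diff \<delta> g y - jump_integrand g 0 y =
       (norm y)\<^sup>2 * (second_diff \<delta> u g - directional u (directional u g) 0 / 2)
       - (g (0 + y) - g 0 - directional y g 0 - directional y (directional y g) 0 / 2)"
      using 3 y \<delta> unfolding dd by (simp add: jump_diff_def jump_integrand_def u_def[symmetric] algebra_simps)
    have "\<bar>(norm y)\<^sup>2 * (second_diff \<delta> u g - directional u (directional u g) 0 / 2)\<bar>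
        \<le> (norm y)\<^sup>2 * (?D ^ 3 * K * \<delta> * ((norm u) ^ 3 + (norm u)\<^sup>2))"
      unfolding abs_mult by (intro mult_mono second_diff_error[OF g \<delta>(1)]) auto
    moreover have "\<bar>g (0 + y) - g 0 - directional y g 0 - directional y (directional y g) 0 / 2\<bar> \<le> (norm y)\<^sup>2 * (?D ^ 3 * K * \<delta>)"
    proof -
      have "norm y ^ 3 \<le> (norm y)\<^sup>2 * \<delta>"
        using 3 by (simp add: power3_eq_cube power2_eq_square mult_left_mono)
      then have "?D ^ 3 * K * norm y ^ 3 \<le> ?D ^ 3 * K * ((norm y)\<^sup>2 * \<delta>)"
        using K by (intro mult_left_mono) auto
      with taylor3_bound[OF g, of 0 y] show ?thesis by (simp add: mult_ac)
    qed
    ultimately have "\<bar>jump_diff \<delta> g y - jump_integrand g 0 y\<bar> \<le> 3 * ((norm y)\<^sup>2 * (?D ^ 3 * K * \<delta>))"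
      unfolding j u(1) by (simp add: mult_ac)
    then show ?thesis using 3 by (simp add: power_le_one mult_ac)
  qed
qed

lemma second_diff_weights:
  assumes "0 < \<delta>" "\<delta> \<le> 1"
  shows "second_diff \<delta> v g = 1 / \<delta>\<^sup>2 * (g (\<delta> *\<^sub>R v) - g 0) + 1 / \<delta> ^ 3 * (g (- (\<delta>\<^sup>2 *\<^sub>R v)) - g 0)"
    and "1 / \<delta>\<^sup>2 + 1 / \<delta> ^ 3 \<le> 2 / \<delta> ^ 3"
proof -
  show "second_diff \<delta> v g = 1 / \<delta>\<^sup>2 * (g (\<delta> *\<^sub>R v) - g 0) + 1 / \<delta> ^ 3 * (g (- (\<delta>\<^sup>2 *\<^sub>R v)) - g 0)"
    using assms by (simp add: second_diff_def add_divide_distrib power2_eq_square power3_eq_cube)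
  have "\<delta> ^ 3 \<le> \<delta>\<^sup>2" using assms by (intro power_decreasing) auto
  then have "1 / \<delta>\<^sup>2 \<le> 1 / \<delta> ^ 3" using assms by (intro divide_left_mono) auto
  then show "1 / \<delta>\<^sup>2 + 1 / \<delta> ^ 3 \<le> 2 / \<delta> ^ 3" by simp
qed

text \<open>The points and weights do not depend on \<open>g\<close>: for fixed \<open>y\<close>
  this is the generator of a pure jump motion, and \<open>w + w'\<close> is its total rate.\<close>

lemma jump_diff_weights:
  fixes y :: "real ^ 'd::finite"
  assumes \<delta>: "0 < \<delta>" "\<delta> \<le> 1" and y: "y \<noteq> 0"
  obtains w w' z z' where "0 \<le> w" "0 \<le> w'" "w + w' \<le> 2 / \<delta> ^ 3 * min 1 ((norm y)\<^sup>2)"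
    "\<And>g. jump_diff \<delta> g y = w * (g z - g 0) + w' * (g z' - g 0)"
proof -
  have d3: "\<delta> ^ 3 \<le> 1" "0 < \<delta> ^ 3" using \<delta> by (auto simp: power_le_one)
  consider "norm y \<ge> 1" | "\<delta> \<le> norm y" "norm y < 1" | "norm y < \<delta>" "norm y < 1" by linarith
  then show ?thesis
  proof cases
    case 1
    show ?thesis
    proof (rule that[of 1 0 y 0])
      have "1 \<le> 2 / \<delta> ^ 3" using d3 by (simp add: le_divide_eq)
      then show "1 + 0 \<le> 2 / \<delta> ^ 3 * min 1 ((norm y)\<^sup>2)" using 1 by (simp add: one_le_power)
    qed (use 1 in \<open>auto simp: jump_diff_def\<close>)
  next
    case 2
    show ?thesis
    proof (rule that[of 1 "1 / \<delta>" y "- (\<delta> *\<^sub>R y)"])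
      \<comment> \<open>In this range \<open>\<delta>\<^sup>2 \<le> (norm y)\<^sup>2\<close>, so the
        rate \<open>2 / \<delta>\<close> is at most \<open>2 / \<delta> ^ 3\<close> times the weight
        of the jump.\<close>
      have "1 + 1 / \<delta> \<le> 2 / \<delta>" using \<delta> by (simp add: field_simps)
      also have "\<dots> = 2 / \<delta> ^ 3 * \<delta>\<^sup>2" using \<delta> by (simp add: power2_eq_square power3_eq_cube)
      also have "\<dots> \<le> 2 / \<delta> ^ 3 * (norm y)\<^sup>2" using \<delta> 2 by (intro mult_left_mono power_mono) auto
      finally show "1 + 1 / \<delta> \<le> 2 / \<delta> ^ 3 * min 1 ((norm y)\<^sup>2)" using 2 by (simp add: power_le_one)
    qed (use 2 \<delta> in \<open>auto simp: jump_diff_def\<close>)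
  next
    case 3
    let ?u = "(1 / norm y) *\<^sub>R y"
    show ?thesis
    proof (rule that[of "(norm y)\<^sup>2 * (1 / \<delta>\<^sup>2)" "(norm y)\<^sup>2 * (1 / \<delta> ^ 3)" "\<delta> *\<^sub>R ?u" "- (\<delta>\<^sup>2 *\<^sub>R ?u)"])
      have "(norm y)\<^sup>2 * (1 / \<delta>\<^sup>2) + (norm y)\<^sup>2 * (1 / \<delta> ^ 3) \<le> (norm y)\<^sup>2 * (2 / \<delta> ^ 3)"
        unfolding distrib_left[symmetric] by (intro mult_left_mono second_diff_weights(2) \<delta>) auto
      then show "(norm y)\<^sup>2 * (1 / \<delta>\<^sup>2) + (norm y)\<^sup>2 * (1 / \<delta> ^ 3) \<le> 2 / \<delta> ^ 3 * min 1 ((norm y)\<^sup>2)"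
        using 3 by (simp add: power_le_one mult_ac)
      show "jump_diff \<delta> g y = (norm y)\<^sup>2 * (1 / \<delta>\<^sup>2) * (g (\<delta> *\<^sub>R ?u) - g 0)
          + (norm y)\<^sup>2 * (1 / \<delta> ^ 3) * (g (- (\<delta>\<^sup>2 *\<^sub>R ?u)) - g 0)" for g
        using 3 \<delta> by (simp only: jump_diff_def second_diff_weights(1)[OF \<delta>] distrib_left mult.assoc not_le[symmetric] if_False simp_thms)
    qed (use \<delta> in auto)
  qed
qed

lemma jump_diff_bound:
  assumes \<delta>: "0 < \<delta>" "\<delta> \<le> 1" and y: "y \<noteq> 0" and M: "\<And>x. \<bar>g x\<bar> \<le> M"
  shows "\<bar>jump_diff \<delta> g y\<bar> \<le> 4 * M / \<delta> ^ 3 * min 1 ((norm y)\<^sup>2)"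
proof -
  obtain w w' z z' where w: "0 \<le> w" "0 \<le> w'" "w + w' \<le> 2 / \<delta> ^ 3 * min 1 ((norm y)\<^sup>2)"
    and eq: "\<And>g. jump_diff \<delta> g y = w * (g z - g 0) + w' * (g z' - g 0)"
    using jump_diff_weights[OF \<delta> y] by blast
  have M0: "0 \<le> M" using M[of 0] by linarith
  have "\<bar>g z - g 0\<bar> \<le> 2 * M" for z using M[of z] M[of 0] by linarith
  then have "\<bar>w * (g z - g 0)\<bar> \<le> w * (2 * M)" "\<bar>w' * (g z' - g 0)\<bar> \<le> w' * (2 * M)"
    using w by (auto simp: abs_mult mult_left_mono)
  then have "\<bar>jump_diff \<delta> g y\<bar> \<le> (w + w') * (2 * M)"
    unfolding eq distrib_right by linarith
  also have "\<dots> \<le> (2 / \<delta> ^ 3 * min 1 ((norm y)\<^sup>2)) * (2 * M)"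
    using w(3) M0 by (intro mult_right_mono) auto
  finally show ?thesis by (simp add: mult_ac)
qed

lemma jump_diff_lower:
  assumes \<delta>: "0 < \<delta>" "\<delta> \<le> 1" and y: "y \<noteq> 0" and g: "\<And>x. 0 \<le> g x"
  shows "- (2 / \<delta> ^ 3 * g 0 * min 1 ((norm y)\<^sup>2)) \<le> jump_diff \<delta> g y"
proof -
  obtain w w' z z' where w: "0 \<le> w" "0 \<le> w'" "w + w' \<le> 2 / \<delta> ^ 3 * min 1 ((norm y)\<^sup>2)"
    and eq: "\<And>g. jump_diff \<delta> g y = w * (g z - g 0) + w' * (g z' - g 0)"
    using jump_diff_weights[OF \<delta> y] by blast
  have n: "- g 0 \<le> g z - g 0" for z using g[of z] by simp
  have "w * - g 0 \<le> w * (g z - g 0)" "w' * - g 0 \<le> w' * (g z' - g 0)"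
    by (rule mult_left_mono[OF n w(1)], rule mult_left_mono[OF n w(2)])
  then have "- ((w + w') * g 0) \<le> jump_diff \<delta> g y"
    unfolding eq distrib_right by linarith
  moreover have "(w + w') * g 0 \<le> (2 / \<delta> ^ 3 * min 1 ((norm y)\<^sup>2)) * g 0"
    using w(3) g by (intro mult_right_mono) auto
  ultimately show ?thesis by (simp add: mult_ac)
qed

lemma second_diff_lower:
  assumes \<delta>: "0 < \<delta>" "\<delta> \<le> 1" and g: "\<And>x. 0 \<le> g x"
  shows "- (2 / \<delta> ^ 3 * g 0) \<le> second_diff \<delta> v g"
proof -
  have n: "- g 0 \<le> g z - g 0" for z using g[of z] by simp
  have "1 / \<delta>\<^sup>2 * - g 0 \<le> 1 / \<delta>\<^sup>2 * (g (\<delta> *\<^sub>R v) - g 0)"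
    "1 / \<delta> ^ 3 * - g 0 \<le> 1 / \<delta> ^ 3 * (g (- (\<delta>\<^sup>2 *\<^sub>R v)) - g 0)"
    by (rule mult_left_mono[OF n], use \<delta> in simp)+
  then have "- ((1 / \<delta>\<^sup>2 + 1 / \<delta> ^ 3) * g 0) \<le> second_diff \<delta> v g"
    unfolding second_diff_weights(1)[OF \<delta>] distrib_right by linarith
  moreover have "(1 / \<delta>\<^sup>2 + 1 / \<delta> ^ 3) * g 0 \<le> 2 / \<delta> ^ 3 * g 0"
    using g by (intro mult_right_mono second_diff_weights(2) \<delta>)
  ultimately show ?thesis by linarith
qed

lemma jump_diff_measurable:
  assumes [measurable]: "g \<in> borel_measurable borel"
  shows "jump_diff \<delta> g \<in> borel_measurable borel"
  unfolding jump_diff_def[abs_def] second_diff_def by measurable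

lemma trace_factorization:
  assumes "smooth g" "\<And>i j. Q $ i $ j = (\<Sum>k\<in>UNIV. v k $ i * v k $ j)"
  shows "trace (Q ** hessian g x) = (\<Sum>k\<in>UNIV. directional (v k) (directional (v k) g) x)"
proof -
  have "directional (v k) (directional (v k) g) x
      = (\<Sum>i\<in>UNIV. \<Sum>j\<in>UNIV. v k $ i * v k $ j * partial j (partial i g) x)" for k
    unfolding directional_def[of _ "directional (v k) g"] partial_directional[OF assms(1)]
    by (subst sum.swap) (simp add: sum_distrib_left mult_ac)
  then have "(\<Sum>k\<in>UNIV. directional (v k) (directional (v k) g) x)
      = (\<Sum>i\<in>UNIV. \<Sum>j\<in>UNIV. \<Sum>k\<in>UNIV. v k $ i * v k $ j * partial j (partial i g) x)"
    by (simp, subst sum.swap, subst (2) sum.swap) simp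
  then show ?thesis
    by (simp add: trace_hessian assms(2) sum_distrib_right)
qed

text \<open>The squares of the entries \<open>v k $ i\<close> are summands of the diagonal entries
  \<open>Q $ i $ i\<close>; bounding a number by its square plus one avoids a square root.\<close>

lemma factor_norm_le:
  fixes Q :: "real ^ 'd::finite ^ 'd" and v :: "'d \<Rightarrow> real ^ 'd"
  assumes "\<And>i j. Q $ i $ j = (\<Sum>k\<in>UNIV. v k $ i * v k $ j)" "norm Q \<le> B"
  shows "norm (v k) \<le> real CARD('d) * B + 1"
proof -
  have "(norm (v k))\<^sup>2 = (\<Sum>i\<in>UNIV. v k $ i * v k $ i)"
    by (simp add: power2_norm_eq_inner inner_vec_def)
  also have "\<dots> \<le> (\<Sum>i\<in>(UNIV :: 'd set). B)"
  proof (rule sum_mono)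
    fix i
    have "v k $ i * v k $ i \<le> (\<Sum>k\<in>UNIV. v k $ i * v k $ i)"
      by (rule member_le_sum) auto
    also have "\<dots> = Q $ i $ i" using assms(1) by simp
    also have "\<dots> \<le> norm (Q $ i)" using component_le_norm_cart[of "Q $ i" i] by linarith
    also have "\<dots> \<le> norm Q" by (rule Finite_Cartesian_Product.norm_nth_le)
    also note assms(2)
    finally show "v k $ i * v k $ i \<le> B" .
  qed
  finally have sq: "(norm (v k))\<^sup>2 \<le> real CARD('d) * B" by simp
  moreover have "norm (v k) \<le> (norm (v k))\<^sup>2 + 1"
    using zero_le_power2[of "norm (v k) - 1"] by (simp add: power2_eq_square algebra_simps) (smt (verit) mult_nonneg_nonneg norm_ge_zero)
  ultimately show ?thesis by linarith
qed

text \<open>\<open>L\<close> is linear, kills constants and satisfies a quantitative positive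
  maximum principle with rate \<open>R / \<delta> ^ 3\<close>: this lower bound makes
  \<open>f 0 + h * L f\<close> a positive functional of \<open>f\<close> whenever
  \<open>0 \<le> h\<close> and \<open>h * R \<le> \<delta> ^ 3\<close>.\<close>

definition approximates ::
    "real \<Rightarrow> real \<Rightarrow> real \<Rightarrow> ((real ^ 'd::finite \<Rightarrow> real) \<Rightarrow> real) \<Rightarrow> ((real ^ 'd \<Rightarrow> real) \<Rightarrow> real) \<Rightarrow> bool" where
  "approximates R C \<delta> A L \<longleftrightarrow>
     (\<forall>f\<in>Cbuc. \<forall>g\<in>Cbuc. L (\<lambda>x. f x + g x) = L f + L g) \<and> (\<forall>f\<in>Cbuc. \<forall>a. L (\<lambda>x. a * f x) = a * L f) \<and>
     (\<forall>c. L (\<lambda>x. c) = 0) \<and> (\<forall>f\<in>Cbuc. (\<forall>x. 0 \<le> f x) \<longrightarrow> - (R / \<delta> ^ 3 * f 0) \<le> L f) \<and>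
     (\<forall>K g. C3_bounded K g \<longrightarrow> \<bar>L g - A g\<bar> \<le> C * K * \<delta>)"

text \<open>The drift becomes a forward difference along \<open>b\<close>, the diffusion a sum of
  second differences along the factors \<open>v k\<close> of \<open>Q\<close>, and the jumps use
  \<open>jump_diff\<close>. The rate \<open>1 + 2 * D + 2 * B\<close> and the error constant collect
  the three contributions in this order.\<close>

lemma levy_operator_approximation:
  fixes b :: "real ^ 'd::finite"
  defines "D \<equiv> real CARD('d)"
  assumes trip: "bounded_triplet B b Q \<nu>" and \<delta>: "0 < \<delta>" "\<delta> \<le> 1"
  shows "\<exists>L. approximates (1 + 2 * D + 2 * B) (D\<^sup>2 * B\<^sup>2 + 2 * D ^ 4 * (D * B + 1) ^ 3 + 3 * D ^ 3 * B) \<delta>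
    (\<lambda>g. levy_operator b Q \<nu> g 0) L"
proof -
  have B0: "0 \<le> B" by (rule triplet_nonneg[OF trip])
  have D1: "1 \<le> D" by (simp add: D_def Suc_leI)
  obtain v :: "'d \<Rightarrow> real ^ 'd" where v: "\<And>i j. Q $ i $ j = (\<Sum>k\<in>UNIV. v k $ i * v k $ j)"
    using trip pos_semidef_factorization unfolding bounded_triplet_def by blast
  define V where "V = D * B + 1"
  have V: "norm (v k) \<le> V" for k
    unfolding V_def D_def using trip by (intro factor_norm_le[OF v]) (simp add: bounded_triplet_def)
  have V1: "1 \<le> V" using B0 D1 by (simp add: V_def)
  define L where "L g = (g (\<delta> *\<^sub>R b) - g 0) / \<delta> + (\<Sum>k\<in>UNIV. second_diff \<delta> (v k) g) + (LINT y|\<nu>. jump_diff \<delta> g y)" for g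
  have int: "integrable \<nu> (jump_diff \<delta> f)" if f: "f \<in> Cbuc" for f
  proof -
    obtain M where M: "\<And>x. \<bar>f x\<bar> \<le> M" "0 \<le> M" using Cbuc_bounded[OF f] by blast
    show ?thesis
      by (rule jump_integral_bound(1)[OF trip jump_diff_measurable[OF Cbuc_measurable[OF f]] jump_diff_bound[OF \<delta> _ M(1)]])
         (use M \<delta> in auto)
  qed
  have sd_add: "second_diff \<delta> w (\<lambda>x. f x + g x) = second_diff \<delta> w f + second_diff \<delta> w g" for f g w
    using \<delta> by (simp add: second_diff_def field_simps)
  have sd_scale: "second_diff \<delta> w (\<lambda>x. a * f x) = a * second_diff \<delta> w f" for f a w
    using \<delta> by (simp add: second_diff_def field_simps)
  have jd_add: "jump_diff \<delta> (\<lambda>x. f x + g x) = (\<lambda>y. jump_diff \<delta> f y + jump_diff \<delta> g y)" for f g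
    using \<delta> by (intro ext) (simp add: jump_diff_def sd_add, simp add: field_simps)
  have jd_scale: "jump_diff \<delta> (\<lambda>x. a * f x) = (\<lambda>y. a * jump_diff \<delta> f y)" for f a
    using \<delta> by (intro ext) (simp add: jump_diff_def sd_scale, simp add: field_simps)
  have add: "L (\<lambda>x. f x + g x) = L f + L g" if "f \<in> Cbuc" "g \<in> Cbuc" for f g
    using int[OF that(1)] int[OF that(2)]
    by (simp add: L_def sd_add jd_add sum.distrib add_divide_distrib diff_divide_distrib)
  have scale: "L (\<lambda>x. a * f x) = a * L f" if "f \<in> Cbuc" for f a
    by (simp add: L_def sd_scale jd_scale sum_distrib_left distrib_left right_diff_distrib diff_divide_distrib)
  have const: "L (\<lambda>x. c) = 0" for c
  proof -
    have "jump_diff \<delta> (\<lambda>x. c) = (\<lambda>y. 0)"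
      by (intro ext) (simp add: jump_diff_def second_diff_def)
    then have "integral\<^sup>L \<nu> (jump_diff \<delta> (\<lambda>x. c)) = 0" by (rule ssubst) simp
    then show ?thesis by (simp add: L_def second_diff_def)
  qed
  have lower: "- ((1 + 2 * D + 2 * B) / \<delta> ^ 3 * f 0) \<le> L f" if f: "f \<in> Cbuc" "\<And>x. 0 \<le> f x" for f
  proof -
    have "\<delta> ^ 3 \<le> \<delta> ^ 1" using \<delta> by (intro power_decreasing) auto
    then have "f 0 / \<delta> \<le> f 0 / \<delta> ^ 3" using \<delta> f by (intro divide_left_mono) auto
    moreover have "- (f 0 / \<delta>) \<le> (f (\<delta> *\<^sub>R b) - f 0) / \<delta>"
      using \<delta> f(2)[of "\<delta> *\<^sub>R b"] by (simp add: diff_divide_distrib)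
    ultimately have 1: "- (f 0 / \<delta> ^ 3) \<le> (f (\<delta> *\<^sub>R b) - f 0) / \<delta>" by linarith
    have "(\<Sum>k\<in>(UNIV::'d set). - (2 / \<delta> ^ 3 * f 0)) \<le> (\<Sum>k\<in>UNIV. second_diff \<delta> (v k) f)"
      by (intro sum_mono second_diff_lower \<delta> f)
    then have 2: "- (D * (2 / \<delta> ^ 3 * f 0)) \<le> (\<Sum>k\<in>UNIV. second_diff \<delta> (v k) f)"
      by (simp add: D_def)
    have 3: "- (2 / \<delta> ^ 3 * f 0 * B) \<le> (LINT y|\<nu>. jump_diff \<delta> f y)"
      using \<delta> f by (intro jump_integral_lower[OF trip int jump_diff_lower]) auto
    have "(1 + 2 * D + 2 * B) / \<delta> ^ 3 * f 0 = f 0 / \<delta> ^ 3 + D * (2 / \<delta> ^ 3 * f 0) + 2 / \<delta> ^ 3 * f 0 * B"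
      using \<delta> by (simp add: field_simps)
    with 1 2 3 show ?thesis unfolding L_def by linarith
  qed
  have err: "\<bar>L g - levy_operator b Q \<nu> g 0\<bar> \<le> (D\<^sup>2 * B\<^sup>2 + 2 * D ^ 4 * V ^ 3 + 3 * D ^ 3 * B) * K * \<delta>"
    if g: "C3_bounded K g" for K and g :: "real ^ 'd \<Rightarrow> real"
  proof -
    have K: "0 \<le> K" and s: "smooth g" using C3_boundedD[OF g] by auto
    have "\<bar>g (\<delta> *\<^sub>R b) - g 0 - \<delta> * directional b g 0\<bar> \<le> D\<^sup>2 * K * (\<delta>\<^sup>2 * (norm b)\<^sup>2)"
      using taylor2_bound[OF g, of 0 "\<delta> *\<^sub>R b"] \<delta> unfolding directional_scaleR
      by (simp add: D_def power_mult_distrib)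
    also have "\<dots> \<le> D\<^sup>2 * K * (\<delta>\<^sup>2 * B\<^sup>2)"
      using K trip by (intro mult_left_mono power_mono) (auto simp: bounded_triplet_def)
    finally have "\<bar>(g (\<delta> *\<^sub>R b) - g 0 - \<delta> * directional b g 0) / \<delta>\<bar> \<le> D\<^sup>2 * K * (\<delta>\<^sup>2 * B\<^sup>2) / \<delta>"
      using \<delta> by (simp add: abs_divide divide_right_mono)
    then have 1: "\<bar>(g (\<delta> *\<^sub>R b) - g 0) / \<delta> - directional b g 0\<bar> \<le> D\<^sup>2 * B\<^sup>2 * K * \<delta>"
      using \<delta> by (simp add: diff_divide_distrib power2_eq_square mult_ac)
    have "\<bar>second_diff \<delta> (v k) g - directional (v k) (directional (v k) g) 0 / 2\<bar> \<le> 2 * D ^ 3 * V ^ 3 * K * \<delta>" for k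
    proof -
      have "norm (v k) ^ 3 \<le> V ^ 3" "norm (v k) ^ 2 \<le> V ^ 2" using V[of k] by (auto intro: power_mono)
      moreover have "V ^ 2 \<le> V ^ 3" using V1 by (intro power_increasing) auto
      ultimately have "norm (v k) ^ 3 + (norm (v k))\<^sup>2 \<le> 2 * V ^ 3" by linarith
      then have "D ^ 3 * K * \<delta> * (norm (v k) ^ 3 + (norm (v k))\<^sup>2) \<le> D ^ 3 * K * \<delta> * (2 * V ^ 3)"
        using K \<delta> D1 by (intro mult_left_mono) auto
      with second_diff_error[OF g \<delta>(1), of "v k"] show ?thesis by (simp add: D_def mult_ac)
    qed
    then have "(\<Sum>k\<in>UNIV. \<bar>second_diff \<delta> (v k) g - directional (v k) (directional (v k) g) 0 / 2\<bar>)
        \<le> (\<Sum>k\<in>(UNIV::'d set). 2 * D ^ 3 * V ^ 3 * K * \<delta>)"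
      by (intro sum_mono)
    then have "\<bar>\<Sum>k\<in>UNIV. second_diff \<delta> (v k) g - directional (v k) (directional (v k) g) 0 / 2\<bar>
        \<le> D * (2 * D ^ 3 * V ^ 3 * K * \<delta>)"
      by (intro order_trans[OF sum_abs]) (simp add: D_def)
    then have 2: "\<bar>(\<Sum>k\<in>UNIV. second_diff \<delta> (v k) g) - 1 / 2 * trace (Q ** hessian g 0)\<bar> \<le> 2 * D ^ 4 * V ^ 3 * K * \<delta>"
      unfolding trace_factorization[OF s v]
      by (simp add: sum_subtractf sum_divide_distrib power4_eq_xxxx power3_eq_cube mult_ac)
    have ji: "integrable \<nu> (jump_integrand g 0)"
      by (rule jump_integral_bound(1)[OF trip jump_integrand_measurable[OF s] jump_integrand_bound[OF C3_C2_bounded[OF g]]])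
         (use K in simp)
    have "\<bar>(LINT y|\<nu>. jump_diff \<delta> g y - jump_integrand g 0 y)\<bar> \<le> 3 * D ^ 3 * K * \<delta> * B"
      unfolding D_def
      by (rule jump_integral_bound(2)[OF trip _ jump_diff_error[OF g \<delta>]])
         (use K \<delta> jump_diff_measurable[OF Cbuc_measurable[OF C3_bounded_Cbuc[OF g]]] jump_integrand_measurable[OF s] in auto)
    then have 3: "\<bar>(LINT y|\<nu>. jump_diff \<delta> g y) - (LINT y|\<nu>. jump_integrand g 0 y)\<bar> \<le> 3 * D ^ 3 * B * K * \<delta>"
      using ji int[OF C3_bounded_Cbuc[OF g]] by (simp add: mult_ac)
    have "(D\<^sup>2 * B\<^sup>2 + 2 * D ^ 4 * V ^ 3 + 3 * D ^ 3 * B) * K * \<delta>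
      = D\<^sup>2 * B\<^sup>2 * K * \<delta> + 2 * D ^ 4 * V ^ 3 * K * \<delta> + 3 * D ^ 3 * B * K * \<delta>"
      by (simp add: distrib_right)
    with 1 2 3 show ?thesis unfolding L_def levy_operator_eq by linarith
  qed
  show ?thesis
    unfolding approximates_def V_def[symmetric]
    by (intro exI[of _ L] conjI ballI allI impI add scale const lower err) auto
qed

section \<open>Existence\<close>

text \<open>Positivity and preservation of constants bound every \<open>\<Phi> \<theta> f\<close> by
  the sup norm of \<open>f\<close>, so the real supremum is a genuine one.\<close>

lemma sublinear_functional_SUP:
  fixes \<Phi> :: "'i \<Rightarrow> (real ^ 'd::finite \<Rightarrow> real) \<Rightarrow> real"
  assumes "I \<noteq> {}"
    and add: "\<And>\<theta> f g. \<theta> \<in> I \<Longrightarrow> f \<in> Cbuc \<Longrightarrow> g \<in> Cbuc \<Longrightarrow> \<Phi> \<theta> (\<lambda>x. f x + g x) = \<Phi> \<theta> f + \<Phi> \<theta> g"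
    and scale: "\<And>\<theta> f a. \<theta> \<in> I \<Longrightarrow> f \<in> Cbuc \<Longrightarrow> \<Phi> \<theta> (\<lambda>x. a * f x) = a * \<Phi> \<theta> f"
    and const: "\<And>\<theta> c. \<theta> \<in> I \<Longrightarrow> \<Phi> \<theta> (\<lambda>x. c) = c"
    and pos: "\<And>\<theta> f. \<theta> \<in> I \<Longrightarrow> f \<in> Cbuc \<Longrightarrow> (\<And>x. 0 \<le> f x) \<Longrightarrow> 0 \<le> \<Phi> \<theta> f"
  shows "sublinear_functional (\<lambda>f. SUP \<theta>\<in>I. \<Phi> \<theta> f)"
    and "\<And>f. f \<in> Cbuc \<Longrightarrow> bdd_above ((\<lambda>\<theta>. \<Phi> \<theta> f) ` I)"
proof -
  have mono: "\<Phi> \<theta> f \<le> \<Phi> \<theta> g" if "\<theta> \<in> I" "f \<in> Cbuc" "g \<in> Cbuc" "\<And>x. f x \<le> g x" for \<theta> f g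
  proof -
    have "0 \<le> \<Phi> \<theta> (\<lambda>x. g x + (-1) * f x)"
      using that by (intro pos Cbuc_add Cbuc_scale) auto
    then show ?thesis
      using that add[OF that(1,3) Cbuc_scale[OF that(2), of "-1"]] scale[OF that(1,2), of "-1"] by simp
  qed
  show bdd: "bdd_above ((\<lambda>\<theta>. \<Phi> \<theta> f) ` I)" if f: "f \<in> Cbuc" for f
  proof -
    obtain M where M: "\<And>x. \<bar>f x\<bar> \<le> M" using Cbuc_bounded[OF f] by blast
    have "\<Phi> \<theta> f \<le> M" if "\<theta> \<in> I" for \<theta>
      using mono[OF that \<open>f \<in> Cbuc\<close> Cbuc_const, of M] M const[OF that, of M] by (simp add: abs_le_iff)
    then show ?thesis by (rule bdd_aboveI2)
  qed
  show "sublinear_functional (\<lambda>f. SUP \<theta>\<in>I. \<Phi> \<theta> f)"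
  proof
    fix f g :: "real ^ 'd \<Rightarrow> real" and a c :: real
    show "(\<lambda>\<omega>. c) \<in> Cbuc" by simp
    show "(SUP \<theta>\<in>I. \<Phi> \<theta> (\<lambda>\<omega>. c)) = c" using const \<open>I \<noteq> {}\<close> by simp
    assume f: "f \<in> Cbuc"
    show "(\<lambda>\<omega>. a * f \<omega>) \<in> Cbuc" by (rule Cbuc_scale[OF f])
    show "(SUP \<theta>\<in>I. \<Phi> \<theta> (\<lambda>\<omega>. a * f \<omega>)) = a * (SUP \<theta>\<in>I. \<Phi> \<theta> f)" if a: "a \<ge> 0"
    proof (rule antisym)
      show "(SUP \<theta>\<in>I. \<Phi> \<theta> (\<lambda>\<omega>. a * f \<omega>)) \<le> a * (SUP \<theta>\<in>I. \<Phi> \<theta> f)"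
        by (intro cSUP_least \<open>I \<noteq> {}\<close>) (auto simp: scale f intro!: mult_left_mono a cSUP_upper bdd)
      show "a * (SUP \<theta>\<in>I. \<Phi> \<theta> f) \<le> (SUP \<theta>\<in>I. \<Phi> \<theta> (\<lambda>\<omega>. a * f \<omega>))"
      proof (cases "a = 0")
        case True
        then show ?thesis using const \<open>I \<noteq> {}\<close> by simp
      next
        case False
        then have a: "a > 0" using that by simp
        have "(SUP \<theta>\<in>I. \<Phi> \<theta> f) \<le> (SUP \<theta>\<in>I. \<Phi> \<theta> (\<lambda>\<omega>. a * f \<omega>)) / a"
        proof (intro cSUP_least \<open>I \<noteq> {}\<close>)
          fix \<theta> assume t: "\<theta> \<in> I"
          have "a * \<Phi> \<theta> f \<le> (SUP \<theta>\<in>I. \<Phi> \<theta> (\<lambda>\<omega>. a * f \<omega>))"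
            using cSUP_upper[OF t bdd[OF Cbuc_scale[OF f, of a]]] scale[OF t f] by simp
          then show "\<Phi> \<theta> f \<le> (SUP \<theta>\<in>I. \<Phi> \<theta> (\<lambda>\<omega>. a * f \<omega>)) / a"
            using a by (simp add: le_divide_eq mult.commute)
        qed
        then show ?thesis using a by (simp add: le_divide_eq mult.commute)
      qed
    qed
    assume g: "g \<in> Cbuc"
    show "(\<lambda>\<omega>. f \<omega> + g \<omega>) \<in> Cbuc" by (rule Cbuc_add[OF f g])
    show "(SUP \<theta>\<in>I. \<Phi> \<theta> (\<lambda>\<omega>. f \<omega> + g \<omega>)) \<le> (SUP \<theta>\<in>I. \<Phi> \<theta> f) + (SUP \<theta>\<in>I. \<Phi> \<theta> g)"
      by (intro cSUP_least \<open>I \<noteq> {}\<close>) (auto simp: add f g intro!: add_mono cSUP_upper bdd)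
    show "(SUP \<theta>\<in>I. \<Phi> \<theta> f) \<le> (SUP \<theta>\<in>I. \<Phi> \<theta> g)" if "\<And>\<omega>. f \<omega> \<le> g \<omega>"
      using that by (intro cSUP_mono \<open>I \<noteq> {}\<close> bdd g) (auto intro!: mono f g)
  qed
qed

lemma sublinear_functional_eval: "sublinear_functional (\<lambda>f. f 0)"
  by unfold_locales (auto simp: Cbuc_add Cbuc_scale)

text \<open>A real supremum at the origin; uniform boundedness of the triplets makes it finite on
  functions with two bounded derivatives, and translating \<open>f\<close> gives the other
  points.\<close>

definition sup_generator ::
    "'i set \<Rightarrow> ('i \<Rightarrow> real ^ 'd::finite) \<Rightarrow> ('i \<Rightarrow> real ^ 'd ^ 'd) \<Rightarrow> ('i \<Rightarrow> (real ^ 'd) measure) \<Rightarrow> (real ^ 'd \<Rightarrow> real) \<Rightarrow> real" where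
  "sup_generator I b Q \<nu> f = (SUP \<theta>\<in>I. levy_operator (b \<theta>) (Q \<theta>) (\<nu> \<theta>) f 0)"

text \<open>The step \<open>g 0 + L g / 2 ^ n\<close> is positive as long as the jump rate is at
  most \<open>2 ^ n\<close>, and the supremum over \<open>\<theta>\<close> is then sublinear.
  Consistency is uniform because the constants depend on the triplets through \<open>B\<close>
  only.\<close>

lemma levy_scheme_exists:
  fixes b :: "'i \<Rightarrow> real ^ 'd::finite"
  assumes "I \<noteq> {}" and trip: "\<And>\<theta>. \<theta> \<in> I \<Longrightarrow> bounded_triplet B (b \<theta>) (Q \<theta>) (\<nu> \<theta>)" and B: "0 \<le> B"
  obtains e where "consistent_scheme e (sup_generator I b Q \<nu>)"
proof -
  define D where "D = real CARD('d)"
  have D1: "1 \<le> D" by (simp add: D_def Suc_leI)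
  define R where "R = 1 + 2 * D + 2 * B"
  define C where "C = D\<^sup>2 * B\<^sup>2 + 2 * D ^ 4 * (D * B + 1) ^ 3 + 3 * D ^ 3 * B"
  have R: "R > 0" using D1 B by (simp add: R_def)
  have C: "C \<ge> 0" using D1 B by (simp add: C_def)
  define A where "A \<theta> g = levy_operator (b \<theta>) (Q \<theta>) (\<nu> \<theta>) g 0" for \<theta> g
  \<comment> \<open>Solves \<open>R / \<delta> ^ 3 = 2 ^ n\<close>: the finest truncation scale at
    which the rate bound still keeps the step positive.\<close>
  define \<delta> where "\<delta> n = root 3 (R / 2 ^ n)" for n :: nat
  have \<delta>: "0 < \<delta> n" "\<delta> n ^ 3 = R / 2 ^ n" for n
    using R by (auto simp: \<delta>_def)
  have "(\<lambda>n. root 3 (R * (1 / 2) ^ n)) \<longlonglongrightarrow> root 3 (R * 0)"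
    by (intro tendsto_intros LIMSEQ_power_zero) auto
  then have \<delta>lim: "\<delta> \<longlonglongrightarrow> 0" by (simp add: \<delta>_def[abs_def] power_one_over)
  have "\<exists>L. approximates R C (\<delta> n) (A \<theta>) L" if "\<theta> \<in> I" "\<delta> n \<le> 1" for \<theta> n
    unfolding R_def C_def D_def A_def by (rule levy_operator_approximation[OF trip[OF that(1)] \<delta>(1) that(2)])
  then obtain L where L: "\<And>\<theta> n. \<theta> \<in> I \<Longrightarrow> \<delta> n \<le> 1 \<Longrightarrow> approximates R C (\<delta> n) (A \<theta>) (L \<theta> n)"
    by metis
  define \<Phi> where "\<Phi> n \<theta> g = g 0 + 1 / 2 ^ n * L \<theta> n g" for n \<theta> g
  \<comment> \<open>For the finitely many \<open>n\<close> with \<open>\<delta> n > 1\<close> the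
    step is evaluation at zero, which is sublinear; consistency concerns large \<open>n\<close>
    only.\<close>
  define e where "e n g = (if \<delta> n \<le> 1 then SUP \<theta>\<in>I. \<Phi> n \<theta> g else g 0)" for n g
  have step: "sublinear_functional (\<lambda>g. SUP \<theta>\<in>I. \<Phi> n \<theta> g) \<and> (\<forall>g\<in>Cbuc. bdd_above ((\<lambda>\<theta>. \<Phi> n \<theta> g) ` I))"
    if n: "\<delta> n \<le> 1" for n
  proof -
    have La: "approximates R C (\<delta> n) (A \<theta>) (L \<theta> n)" if "\<theta> \<in> I" for \<theta>
      by (rule L[OF that n])
    have add: "\<Phi> n \<theta> (\<lambda>x. f x + g x) = \<Phi> n \<theta> f + \<Phi> n \<theta> g" if "\<theta> \<in> I" "f \<in> Cbuc" "g \<in> Cbuc" for \<theta> f g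
      using La[OF that(1)] that by (simp add: approximates_def \<Phi>_def distrib_left add_divide_distrib)
    have scale: "\<Phi> n \<theta> (\<lambda>x. a * f x) = a * \<Phi> n \<theta> f" if "\<theta> \<in> I" "f \<in> Cbuc" for \<theta> f a
      using La[OF that(1)] that by (simp add: approximates_def \<Phi>_def distrib_left)
    have const: "\<Phi> n \<theta> (\<lambda>x. c) = c" if "\<theta> \<in> I" for \<theta> c
      using La[OF that] by (simp add: approximates_def \<Phi>_def)
    have pos: "0 \<le> \<Phi> n \<theta> f" if "\<theta> \<in> I" "f \<in> Cbuc" "\<And>x. 0 \<le> f x" for \<theta> f
    proof -
      have "- (R / \<delta> n ^ 3 * f 0) \<le> L \<theta> n f" using La[OF that(1)] that(2,3) by (simp add: approximates_def)
      then have "- (2 ^ n * f 0) \<le> L \<theta> n f" using R by (simp add: \<delta>(2))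
      then have "- f 0 \<le> 1 / 2 ^ n * L \<theta> n f" by (simp add: le_divide_eq mult.commute)
      then show ?thesis by (simp add: \<Phi>_def)
    qed
    have "sublinear_functional (\<lambda>g. SUP \<theta>\<in>I. \<Phi> n \<theta> g)"
      by (rule sublinear_functional_SUP(1)[where \<Phi> = "\<Phi> n", OF \<open>I \<noteq> {}\<close>]) (fact add scale const pos)+
    moreover have "bdd_above ((\<lambda>\<theta>. \<Phi> n \<theta> g) ` I)" if "g \<in> Cbuc" for g
      by (rule sublinear_functional_SUP(2)[where \<Phi> = "\<Phi> n", OF \<open>I \<noteq> {}\<close>]) (fact add scale const pos that)+
    ultimately show ?thesis by simp
  qed
  have Gbd: "bdd_above ((\<lambda>\<theta>. A \<theta> g) ` I)" if g: "C3_bounded K g" for K and g :: "real ^ 'd \<Rightarrow> real"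
  proof (rule bdd_aboveI2)
    fix \<theta> assume "\<theta> \<in> I"
    from levy_operator_bound[OF trip[OF this] C3_C2_bounded[OF g], of 0]
    show "A \<theta> g \<le> 4 * real CARD('d) ^ 2 * B * K" by (simp add: A_def)
  qed
  have "consistent_scheme e (sup_generator I b Q \<nu>)"
  proof (rule consistent_scheme.intro)
    show "sublinear_functional (e n)" for n
      using step[of n] sublinear_functional_eval by (cases "\<delta> n \<le> 1") (simp_all add: e_def[abs_def])
  next
    fix \<eta> K :: real assume \<eta>: "\<eta> > 0"
    have cp: "0 < C * \<bar>K\<bar> + 1" using C by (intro add_nonneg_pos mult_nonneg_nonneg) auto
    have "\<forall>\<^sub>F n in sequentially. \<delta> n < min 1 (\<eta> / (C * \<bar>K\<bar> + 1))"
      using \<eta> cp by (intro order_tendstoD(2)[OF \<delta>lim]) simp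
    then obtain N where N: "\<And>n. n \<ge> N \<Longrightarrow> \<delta> n < min 1 (\<eta> / (C * \<bar>K\<bar> + 1))"
      by (auto simp: eventually_sequentially)
    show "\<exists>N. \<forall>n\<ge>N. \<forall>g. C3_bounded K g \<longrightarrow> \<bar>e n g - g 0 - sup_generator I b Q \<nu> g / 2 ^ n\<bar> \<le> \<eta> / 2 ^ n"
    proof (intro exI[of _ N] allI impI)
      fix n and g :: "real ^ 'd \<Rightarrow> real" assume n: "n \<ge> N" and g: "C3_bounded K g"
      have n1: "\<delta> n \<le> 1" using N[OF n] by simp
      have K: "0 \<le> K" using C3_boundedD[OF g] by simp
      have CK: "C * K * \<delta> n \<le> \<eta>"
      proof -
        have "C * K * \<delta> n \<le> (C * \<bar>K\<bar> + 1) * \<delta> n" using K \<delta>(1)[of n] by (intro mult_right_mono) auto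
        also have "\<dots> \<le> \<eta>" using N[OF n] cp by (simp add: less_divide_eq mult.commute)
        finally show ?thesis .
      qed
      have near: "\<bar>L \<theta> n g - A \<theta> g\<bar> \<le> \<eta>" if "\<theta> \<in> I" for \<theta>
        using L[OF that n1] g CK unfolding approximates_def by (meson order_trans)
      have G: "sup_generator I b Q \<nu> g = (SUP \<theta>\<in>I. A \<theta> g)" by (simp add: sup_generator_def A_def)
      have en: "e n g = (SUP \<theta>\<in>I. \<Phi> n \<theta> g)" using n1 by (simp add: e_def)
      have "e n g \<le> g 0 + ((SUP \<theta>\<in>I. A \<theta> g) + \<eta>) / 2 ^ n"
        unfolding en
      proof (intro cSUP_least \<open>I \<noteq> {}\<close>)
        fix \<theta> assume t: "\<theta> \<in> I"
        have "L \<theta> n g \<le> (SUP \<theta>\<in>I. A \<theta> g) + \<eta>"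
          using near[OF t] cSUP_upper[OF t Gbd[OF g]] by linarith
        then show "\<Phi> n \<theta> g \<le> g 0 + ((SUP \<theta>\<in>I. A \<theta> g) + \<eta>) / 2 ^ n"
          by (simp add: \<Phi>_def divide_right_mono)
      qed
      moreover have "(SUP \<theta>\<in>I. A \<theta> g) \<le> 2 ^ n * (e n g - g 0) + \<eta>"
      proof (intro cSUP_least \<open>I \<noteq> {}\<close>)
        fix \<theta> assume t: "\<theta> \<in> I"
        have "\<Phi> n \<theta> g \<le> e n g"
          unfolding en using step[OF n1] C3_bounded_Cbuc[OF g] by (intro cSUP_upper t) auto
        then have "L \<theta> n g \<le> 2 ^ n * (e n g - g 0)"
          by (simp add: \<Phi>_def field_simps)
        with near[OF t] show "A \<theta> g \<le> 2 ^ n * (e n g - g 0) + \<eta>" by linarith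
      qed
      then have "(SUP \<theta>\<in>I. A \<theta> g) / 2 ^ n \<le> (2 ^ n * (e n g - g 0) + \<eta>) / 2 ^ n"
        by (rule divide_right_mono) simp
      then have "(SUP \<theta>\<in>I. A \<theta> g) / 2 ^ n \<le> e n g - g 0 + \<eta> / 2 ^ n"
        by (simp add: add_divide_distrib)
      ultimately show "\<bar>e n g - g 0 - sup_generator I b Q \<nu> g / 2 ^ n\<bar> \<le> \<eta> / 2 ^ n"
        unfolding G abs_le_iff add_divide_distrib by linarith
    qed
  next
    fix K :: real
    define \<Lambda> where "\<Lambda> = 4 * D ^ 3 * B * K"
    have "lipschitz_bounded \<Lambda> \<Lambda> (\<lambda>x. sup_generator I b Q \<nu> (\<lambda>y. g (x + y)))" if g: "C3_bounded K g" for g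
    proof -
      have K: "0 \<le> K" and s: "smooth g" using C3_boundedD[OF g] by auto
      let ?A = "\<lambda>\<theta> x. levy_operator (b \<theta>) (Q \<theta>) (\<nu> \<theta>) g x"
      have G: "sup_generator I b Q \<nu> (\<lambda>y. g (x + y)) = (SUP \<theta>\<in>I. ?A \<theta> x)" for x
        by (simp add: sup_generator_def levy_operator_translate[OF s])
      have bound: "\<bar>?A \<theta> x\<bar> \<le> \<Lambda>" if "\<theta> \<in> I" for \<theta> x
      proof -
        have "D\<^sup>2 \<le> D ^ 3" using D1 by (intro power_increasing) auto
        then have "4 * D\<^sup>2 * B * K \<le> \<Lambda>"
          unfolding \<Lambda>_def using B K by (intro mult_right_mono) auto
        with levy_operator_bound[OF trip[OF that] C3_C2_bounded[OF g], of x] show ?thesis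
          by (simp add: D_def)
      qed
      have bdd: "bdd_above ((\<lambda>\<theta>. ?A \<theta> x) ` I)" for x
        using bound by (intro bdd_aboveI2[of _ _ \<Lambda>]) (simp add: abs_le_iff)
      have lip: "?A \<theta> x \<le> ?A \<theta> y + \<Lambda> * dist x y" if "\<theta> \<in> I" for \<theta> x y
        using levy_operator_lipschitz[OF trip[OF that] g, of x y]
        by (simp add: \<Lambda>_def D_def dist_norm abs_le_iff)
      have sup_lip: "(SUP \<theta>\<in>I. ?A \<theta> x) \<le> (SUP \<theta>\<in>I. ?A \<theta> y) + \<Lambda> * dist x y" for x y
      proof (intro cSUP_least \<open>I \<noteq> {}\<close>)
        fix \<theta> assume t: "\<theta> \<in> I"
        from lip[OF t, of x y] cSUP_upper[OF t bdd[of y]]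
        show "?A \<theta> x \<le> (SUP \<theta>\<in>I. ?A \<theta> y) + \<Lambda> * dist x y" by linarith
      qed
      have "\<bar>SUP \<theta>\<in>I. ?A \<theta> x\<bar> \<le> \<Lambda>" for x
      proof -
        obtain \<theta> where t: "\<theta> \<in> I" using \<open>I \<noteq> {}\<close> by blast
        have "- \<Lambda> \<le> (SUP \<theta>\<in>I. ?A \<theta> x)"
          using bound[OF t, of x] cSUP_upper[OF t bdd[of x]] by linarith
        moreover have "(SUP \<theta>\<in>I. ?A \<theta> x) \<le> \<Lambda>"
          using bound by (intro cSUP_least \<open>I \<noteq> {}\<close>) (simp add: abs_le_iff)
        ultimately show ?thesis by linarith
      qed
      moreover have "\<bar>(SUP \<theta>\<in>I. ?A \<theta> x) - (SUP \<theta>\<in>I. ?A \<theta> y)\<bar> \<le> \<Lambda> * dist x y" for x y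
        using sup_lip[of x y] sup_lip[of y x] by (simp add: dist_commute abs_le_iff)
      ultimately show ?thesis
        unfolding lipschitz_bounded_def G by blast
    qed
    then show "\<exists>\<Lambda>. \<forall>g. C3_bounded K g \<longrightarrow> lipschitz_bounded \<Lambda> \<Lambda> (\<lambda>x. sup_generator I b Q \<nu> (\<lambda>y. g (x + y)))"
      by blast
  qed
  then show ?thesis using that by blast
qed

lemma generator_eqI:
  assumes "generator_rel \<E> X f g"
  shows "generator \<E> X f = g"
  unfolding generator_def
proof (rule the_equality)
  show "generator_rel \<E> X f g" by (rule assms)
  fix h assume h: "generator_rel \<E> X f h"
  show "h = g"
  proof
    fix x
    let ?q = "\<lambda>t. (levy_semigroup \<E> X t f x - f x) / t"
    have "(?q \<longlongrightarrow> h x) (at_right 0)" "(?q \<longlongrightarrow> g x) (at_right 0)"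
      using assms h unfolding generator_rel_def by blast+
    then show "h x = g x"
      by (rule tendsto_unique[OF trivial_limit_at_right_real])
  qed
qed

text \<open>The limit semigroup of the scheme is realised on path space. By
  \<open>limit_op_generator\<close> its difference quotients on test functions converge to the
  supremum of the operators.\<close>

theorem levy_process_exists:
  fixes b :: "'i \<Rightarrow> real ^ 'd::finite"
  assumes I: "I \<noteq> {}" and ub: "uniformly_bounded_triplets I b Q \<nu>"
  shows "\<exists>(H :: ((real \<Rightarrow> real ^ 'd) \<Rightarrow> real) set) \<E> (X :: real \<Rightarrow> (real \<Rightarrow> real ^ 'd) \<Rightarrow> real ^ 'd).
    sublinear_levy_process H \<E> X \<and> has_characteristics \<E> X I b Q \<nu>"
proof -
  obtain B where trip: "\<And>\<theta>. \<theta> \<in> I \<Longrightarrow> bounded_triplet B (b \<theta>) (Q \<theta>) (\<nu> \<theta>)" and B: "B \<ge> 0"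
    using uniformly_bounded_tripletsE[OF ub I] by blast
  obtain e where e: "consistent_scheme e (sup_generator I b Q \<nu>)"
    by (rule levy_scheme_exists[where b = b and Q = Q and \<nu> = \<nu>, OF I _ B]) (erule trip, rule that)
  interpret S: consistent_scheme e "sup_generator I b Q \<nu>" by (rule e)
  interpret T: convolution_semigroup S.limit_functional by (rule S.limit_functional_semigroup)
  let ?X = "\<lambda>t (\<omega> :: real \<Rightarrow> real ^ 'd). \<omega> t"
  let ?G = "\<lambda>f x. sup_generator I b Q \<nu> (\<lambda>y. f (x + y))"
  have rel: "generator_rel T.path_functional ?X f (?G f)" if f: "f \<in> Cc_infty" for f
    unfolding generator_rel_def
  proof (intro conjI allI)
    obtain K where K: "C3_bounded K f" using Cc_infty_C3[OF f] .
    show "f \<in> Cbuc" by (rule Cc_infty_Cbuc[OF f])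
    show "?G f \<in> Cbuc"
      using S.generator_lipschitz[of K] K lipschitz_bounded_Cbuc by blast
    fix x
    show "((\<lambda>t. (levy_semigroup T.path_functional ?X t f x - f x) / t) \<longlongrightarrow> ?G f x) (at_right 0)"
    proof (rule tendstoI)
      fix \<epsilon> :: real assume \<epsilon>: "\<epsilon> > 0"
      then obtain \<delta> where \<delta>: "\<delta> > 0" "\<And>t x. 0 \<le> t \<Longrightarrow> t \<le> \<delta> \<Longrightarrow>
          \<bar>S.limit_op t f x - f x - t * ?G f x\<bar> \<le> t * (\<epsilon> / 2)"
        using S.limit_op_generator[OF K, of "\<epsilon> / 2"] by auto
      have "dist ((levy_semigroup T.path_functional ?X t f x - f x) / t) (?G f x) < \<epsilon>" if t: "0 < t" "t < \<delta>" for t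
      proof -
        have l: "levy_semigroup T.path_functional ?X t f x = S.limit_op t f x"
          using T.levy_semigroup_path_process[OF Cc_infty_Cbuc[OF f], of t x] t
          by (simp add: S.shift_op_limit_functional)
        have "(S.limit_op t f x - f x) / t - ?G f x = (S.limit_op t f x - f x - t * ?G f x) / t"
          using t by (simp add: diff_divide_distrib)
        then have r: "\<bar>(S.limit_op t f x - f x) / t - ?G f x\<bar> = \<bar>S.limit_op t f x - f x - t * ?G f x\<bar> / t"
          using t by (simp add: abs_divide)
        have "\<bar>S.limit_op t f x - f x - t * ?G f x\<bar> / t \<le> \<epsilon> / 2"
          using \<delta>(2)[of t x] t by (simp add: divide_le_eq mult.commute)
        then show ?thesis using \<epsilon> unfolding dist_real_def l r by linarith
      qed
      then show "\<forall>\<^sub>F t in at_right 0. dist ((levy_semigroup T.path_functional ?X t f x - f x) / t) (?G f x) < \<epsilon>"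
        using \<delta>(1) by (auto simp: eventually_at_right intro!: exI[of _ \<delta>])
    qed
  qed
  \<comment> \<open>The real supremum agrees with the one in the extended reals because it is
    bounded above and taken over a nonempty set.\<close>
  have sup: "ereal (?G f x) = (SUP \<theta>\<in>I. ereal (levy_operator (b \<theta>) (Q \<theta>) (\<nu> \<theta>) f x))" if f: "f \<in> Cc_infty" for f x
  proof -
    obtain K where K: "C3_bounded K f" using Cc_infty_C3[OF f] .
    have bound: "\<bar>levy_operator (b \<theta>) (Q \<theta>) (\<nu> \<theta>) f x\<bar> \<le> 4 * real CARD('d) ^ 2 * B * K" if "\<theta> \<in> I" for \<theta>
      by (rule levy_operator_bound[OF trip[OF that] C3_C2_bounded[OF K]])
    have "\<bar>SUP \<theta>\<in>I. ereal (levy_operator (b \<theta>) (Q \<theta>) (\<nu> \<theta>) f x)\<bar> \<noteq> \<infinity>"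
    proof -
      let ?s = "SUP \<theta>\<in>I. ereal (levy_operator (b \<theta>) (Q \<theta>) (\<nu> \<theta>) f x)"
      have "?s \<le> ereal (4 * real CARD('d) ^ 2 * B * K)"
        using bound by (intro SUP_least) (simp add: abs_le_iff)
      moreover obtain \<theta> where "\<theta> \<in> I" using I by blast
      then have "ereal (levy_operator (b \<theta>) (Q \<theta>) (\<nu> \<theta>) f x) \<le> ?s" by (rule SUP_upper)
      ultimately show ?thesis by auto
    qed
    then show ?thesis
      using levy_operator_translate[OF C3_boundedD(1)[OF K]]
      by (simp add: sup_generator_def ereal_SUP)
  qed
  have "has_characteristics T.path_functional ?X I b Q \<nu>"
    unfolding has_characteristics_def generator_domain_def
    using rel sup generator_eqI[OF rel] by auto
  with T.path_process_levy show ?thesis by blast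
qed

section \<open>The generator determines the one-dimensional laws\<close>

lemma convolve_diff:
  assumes \<rho>: "\<rho> \<in> Cc_infty" and u: "u \<in> Cbuc" "v \<in> Cbuc"
  shows "convolve \<rho> (\<lambda>y. u y - v y) x = convolve \<rho> u x - convolve \<rho> v x"
proof -
  obtain M M' where "\<And>y. \<bar>u y\<bar> \<le> M" "\<And>y. \<bar>v y\<bar> \<le> M'" using Cbuc_bounded u by metis
  then show ?thesis
    unfolding convolve_def right_diff_distrib using u
    by (intro Bochner_Integration.integral_diff convolve_integrable[OF \<rho>] Cbuc_measurable)
qed

lemma C2_bounded_Cbuc:
  fixes f :: "real ^ 'd::finite \<Rightarrow> real"
  assumes "C2_bounded K f"
  shows "f \<in> Cbuc"
proof (rule lipschitz_bounded_Cbuc)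
  show "lipschitz_bounded (real CARD('d) * K) K f"
    unfolding lipschitz_bounded_def
    using assms lipschitz_of_partial_bound[of f K _ 0] by (auto simp: C2_bounded_def dist_norm)
qed

text \<open>The product and its derivatives vanish outside the ball carrying \<open>f\<close>, so
  \<open>g\<close> is controlled on that ball; four is the number of terms in a second derivative of
  a product.\<close>

lemma C2_bounded_mult:
  fixes f g :: "real ^ 'd::finite \<Rightarrow> real"
  assumes f: "C3_bounded K f" "\<And>x. norm x > R \<Longrightarrow> f x = 0" and g: "smooth g"
    and b: "\<And>x. norm x \<le> R \<Longrightarrow> \<bar>g x\<bar> \<le> c" "\<And>i x. norm x \<le> R \<Longrightarrow> \<bar>partial i g x\<bar> \<le> c"
      "\<And>i j x. norm x \<le> R \<Longrightarrow> \<bar>partial i (partial j g) x\<bar> \<le> c" and c: "0 \<le> c"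
  shows "C2_bounded (4 * K * c) (\<lambda>x. f x * g x)"
proof -
  note fD = C3_boundedD[OF f(1)]
  have K: "0 \<le> K" by (rule fD)
  have s: "smooth (partial i f)" "smooth (partial i g)" for i using fD(1) g by (auto intro: smooth_partial)
  have p1: "partial i (\<lambda>x. f x * g x) = (\<lambda>x. partial i f x * g x + f x * partial i g x)" for i
    using fD(1) g by (auto simp: partial_mult smooth_differentiable)
  have p2: "partial j (partial i (\<lambda>x. f x * g x)) x = (partial j (partial i f) x * g x + partial i f x * partial j g x)
      + (partial j f x * partial i g x + f x * partial j (partial i g) x)" for i j x
    unfolding p1 using s fD(1) g
    by (subst partial_add) (auto simp: partial_mult smooth_differentiable smooth_mult)
  have m: "\<bar>a * b\<bar> \<le> K * c" if "\<bar>a\<bar> \<le> K" "\<bar>b\<bar> \<le> c" for a b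
    using that K by (simp add: abs_mult mult_mono)
  have Kc: "0 \<le> K * c" using K c by simp
  have z1: "partial i f x = 0" if "norm x > R" for i x by (rule partial_eq_0[OF f(2) that])
  have z2: "partial j (partial i f) x = 0" if "norm x > R" for i j x by (rule partial_eq_0[OF z1 that])
  note z = f(2) z1 z2
  show ?thesis
    unfolding C2_bounded_def
  proof (intro conjI allI)
    show "smooth (\<lambda>x. f x * g x)" by (rule smooth_mult[OF fD(1) g])
    fix i j x
    show "\<bar>f x * g x\<bar> \<le> 4 * K * c"
    proof (cases "norm x \<le> R")
      case True
      from m[OF fD(2)[of x] b(1)[OF True]] Kc show ?thesis by linarith
    qed (use Kc z in auto)
    show "\<bar>partial i (\<lambda>x. f x * g x) x\<bar> \<le> 4 * K * c"
    proof (cases "norm x \<le> R")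
      case True
      from m[OF fD(3)[of i x] b(1)[OF True]] m[OF fD(2)[of x] b(2)[OF True, of i]] Kc
      show ?thesis unfolding p1 by linarith
    qed (use Kc z in \<open>auto simp: p1\<close>)
    show "\<bar>partial i (partial j (\<lambda>x. f x * g x)) x\<bar> \<le> 4 * K * c"
    proof (cases "norm x \<le> R")
      case True
      from m[OF fD(4)[of i j x] b(1)[OF True]] m[OF fD(3)[of j x] b(2)[OF True, of i]]
        m[OF fD(3)[of i x] b(2)[OF True, of j]] m[OF fD(2)[of x] b(3)[OF True, of i j]] Kc
      show ?thesis unfolding p2 by linarith
    qed (use Kc z in \<open>auto simp: p2\<close>)
  qed
qed

text \<open>Convergence of the difference quotients is assumed at the origin and for each test
  function separately, which is what characteristics provide; uniformity has to be earned.\<close>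

locale generated_family =
  fixes E :: "real \<Rightarrow> (real ^ 'd::finite \<Rightarrow> real) \<Rightarrow> real" and A :: "(real ^ 'd \<Rightarrow> real) \<Rightarrow> real"
  assumes sublinear: "t \<ge> 0 \<Longrightarrow> sublinear_functional (E t)"
    and generator: "f \<in> Cc_infty \<Longrightarrow> ((\<lambda>h. (E h f - f 0) / h) \<longlongrightarrow> A f) (at_right 0)"
begin

text \<open>The shift by \<open>c\<close> makes the estimate available for
  \<open>q = (q - 1) + 1\<close>, where \<open>q - 1\<close> is the test function.\<close>

lemma generator_upper:
  assumes f: "f \<in> Cc_infty" and "f 0 + c \<le> 0"
  shows "\<forall>\<^sub>F h in at_right 0. E h f + c \<le> (\<bar>A f\<bar> + 1) * h"
proof -
  have "\<forall>\<^sub>F h in at_right 0. (E h f - f 0) / h < \<bar>A f\<bar> + 1"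
    by (rule order_tendstoD(2)[OF generator[OF f]]) simp
  moreover have "\<forall>\<^sub>F h in at_right (0::real). h > 0" by (simp add: eventually_at_filter)
  ultimately show ?thesis
  proof eventually_elim
    case (elim h)
    then have "E h f - f 0 < (\<bar>A f\<bar> + 1) * h" by (simp add: divide_less_eq)
    with assms(2) show ?case by linarith
  qed
qed

text \<open>A function that is small in \<open>C\<^sup>2\<close> is dominated by a small multiple of finitely many fixed test
  functions vanishing at the origin.\<close>

lemma C2_growth:
  obtains C where "0 \<le> C"
    "\<forall>\<^sub>F h in at_right 0. \<forall>c w. 0 \<le> c \<longrightarrow> C2_bounded c w \<longrightarrow> E h w - w 0 \<le> C * c * h"
proof -
  let ?D = "real CARD('d)"
  obtain q :: "real ^ 'd \<Rightarrow> real" and Kq where q: "C3_bounded Kq q" "q 0 = 0"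
    "\<And>z. min 1 ((norm z)\<^sup>2) \<le> q z" "(\<lambda>z. q z - 1) \<in> Cc_infty"
    using quadratic_cutoff by blast
  note qC = C3_bounded_Cbuc[OF q(1)]
  obtain \<zeta> :: "real ^ 'd \<Rightarrow> real" where \<zeta>: "\<zeta> \<in> Cc_infty" "\<And>x. 0 \<le> \<zeta> x" "\<And>x. \<zeta> x \<le> 1"
      "\<And>x. norm x \<le> 1 \<Longrightarrow> \<zeta> x = 1" "\<And>x. norm x > 1 + 2 \<Longrightarrow> \<zeta> x = 0"
    using cutoff_exists[OF zero_less_one] by blast
  \<comment> \<open>Coordinate functions with compact support; they carry the gradient part of
    \<open>w\<close>. Their negatives are estimated separately, because a sublinear functional is
    not odd.\<close>
  define \<psi> where "\<psi> i y = y $ i * \<zeta> y" for i and y :: "real ^ 'd"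
  have \<psi>Cc: "\<psi> i \<in> Cc_infty" "(\<lambda>y. - \<psi> i y) \<in> Cc_infty" for i
    unfolding \<psi>_def[abs_def] using Cc_infty_mult[OF smooth_coord \<zeta>(1), of i]
      Cc_infty_mult[OF smooth_const, of _ "-1"] by fastforce+
  note \<psi>C = Cc_infty_Cbuc[OF \<psi>Cc(1)] Cc_infty_Cbuc[OF \<psi>Cc(2)]
  have \<psi>3: "\<bar>\<psi> i y\<bar> \<le> 3" for i y
  proof (cases "norm y \<le> 3")
    case True
    have "\<bar>y $ i\<bar> * \<bar>\<zeta> y\<bar> \<le> 3 * 1"
      using component_le_norm_cart[of y i] True \<zeta>(2)[of y] \<zeta>(3)[of y] by (intro mult_mono) auto
    then show ?thesis by (simp add: \<psi>_def abs_mult)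
  qed (use \<zeta>(5)[of y] in \<open>simp add: \<psi>_def\<close>)
  define P where "P = (\<Sum>i\<in>UNIV. max (\<bar>A (\<psi> i)\<bar> + 1) (\<bar>A (\<lambda>y. - \<psi> i y)\<bar> + 1))"
  define Pq where "Pq = \<bar>A (\<lambda>z. q z - 1)\<bar> + 1"
  \<comment> \<open>The summand \<open>?D\<^sup>2\<close> covers the Taylor remainder in the unit
    ball; outside it, \<open>2\<close> covers the increment of \<open>w\<close> and
    \<open>3 * ?D\<close> the lower bound of the coordinate terms.\<close>
  define B where "B = 2 + 3 * ?D + ?D\<^sup>2"
  have B: "0 \<le> B" by (simp add: B_def)
  have P: "0 \<le> P" unfolding P_def by (intro sum_nonneg) (simp add: le_max_iff_disj)
  have "\<forall>\<^sub>F h in at_right 0. \<forall>i\<in>UNIV. E h (\<psi> i) + 0 \<le> (\<bar>A (\<psi> i)\<bar> + 1) * h"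
    by (intro eventually_ball_finite generator_upper \<psi>Cc ballI) (auto simp: \<psi>_def)
  moreover have "\<forall>\<^sub>F h in at_right 0. \<forall>i\<in>UNIV. E h (\<lambda>y. - \<psi> i y) + 0 \<le> (\<bar>A (\<lambda>y. - \<psi> i y)\<bar> + 1) * h"
    by (intro eventually_ball_finite generator_upper \<psi>Cc ballI) (auto simp: \<psi>_def)
  moreover have "\<forall>\<^sub>F h in at_right 0. E h (\<lambda>z. q z - 1) + 1 \<le> Pq * h"
    unfolding Pq_def by (rule generator_upper[OF q(4)]) (simp add: q(2))
  moreover have "\<forall>\<^sub>F h in at_right (0::real). h > 0" by (simp add: eventually_at_filter)
  \<comment> \<open>The range of admissible \<open>h\<close> is determined by finitely many fixed
    test functions, which is why it is the same for all \<open>w\<close>.\<close>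
  ultimately have "\<forall>\<^sub>F h in at_right 0. \<forall>c w. 0 \<le> c \<longrightarrow> C2_bounded c w \<longrightarrow> E h w - w 0 \<le> (P + B * Pq) * c * h"
  proof eventually_elim
    case (elim h)
    interpret S: sublinear_expectation_space Cbuc "E h" by (rule sublinear) (use elim in simp)
    show ?case
    proof (intro allI impI)
      fix c and w :: "real ^ 'd \<Rightarrow> real" assume c: "(0::real) \<le> c" and w: "C2_bounded c w"
      have sm: "smooth w" and w0: "\<And>x. \<bar>w x\<bar> \<le> c" and w1: "\<And>i x. \<bar>partial i w x\<bar> \<le> c"
        and w2: "\<And>i j x. \<bar>partial i (partial j w) x\<bar> \<le> c"
        using w by (auto simp: C2_bounded_def)
      let ?a = "\<lambda>i. partial i w 0"
      have dom: "w y \<le> ((\<Sum>i\<in>UNIV. ?a i * \<psi> i y) + (B * c) * q y) + w 0" for y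
      proof (cases "norm y \<le> 1")
        case True
        have "\<bar>w (0 + y) - w 0 - directional y w 0\<bar> \<le> ?D\<^sup>2 * c * (norm y)\<^sup>2"
          by (rule taylor2_bound_ball[OF sm w2])
        moreover have "directional y w 0 = (\<Sum>i\<in>UNIV. ?a i * \<psi> i y)"
          using True by (simp add: directional_def \<psi>_def \<zeta> mult_ac)
        moreover have "?D\<^sup>2 * c * (norm y)\<^sup>2 \<le> (B * c) * q y"
        proof (rule mult_mono)
          show "?D\<^sup>2 * c \<le> B * c" using c by (intro mult_right_mono) (simp_all add: B_def)
          show "(norm y)\<^sup>2 \<le> q y" using q(3)[of y] True by (simp add: power_le_one)
        qed (use B c in auto)
        ultimately show ?thesis unfolding abs_le_iff by simp
      next
        case False
        have "\<bar>\<Sum>i\<in>UNIV. ?a i * \<psi> i y\<bar> \<le> (\<Sum>i\<in>(UNIV::'d set). c * 3)"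
          using w1 \<psi>3 c by (intro order_trans[OF sum_abs] sum_mono) (auto simp: abs_mult intro!: mult_mono)
        then have 1: "- (3 * ?D * c) \<le> (\<Sum>i\<in>UNIV. ?a i * \<psi> i y)"
          unfolding abs_le_iff by (simp add: mult_ac)
        have "1 \<le> q y" using q(3)[of y] False by (smt (verit) one_le_power)
        then have "B * c * 1 \<le> B * c * q y" using B c by (intro mult_left_mono) auto
        moreover have "B * c = 2 * c + 3 * ?D * c + ?D\<^sup>2 * c" by (simp add: B_def algebra_simps)
        moreover have "0 \<le> ?D\<^sup>2 * c" using c by simp
        moreover have "w y - w 0 \<le> 2 * c" using w0[of y] w0[of 0] by linarith
        ultimately show ?thesis using 1 by linarith
      qed
      have aC: "(\<lambda>y. ?a i * \<psi> i y) \<in> Cbuc" for i by (rule Cbuc_scale[OF \<psi>C(1)])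
      have sC: "(\<lambda>y. \<Sum>i\<in>UNIV. ?a i * \<psi> i y) \<in> Cbuc" by (intro Cbuc_sum aC) auto
      have bq: "(\<lambda>y. (B * c) * q y) \<in> Cbuc" by (rule Cbuc_scale[OF qC])
      have "E h w \<le> E h (\<lambda>y. (\<Sum>i\<in>UNIV. ?a i * \<psi> i y) + (B * c) * q y) + w 0"
        by (rule S.mono_const[OF C2_bounded_Cbuc[OF w] Cbuc_add[OF sC bq] dom])
      also have "E h (\<lambda>y. (\<Sum>i\<in>UNIV. ?a i * \<psi> i y) + (B * c) * q y)
          \<le> (\<Sum>i\<in>UNIV. E h (\<lambda>y. ?a i * \<psi> i y)) + E h (\<lambda>y. (B * c) * q y)"
        by (rule order_trans[OF S.subadditive[OF sC bq] add_right_mono[OF S.sum_le]]) (use aC in auto)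
      also have "(\<Sum>i\<in>UNIV. E h (\<lambda>y. ?a i * \<psi> i y)) \<le> (\<Sum>i\<in>UNIV. c * (max (\<bar>A (\<psi> i)\<bar> + 1) (\<bar>A (\<lambda>y. - \<psi> i y)\<bar> + 1) * h))"
      proof (rule sum_mono)
        fix i
        let ?m = "max (\<bar>A (\<psi> i)\<bar> + 1) (\<bar>A (\<lambda>y. - \<psi> i y)\<bar> + 1)"
        have m0: "0 \<le> ?m * h" using elim by (simp add: le_max_iff_disj)
        have "(\<bar>A (\<psi> i)\<bar> + 1) * h \<le> ?m * h" "(\<bar>A (\<lambda>y. - \<psi> i y)\<bar> + 1) * h \<le> ?m * h"
          using elim by (intro mult_right_mono; simp)+
        then have E: "E h (\<psi> i) \<le> ?m * h" "E h (\<lambda>y. - \<psi> i y) \<le> ?m * h"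
          using elim(1,2) by (auto intro: order_trans)
        show "E h (\<lambda>y. ?a i * \<psi> i y) \<le> c * (?m * h)"
        proof (cases "?a i \<ge> 0")
          case True
          then have "E h (\<lambda>y. ?a i * \<psi> i y) = ?a i * E h (\<psi> i)"
            by (intro S.pos_homogeneous \<psi>C)
          also have "\<dots> \<le> ?a i * (?m * h)" using True E by (intro mult_left_mono)
          also have "\<dots> \<le> c * (?m * h)" using w1[of i 0] m0 by (intro mult_right_mono) auto
          finally show ?thesis .
        next
          case False
          have "E h (\<lambda>y. ?a i * \<psi> i y) = E h (\<lambda>y. (- ?a i) * (- \<psi> i y))" by simp
          also have "\<dots> = - ?a i * E h (\<lambda>y. - \<psi> i y)"
            using False by (intro S.pos_homogeneous \<psi>C) simp
          also have "\<dots> \<le> - ?a i * (?m * h)" using False E by (intro mult_left_mono) auto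
          also have "\<dots> \<le> c * (?m * h)" using w1[of i 0] m0 by (intro mult_right_mono) auto
          finally show ?thesis .
        qed
      qed
      also have "\<dots> = P * c * h" by (simp add: P_def sum_distrib_left sum_distrib_right mult_ac)
      also have "E h (\<lambda>y. (B * c) * q y) \<le> (B * c) * (Pq * h)"
      proof -
        have "E h (\<lambda>y. (B * c) * q y) = (B * c) * E h q"
          using B c by (intro S.pos_homogeneous qC) simp
        moreover have "E h q \<le> Pq * h"
          using elim(3) S.add_const[OF Cc_infty_Cbuc[OF q(4)], of 1] by simp
        ultimately show ?thesis using B c by (simp add: mult_left_mono)
      qed
      finally show "E h w - w 0 \<le> (P + B * Pq) * c * h" by (simp add: algebra_simps)
    qed
  qed
  moreover have "0 \<le> P + B * Pq" using P B by (simp add: Pq_def)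
  ultimately show ?thesis using that by blast
qed

end

lemma C2_bounded_minus: "C2_bounded K f \<Longrightarrow> C2_bounded K (\<lambda>x. - f x)"
proof -
  assume f: "C2_bounded K f"
  then have s: "smooth f" by (simp add: C2_bounded_def)
  have p: "partial i (\<lambda>x. - g x) = (\<lambda>x. - partial i g x)" if "smooth g" for g i
    using partial_diff[OF smooth_const[of 0] that] by simp
  have "smooth (\<lambda>x. - f x)" using smooth_diff[OF smooth_const[of 0] s] by simp
  with f show ?thesis by (simp add: C2_bounded_def p s smooth_partial)
qed

text \<open>The difference is dominated by \<open>M * (1 - \<zeta>)\<close>, and
  \<open>e (1 - \<zeta>) = 1 + e (- \<zeta>)\<close> measures the mass beyond the cutoff. The second
  form is used because \<open>- \<zeta>\<close> can be taken as a test function.\<close>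

lemma cutoff_error:
  assumes e: "sublinear_functional e" and \<zeta>: "\<zeta> \<in> Cbuc" "\<And>x. \<zeta> x \<le> 1"
    and g: "g \<in> Cbuc" "(\<lambda>x. \<zeta> x * g x) \<in> Cbuc" "\<And>x. \<bar>g x\<bar> \<le> M" and M: "0 \<le> M"
  shows "\<bar>e g - e (\<lambda>x. \<zeta> x * g x)\<bar> \<le> M * (1 + e (\<lambda>x. - \<zeta> x))"
proof -
  interpret S: sublinear_expectation_space Cbuc e by fact
  have c: "(\<lambda>x. M * (1 - \<zeta> x)) \<in> Cbuc" by (intro Cbuc_scale Cbuc_diff Cbuc_const \<zeta>)
  have le: "\<bar>g x - \<zeta> x * g x\<bar> \<le> M * (1 - \<zeta> x)" for x
  proof -
    have "g x - \<zeta> x * g x = g x * (1 - \<zeta> x)" by (simp add: algebra_simps)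
    then have "\<bar>g x - \<zeta> x * g x\<bar> = \<bar>g x\<bar> * (1 - \<zeta> x)"
      using \<zeta>(2)[of x] by (simp add: abs_mult)
    with g(3)[of x] \<zeta>(2)[of x] show ?thesis by (simp add: mult_right_mono)
  qed
  have eq: "e (\<lambda>x. M * (1 - \<zeta> x)) = M * (1 + e (\<lambda>x. - \<zeta> x))"
    using S.pos_homogeneous[OF Cbuc_diff[OF Cbuc_const \<zeta>(1)] M, of 1] S.add_const[OF Cbuc_minus[OF \<zeta>(1)], of 1]
    by (simp add: add.commute)
  have "e g - e (\<lambda>x. \<zeta> x * g x) \<le> e (\<lambda>x. g x - \<zeta> x * g x)" by (rule S.diff_le[OF g(1,2)])
  also have "\<dots> \<le> e (\<lambda>x. M * (1 - \<zeta> x))"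
    by (intro S.monotone Cbuc_diff g c) (use le in \<open>auto simp: abs_le_iff\<close>)
  finally have 1: "e g - e (\<lambda>x. \<zeta> x * g x) \<le> M * (1 + e (\<lambda>x. - \<zeta> x))" unfolding eq .
  have "e (\<lambda>x. \<zeta> x * g x) - e g \<le> e (\<lambda>x. \<zeta> x * g x - g x)" by (rule S.diff_le[OF g(2,1)])
  also have "\<dots> \<le> e (\<lambda>x. M * (1 - \<zeta> x))"
  proof (intro S.monotone Cbuc_diff g c)
    show "\<zeta> x * g x - g x \<le> M * (1 - \<zeta> x)" for x using le[of x] by linarith
  qed
  finally have 2: "e (\<lambda>x. \<zeta> x * g x) - e g \<le> M * (1 + e (\<lambda>x. - \<zeta> x))" unfolding eq .
  from 1 2 show ?thesis by linarith
qed

text \<open>Arzela-Ascoli on a ball. Comparing with the member \<open>k N\<close> of the subsequence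
  instead of the limit keeps the reference function bounded and Lipschitz on the whole space, so
  that it can be mollified.\<close>

lemma lipschitz_subsequence:
  fixes u :: "nat \<Rightarrow> real ^ 'd::finite \<Rightarrow> real"
  assumes u: "\<And>n. lipschitz_bounded L M (u n)" and "\<kappa> > 0"
  obtains k :: "nat \<Rightarrow> nat" and N where "strict_mono k"
    "\<And>n x. n \<ge> N \<Longrightarrow> norm x \<le> R \<Longrightarrow> \<bar>u (k n) x - u (k N) x\<bar> \<le> \<kappa>"
proof -
  obtain g and k :: "nat \<Rightarrow> nat" where k: "strict_mono k" and
    g: "\<And>e. 0 < e \<Longrightarrow> \<exists>N. \<forall>n x. n \<ge> N \<and> x \<in> cball 0 R \<longrightarrow> norm (u (k n) x - g x) < e"
  proof (rule Arzela_Ascoli[of "cball (0 :: real ^ 'd) R" u M])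
    show "norm (u n x) \<le> M" for n x using u[of n] by (simp add: lipschitz_bounded_def)
    fix x :: "real ^ 'd" and e :: real assume "e > 0"
    show "\<exists>d>0. \<forall>n y. y \<in> cball 0 R \<and> norm (x - y) < d \<longrightarrow> norm (u n x - u n y) < e"
    proof (intro exI[of _ "e / (\<bar>L\<bar> + 1)"] conjI allI impI)
      fix n y assume "y \<in> cball 0 R \<and> norm (x - y) < e / (\<bar>L\<bar> + 1)"
      then have "norm (x - y) * (\<bar>L\<bar> + 1) < e" by (simp add: pos_less_divide_eq)
      moreover have "L * norm (x - y) \<le> norm (x - y) * (\<bar>L\<bar> + 1)"
        by (subst mult.commute) (intro mult_left_mono, auto)
      moreover have "\<bar>u n x - u n y\<bar> \<le> L * norm (x - y)" using u[of n] by (simp add: lipschitz_bounded_def dist_norm)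
      ultimately show "norm (u n x - u n y) < e" by simp
    qed (use \<open>e > 0\<close> in auto)
  qed auto
  obtain N where N: "\<And>n x. n \<ge> N \<Longrightarrow> x \<in> cball 0 R \<Longrightarrow> norm (u (k n) x - g x) < \<kappa> / 2"
    using g[of "\<kappa> / 2"] \<open>\<kappa> > 0\<close> by auto
  show ?thesis
  proof (rule that[OF k])
    fix n x assume "n \<ge> N" "norm (x :: real ^ 'd) \<le> R"
    then have "norm (u (k n) x - g x) < \<kappa> / 2" "norm (u (k N) x - g x) < \<kappa> / 2"
      by (intro N; simp)+
    then show "\<bar>u (k n) x - u (k N) x\<bar> \<le> \<kappa>"
      unfolding real_norm_def by linarith
  qed
qed

text \<open>Tightness in terms of the generator alone: \<open>A (- \<zeta>)\<close> is the initial
  rate at which \<open>1 - \<zeta>\<close>, zero at the origin, gains expectation, that is, the rate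
  of jumps beyond the cutoff.\<close>

locale two_generated_families = E: generated_family E A + E': generated_family E' A
  for E E' :: "real \<Rightarrow> (real ^ 'd::finite \<Rightarrow> real) \<Rightarrow> real" and A :: "(real ^ 'd \<Rightarrow> real) \<Rightarrow> real" +
  assumes tight: "\<eta> > 0 \<Longrightarrow> \<exists>\<zeta>\<in>Cc_infty. (\<forall>x. 0 \<le> \<zeta> x \<and> \<zeta> x \<le> 1) \<and> \<zeta> 0 = 1 \<and> A (\<lambda>x. - \<zeta> x) \<le> \<eta>"
begin

text \<open>The compactness argument: mollifications of uniformly Lipschitz functions are precompact in \<open>C\<^sup>2\<close> on
  bounded sets, so pointwise convergence of the difference quotients is uniform over them.\<close>

lemma uniformly_close:
  assumes \<rho>: "mollifier r \<rho>" and M: "0 \<le> M" and \<eta>: "\<eta> > 0"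
  shows "\<exists>h0>0. \<forall>h. 0 < h \<longrightarrow> h < h0 \<longrightarrow>
    (\<forall>u. lipschitz_bounded L M u \<longrightarrow> \<bar>E h (convolve \<rho> u) - E' h (convolve \<rho> u)\<bar> \<le> \<eta> * h)"
proof (rule ccontr)
  assume "\<not> ?thesis"
  then have bad: "\<exists>h u. 0 < h \<and> h < h0 \<and> lipschitz_bounded L M u \<and> \<eta> * h < \<bar>E h (convolve \<rho> u) - E' h (convolve \<rho> u)\<bar>"
    if "h0 > 0" for h0
    using that by (meson not_le)
  have "\<forall>n. \<exists>h u. 0 < h \<and> h < 1 / real (Suc n) \<and> lipschitz_bounded L M u \<and> \<eta> * h < \<bar>E h (convolve \<rho> u) - E' h (convolve \<rho> u)\<bar>"
    using bad by simp
  then obtain h u where h: "\<And>n. 0 < h n" "\<And>n. h n < 1 / real (Suc n)" and u: "\<And>n. lipschitz_bounded L M (u n)"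
    and viol: "\<And>n. \<eta> * h n < \<bar>E (h n) (convolve \<rho> (u n)) - E' (h n) (convolve \<rho> (u n))\<bar>"
    by metis
  have hlim: "h \<longlonglongrightarrow> 0"
  proof (rule tendsto_sandwich[where f = "\<lambda>_. 0" and h = "\<lambda>n. 1 / real (Suc n)"])
    show "(\<lambda>n. 1 / real (Suc n)) \<longlonglongrightarrow> 0" by (rule LIMSEQ_Suc[OF lim_1_over_n])
    show "(\<lambda>_. 0::real) \<longlonglongrightarrow> 0" by simp
  qed (use h in \<open>auto simp: less_imp_le intro!: always_eventually\<close>)
  note \<rho>D = mollifierD[OF \<rho>]
  \<comment> \<open>The two cutoff errors, at most \<open>2 * M * \<kappa>1 * h\<close> each, take
    together at most \<open>\<eta> / 4 * h\<close> of the budget.\<close>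
  define \<kappa>1 where "\<kappa>1 = \<eta> / (16 * (M + 1))"
  have \<kappa>1: "\<kappa>1 > 0" using \<eta> M by (simp add: \<kappa>1_def)
  obtain \<zeta> where \<zeta>: "\<zeta> \<in> Cc_infty" "\<And>x. 0 \<le> \<zeta> x" "\<And>x. \<zeta> x \<le> 1" "\<zeta> 0 = 1" "A (\<lambda>x. - \<zeta> x) \<le> \<kappa>1"
    using tight[OF \<kappa>1] by blast
  have m\<zeta>: "(\<lambda>x. - \<zeta> x) \<in> Cc_infty" using Cc_infty_mult[OF smooth_const \<zeta>(1), of "-1"] by simp
  obtain K where K: "C3_bounded K \<zeta>" using Cc_infty_C3[OF \<zeta>(1)] .
  obtain R where R: "\<And>x. norm x > R \<Longrightarrow> \<zeta> x = 0" using \<zeta>(1) by (auto simp: Cc_infty_iff)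
  obtain C where C: "C \<ge> 0" and Cb:
    "\<And>(u :: real ^ 'd \<Rightarrow> real) x m M. u \<in> borel_measurable borel \<Longrightarrow> (\<And>y. \<bar>u y\<bar> \<le> M) \<Longrightarrow>
      (\<And>y. norm (x - y) \<le> r \<Longrightarrow> \<bar>u y\<bar> \<le> m) \<Longrightarrow> 0 \<le> m \<Longrightarrow>
      \<bar>convolve \<rho> u x\<bar> \<le> C * m \<and> (\<forall>i. \<bar>partial i (convolve \<rho> u) x\<bar> \<le> C * m) \<and>
      (\<forall>i j. \<bar>partial i (partial j (convolve \<rho> u)) x\<bar> \<le> C * m) \<and>
      (\<forall>i j k. \<bar>partial i (partial j (partial k (convolve \<rho> u))) x\<bar> \<le> C * m)"
    using mollified_local_bounds[OF \<rho>] by blast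
  obtain G where G: "0 \<le> G" "\<forall>\<^sub>F h in at_right 0. \<forall>c w. 0 \<le> c \<longrightarrow> C2_bounded c w \<longrightarrow> E h w - w 0 \<le> G * c * h"
    using E.C2_growth by blast
  obtain G' where G': "0 \<le> G'" "\<forall>\<^sub>F h in at_right 0. \<forall>c w. 0 \<le> c \<longrightarrow> C2_bounded c w \<longrightarrow> E' h w - w 0 \<le> G' * c * h"
    using E'.C2_growth by blast
  have K0: "0 \<le> K" using C3_boundedD[OF K] by simp
  define T where "T = 4 * K * C * (G + G')"
  have T: "0 \<le> T" using K0 C G G' by (simp add: T_def)
  \<comment> \<open>With closeness \<open>\<kappa>\<close> on the ball, the growth estimates of both
    families together contribute at most \<open>\<eta> / 8 * h\<close>.\<close>
  define \<kappa> where "\<kappa> = \<eta> / (8 * (T + 1))"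
  have \<kappa>: "\<kappa> > 0" using \<eta> T by (simp add: \<kappa>_def)
  have T\<kappa>: "T * \<kappa> \<le> \<eta> / 8"
  proof -
    have "T * \<kappa> \<le> (T + 1) * \<kappa>" using \<kappa> by (intro mult_right_mono) auto
    also have "\<dots> = \<eta> / 8" unfolding \<kappa>_def using T by (intro mult_divide_cancel) simp
    finally show ?thesis .
  qed
  \<comment> \<open>The radius is \<open>R + r\<close> because on the support of
    \<open>\<zeta>\<close> the mollified function sees \<open>u\<close> up to distance
    \<open>r\<close> further out.\<close>
  obtain k :: "nat \<Rightarrow> nat" and N where k: "strict_mono k" and
    N: "\<And>n x. n \<ge> N \<Longrightarrow> norm x \<le> R + r \<Longrightarrow> \<bar>u (k n) x - u (k N) x\<bar> \<le> \<kappa>"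
  proof (rule lipschitz_subsequence[where u = u and R = "R + r", OF _ \<kappa>])
    show "lipschitz_bounded L M (u n)" for n by (rule u)
    fix k :: "nat \<Rightarrow> nat" and N
    assume "strict_mono k" and *: "\<And>n x. n \<ge> N \<Longrightarrow> norm x \<le> R + r \<Longrightarrow> \<bar>u (k n) x - u (k N) x\<bar> \<le> \<kappa>"
    show thesis by (rule that[of k N]) (fact \<open>strict_mono k\<close>, rule *)
  qed
  define g where "g n = convolve \<rho> (u (k n))" for n
  define f where "f n x = \<zeta> x * g n x" for n x
  note uC = lipschitz_bounded_Cbuc[OF u]
  have uM: "\<bar>u n y\<bar> \<le> M" for n y using u[of n] by (simp add: lipschitz_bounded_def)
  have sg: "smooth (g n)" for n
    unfolding g_def by (rule smooth_convolve[OF \<rho>D(1) Cbuc_measurable[OF uC] uM])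
  have gC: "g n \<in> Cbuc" for n
    using convolve_C3_bounded[OF \<rho> uC[of "k n"]] C3_bounded_Cbuc unfolding g_def by metis
  have gM: "\<bar>g n x\<bar> \<le> M" for n x
    using convolve_const_on[OF \<rho> Cbuc_measurable[OF uC[of "k n"]], of x 0 M M] uM by (simp add: g_def)
  have fCc: "f n \<in> Cc_infty" for n
    unfolding f_def[abs_def] using Cc_infty_mult[OF sg \<zeta>(1)] by (simp add: mult.commute)
  note fC = Cc_infty_Cbuc[OF fCc]
  define c where "c = 4 * K * (C * \<kappa>)"
  have c: "0 \<le> c" using K0 C \<kappa> by (simp add: c_def)
  have w: "C2_bounded c (\<lambda>x. f n x - f N x)" if n: "n \<ge> N" for n
  proof -
    define v where "v = (\<lambda>y. u (k n) y - u (k N) y)"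
    have vC: "v \<in> Cbuc" unfolding v_def by (rule Cbuc_diff[OF uC uC])
    have vM: "\<bar>v y\<bar> \<le> 2 * M" for y using uM[of "k n" y] uM[of "k N" y] unfolding v_def by linarith
    have b: "\<bar>convolve \<rho> v x\<bar> \<le> C * \<kappa> \<and> (\<forall>i. \<bar>partial i (convolve \<rho> v) x\<bar> \<le> C * \<kappa>) \<and>
      (\<forall>i j. \<bar>partial i (partial j (convolve \<rho> v)) x\<bar> \<le> C * \<kappa>)" if x: "norm x \<le> R" for x
    proof -
      have "\<bar>v y\<bar> \<le> \<kappa>" if "norm (x - y) \<le> r" for y
      proof -
        have "norm y \<le> R + r" using x that norm_triangle_ineq3[of x y] by linarith
        from N[OF n this] show ?thesis by (simp add: v_def)
      qed
      from Cb[OF Cbuc_measurable[OF vC] vM this] \<kappa> show ?thesis by auto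
    qed
    have "C2_bounded (4 * K * (C * \<kappa>)) (\<lambda>x. \<zeta> x * convolve \<rho> v x)"
      by (rule C2_bounded_mult[OF K R smooth_convolve[OF \<rho>D(1) Cbuc_measurable[OF vC] vM]])
         (use b C \<kappa> in auto)
    moreover have "(\<lambda>x. \<zeta> x * convolve \<rho> v x) = (\<lambda>x. f n x - f N x)"
      by (simp add: f_def g_def v_def convolve_diff[OF \<rho>D(1) uC uC] right_diff_distrib)
    ultimately show ?thesis by (simp add: c_def)
  qed
  \<comment> \<open>Pointwise convergence is used for the single function \<open>f N\<close>, on
    which both families have the same generator.\<close>
  have quad: "\<forall>\<^sub>F h in at_right 0. \<bar>E h (f N) - E' h (f N)\<bar> \<le> \<eta> / 4 * h"
  proof -
    have "((\<lambda>h. (E h (f N) - f N 0) / h - (E' h (f N) - f N 0) / h) \<longlongrightarrow> A (f N) - A (f N)) (at_right 0)"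
      by (intro tendsto_diff E.generator E'.generator fCc)
    then have "((\<lambda>h. (E h (f N) - f N 0) / h - (E' h (f N) - f N 0) / h) \<longlongrightarrow> 0) (at_right 0)" by simp
    from tendstoD[OF this, of "\<eta> / 4"] \<eta>
    have "\<forall>\<^sub>F h in at_right 0. dist ((E h (f N) - f N 0) / h - (E' h (f N) - f N 0) / h) 0 < \<eta> / 4"
      by (simp only: divide_pos_pos zero_less_numeral)
    then have "\<forall>\<^sub>F h in at_right 0. \<bar>(E h (f N) - f N 0) / h - (E' h (f N) - f N 0) / h\<bar> < \<eta> / 4"
      unfolding dist_real_def diff_0_right .
    moreover have "\<forall>\<^sub>F h in at_right (0::real). h > 0" by (simp add: eventually_at_filter)
    ultimately show ?thesis
    proof eventually_elim
      case (elim h)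
      have "(E h (f N) - f N 0) / h - (E' h (f N) - f N 0) / h = (E h (f N) - E' h (f N)) / h"
        by (simp add: diff_divide_distrib)
      with elim show ?case by (simp add: divide_less_eq)
    qed
  qed
  have cut: "\<forall>\<^sub>F h in at_right 0. 1 + F h (\<lambda>x. - \<zeta> x) \<le> 2 * \<kappa>1 * h"
    if F: "generated_family F A" for F
  proof -
    have "((\<lambda>h. (F h (\<lambda>x. - \<zeta> x) - - \<zeta> 0) / h) \<longlongrightarrow> A (\<lambda>x. - \<zeta> x)) (at_right 0)"
      by (rule generated_family.generator[OF F m\<zeta>])
    then have "\<forall>\<^sub>F h in at_right 0. (F h (\<lambda>x. - \<zeta> x) - - \<zeta> 0) / h < 2 * \<kappa>1"
      by (rule order_tendstoD(2)) (use \<zeta>(5) \<kappa>1 in linarith)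
    moreover have "\<forall>\<^sub>F h in at_right (0::real). h > 0" by (simp add: eventually_at_filter)
    ultimately show ?thesis
      by eventually_elim (simp add: divide_less_eq \<zeta>(4))
  qed
  have pos: "\<forall>\<^sub>F h in at_right (0::real). h > 0" by (simp add: eventually_at_filter)
  have "\<forall>\<^sub>F h in at_right 0. \<forall>n\<ge>N. \<bar>E h (g n) - E' h (g n)\<bar> \<le> \<eta> * h"
    using G(2) G'(2) quad cut[OF E.generated_family_axioms] cut[OF E'.generated_family_axioms] pos
  proof eventually_elim
    case (elim h)
    \<comment> \<open>The increment \<open>f n 0 - f N 0\<close> is the same for both families and
      drops out of their difference. In units of \<open>\<eta> * h\<close> the total is
      \<open>1 / 4\<close> for \<open>f N\<close>, \<open>1 / 8\<close> for growth and
      \<open>1 / 4\<close> for the two cutoffs.\<close>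
    have part: "\<bar>F (f n) - F (f N) - (f n 0 - f N 0)\<bar> \<le> Gx * c * h \<and> \<bar>F (g n) - F (f n)\<bar> \<le> M * (2 * \<kappa>1 * h)"
      if F: "sublinear_functional F" and gr: "\<forall>c w. 0 \<le> c \<longrightarrow> C2_bounded c w \<longrightarrow> F w - w 0 \<le> Gx * c * h"
        and ct: "1 + F (\<lambda>x. - \<zeta> x) \<le> 2 * \<kappa>1 * h" and n: "n \<ge> N" for F Gx n
    proof
      interpret S: sublinear_expectation_space Cbuc F by fact
      have "F (f n) - F (f N) \<le> F (\<lambda>x. f n x - f N x)" by (rule S.diff_le[OF fC fC])
      also have "\<dots> \<le> (f n 0 - f N 0) + Gx * c * h" using gr c w[OF n] by fastforce
      finally have 1: "F (f n) - F (f N) - (f n 0 - f N 0) \<le> Gx * c * h" by simp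
      have "F (f N) - F (f n) \<le> F (\<lambda>x. f N x - f n x)" by (rule S.diff_le[OF fC fC])
      also have "\<dots> \<le> (f N 0 - f n 0) + Gx * c * h" using gr c C2_bounded_minus[OF w[OF n]] by fastforce
      finally have 2: "F (f N) - F (f n) - (f N 0 - f n 0) \<le> Gx * c * h" by simp
      from 1 2 show "\<bar>F (f n) - F (f N) - (f n 0 - f N 0)\<bar> \<le> Gx * c * h" by linarith
      have "\<bar>F (g n) - F (f n)\<bar> \<le> M * (1 + F (\<lambda>x. - \<zeta> x))"
        unfolding f_def[abs_def] by (rule cutoff_error[OF F Cc_infty_Cbuc[OF \<zeta>(1)] \<zeta>(3) gC _ gM M])
          (use fC in \<open>simp add: f_def[abs_def]\<close>)
      also have "\<dots> \<le> M * (2 * \<kappa>1 * h)" using ct M by (rule mult_left_mono)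
      finally show "\<bar>F (g n) - F (f n)\<bar> \<le> M * (2 * \<kappa>1 * h)" .
    qed
    have M\<kappa>: "M * (2 * \<kappa>1 * h) \<le> \<eta> / 8 * h"
    proof -
      have "M * \<kappa>1 \<le> (M + 1) * \<kappa>1" using \<kappa>1 by (intro mult_right_mono) auto
      also have "\<dots> = \<eta> / 16" unfolding \<kappa>1_def using M by (intro mult_divide_cancel) simp
      finally have "(2 * (M * \<kappa>1)) * h \<le> (2 * (\<eta> / 16)) * h" using elim by (intro mult_right_mono) auto
      then show ?thesis by (simp add: mult_ac)
    qed
    have Gc: "G * c * h + G' * c * h \<le> \<eta> / 8 * h"
    proof -
      have "G * c * h + G' * c * h = (T * \<kappa>) * h" by (simp add: c_def T_def algebra_simps)
      also have "\<dots> \<le> \<eta> / 8 * h" using T\<kappa> elim by (intro mult_right_mono) auto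
      finally show ?thesis .
    qed
    have S: "sublinear_functional (E h)" "sublinear_functional (E' h)"
      using elim by (auto intro!: E.sublinear E'.sublinear)
    have \<eta>h: "0 < \<eta> * h" using \<eta> elim by simp
    show ?case
    proof (intro allI impI)
      fix n assume n: "n \<ge> N"
      from part[OF S(1) elim(1) elim(4) n] part[OF S(2) elim(2) elim(5) n] elim(3) M\<kappa> Gc \<eta>h
      show "\<bar>E h (g n) - E' h (g n)\<bar> \<le> \<eta> * h" by linarith
    qed
  qed
  moreover have "filterlim (\<lambda>n. h (k n)) (at_right 0) sequentially"
  proof -
    have "(\<lambda>n. h (k n)) \<longlonglongrightarrow> 0"
      using LIMSEQ_subseq_LIMSEQ[OF hlim k] by (simp add: o_def)
    then show ?thesis
      by (rule tendsto_imp_filterlim_at_right) (use h in auto)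
  qed
  ultimately have "\<forall>\<^sub>F m in sequentially. \<forall>n\<ge>N. \<bar>E (h (k m)) (g n) - E' (h (k m)) (g n)\<bar> \<le> \<eta> * h (k m)"
    by (rule eventually_compose_filterlim)
  then obtain m0 where "\<And>m n. m \<ge> m0 \<Longrightarrow> n \<ge> N \<Longrightarrow> \<bar>E (h (k m)) (g n) - E' (h (k m)) (g n)\<bar> \<le> \<eta> * h (k m)"
    by (auto simp: eventually_sequentially)
  \<comment> \<open>The same index is used for the time and for the function, which is where the
    assumed violation sits.\<close>
  from this[of "max m0 N" "max m0 N"] viol[of "k (max m0 N)"] show False
    by (simp add: g_def)
qed

text \<open>\<open>t\<close> is divided into \<open>n\<close> equal steps shorter than
  \<open>h0\<close>; the comparison of schemes adds the local errors \<open>\<eta> * h\<close> up to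
  \<open>\<eta> * t\<close>.\<close>

theorem families_eq:
  assumes pow: "\<And>n h f. n \<ge> 1 \<Longrightarrow> h > 0 \<Longrightarrow> f \<in> Cbuc \<Longrightarrow> E (real n * h) f = (shift_op (E h) ^^ n) f 0"
    and pow': "\<And>n h f. n \<ge> 1 \<Longrightarrow> h > 0 \<Longrightarrow> f \<in> Cbuc \<Longrightarrow> E' (real n * h) f = (shift_op (E' h) ^^ n) f 0"
    and t: "t > 0" and f: "f \<in> Cbuc"
  shows "E t f = E' t f"
proof -
  interpret S: sublinear_expectation_space Cbuc "E t" by (rule E.sublinear) (use t in simp)
  interpret S': sublinear_expectation_space Cbuc "E' t" by (rule E'.sublinear) (use t in simp)
  have lip: "\<bar>E t u - E' t u\<bar> \<le> 0 + \<epsilon>" if u: "lipschitz_bounded L M u" and \<epsilon>: "\<epsilon> > 0" for L M u \<epsilon>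
  proof -
    define r where "r = \<epsilon> / (4 * (\<bar>L\<bar> + 1))"
    have r: "r > 0" using \<epsilon> by (simp add: r_def)
    have "\<bar>L\<bar> * r \<le> (\<bar>L\<bar> + 1) * r" using r by (intro mult_right_mono) auto
    also have "\<dots> = \<epsilon> / 4" unfolding r_def by (rule mult_divide_cancel) simp
    finally have Lr: "\<bar>L\<bar> * r \<le> \<epsilon> / 4" .
    obtain \<rho> :: "real ^ 'd \<Rightarrow> real" where \<rho>: "mollifier r \<rho>" using mollifier_exists[OF r] .
    have M0: "0 \<le> M" using u unfolding lipschitz_bounded_def by (meson abs_ge_zero order_trans)
    define \<eta> where "\<eta> = \<epsilon> / (2 * t)"
    have \<eta>: "\<eta> > 0" using \<epsilon> t by (simp add: \<eta>_def)
    obtain h0 where h0: "h0 > 0" and close: "\<And>h v. 0 < h \<Longrightarrow> h < h0 \<Longrightarrow> lipschitz_bounded L M v \<Longrightarrow>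
        \<bar>E h (convolve \<rho> v) - E' h (convolve \<rho> v)\<bar> \<le> \<eta> * h"
      using uniformly_close[OF \<rho> M0 \<eta>, of L] by blast
    obtain n :: nat where n: "t / h0 < real n" using reals_Archimedean2 by blast
    then have n0: "n \<ge> 1" using h0 t by (cases n) (auto simp: divide_less_0_iff not_less)
    define h where "h = t / real n"
    have h: "0 < h" "h < h0" "real n * h = t"
      using n n0 h0 t by (auto simp: h_def field_simps)
    note uC = lipschitz_bounded_Cbuc[OF u]
    have sub: "sublinear_functional (E h)" "sublinear_functional (E' h)"
      using h by (auto intro!: E.sublinear E'.sublinear)
    have c1: "E' h (convolve \<rho> v) \<le> E h (convolve \<rho> v) + \<eta> * h"
      and c2: "E h (convolve \<rho> v) \<le> E' h (convolve \<rho> v) + \<eta> * h" if "lipschitz_bounded L M v" for v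
      using close[OF h(1,2) that] by linarith+
    have "(shift_op (E' h) ^^ n) u 0 \<le> (shift_op (E h) ^^ n) u 0 + 2 * (\<bar>L\<bar> * r) + real n * (\<eta> * h)"
      by (rule scheme_comparison[OF \<rho> sub u]) (rule c1)
    moreover have "(shift_op (E h) ^^ n) u 0 \<le> (shift_op (E' h) ^^ n) u 0 + 2 * (\<bar>L\<bar> * r) + real n * (\<eta> * h)"
      by (rule scheme_comparison[OF \<rho> sub(2,1) u]) (rule c2)
    moreover have "real n * (\<eta> * h) = \<epsilon> / 2"
      using h(3) t by (simp add: \<eta>_def mult.left_commute)
    moreover have "E t u = (shift_op (E h) ^^ n) u 0" "E' t u = (shift_op (E' h) ^^ n) u 0"
      using pow[OF n0 h(1) uC] pow'[OF n0 h(1) uC] h(3) by auto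
    ultimately show ?thesis using Lr by linarith
  qed
  have "\<bar>E t f - E' t f\<bar> \<le> 0 + \<epsilon>" if "\<epsilon> > 0" for \<epsilon>
  proof -
    obtain L M u where u: "lipschitz_bounded L M u" "\<And>x. \<bar>f x - u x\<bar> \<le> \<epsilon> / 2"
      using Cbuc_lipschitz_approx[OF f, of "\<epsilon> / 2"] \<open>\<epsilon> > 0\<close> by auto
    have "\<bar>E t u - E' t u\<bar> \<le> 0"
      by (rule field_le_epsilon) (rule lip[OF u(1)])
    moreover have "\<bar>E t f - E t u\<bar> \<le> \<epsilon> / 2" "\<bar>E' t f - E' t u\<bar> \<le> \<epsilon> / 2"
      by (intro S.abs_diff_le S'.abs_diff_le f lipschitz_bounded_Cbuc[OF u(1)] u(2))+
    ultimately show ?thesis by linarith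
  qed
  from field_le_epsilon[OF this] show ?thesis by simp
qed

end

section \<open>Uniqueness\<close>

context sublinear_levy_process
begin

definition law :: "real \<Rightarrow> (real ^ 'd \<Rightarrow> real) \<Rightarrow> real" where
  "law t f = \<E> (\<lambda>\<omega>. f (X t \<omega>))"

lemma value_mem: "t \<ge> 0 \<Longrightarrow> f \<in> Cbuc \<Longrightarrow> (\<lambda>\<omega>. f (X t \<omega>)) \<in> H"
  using adapted by (simp add: adapted_def)

lemma increment_mem: "0 \<le> s \<Longrightarrow> s \<le> t \<Longrightarrow> f \<in> Cbuc \<Longrightarrow> (\<lambda>\<omega>. f (X t \<omega> - X s \<omega>)) \<in> H"
  using stationary_increments by (simp add: eq_in_law_def adapted_def)

lemma increment_law: "0 \<le> s \<Longrightarrow> s \<le> t \<Longrightarrow> f \<in> Cbuc \<Longrightarrow> \<E> (\<lambda>\<omega>. f (X t \<omega> - X s \<omega>)) = law (t - s) f"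
  using stationary_increments by (simp add: eq_in_law_def law_def)

lemma law_0: "f \<in> Cbuc \<Longrightarrow> law 0 f = f 0"
  using start by (simp add: eq_in_law_def law_def const_preserving)

lemma sublinear_law: "t \<ge> 0 \<Longrightarrow> sublinear_functional (law t)"
  by unfold_locales
     (auto simp: law_def Cbuc_add Cbuc_scale const_preserving intro!: value_mem subadditive pos_homogeneous monotone)

text \<open>The inner expectation over the last increment depends on its law only, and by
  stationarity that is the law of the process at time \<open>t (Suc k) - t k\<close>.\<close>

lemma increments_expectation_Suc:
  assumes t: "t 0 = 0" "\<And>i. i < Suc k \<Longrightarrow> t i < t (Suc i)" and k: "1 \<le> k" and \<phi>: "\<phi> \<in> Cbuc_tuples (Suc k)"
  defines "Y \<equiv> \<lambda>\<omega>. map (\<lambda>i. X (t (Suc i)) \<omega> - X (t i) \<omega>) [0..<k]"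
  shows "(\<lambda>\<omega>. \<phi> (Y \<omega> @ [X (t (Suc k)) \<omega> - X (t k) \<omega>])) \<in> H"
    and "\<E> (\<lambda>\<omega>. \<phi> (Y \<omega> @ [X (t (Suc k)) \<omega> - X (t k) \<omega>]))
      = \<E> (\<lambda>\<omega>. law (t (Suc k) - t k) (\<lambda>z. \<phi> (Y \<omega> @ [z])))"
proof -
  have "indep_seq H \<E> (Suc k) (\<lambda>i \<omega>. X (t (Suc i)) \<omega> - X (t i) \<omega>)"
    by (rule indep_increments) (use t in auto)
  then have "indep_pair H \<E> k Y (\<lambda>\<omega>. X (t (Suc k)) \<omega> - X (t k) \<omega>)"
    using k unfolding indep_seq_def Y_def by simp
  then have *: "(\<lambda>\<omega>. \<phi> (Y \<omega> @ [X (t (Suc k)) \<omega> - X (t k) \<omega>])) \<in> H"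
    "\<E> (\<lambda>\<omega>. \<phi> (Y \<omega> @ [X (t (Suc k)) \<omega> - X (t k) \<omega>]))
      = \<E> (\<lambda>\<omega>. \<E> (\<lambda>\<omega>'. \<phi> (Y \<omega> @ [X (t (Suc k)) \<omega>' - X (t k) \<omega>'])))"
    using \<phi> unfolding indep_pair_def by auto
  show "(\<lambda>\<omega>. \<phi> (Y \<omega> @ [X (t (Suc k)) \<omega> - X (t k) \<omega>])) \<in> H" by (rule *)
  have pos: "0 \<le> t i" if "i \<le> k" for i
    using that
  proof (induction i)
    case (Suc i)
    then show ?case using t(2)[of i] by simp
  qed (simp add: t)
  have "\<E> (\<lambda>\<omega>'. \<phi> (Y \<omega> @ [X (t (Suc k)) \<omega>' - X (t k) \<omega>'])) = law (t (Suc k) - t k) (\<lambda>z. \<phi> (Y \<omega> @ [z]))" for \<omega>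
    using t(2)[of k] pos[of k] by (intro increment_law Cbuc_tuples_section[OF \<phi>]) (auto simp: Y_def)
  then show "\<E> (\<lambda>\<omega>. \<phi> (Y \<omega> @ [X (t (Suc k)) \<omega> - X (t k) \<omega>]))
      = \<E> (\<lambda>\<omega>. law (t (Suc k) - t k) (\<lambda>z. \<phi> (Y \<omega> @ [z])))"
    using * by simp
qed

lemma sum_two_Cbuc_tuples:
  assumes f: "f \<in> Cbuc"
  shows "(\<lambda>xs :: (real ^ 'd) list. f (xs ! 0 + xs ! 1)) \<in> Cbuc_tuples (Suc 1)"
proof -
  obtain M where M: "\<And>x. \<bar>f x\<bar> \<le> M" using Cbuc_bounded[OF f] by blast
  show ?thesis
  proof (rule Cbuc_tuplesI[OF M])
    fix e :: real assume "e > 0"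
    then obtain d where d: "d > 0" "\<And>x y. dist x y < d \<Longrightarrow> \<bar>f x - f y\<bar> \<le> e"
      using Cbuc_modulus[OF f] by blast
    show "\<exists>d>0. \<forall>xs ys. length xs = Suc 1 \<longrightarrow> length ys = Suc 1 \<longrightarrow> (\<forall>i<Suc 1. dist (xs ! i) (ys ! i) < d) \<longrightarrow>
        \<bar>f (xs ! 0 + xs ! 1) - f (ys ! 0 + ys ! 1)\<bar> \<le> e"
    proof (intro exI[of _ "d / 2"] conjI allI impI d(2))
      fix xs ys :: "(real ^ 'd) list" assume "\<forall>i<Suc 1. dist (xs ! i) (ys ! i) < d / 2"
      then have "dist (xs ! 0) (ys ! 0) < d / 2" "dist (xs ! 1) (ys ! 1) < d / 2" by auto
      then show "dist (xs ! 0 + xs ! 1) (ys ! 0 + ys ! 1) < d"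
        using dist_triangle_add[of "xs ! 0" "xs ! 1" "ys ! 0" "ys ! 1"] by linarith
    qed (use d in simp)
  qed
qed

text \<open>Independence of the increments over \<open>[0, s]\<close> and \<open>[s, s + t]\<close>,
  tested on their sum. Working with increments from time zero, which by stationarity have the laws
  of the values, circumvents that \<open>X 0\<close> vanishes only in law.\<close>

lemma law_semigroup:
  assumes f: "f \<in> Cbuc" and s: "s > 0" and t: "t > 0"
  shows "law (s + t) f = law s (shift_op (law t) f)"
proof -
  define \<tau> :: "nat \<Rightarrow> real" where "\<tau> i = (if i = 0 then 0 else if i = 1 then s else s + t)" for i
  have \<tau>: "\<tau> 0 = 0" "\<tau> (Suc 0) = s" "\<tau> (Suc (Suc 0)) = s + t" by (auto simp: \<tau>_def)
  have mono: "\<tau> i < \<tau> (Suc i)" if "i < Suc 1" for i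
    using that s t by (auto simp: \<tau>_def less_Suc_eq)
  have C: "shift_op (law t) f \<in> Cbuc" by (rule shift_op_Cbuc[OF sublinear_law f]) (use t in simp)
  from increments_expectation_Suc(2)[OF \<tau>(1) mono _ sum_two_Cbuc_tuples[OF f]]
  have "\<E> (\<lambda>\<omega>. f ((X s \<omega> - X 0 \<omega>) + (X (s + t) \<omega> - X s \<omega>)))
      = \<E> (\<lambda>\<omega>. law t (\<lambda>z. f ((X s \<omega> - X 0 \<omega>) + z)))"
    by (simp add: \<tau>)
  then have "\<E> (\<lambda>\<omega>. f (X (s + t) \<omega> - X 0 \<omega>)) = \<E> (\<lambda>\<omega>. shift_op (law t) f (X s \<omega> - X 0 \<omega>))"
    by (simp add: shift_op_def)
  then show ?thesis
    using increment_law[of 0 "s + t", OF _ _ f] increment_law[of 0 s, OF _ _ C] s t by simp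
qed

text \<open>Induction with \<open>f\<close> arbitrary, because after the first step the remaining
  ones act on all translates of \<open>f\<close>.\<close>

lemma law_power:
  assumes h: "h > 0" and "n \<ge> 1"
  shows "f \<in> Cbuc \<Longrightarrow> law (real n * h) f = (shift_op (law h) ^^ n) f 0"
  using assms(2)
proof (induction n arbitrary: f rule: dec_induct)
  case base
  then show ?case by (simp add: shift_op_0)
next
  case (step n)
  have sl: "sublinear_functional (law h)" by (rule sublinear_law) (use h in simp)
  have "law (h + real n * h) f = law h (shift_op (law (real n * h)) f)"
    using step h by (intro law_semigroup) auto
  also have "shift_op (law (real n * h)) f = (shift_op (law h) ^^ n) f"
  proof
    fix x
    have "shift_op (law (real n * h)) f x = (shift_op (law h) ^^ n) (\<lambda>y. f (x + y)) 0"
      unfolding shift_op_def[of "law (real n * h)"] by (rule step.IH[OF Cbuc_translate[OF step.prems]])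
    then show "shift_op (law (real n * h)) f x = (shift_op (law h) ^^ n) f x"
      by (simp add: shift_op_power_translate)
  qed
  finally show ?case by (simp add: shift_op_0 algebra_simps)
qed

lemma law_generated_family:
  assumes "has_characteristics \<E> X I b Q \<nu>"
  shows "generated_family law (\<lambda>f. generator \<E> X f 0)"
proof (rule generated_family.intro)
  show "sublinear_functional (law t)" if "t \<ge> 0" for t by (rule sublinear_law[OF that])
  fix f :: "real ^ 'd \<Rightarrow> real" assume f: "f \<in> Cc_infty"
  then obtain g where g: "generator_rel \<E> X f g"
    using assms by (auto simp: has_characteristics_def generator_domain_def)
  then have "((\<lambda>t. (levy_semigroup \<E> X t f 0 - f 0) / t) \<longlongrightarrow> g 0) (at_right 0)"
    by (simp add: generator_rel_def)
  then show "((\<lambda>h. (law h f - f 0) / h) \<longlongrightarrow> generator \<E> X f 0) (at_right 0)"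
    by (simp add: generator_eqI[OF g] levy_semigroup_def law_def)
qed

end

lemma generator_eq_of_characteristics:
  assumes "has_characteristics \<E> X I b Q \<nu>" "has_characteristics \<E>' Y I b Q \<nu>" "f \<in> Cc_infty"
  shows "generator \<E> X f x = generator \<E>' Y f x"
proof -
  have "ereal (generator \<E> X f x) = ereal (generator \<E>' Y f x)"
    using assms unfolding has_characteristics_def by simp
  then show ?thesis by simp
qed

text \<open>\<open>\<zeta>\<close> is one near the origin, so the derivatives of
  \<open>- \<zeta>\<close> vanish there and the operator reduces to the integral of
  \<open>1 - \<zeta>\<close>, which is at most the mass of \<open>\<nu> \<theta>\<close> beyond
  \<open>R\<close>.\<close>

lemma generator_tight:
  fixes b :: "'i \<Rightarrow> real ^ 'd::finite"
  assumes I: "I \<noteq> {}" and trip: "\<And>\<theta>. \<theta> \<in> I \<Longrightarrow> bounded_triplet B (b \<theta>) (Q \<theta>) (\<nu> \<theta>)"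
    and tight: "tight_jumps I \<nu>" and ch: "has_characteristics \<E> X I b Q \<nu>" and \<eta>: "\<eta> > 0"
  shows "\<exists>\<zeta>\<in>Cc_infty. (\<forall>x. 0 \<le> \<zeta> x \<and> \<zeta> x \<le> 1) \<and> \<zeta> 0 = 1 \<and> generator \<E> X (\<lambda>x. - \<zeta> x) 0 \<le> \<eta>"
proof -
  have "\<forall>\<^sub>F R in at_top. (SUP \<theta>\<in>I. emeasure (\<nu> \<theta>) {y \<in> space (\<nu> \<theta>). norm y > R}) < ennreal \<eta>"
    using tight \<eta> unfolding tight_jumps_def by (intro order_tendstoD(2)) auto
  then have "\<forall>\<^sub>F R in at_top. (SUP \<theta>\<in>I. emeasure (\<nu> \<theta>) {y \<in> space (\<nu> \<theta>). norm y > R}) < ennreal \<eta> \<and> R > 1"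
    using eventually_gt_at_top[of "1::real"] by eventually_elim auto
  then obtain R where R: "R > 1" and sup: "(SUP \<theta>\<in>I. emeasure (\<nu> \<theta>) {y \<in> space (\<nu> \<theta>). norm y > R}) < ennreal \<eta>"
    using eventually_happens by fastforce
  have "R > 0" using R by simp
  obtain \<zeta> :: "real ^ 'd \<Rightarrow> real" where \<zeta>: "\<zeta> \<in> Cc_infty" "\<And>x. 0 \<le> \<zeta> x" "\<And>x. \<zeta> x \<le> 1"
      "\<And>x. norm x \<le> R \<Longrightarrow> \<zeta> x = 1" "\<And>x. norm x > R + 2 \<Longrightarrow> \<zeta> x = 0"
    using cutoff_exists[OF \<open>R > 0\<close>] by blast
  let ?f = "\<lambda>x. - \<zeta> x"
  have fCc: "?f \<in> Cc_infty" using Cc_infty_mult[OF smooth_const \<zeta>(1), of "-1"] by simp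
  have loc: "partial i g 0 = 0" if "\<And>x. norm x < R \<Longrightarrow> g x = c" for i c and g :: "real ^ 'd \<Rightarrow> real"
  proof -
    have "(g has_derivative (\<lambda>_. 0)) (at 0)"
      by (rule has_derivative_transform_within_open[where s = "ball 0 R", OF has_derivative_const[of c]])
         (use that \<open>R > 0\<close> in auto)
    from partial_eqI[OF this] show ?thesis by simp
  qed
  have locx: "partial i ?f x = 0" if x: "norm x < R" for i x
  proof -
    have "(?f has_derivative (\<lambda>_. 0)) (at x)"
      by (rule has_derivative_transform_within_open[where s = "ball 0 R", OF has_derivative_const[of "-1"]])
         (use \<zeta>(4) x in auto)
    from partial_eqI[OF this] show ?thesis by simp
  qed
  have "levy_operator (b \<theta>) (Q \<theta>) (\<nu> \<theta>) ?f 0 \<le> \<eta>" if t: "\<theta> \<in> I" for \<theta>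
  proof -
    let ?S = "{y \<in> space (\<nu> \<theta>). norm y > R}"
    have em: "emeasure (\<nu> \<theta>) ?S < ennreal \<eta>"
      using sup by (rule le_less_trans[OF SUP_upper[OF t]])
    have S: "?S \<in> sets (\<nu> \<theta>)"
    proof -
      have "norm \<in> borel_measurable (\<nu> \<theta>)" by (rule jump_measurable[OF trip[OF t]]) measurable
      then show ?thesis by measurable
    qed
    have "jump_integrand ?f 0 y = 1 - \<zeta> y" for y
      using locx[of 0] \<open>R > 0\<close> by (simp add: jump_integrand_def directional_def \<zeta>)
    then have "levy_operator (b \<theta>) (Q \<theta>) (\<nu> \<theta>) ?f 0 = (LINT y|\<nu> \<theta>. 1 - \<zeta> y)"
      using locx[of 0] loc[of "partial _ ?f" 0, OF locx] \<open>R > 0\<close>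
      by (simp add: levy_operator_eq directional_def trace_hessian)
    also have "\<dots> \<le> (LINT y|\<nu> \<theta>. indicator ?S y)"
    proof (rule integral_mono)
      have i: "integrable (\<nu> \<theta>) (indicator ?S :: _ \<Rightarrow> real)"
        using S em by (intro integrable_real_indicator) (auto intro: less_trans)
      then show "integrable (\<nu> \<theta>) (indicator ?S :: _ \<Rightarrow> real)" .
      have le: "1 - \<zeta> y \<le> indicator ?S y" if "y \<in> space (\<nu> \<theta>)" for y
        using that \<zeta>(2)[of y] \<zeta>(4)[of y] by (cases "norm y \<le> R") auto
      show "integrable (\<nu> \<theta>) (\<lambda>y. 1 - \<zeta> y)"
      proof (rule Bochner_Integration.integrable_bound[OF i])
        show "(\<lambda>y. 1 - \<zeta> y) \<in> borel_measurable (\<nu> \<theta>)"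
          by (rule jump_measurable[OF trip[OF t]]) (use Cc_infty_measurable[OF \<zeta>(1)] in measurable)
        show "AE y in \<nu> \<theta>. norm (1 - \<zeta> y) \<le> norm (indicator ?S y :: real)"
          using le \<zeta>(3) by (intro AE_I2) auto
      qed
      show "1 - \<zeta> y \<le> indicator ?S y" if "y \<in> space (\<nu> \<theta>)" for y by (rule le[OF that])
    qed
    also have "\<dots> = measure (\<nu> \<theta>) ?S" using S by simp
    also have "\<dots> \<le> \<eta>"
      using em \<eta> by (simp add: measure_def enn2real_leI less_imp_le)
    finally show ?thesis .
  qed
  then have "(SUP \<theta>\<in>I. ereal (levy_operator (b \<theta>) (Q \<theta>) (\<nu> \<theta>) ?f 0)) \<le> ereal \<eta>"
    by (intro SUP_least) simp
  then have "generator \<E> X ?f 0 \<le> \<eta>"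
    using ch fCc unfolding has_characteristics_def by (simp flip: ereal_less_eq(3))
  with \<zeta> \<open>R > 0\<close> show ?thesis by (intro bexI[of _ \<zeta>]) auto
qed

lemma laws_eq:
  fixes b :: "'i \<Rightarrow> real ^ 'd::finite"
  assumes I: "I \<noteq> {}" and ub: "uniformly_bounded_triplets I b Q \<nu>" and tight: "tight_jumps I \<nu>"
    and X: "sublinear_levy_process H \<E> X" "has_characteristics \<E> X I b Q \<nu>"
    and Y: "sublinear_levy_process H' \<E>' Y" "has_characteristics \<E>' Y I b Q \<nu>"
    and t: "t \<ge> 0" and f: "f \<in> Cbuc"
  shows "sublinear_levy_process.law \<E> X t f = sublinear_levy_process.law \<E>' Y t f"
proof -
  interpret X: sublinear_levy_process H \<E> X by (rule X)
  interpret Y: sublinear_levy_process H' \<E>' Y by (rule Y)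
  obtain B where trip: "\<And>\<theta>. \<theta> \<in> I \<Longrightarrow> bounded_triplet B (b \<theta>) (Q \<theta>) (\<nu> \<theta>)" and B: "B \<ge> 0"
    using uniformly_bounded_tripletsE[OF ub I] by blast
  let ?A = "\<lambda>f. generator \<E> X f 0"
  have gY: "generated_family Y.law ?A"
  proof (rule generated_family.intro)
    show "sublinear_functional (Y.law t)" if "t \<ge> 0" for t by (rule Y.sublinear_law[OF that])
    show "((\<lambda>h. (Y.law h f - f 0) / h) \<longlongrightarrow> ?A f) (at_right 0)" if "f \<in> Cc_infty" for f
      using generated_family.generator[OF Y.law_generated_family[OF Y(2)] that]
      by (simp add: generator_eq_of_characteristics[OF X(2) Y(2) that])
  qed
  interpret two_generated_families X.law Y.law ?A
    by (rule two_generated_families.intro[OF X.law_generated_family[OF X(2)] gY])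
       (rule two_generated_families_axioms.intro, rule generator_tight[where b = b and Q = Q and \<nu> = \<nu>, OF I _ tight X(2)], erule trip, assumption)
  show ?thesis
  proof (cases "t = 0")
    case True
    then show ?thesis using f by (simp add: X.law_0 Y.law_0)
  next
    case False
    with t show ?thesis
      by (intro families_eq f X.law_power Y.law_power) auto
  qed
qed

text \<open>Induction on the number of increments: the last one is integrated out by its law, which
  is common to both processes, and leaves a test function of the others. Membership in
  \<open>H\<close> is part of the conclusion because the removal of the initial value builds on
  it.\<close>

lemma increments_law_unique:
  assumes X: "sublinear_levy_process H \<E> X" and Y: "sublinear_levy_process H' \<E>' Y"
    and law: "\<And>t f. t \<ge> 0 \<Longrightarrow> f \<in> Cbuc \<Longrightarrow> sublinear_levy_process.law \<E> X t f = sublinear_levy_process.law \<E>' Y t f"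
    and t: "t 0 = 0" "\<And>i. i < n \<Longrightarrow> t i < t (Suc i)" and \<phi>: "\<phi> \<in> Cbuc_tuples n"
  shows "(\<lambda>\<omega>. \<phi> (map (\<lambda>i. X (t (Suc i)) \<omega> - X (t i) \<omega>) [0..<n])) \<in> H \<and>
    \<E> (\<lambda>\<omega>. \<phi> (map (\<lambda>i. X (t (Suc i)) \<omega> - X (t i) \<omega>) [0..<n]))
      = \<E>' (\<lambda>\<omega>. \<phi> (map (\<lambda>i. Y (t (Suc i)) \<omega> - Y (t i) \<omega>) [0..<n]))"
proof -
  interpret X: sublinear_levy_process H \<E> X by (rule X)
  interpret Y: sublinear_levy_process H' \<E>' Y by (rule Y)
  show ?thesis
    using t(2) \<phi>
  proof (induction n arbitrary: \<phi>)
    case 0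
    then show ?case by (simp add: X.const_mem X.const_preserving Y.const_preserving)
  next
    case (Suc k)
    show ?case
    proof (cases "k = 0")
      case True
      have f: "(\<lambda>z. \<phi> ([] @ [z])) \<in> Cbuc"
        using Suc.prems(2) True by (intro Cbuc_tuples_section) auto
      have "0 < t (Suc 0)" using Suc.prems(1)[of 0] t(1) by simp
      with True f show ?thesis
        using X.increment_mem[of 0 "t (Suc 0)", OF _ _ f] X.increment_law[of 0 "t (Suc 0)", OF _ _ f]
          Y.increment_law[of 0 "t (Suc 0)", OF _ _ f] law[of "t (Suc 0)", OF _ f]
        by (simp add: t(1))
    next
      case False
      then have k: "1 \<le> k" by simp
      define \<psi> where "\<psi> x = X.law (t (Suc k) - t k) (\<lambda>z. \<phi> (x @ [z]))" for x
      have pos: "0 \<le> t (Suc k) - t k" using Suc.prems(1)[of k] by simp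
      interpret S: sublinear_expectation_space Cbuc "X.law (t (Suc k) - t k)" by (rule X.sublinear_law[OF pos])
      have \<psi>: "\<psi> \<in> Cbuc_tuples k"
        unfolding \<psi>_def
        by (rule S.Cbuc_tuples_partial_expectation[OF Suc.prems(2), where Y = "\<lambda>z. z"])
           (rule Cbuc_tuples_section[OF Suc.prems(2)])
      have \<psi>Y: "Y.law (t (Suc k) - t k) (\<lambda>z. \<phi> (x @ [z])) = \<psi> x" if "length x = k" for x
        unfolding \<psi>_def using law[OF pos Cbuc_tuples_section[OF Suc.prems(2) that]] by simp
      have "\<E> (\<lambda>\<omega>. \<psi> (map (\<lambda>i. X (t (Suc i)) \<omega> - X (t i) \<omega>) [0..<k]))
          = \<E>' (\<lambda>\<omega>. \<psi> (map (\<lambda>i. Y (t (Suc i)) \<omega> - Y (t i) \<omega>) [0..<k]))"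
        using Suc.IH[OF _ \<psi>] Suc.prems(1) by simp
      then show ?thesis
        using X.increments_expectation_Suc[OF t(1) Suc.prems(1) k Suc.prems(2)]
          Y.increments_expectation_Suc[OF t(1) Suc.prems(1) k Suc.prems(2)]
        by (simp add: \<psi>Y) (simp add: \<psi>_def)
    qed
  qed
qed

text \<open>Values of a process relative to its start are partial sums of increments;
  \<open>k j\<close> is the number of increments summed for the \<open>j\<close>-th requested
  time.\<close>

lemma Cbuc_tuples_partial_sums:
  fixes \<phi> :: "(real ^ 'd::finite) list \<Rightarrow> real"
  assumes \<phi>: "\<phi> \<in> Cbuc_tuples N" and k: "\<And>j. j < N \<Longrightarrow> k j \<le> m"
  shows "(\<lambda>xs. \<phi> (map (\<lambda>j. \<Sum>l<k j. xs ! l) [0..<N])) \<in> Cbuc_tuples m"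
proof -
  obtain M where M: "\<And>xs. length xs = N \<Longrightarrow> \<bar>\<phi> xs\<bar> \<le> M" using Cbuc_tuplesE[OF \<phi>] by blast
  show ?thesis
  proof (rule Cbuc_tuplesI)
    show "\<bar>\<phi> (map (\<lambda>j. \<Sum>l<k j. xs ! l) [0..<N])\<bar> \<le> M" for xs by (rule M) simp
    fix e :: real assume "e > 0"
    then obtain d where d: "d > 0" "\<And>xs ys. length xs = N \<Longrightarrow> length ys = N \<Longrightarrow>
      (\<And>i. i < N \<Longrightarrow> dist (xs ! i) (ys ! i) < d) \<Longrightarrow> \<bar>\<phi> xs - \<phi> ys\<bar> \<le> e"
      using Cbuc_tuples_modulus[OF \<phi>] by blast
    define d' where "d' = d / (real m + 1)"
    have d': "d' > 0" "real m * d' < d" using d(1) by (auto simp: d'_def field_simps)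
    show "\<exists>d>0. \<forall>xs ys. length xs = m \<longrightarrow> length ys = m \<longrightarrow> (\<forall>i<m. dist (xs ! i) (ys ! i) < d) \<longrightarrow>
       \<bar>\<phi> (map (\<lambda>j. \<Sum>l<k j. xs ! l) [0..<N]) - \<phi> (map (\<lambda>j. \<Sum>l<k j. ys ! l) [0..<N])\<bar> \<le> e"
    proof (intro exI[of _ d'] conjI allI impI d'(1))
      fix xs ys :: "(real ^ 'd) list" assume near: "\<forall>i<m. dist (xs ! i) (ys ! i) < d'"
      have "dist (\<Sum>l<k j. xs ! l) (\<Sum>l<k j. ys ! l) < d" if j: "j < N" for j
      proof -
        have "dist (\<Sum>l<k j. xs ! l) (\<Sum>l<k j. ys ! l) \<le> (\<Sum>l<k j. norm (xs ! l - ys ! l))"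
          unfolding dist_norm sum_subtractf[symmetric] by (rule norm_sum)
        also have "\<dots> \<le> (\<Sum>l<k j. d')"
          using near k[OF j] by (intro sum_mono) (simp add: dist_norm less_imp_le)
        also have "\<dots> \<le> real m * d'" using k[OF j] d' by simp
        finally show ?thesis using d'(2) by linarith
      qed
      then show "\<bar>\<phi> (map (\<lambda>j. \<Sum>l<k j. xs ! l) [0..<N]) - \<phi> (map (\<lambda>j. \<Sum>l<k j. ys ! l) [0..<N])\<bar> \<le> e"
        by (intro d(2)) auto
    qed
  qed
qed

text \<open>The initial value vanishes only in law, so it is removed at the price of an error that is
  dominated by \<open>min 1 |X\<^sub>0|\<close>.\<close>

lemma (in sublinear_levy_process) remove_initial_value:
  assumes \<phi>: "\<phi> \<in> Cbuc_tuples (length ts)"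
    and mem: "(\<lambda>\<omega>. \<phi> (map (\<lambda>t. X t \<omega>) ts)) \<in> H" "(\<lambda>\<omega>. \<phi> (map (\<lambda>t. X t \<omega> - X 0 \<omega>) ts)) \<in> H"
  shows "\<E> (\<lambda>\<omega>. \<phi> (map (\<lambda>t. X t \<omega>) ts)) = \<E> (\<lambda>\<omega>. \<phi> (map (\<lambda>t. X t \<omega> - X 0 \<omega>) ts))"
proof -
  let ?F = "\<lambda>\<omega>. \<phi> (map (\<lambda>t. X t \<omega>) ts)" and ?G = "\<lambda>\<omega>. \<phi> (map (\<lambda>t. X t \<omega> - X 0 \<omega>) ts)"
  obtain M where M: "0 \<le> M" "\<And>xs. length xs = length ts \<Longrightarrow> \<bar>\<phi> xs\<bar> \<le> M" using Cbuc_tuplesE[OF \<phi>] by blast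
  define q :: "real ^ 'd \<Rightarrow> real" where "q = (\<lambda>x. min 1 (norm x))"
  have "lipschitz_bounded 1 1 q"
    unfolding lipschitz_bounded_def q_def
  proof (intro conjI allI)
    fix x y :: "real ^ 'd"
    show "\<bar>min 1 (norm x) - min 1 (norm y)\<bar> \<le> 1 * dist x y"
      using norm_triangle_ineq3[of x y] by (simp add: dist_norm min_def) linarith
  qed simp
  then have q: "q \<in> Cbuc" by (rule lipschitz_bounded_Cbuc)
  have near: "\<bar>\<E> ?F - \<E> ?G\<bar> \<le> 0 + e" if e: "e > 0" for e
  proof -
    obtain d where d: "d > 0" "\<And>xs ys. length xs = length ts \<Longrightarrow> length ys = length ts \<Longrightarrow>
      (\<And>i. i < length ts \<Longrightarrow> dist (xs ! i) (ys ! i) < d) \<Longrightarrow> \<bar>\<phi> xs - \<phi> ys\<bar> \<le> e"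
      using Cbuc_tuples_modulus[OF \<phi> e] by blast
    \<comment> \<open>Chebyshev constant: where \<open>norm (X 0 \<omega>) \<ge> d\<close> the
      difference is at most \<open>2 * M\<close>, while
      \<open>q (X 0 \<omega>) \<ge> min 1 d\<close>.\<close>
    define a where "a = 2 * M / min 1 d"
    have a: "0 \<le> a" using M d by (simp add: a_def)
    have qm: "(\<lambda>\<omega>. q (X 0 \<omega>)) \<in> H" by (rule value_mem[OF _ q]) simp
    have diff: "\<bar>?F \<omega> - ?G \<omega>\<bar> \<le> a * q (X 0 \<omega>) + e" for \<omega>
    proof (cases "norm (X 0 \<omega>) < d")
      case True
      have "\<bar>?F \<omega> - ?G \<omega>\<bar> \<le> e" using True by (intro d(2)) (auto simp: dist_norm)
      moreover have "0 \<le> a * q (X 0 \<omega>)" using a by (simp add: q_def)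
      ultimately show ?thesis by linarith
    next
      case False
      then have "min 1 d \<le> q (X 0 \<omega>)" by (auto simp: q_def)
      then have "a * min 1 d \<le> a * q (X 0 \<omega>)" using a by (rule mult_left_mono)
      then have "2 * M \<le> a * q (X 0 \<omega>)" using d(1) by (simp add: a_def)
      moreover have "\<bar>?F \<omega>\<bar> \<le> M" "\<bar>?G \<omega>\<bar> \<le> M" by (auto intro: M)
      ultimately show ?thesis using e by linarith
    qed
    \<comment> \<open>The law of \<open>X 0\<close> is evaluation at the origin, where
      \<open>q\<close> vanishes; this makes the exceptional part invisible to
      \<open>\<E>\<close>.\<close>
    have E0: "\<E> (\<lambda>\<omega>. a * q (X 0 \<omega>)) = 0"
      using law_0[OF q] pos_homogeneous[OF qm a] by (simp add: law_def q_def)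
    have bound: "\<E> U - \<E> V \<le> e"
      if UV: "U \<in> H" "V \<in> H" "\<And>\<omega>. U \<omega> - V \<omega> \<le> a * q (X 0 \<omega>) + e" for U V
    proof -
      have "\<E> U - \<E> V \<le> \<E> (\<lambda>\<omega>. U \<omega> - V \<omega>)" by (rule diff_le[OF UV(1,2)])
      also have "\<dots> \<le> \<E> (\<lambda>\<omega>. a * q (X 0 \<omega>)) + e"
        by (rule mono_const[OF diff_mem[OF UV(1,2)] scale_mem[OF qm] UV(3)])
      finally show ?thesis by (simp add: E0)
    qed
    have "?F \<omega> - ?G \<omega> \<le> a * q (X 0 \<omega>) + e" "?G \<omega> - ?F \<omega> \<le> a * q (X 0 \<omega>) + e" for \<omega>
      using diff[of \<omega>] by linarith+
    from bound[OF mem this(1)] bound[OF mem(2,1) this(2)] show ?thesis by linarith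
  qed
  from field_le_epsilon[OF near] show ?thesis by simp
qed

text \<open>An arbitrary list of times, possibly unordered and with repetitions or zeros, is reduced
  to the strictly increasing grid of its positive times; the joint values relative to time zero are
  functions of the increments along it.\<close>

lemma same_fdd_of_laws:
  fixes X :: "real \<Rightarrow> 'w \<Rightarrow> real ^ 'd::finite"
  assumes X: "sublinear_levy_process H \<E> X" and Y: "sublinear_levy_process H' \<E>' Y"
    and law: "\<And>t f. t \<ge> 0 \<Longrightarrow> f \<in> Cbuc \<Longrightarrow> sublinear_levy_process.law \<E> X t f = sublinear_levy_process.law \<E>' Y t f"
  shows "same_fdd H \<E> X H' \<E>' Y"
  unfolding same_fdd_def
proof (intro allI impI)
  fix ts :: "real list" and \<phi> :: "(real ^ 'd) list \<Rightarrow> real"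
  assume ts: "\<forall>t\<in>set ts. 0 \<le> t" and \<phi>: "\<phi> \<in> Cbuc_tuples (length ts)"
    and mX: "(\<lambda>\<omega>. \<phi> (map (\<lambda>t. X t \<omega>) ts)) \<in> H" and mY: "(\<lambda>\<omega>. \<phi> (map (\<lambda>t. Y t \<omega>) ts)) \<in> H'"
  interpret X: sublinear_levy_process H \<E> X by (rule X)
  interpret Y: sublinear_levy_process H' \<E>' Y by (rule Y)
  \<comment> \<open>Zero is prepended separately as \<open>\<tau> 0\<close>, so that every listed
    time is some \<open>\<tau> k\<close> with \<open>k \<le> m\<close>, a zero time being an empty
    sum of increments.\<close>
  define P where "P = sorted_list_of_set {t \<in> set ts. t > 0}"
  define m where "m = length P"
  define \<tau> where "\<tau> i = (0 # P) ! i" for i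
  have P: "sorted_wrt (<) P" "set P = {t \<in> set ts. t > 0}" by (simp_all add: P_def)
  then have sP: "sorted_wrt (<) (0 # P)" by auto
  have \<tau>: "\<tau> 0 = 0" "\<And>i. i < m \<Longrightarrow> \<tau> i < \<tau> (Suc i)"
  proof -
    show "\<tau> 0 = 0" by (simp add: \<tau>_def)
    show "\<tau> i < \<tau> (Suc i)" if "i < m" for i
      using sorted_wrt_nth_less[OF sP, of i "Suc i"] that by (simp add: \<tau>_def m_def)
  qed
  have "\<exists>k. k \<le> m \<and> ts ! j = \<tau> k" if "j < length ts" for j
  proof -
    have "ts ! j \<in> set ts" by (rule nth_mem[OF that])
    moreover from this have "0 \<le> ts ! j" using ts by blast
    ultimately have "ts ! j \<in> set (0 # P)" using P(2) by (cases "ts ! j = 0") auto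
    then obtain k where k: "k < length (0 # P)" "(0 # P) ! k = ts ! j" unfolding in_set_conv_nth by blast
    then have "k \<le> m" "ts ! j = \<tau> k" unfolding \<tau>_def m_def by simp_all
    then show ?thesis by blast
  qed
  then obtain k where k: "\<And>j. j < length ts \<Longrightarrow> k j \<le> m" "\<And>j. j < length ts \<Longrightarrow> ts ! j = \<tau> (k j)" by metis
  define \<Phi> where "\<Phi> xs = \<phi> (map (\<lambda>j. \<Sum>l<k j. xs ! l) [0..<length ts])" for xs
  have \<Phi>: "\<Phi> \<in> Cbuc_tuples m"
    unfolding \<Phi>_def by (rule Cbuc_tuples_partial_sums[OF \<phi> k(1)])
  have inc: "\<Phi> (map (\<lambda>i. Z (\<tau> (Suc i)) - Z (\<tau> i)) [0..<m]) = \<phi> (map (\<lambda>t. Z t - Z 0) ts)"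
    for Z :: "real \<Rightarrow> real ^ 'd"
  proof -
    have "map (\<lambda>j. \<Sum>l<k j. map (\<lambda>i. Z (\<tau> (Suc i)) - Z (\<tau> i)) [0..<m] ! l) [0..<length ts]
        = map (\<lambda>t. Z t - Z 0) ts"
    proof (rule nth_equalityI)
      fix j assume "j < length (map (\<lambda>j. \<Sum>l<k j. map (\<lambda>i. Z (\<tau> (Suc i)) - Z (\<tau> i)) [0..<m] ! l) [0..<length ts])"
      then have j: "j < length ts" by simp
      have "(\<Sum>l<k j. map (\<lambda>i. Z (\<tau> (Suc i)) - Z (\<tau> i)) [0..<m] ! l) = (\<Sum>l<k j. Z (\<tau> (Suc l)) - Z (\<tau> l))"
        using k(1)[OF j] by (intro sum.cong) auto
      also have "\<dots> = Z (\<tau> (k j)) - Z (\<tau> 0)" by (rule sum_lessThan_telescope)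
      finally show "map (\<lambda>j. \<Sum>l<k j. map (\<lambda>i. Z (\<tau> (Suc i)) - Z (\<tau> i)) [0..<m] ! l) [0..<length ts] ! j
          = map (\<lambda>t. Z t - Z 0) ts ! j"
        using j k(2)[OF j] \<tau>(1) by simp
    qed simp
    then show ?thesis by (simp add: \<Phi>_def)
  qed
  have mX0: "(\<lambda>\<omega>. \<phi> (map (\<lambda>t. X t \<omega> - X 0 \<omega>) ts)) \<in> H"
    and eq: "\<E> (\<lambda>\<omega>. \<phi> (map (\<lambda>t. X t \<omega> - X 0 \<omega>) ts)) = \<E>' (\<lambda>\<omega>. \<phi> (map (\<lambda>t. Y t \<omega> - Y 0 \<omega>) ts))"
    using increments_law_unique[OF X Y law \<tau> \<Phi>] inc[of "\<lambda>t. X t _"] inc[of "\<lambda>t. Y t _"] by simp_all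
  have mY0: "(\<lambda>\<omega>. \<phi> (map (\<lambda>t. Y t \<omega> - Y 0 \<omega>) ts)) \<in> H'"
    using increments_law_unique[OF Y X law[symmetric] \<tau> \<Phi>] inc[of "\<lambda>t. Y t _"] by simp
  show "\<E> (\<lambda>\<omega>. \<phi> (map (\<lambda>t. X t \<omega>) ts)) = \<E>' (\<lambda>\<omega>. \<phi> (map (\<lambda>t. Y t \<omega>) ts))"
    using X.remove_initial_value[OF \<phi> mX mX0] Y.remove_initial_value[OF \<phi> mY mY0] eq by simp
qed

theorem theorem6p4:
  fixes I :: "'i set"
    and b :: "'i \<Rightarrow> real ^ 'd::finite"
    and Q :: "'i \<Rightarrow> real ^ 'd ^ 'd"
    and \<nu> :: "'i \<Rightarrow> (real ^ 'd) measure"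
  assumes "I \<noteq> {}"
    and "uniformly_bounded_triplets I b Q \<nu>"
  shows "(\<exists>(H :: ((real \<Rightarrow> real ^ 'd) \<Rightarrow> real) set) \<E> (X :: real \<Rightarrow> (real \<Rightarrow> real ^ 'd) \<Rightarrow> real ^ 'd).
            sublinear_levy_process H \<E> X \<and> has_characteristics \<E> X I b Q \<nu>)
    \<and> (tight_jumps I \<nu> \<longrightarrow>
        (\<exists>(H :: ((real \<Rightarrow> real ^ 'd) \<Rightarrow> real) set) \<E> (X :: real \<Rightarrow> (real \<Rightarrow> real ^ 'd) \<Rightarrow> real ^ 'd).
            sublinear_levy_process H \<E> X \<and> has_characteristics \<E> X I b Q \<nu>)
        \<and> (\<forall>(H :: ('w \<Rightarrow> real) set) \<E> (X :: real \<Rightarrow> 'w \<Rightarrow> real ^ 'd)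
             (H' :: ('v \<Rightarrow> real) set) \<E>' (Y :: real \<Rightarrow> 'v \<Rightarrow> real ^ 'd).
            sublinear_levy_process H \<E> X \<and> has_characteristics \<E> X I b Q \<nu> \<longrightarrow>
            sublinear_levy_process H' \<E>' Y \<and> has_characteristics \<E>' Y I b Q \<nu> \<longrightarrow>
            same_fdd H \<E> X H' \<E>' Y))"
proof (intro conjI impI allI)
  show ex: "\<exists>(H :: ((real \<Rightarrow> real ^ 'd) \<Rightarrow> real) set) \<E> (X :: real \<Rightarrow> (real \<Rightarrow> real ^ 'd) \<Rightarrow> real ^ 'd).
      sublinear_levy_process H \<E> X \<and> has_characteristics \<E> X I b Q \<nu>"
    by (rule levy_process_exists[OF assms])
  then show "\<exists>(H :: ((real \<Rightarrow> real ^ 'd) \<Rightarrow> real) set) \<E> (X :: real \<Rightarrow> (real \<Rightarrow> real ^ 'd) \<Rightarrow> real ^ 'd).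
      sublinear_levy_process H \<E> X \<and> has_characteristics \<E> X I b Q \<nu>" .
  fix H :: "('w \<Rightarrow> real) set" and \<E> and X :: "real \<Rightarrow> 'w \<Rightarrow> real ^ 'd"
    and H' :: "('v \<Rightarrow> real) set" and \<E>' and Y :: "real \<Rightarrow> 'v \<Rightarrow> real ^ 'd"
  assume tight: "tight_jumps I \<nu>"
    and X: "sublinear_levy_process H \<E> X \<and> has_characteristics \<E> X I b Q \<nu>"
    and Y: "sublinear_levy_process H' \<E>' Y \<and> has_characteristics \<E>' Y I b Q \<nu>"
  show "same_fdd H \<E> X H' \<E>' Y"
    using X Y laws_eq[OF assms tight] by (intro same_fdd_of_laws) blast+
qed

end
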